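(* Let $\Omega$ be a bounded Jones domain in $\mathbb R^n$, with $n\ge2$. Assume that $q\in[1,\infty]$, $\alpha,\beta\in\mathbb R$ are $L^1$-admissible. Then $$W^nL^{(1,q;\alpha,\beta)}(\Omega)\hookrightarrow C^{0,\widehat\omega_n(\cdot)}(\Omega),$$ where $\widehat\omega_n\colon(0,\infty)\to(0,\infty)$ obeys, near $0$, - $\widehat\omega_n(r)\approx\log^{-\frac1q-\alpha}(\frac er)\log\log^{-\beta}(\frac er)$ if $q\in[1,\infty]$, $\alpha>-\frac1q$, $\beta\in\mathbb R$; - $\widehat\omega_n(r)\approx\log\log^{-\frac1q-\beta}(\frac er)$ if $q\in[1,\infty]$, $\alpha=-\frac1q$, $\beta>-\frac1q$; - $\widehat\omega_n(r)\approx\log\log\log^{-\frac1q}(\frac er)$ if $q\in[1,\infty)$, $\alpha=\beta=-\frac1q$. Moreover, $\widehat\omega_n$ is (up to multiplicative constants) the optimal modulus of continuity in this embedding: if $\sigma$ is a modulus of continuity such that $W^nL^{(1,q;\alpha,\beta)}(\Omega)\hookrightarrow C^{0,\sigma(\cdot)}(\Omega)$, then $C^{0,\widehat\omega_n(\cdot)}(\Omega)\hookrightarrow C^{0,\sigma(\cdot)}(\Omega)$.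
   Context: Conventions: $\frac1\infty=0$. $\log^a(x)=(\log x)^a$, $\log\log^a(x)=(\log\log x)^a$, $\log\log\log^a(x)=(\log\log\log x)^a$. For positive functions, "$A\approx B$ near $0$" means that $c^{-1}B\le A\le cB$ on $(0,r_0)$ for some $c,r_0>0$. The arrow $\hookrightarrow$ denotes continuous embedding (for continuous targets, after choosing a suitable representative). For measurable $u$ on $E$: $u^*(s)=\inf\{t\ge0:|\{x\in E:|u(x)|>t\}|\le s\}$, $u^{**}(s)=\frac1s\int_0^su^*(t)\,dt$. Let $\ell(s)=1+|\log s|$, $\ell\ell(s)=1+\log\ell(s)$ and $\|f\|_{L^{(1,q;\alpha,\beta)}(0,1)}=\|s^{1-\frac1q}\ell^\alpha(s)\ell\ell^\beta(s)f^{**}(s)\|_{L^q(0,1)}$. $X(\Omega)$, with $X=L^{(1,q;\alpha,\beta)}$, is the space of measurable $u$ on $\Omega$ with $\|u\|_{X(\Omega)}=\|u^*(|\Omega|\,\cdot)\|_{X(0,1)}<\infty$. $(q,\alpha,\beta)$ is $L^1$-admissible if one of the following holds: $q\in[1,\infty],\alpha>-\frac1q,\beta\in\mathbb R$; $q\in[1,\infty],\alpha=-\frac1q,\beta>-\frac1q$; $q\in[1,\infty),\alpha=\beta=-\frac1q$. $W^nX(\Omega)$ is the space of $n$-times weakly differentiable $u$ on $\Omega$ with $|\nabla^ku|\in X(\Omega)$ for $k=0,\dots,n$, normed by $\sum_{k=0}^n\||\nabla^ku|\|_{X(\Omega)}$, where $\nabla^ku$ is the vector of all $k$-th order weak derivatives.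 A modulus of continuity is a function $\sigma\colon(0,\infty)\to(0,\infty)$ that is equivalent, up to positive multiplicative constants, near $0$ to a non-decreasing function and satisfies $\lim_{r\to0^+}\sigma(r)=0$ and $\liminf_{r\to0^+}\sigma(r)/r>0$. $C^{0,\sigma(\cdot)}(\Omega)$ is the space of bounded continuous $u$ on $\Omega$ with finite norm $\|u\|_{L^\infty(\Omega)}+\sup_{x\ne y\in\Omega}\frac{|u(x)-u(y)|}{\sigma(|x-y|)}$. For bounded $\Omega$, only the behaviour of $\sigma$ near $0$, up to multiplicative constants, matters. A domain is a connected open set. A domain $\Omega$ is a Jones domain (an $(\varepsilon,\delta)$-domain) if there exist $\varepsilon\in(0,1)$ and $\delta\in(1,\infty]$ such that for all $x,y\in\Omega$ with $|x-y|<\delta$ there is a rectifiable arc $\gamma\subset\Omega$ joining $x$ to $y$ whose length satisfies $\ell(\gamma)\le\frac{|x-y|}\varepsilon$ and $\operatorname{dist}(z,\partial\Omega)\ge\varepsilon\frac{|x-z||y-z|}{|x-y|}$ for all $z\in\gamma$.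
   Formalization: The function ω̂_n is additionally assumed to be bounded below by a positive constant on each compact interval [a,b] in (0,∞); without this, an ω̂_n degenerating to 0 at a positive distance makes the embedding false, e.g. for u = x_1 on a ball. *)

theory Defs
  imports "HOL-Analysis.Analysis" "HOL-Probability.Essential_Supremum"
begin

section \<open>Lebesgue norms and rearrangements\<close>

text \<open>Norms take values in \<^typ>\<open>ennreal\<close>, so that they are defined for all functions, and exponents
  \<open>q \<in> [1, \<infinity>]\<close> are of type \<^typ>\<open>ennreal\<close>.\<close>

definition ennreal_powr :: "ennreal \<Rightarrow> real \<Rightarrow> ennreal"  (* used for positive exponents only *)
  where "ennreal_powr x p = (if x = \<infinity> then \<infinity> else ennreal (enn2real x powr p))"

definition Lq_norm :: "'a measure \<Rightarrow> ennreal \<Rightarrow> ('a \<Rightarrow> ennreal) \<Rightarrow> ennreal"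
  where "Lq_norm M q g =
    (if q = \<infinity> then esssup M g
     else ennreal_powr (\<integral>\<^sup>+x. ennreal_powr (g x) (enn2real q) \<partial>M) (1 / enn2real q))"

text \<open>The real number \<open>1/q\<close>, with \<open>1/\<infinity> = 0\<close>.\<close>

definition recip :: "ennreal \<Rightarrow> real"
  where "recip q = enn2real (1 / q)"

text \<open>\<open>u\<^sup>*\<close> and \<open>u\<^sup>*\<^sup>*\<close>. The argument \<open>f\<close> plays the role of \<open>|u|\<close>. Admitting the level \<open>t = \<infinity>\<close>
  does not change the infimum, as the infimum of the empty set is \<open>\<infinity>\<close>.\<close>

definition rearr :: "'a measure \<Rightarrow> ('a \<Rightarrow> ennreal) \<Rightarrow> real \<Rightarrow> ennreal"
  where "rearr M f s = Inf {t. emeasure M {x \<in> space M. t < f x} \<le> ennreal s}"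

definition rearr_avg :: "'a measure \<Rightarrow> ('a \<Rightarrow> ennreal) \<Rightarrow> real \<Rightarrow> ennreal"
  where "rearr_avg M f s = (\<integral>\<^sup>+t\<in>{0<..<s}. rearr M f t \<partial>lborel) / ennreal s"


section \<open>The Lorentz--Zygmund type spaces \<open>L\<^sup>(\<^sup>1\<^sup>,\<^sup>q\<^sup>;\<^sup>\<alpha>\<^sup>,\<^sup>\<beta>\<^sup>)\<close>\<close>

definition ell :: "real \<Rightarrow> real"
  where "ell s = 1 + \<bar>ln s\<bar>"

definition ellell :: "real \<Rightarrow> real"
  where "ellell s = 1 + ln (ell s)"

definition LZ_norm :: "ennreal \<Rightarrow> real \<Rightarrow> real \<Rightarrow> (real \<Rightarrow> ennreal) \<Rightarrow> ennreal"
  where "LZ_norm q \<alpha> \<beta> f =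
    Lq_norm (lebesgue_on {0<..<1}) q
      (\<lambda>s. ennreal (s powr (1 - recip q) * ell s powr \<alpha> * ellell s powr \<beta>)
            * rearr_avg (lebesgue_on {0<..<1}) f s)"

definition LZ_norm_on ::
    "'a::euclidean_space set \<Rightarrow> ennreal \<Rightarrow> real \<Rightarrow> real \<Rightarrow> ('a \<Rightarrow> real) \<Rightarrow> ennreal"
  where "LZ_norm_on \<Omega> q \<alpha> \<beta> u =
    LZ_norm q \<alpha> \<beta> (\<lambda>s. rearr (lebesgue_on \<Omega>) (\<lambda>x. ennreal \<bar>u x\<bar>) (measure lebesgue \<Omega> * s))"

definition LZ_space ::
    "'a::euclidean_space set \<Rightarrow> ennreal \<Rightarrow> real \<Rightarrow> real \<Rightarrow> ('a \<Rightarrow> real) set"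
  where "LZ_space \<Omega> q \<alpha> \<beta> =
    {u. u \<in> borel_measurable (lebesgue_on \<Omega>) \<and> LZ_norm_on \<Omega> q \<alpha> \<beta> u < \<infinity>}"

definition L1_admissible :: "ennreal \<Rightarrow> real \<Rightarrow> real \<Rightarrow> bool"
  where "L1_admissible q \<alpha> \<beta> \<longleftrightarrow>
    1 \<le> q \<and> \<alpha> > - recip q
    \<or> 1 \<le> q \<and> \<alpha> = - recip q \<and> \<beta> > - recip q
    \<or> 1 \<le> q \<and> q < \<infinity> \<and> \<alpha> = - recip q \<and> \<beta> = - recip q"


section \<open>Weak derivatives and Sobolev spaces\<close>

text \<open>A list \<open>[i\<^sub>1, \<dots>, i\<^sub>k]\<close> of coordinate indices stands for the differential operator
  \<open>\<partial>\<^sub>i\<^sub>1 \<dots> \<partial>\<^sub>i\<^sub>k\<close> of order \<open>k\<close>.\<close>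

definition partial_deriv :: "'n::finite \<Rightarrow> (real^'n \<Rightarrow> real) \<Rightarrow> real^'n \<Rightarrow> real"
  where "partial_deriv i f x = frechet_derivative f (at x) (axis i 1)"

definition partial_derivs :: "'n::finite list \<Rightarrow> (real^'n \<Rightarrow> real) \<Rightarrow> real^'n \<Rightarrow> real"
  where "partial_derivs is f = foldr partial_deriv is f"

definition test_functions :: "(real^'n::finite) set \<Rightarrow> (real^'n \<Rightarrow> real) set"
  where "test_functions \<Omega> =
    {\<phi>. (\<forall>is x. partial_derivs is \<phi> differentiable (at x))
       \<and> compact (closure {x. \<phi> x \<noteq> 0}) \<and> closure {x. \<phi> x \<noteq> 0} \<subseteq> \<Omega>}"

definition locally_integrable :: "'a::euclidean_space set \<Rightarrow> ('a \<Rightarrow> real) \<Rightarrow> bool"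
  where "locally_integrable \<Omega> u \<longleftrightarrow> (\<forall>K. compact K \<longrightarrow> K \<subseteq> \<Omega> \<longrightarrow> integrable (lebesgue_on K) u)"

definition has_weak_deriv ::
    "(real^'n::finite) set \<Rightarrow> 'n list \<Rightarrow> (real^'n \<Rightarrow> real) \<Rightarrow> (real^'n \<Rightarrow> real) \<Rightarrow> bool"
  where "has_weak_deriv \<Omega> is u v \<longleftrightarrow>
    locally_integrable \<Omega> u \<and> locally_integrable \<Omega> v \<and>
    (\<forall>\<phi>\<in>test_functions \<Omega>.
      (\<integral>x. u x * partial_derivs is \<phi> x \<partial>lebesgue_on \<Omega>)
        = (-1) ^ length is * (\<integral>x. v x * \<phi> x \<partial>lebesgue_on \<Omega>))"

text \<open>Weak derivatives are unique almost everywhere, and the norms below do not distinguish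
  functions that agree almost everywhere.\<close>

definition weak_deriv ::
    "(real^'n::finite) set \<Rightarrow> 'n list \<Rightarrow> (real^'n \<Rightarrow> real) \<Rightarrow> real^'n \<Rightarrow> real"
  where "weak_deriv \<Omega> is u = (SOME v. has_weak_deriv \<Omega> is u v)"

definition weakly_differentiable :: "(real^'n::finite) set \<Rightarrow> nat \<Rightarrow> (real^'n \<Rightarrow> real) \<Rightarrow> bool"
  where "weakly_differentiable \<Omega> m u \<longleftrightarrow> (\<forall>is. length is \<le> m \<longrightarrow> (\<exists>v. has_weak_deriv \<Omega> is u v))"

text \<open>The Euclidean length of \<open>\<nabla>\<^sup>k u\<close>. Mixed derivatives occur in it with multiplicity, once for
  every order of differentiation.\<close>

definition abs_weak_grad ::
    "(real^'n::finite) set \<Rightarrow> nat \<Rightarrow> (real^'n \<Rightarrow> real) \<Rightarrow> real^'n \<Rightarrow> real"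
  where "abs_weak_grad \<Omega> k u x = sqrt (\<Sum>is | length is = k. (weak_deriv \<Omega> is u x)\<^sup>2)"

definition sobolev_LZ_norm ::
    "(real^'n::finite) set \<Rightarrow> nat \<Rightarrow> ennreal \<Rightarrow> real \<Rightarrow> real \<Rightarrow> (real^'n \<Rightarrow> real) \<Rightarrow> ennreal"
  where "sobolev_LZ_norm \<Omega> m q \<alpha> \<beta> u = (\<Sum>k=0..m. LZ_norm_on \<Omega> q \<alpha> \<beta> (abs_weak_grad \<Omega> k u))"

definition sobolev_LZ_space ::
    "(real^'n::finite) set \<Rightarrow> nat \<Rightarrow> ennreal \<Rightarrow> real \<Rightarrow> real \<Rightarrow> (real^'n \<Rightarrow> real) set"
  where "sobolev_LZ_space \<Omega> m q \<alpha> \<beta> =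
    {u. weakly_differentiable \<Omega> m u \<and> (\<forall>k\<in>{0..m}. abs_weak_grad \<Omega> k u \<in> LZ_space \<Omega> q \<alpha> \<beta>)}"


section \<open>Moduli of continuity and generalized Hoelder spaces\<close>

definition equiv_near_0 :: "(real \<Rightarrow> real) \<Rightarrow> (real \<Rightarrow> real) \<Rightarrow> bool"
  where "equiv_near_0 A B \<longleftrightarrow>
    (\<exists>c>0. \<exists>r\<^sub>0>0. \<forall>r\<in>{0<..<r\<^sub>0}. inverse c * B r \<le> A r \<and> A r \<le> c * B r)"

definition modulus_of_continuity :: "(real \<Rightarrow> real) \<Rightarrow> bool"
  where "modulus_of_continuity \<sigma> \<longleftrightarrow>
    (\<forall>r>0. \<sigma> r > 0)
    \<and> (\<exists>\<tau>. mono_on {0<..} \<tau> \<and> equiv_near_0 \<sigma> \<tau>)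
    \<and> (\<sigma> \<longlongrightarrow> 0) (at_right 0)
    \<and> Liminf (at_right 0) (\<lambda>r. ereal (\<sigma> r / r)) > 0"

definition hoelder_norm :: "'a::euclidean_space set \<Rightarrow> (real \<Rightarrow> real) \<Rightarrow> ('a \<Rightarrow> real) \<Rightarrow> ennreal"
  where "hoelder_norm \<Omega> \<sigma> u =
    Lq_norm (lebesgue_on \<Omega>) \<infinity> (\<lambda>x. ennreal \<bar>u x\<bar>)
    + (SUP (x, y)\<in>{(x, y). x \<in> \<Omega> \<and> y \<in> \<Omega> \<and> x \<noteq> y}. ennreal (\<bar>u x - u y\<bar> / \<sigma> (dist x y)))"

definition hoelder_space :: "'a::euclidean_space set \<Rightarrow> (real \<Rightarrow> real) \<Rightarrow> ('a \<Rightarrow> real) set"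
  where "hoelder_space \<Omega> \<sigma> =
    {u. continuous_on \<Omega> u \<and> bounded (u ` \<Omega>) \<and> hoelder_norm \<Omega> \<sigma> u < \<infinity>}"

text \<open>Continuous embedding of one function space on \<open>\<Omega>\<close> into another one. A function is identified
  with its representatives; a continuous representative on an open set is unique.\<close>

definition embeds ::
    "'a::euclidean_space set \<Rightarrow> ('a \<Rightarrow> real) set \<Rightarrow> (('a \<Rightarrow> real) \<Rightarrow> ennreal)
      \<Rightarrow> ('a \<Rightarrow> real) set \<Rightarrow> (('a \<Rightarrow> real) \<Rightarrow> ennreal) \<Rightarrow> bool"
  where "embeds \<Omega> A normA B normB \<longleftrightarrow>
    (\<exists>C::real. C > 0 \<and>
      (\<forall>u\<in>A. \<exists>v\<in>B. (AE x in lebesgue_on \<Omega>. v x = u x) \<and> normB v \<le> ennreal C * normA u))"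


section \<open>Jones domains\<close>

definition path_length :: "(real \<Rightarrow> 'a::metric_space) \<Rightarrow> ennreal"
  where "path_length \<gamma> =
    (SUP ts\<in>{ts. sorted ts \<and> set ts \<subseteq> {0..1}}.
      \<Sum>i<length ts - 1. ennreal (dist (\<gamma> (ts ! i)) (\<gamma> (ts ! Suc i))))"

definition rectifiable :: "(real \<Rightarrow> 'a::metric_space) \<Rightarrow> bool"
  where "rectifiable \<gamma> \<longleftrightarrow> path_length \<gamma> < \<infinity>"

text \<open>The points \<open>x\<close>, \<open>y\<close> have to be distinct, since an arc has distinct endpoints.
  The premise on the frontier is needed since the distance to the empty set is infinite, whereas
  \<open>infdist z {} = 0\<close>; it is met by all bounded nonempty domains.\<close>

definition Jones_domain :: "'a::euclidean_space set \<Rightarrow> bool"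
  where "Jones_domain \<Omega> \<longleftrightarrow>
    open \<Omega> \<and> connected \<Omega> \<and>
    (\<exists>\<epsilon>::real. \<exists>\<delta>::ereal. 0 < \<epsilon> \<and> \<epsilon> < 1 \<and> 1 < \<delta> \<and>
      (\<forall>x\<in>\<Omega>. \<forall>y\<in>\<Omega>. x \<noteq> y \<and> ereal (dist x y) < \<delta> \<longrightarrow>
        (\<exists>\<gamma>. arc \<gamma> \<and> rectifiable \<gamma> \<and> path_image \<gamma> \<subseteq> \<Omega> \<and> pathstart \<gamma> = x \<and> pathfinish \<gamma> = y
          \<and> path_length \<gamma> \<le> ennreal (dist x y / \<epsilon>)
          \<and> (\<forall>z\<in>path_image \<gamma>. frontier \<Omega> \<noteq> {} \<longrightarrow>
                \<epsilon> * (dist x z * dist y z / dist x y) \<le> infdist z (frontier \<Omega>)))))"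

end

theory Submission
  imports Defs
begin

text \<open>The embedding rests on averages of the Taylor polynomials of \<open>u\<close> against a bump of centre \<open>c\<close> and
  radius \<open>s\<close>. When \<open>(c, s)\<close> moves, the bump changes by a divergence, and integrating by parts leaves only
  derivatives of the top order \<open>n\<close>; so the average changes by at most a multiple of
  \<open>s\<^sup>-\<^sup>n \<integral> |x - z|\<^sup>n\<^sup>-\<^sup>1 |\<nabla>\<^sup>n u(z)| dz\<close>. Summed along the chain of balls which a Jones domain provides from any point
  to any other, this bounds the oscillation of a continuous representative of \<open>u\<close> at scale \<open>r\<close> by
  \<open>\<Theta>(r) + r \<Sum> \<Theta>(s\<^sub>j) / s\<^sub>j\<close> over dyadic \<open>s\<^sub>j > r\<close>, where \<open>\<Theta>(s)\<close> bounds the integral of \<open>|\<nabla>\<^sup>n u|\<close> over balls of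
  radius \<open>s\<close>. The norm of \<open>L\<^sup>(\<^sup>1\<^sup>,\<^sup>q\<^sup>;\<^sup>\<alpha>\<^sup>,\<^sup>\<beta>\<^sup>)\<close> controls such integrals with the factor \<open>\<omega>(s)\<close>, and \<open>\<omega>\<close> varies so slowly that the
  sum is again of the size of \<open>\<omega>(r)\<close>. Conversely, a smooth bump of height \<open>1\<close> and width \<open>r\<close> has norm at most
  a multiple of \<open>1 / \<omega>(r)\<close>, which makes \<open>\<omega>\<close> optimal.\<close>

section \<open>Partial derivatives of smooth functions\<close>

text \<open>The order n is critical: the factor \<open>s ^ (1 - n)\<close> paid for moving a ball of
  radius s is exactly compensated by the kernel of degree n - 1, so one link of a chain costs just
  the mass of the top gradient near it. A descent to a point has infinitely many links; since n - 1
  is at least 1, each z is charged a geometric series, and the whole descent costs no more than its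
  first scale. Comparing two points also requires a change of the evaluation point. This
  differentiates the averaged polynomial and leaves the same object of order n - 1 for a first
  derivative; a link then costs an extra factor 1 / s, and the chain has to run upwards to a fixed
  scale. Hence the second term of the oscillation bound. Balls always stay inside \<Omega>, whereas
  evaluation points may leave it. The norm is handled in the variable y = 1 - ln r. The q-th power
  of \<open>gauge\<close> is comparable to the integral of the q-th power of the weight, which
  explains the three cases, and \<open>gauge\<close> grows at most like \<open>exp (y / 2)\<close>,
  that is, like the root of 1 / r. Distances that are not small need separate care, because a
  modulus carries no information there: on one side \<omega> is assumed bounded below, on the other
  coordinate functions are tested.\<close>

lemma partial_deriv_eq:
  assumes "(f has_derivative f') (at x)"
  shows "partial_deriv i f x = f' (axis i 1)"
  using frechet_derivative_at[OF assms] by (simp add: partial_deriv_def)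

lemma partial_deriv_const [simp]: "partial_deriv i (\<lambda>x. c) = (\<lambda>x. 0)"
  by (rule ext, subst partial_deriv_eq[OF has_derivative_const]) simp

lemma partial_deriv_add:
  assumes "f differentiable (at x)" "g differentiable (at x)"
  shows "partial_deriv i (\<lambda>x. f x + g x) x = partial_deriv i f x + partial_deriv i g x"
  using partial_deriv_eq[OF has_derivative_add[OF assms[unfolded frechet_derivative_works]]] by (simp add: partial_deriv_def)

lemma partial_deriv_mult:
  assumes "f differentiable (at x)" "g differentiable (at x)"
  shows "partial_deriv i (\<lambda>x. f x * g x) x = partial_deriv i f x * g x + f x * partial_deriv i g x"
  using partial_deriv_eq[OF has_derivative_mult[OF assms[unfolded frechet_derivative_works]]] by (simp add: partial_deriv_def)

lemma partial_deriv_coord: "partial_deriv i (\<lambda>x. x $ j) = (\<lambda>x. if i = j then 1 else 0)"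
proof
  fix x :: "real^'a"
  have "((\<lambda>x::real^'a. x $ j) has_derivative (\<lambda>x. x $ j)) (at x)"
   by (rule bounded_linear_imp_has_derivative) (rule bounded_linear_vec_nth)
  from partial_deriv_eq[OF this, of i]
  show "partial_deriv i (\<lambda>x. x $ j) x = (if i = j then 1 else 0)" by (simp add: axis_def)
qed

lemma has_derivative_partial_deriv_sum:
  assumes "f differentiable (at x)"
  shows "(f has_derivative (\<lambda>h. \<Sum>i\<in>UNIV. partial_deriv i f x * h $ i)) (at x)"
proof -
  let ?D = "frechet_derivative f (at x)"
  have D: "(f has_derivative ?D) (at x)" using assms by (simp add: frechet_derivative_works)
  then interpret bounded_linear ?D by (rule has_derivative_bounded_linear)
  have "?D = (\<lambda>h. \<Sum>i\<in>UNIV. partial_deriv i f x * h $ i)"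
  proof
   fix h :: "real^'a"
   have e: "(\<Sum>i\<in>UNIV. h $ i *\<^sub>R axis i 1) = h" using basis_expansion[of h] by (simp add: scalar_mult_eq_scaleR)
   have "?D h = ?D (\<Sum>i\<in>UNIV. h $ i *\<^sub>R axis i 1)" by (simp only: e)
   also have "\<dots> = (\<Sum>i\<in>UNIV. partial_deriv i f x * h $ i)" by (simp add: sum scaleR partial_deriv_def mult.commute)
   finally show "?D h = (\<Sum>i\<in>UNIV. partial_deriv i f x * h $ i)" .
  qed
  with D show ?thesis by simp
qed

text \<open>Differentiability, rather than continuity, of the derivatives up to order k is required,
  in agreement with \<open>test_functions\<close>. Induction on k rests on \<open>Ck_Suc\<close>,
  which splits off the innermost derivative.\<close>

definition Ck :: "nat \<Rightarrow> (real^'n::finite \<Rightarrow> real) \<Rightarrow> bool"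
  where "Ck k f \<longleftrightarrow> (\<forall>is x. length is \<le> k \<longrightarrow> partial_derivs is f differentiable (at x))"

lemma partial_derivs_append: "partial_derivs (is @ js) f = partial_derivs is (partial_derivs js f)"
  by (simp add: partial_derivs_def)

lemma partial_derivs_Nil [simp]: "partial_derivs [] f = f"
  and partial_derivs_Cons: "partial_derivs (i # is) f = partial_deriv i (partial_derivs is f)"
  and partial_derivs_single [simp]: "partial_derivs [i] f = partial_deriv i f"
  by (simp_all add: partial_derivs_def)

lemma Ck_0: "Ck 0 f \<longleftrightarrow> (\<forall>x. f differentiable (at x))"
  by (simp add: Ck_def)

lemma Ck_Suc: "Ck (Suc k) f \<longleftrightarrow> (\<forall>x. f differentiable (at x)) \<and> (\<forall>i. Ck k (partial_deriv i f))"
proof (intro iffI conjI allI)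
  fix x assume "Ck (Suc k) f" then show "f differentiable (at x)" by (auto simp: Ck_def dest!: spec[of _ "[]"])
next
  fix i assume *: "Ck (Suc k) f"
  show "Ck k (partial_deriv i f)" unfolding Ck_def
  proof (intro allI impI)
   fix "is" :: "'a list" and x assume "length is \<le> k"
   then show "partial_derivs is (partial_deriv i f) differentiable at x"
    using *[unfolded Ck_def, rule_format, of "is @ [i]" x] by (simp add: partial_derivs_append)
  qed
next
  assume *: "(\<forall>x. f differentiable at x) \<and> (\<forall>i. Ck k (partial_deriv i f))"
  show "Ck (Suc k) f" unfolding Ck_def
  proof (intro allI impI)
   fix "is" :: "'a list" and x assume l: "length is \<le> Suc k"
   show "partial_derivs is f differentiable at x"
   proof (cases "is" rule: rev_cases)
    case Nil then show ?thesis using * by simp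
   next
    case (snoc js i) then show ?thesis using * l by (auto simp: Ck_def partial_derivs_append)
   qed
  qed
qed

lemma Ck_imp_differentiable: "Ck k f \<Longrightarrow> f differentiable (at x)"
  by (auto simp: Ck_def dest!: spec[of _ "[]"])

lemma Ck_SucD: "Ck (Suc k) f \<Longrightarrow> Ck k f"
  by (simp add: Ck_def)

lemma Ck_const: "Ck k (\<lambda>x. c)"
  by (induction k arbitrary: c) (auto simp: Ck_0 Ck_Suc)

lemma Ck_coord: "Ck k (\<lambda>x. x $ i)"
proof -
  have "(\<lambda>x::real^'a. x $ i) differentiable (at x)" for x by (rule bounded_linear_imp_differentiable) (rule bounded_linear_vec_nth)
  then show ?thesis by (cases k) (auto simp: Ck_0 Ck_Suc partial_deriv_coord Ck_const)
qed

lemma Ck_add: "Ck k f \<Longrightarrow> Ck k g \<Longrightarrow> Ck k (\<lambda>x. f x + g x)"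
proof (induction k arbitrary: f g)
  case (Suc k)
  have "partial_deriv i (\<lambda>x. f x + g x) = (\<lambda>x. partial_deriv i f x + partial_deriv i g x)" for i
   by (rule ext, rule partial_deriv_add) (use Suc.prems in \<open>auto intro: Ck_imp_differentiable\<close>)
  with Suc show ?case by (auto simp: Ck_Suc)
qed (auto simp: Ck_0)

lemma Ck_mult: "Ck k f \<Longrightarrow> Ck k g \<Longrightarrow> Ck k (\<lambda>x. f x * g x)"
proof (induction k arbitrary: f g)
  case (Suc k)
  have "partial_deriv i (\<lambda>x. f x * g x) = (\<lambda>x. partial_deriv i f x * g x + f x * partial_deriv i g x)" for i
   by (rule ext, rule partial_deriv_mult) (use Suc.prems in \<open>auto intro: Ck_imp_differentiable\<close>)
  with Suc show ?case by (auto simp: Ck_Suc intro!: Ck_add Suc.IH Ck_SucD[OF Suc.prems(1)] Ck_SucD[OF Suc.prems(2)])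
qed (auto simp: Ck_0)

definition smooth :: "(real^'n::finite \<Rightarrow> real) \<Rightarrow> bool"
  where "smooth f \<longleftrightarrow> (\<forall>is x. partial_derivs is f differentiable (at x))"

lemma smooth_iff_Ck: "smooth f \<longleftrightarrow> (\<forall>k. Ck k f)"
  by (auto simp: smooth_def Ck_def)

lemma smooth_const [simp, intro]: "smooth (\<lambda>x. c)"
  and smooth_coord [simp, intro]: "smooth (\<lambda>x. x $ i)"
  and smooth_add [intro]: "smooth f \<Longrightarrow> smooth g \<Longrightarrow> smooth (\<lambda>x. f x + g x)"
  and smooth_mult [intro]: "smooth f \<Longrightarrow> smooth g \<Longrightarrow> smooth (\<lambda>x. f x * g x)"
  by (auto simp: smooth_iff_Ck Ck_const Ck_coord Ck_add Ck_mult)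

lemma smooth_minus [intro]: "smooth f \<Longrightarrow> smooth (\<lambda>x. - f x)"
  using smooth_mult[OF smooth_const[of "-1"], of f] by simp

lemma smooth_diff [intro]: "smooth f \<Longrightarrow> smooth g \<Longrightarrow> smooth (\<lambda>x. f x - g x)"
  using smooth_add[OF _ smooth_minus, of f g] by simp

lemma smooth_divide_const [intro]: "smooth f \<Longrightarrow> smooth (\<lambda>x. f x / c)"
  using smooth_mult[OF _ smooth_const[of "1/c"], of f] by simp

lemma smooth_power [intro]: "smooth f \<Longrightarrow> smooth (\<lambda>x. f x ^ k)"
  by (induction k) auto

lemma smooth_sum [intro]: "(\<And>i. i \<in> I \<Longrightarrow> smooth (f i)) \<Longrightarrow> smooth (\<lambda>x. \<Sum>i\<in>I. f i x)"
  by (induction I rule: infinite_finite_induct) auto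

lemma smooth_prod [intro]: "(\<And>i. i \<in> I \<Longrightarrow> smooth (f i)) \<Longrightarrow> smooth (\<lambda>x. \<Prod>i\<in>I. f i x)"
  by (induction I rule: infinite_finite_induct) auto

lemma smooth_differentiable: "smooth f \<Longrightarrow> f differentiable (at x)"
  by (auto simp: smooth_iff_Ck intro: Ck_imp_differentiable)

lemma smooth_continuous: "smooth f \<Longrightarrow> continuous_on S f"
  by (meson continuous_at_imp_continuous_on differentiable_imp_continuous_within smooth_differentiable)

lemma smooth_partial_deriv [intro]: "smooth f \<Longrightarrow> smooth (partial_deriv i f)"
  unfolding smooth_iff_Ck using Ck_Suc by blast

lemma smooth_partial_derivs [intro]: "smooth f \<Longrightarrow> smooth (partial_derivs is f)"
  by (induction "is") (auto simp: partial_derivs_Cons)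

lemma smooth_has_derivative:
  "smooth f \<Longrightarrow> (f has_derivative (\<lambda>h. \<Sum>i\<in>UNIV. partial_deriv i f x * h $ i)) (at x)"
  by (intro has_derivative_partial_deriv_sum smooth_differentiable)

lemma smooth_has_line_derivative:
  fixes f :: "real^'n::finite \<Rightarrow> real"
  assumes "smooth f"
  shows "((\<lambda>t. f (a + t *\<^sub>R h)) has_real_derivative (\<Sum>i\<in>UNIV. partial_deriv i f (a + t *\<^sub>R h) * h $ i)) (at t within T)"
proof -
  have "((\<lambda>t. a + t *\<^sub>R h) has_derivative (\<lambda>t. t *\<^sub>R h)) (at t within T)" by (auto intro!: derivative_eq_intros)
  note * = has_derivative_compose[OF this smooth_has_derivative[OF assms]]
  have eq: "(\<lambda>s. \<Sum>i\<in>UNIV. partial_deriv i f (a + t *\<^sub>R h) * (s *\<^sub>R h) $ i)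
   = (*) (\<Sum>i\<in>UNIV. partial_deriv i f (a + t *\<^sub>R h) * h $ i)"
   by (rule ext) (simp add: sum_distrib_left mult.assoc mult.left_commute mult.commute)
  show ?thesis using *[unfolded eq] by (simp add: has_field_derivative_def)
qed

lemma smooth_coord_line_derivative:
  fixes f :: "real^'n::finite \<Rightarrow> real"
  assumes "smooth f"
  shows "((\<lambda>t. f (a + t *\<^sub>R axis i 1)) has_real_derivative partial_deriv i f (a + t *\<^sub>R axis i 1)) (at t within T)"
proof -
  have "(\<Sum>j\<in>UNIV. partial_deriv j f (a + t *\<^sub>R axis i 1) * axis i 1 $ j) = partial_deriv i f (a + t *\<^sub>R axis i 1)"
   by (simp add: axis_def if_distrib cong: if_cong)
  then show ?thesis using smooth_has_line_derivative[OF assms, of a "axis i 1" t T] by simp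
qed

section \<open>Symmetry of mixed derivatives\<close>

lemma second_difference_mean_value:
  fixes f :: "real^'n::finite \<Rightarrow> real"
  assumes "smooth f" "h > 0"
  shows "\<exists>s t. 0 < s \<and> s < h \<and> 0 < t \<and> t < h \<and>
   f (x + h *\<^sub>R axis i 1 + h *\<^sub>R axis j 1) - f (x + h *\<^sub>R axis i 1) - f (x + h *\<^sub>R axis j 1) + f x
    = h * h * partial_deriv j (partial_deriv i f) (x + s *\<^sub>R axis i 1 + t *\<^sub>R axis j 1)"
proof -
  define e d :: "real^'n" where "e = axis i 1" and "d = axis j 1"
  \<comment> \<open>The mean value theorem is applied to the first difference in direction j as a
    function of the step in direction i, and afterwards to the resulting derivative as a function of
    the step in direction j.\<close>
  have D: "((\<lambda>t. f (x + h *\<^sub>R d + t *\<^sub>R e) - f (x + t *\<^sub>R e)) has_real_derivative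
    partial_deriv i f (x + h *\<^sub>R d + t *\<^sub>R e) - partial_deriv i f (x + t *\<^sub>R e)) (at t)" for t
   unfolding e_def d_def by (intro derivative_intros smooth_coord_line_derivative assms)
  obtain s where s: "0 < s" "s < h" and s': "(f (x + h *\<^sub>R d + h *\<^sub>R e) - f (x + h *\<^sub>R e)) - (f (x + h *\<^sub>R d + 0 *\<^sub>R e) - f (x + 0 *\<^sub>R e))
    = (h - 0) * (partial_deriv i f (x + h *\<^sub>R d + s *\<^sub>R e) - partial_deriv i f (x + s *\<^sub>R e))"
   using MVT2[OF assms(2) D] by blast
  have D2: "((\<lambda>t. partial_deriv i f (x + s *\<^sub>R e + t *\<^sub>R d)) has_real_derivative
    partial_deriv j (partial_deriv i f) (x + s *\<^sub>R e + t *\<^sub>R d)) (at t)" for t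
   unfolding e_def d_def by (intro derivative_intros smooth_coord_line_derivative smooth_partial_deriv assms)
  obtain t where t: "0 < t" "t < h" and t': "partial_deriv i f (x + s *\<^sub>R e + h *\<^sub>R d) - partial_deriv i f (x + s *\<^sub>R e + 0 *\<^sub>R d)
    = (h - 0) * partial_deriv j (partial_deriv i f) (x + s *\<^sub>R e + t *\<^sub>R d)" using MVT2[OF assms(2) D2] by blast
  have "f (x + h *\<^sub>R e + h *\<^sub>R d) - f (x + h *\<^sub>R e) - f (x + h *\<^sub>R d) + f x
   = h * h * partial_deriv j (partial_deriv i f) (x + s *\<^sub>R e + t *\<^sub>R d)"
   using s' t' by (simp add: add.commute add.left_commute algebra_simps)
  with s t show ?thesis unfolding e_def d_def by blast
qed

text \<open>The second difference over a square of side h is symmetric in i and j, hence equals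
  \<open>h * h\<close> times either mixed derivative at suitable points of the square. With h = 1 /
  (k + 1) tending to 0, continuity gives equality at x.\<close>

lemma partial_deriv_commute:
  assumes "smooth f"
  shows "partial_deriv i (partial_deriv j f) = partial_deriv j (partial_deriv i f)"
proof
  fix x :: "real^'a"
  let ?p = "\<lambda>s t. x + s *\<^sub>R axis i 1 + t *\<^sub>R axis j (1::real)"
  have "\<exists>s t. \<forall>k. 0 < s k \<and> s k < 1 / real (Suc k) \<and> 0 < t k \<and> t k < 1 / real (Suc k) \<and>
    f (x + (1/real (Suc k)) *\<^sub>R axis i 1 + (1/real (Suc k)) *\<^sub>R axis j 1) - f (x + (1/real (Suc k)) *\<^sub>R axis i 1) - f (x + (1/real (Suc k)) *\<^sub>R axis j 1) + f x
    = (1/real (Suc k)) * (1/real (Suc k)) * partial_deriv j (partial_deriv i f) (x + s k *\<^sub>R axis i 1 + t k *\<^sub>R axis j 1)" (is "\<exists>s t. \<forall>k. ?P i j k (s k) (t k)") for i j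
  proof -
   have "\<forall>k. \<exists>s t. ?P i j k s t" by (intro allI second_difference_mean_value assms) simp
   from choice[OF this] obtain s where "\<forall>k. \<exists>t. ?P i j k (s k) t" ..
   from choice[OF this] show ?thesis by blast
  qed
  then obtain s t s' t' where st: "\<And>k. ?P i j k (s k) (t k)" and st': "\<And>k. ?P j i k (s' k) (t' k)" by metis
  have lim: "(\<lambda>k. g (x + s k *\<^sub>R axis i 1 + t k *\<^sub>R axis j 1)) \<longlonglongrightarrow> g x"
   if g: "smooth g" and b: "\<And>k. 0 < s k \<and> s k < 1 / real (Suc k) \<and> 0 < t k \<and> t k < 1 / real (Suc k)"
   for g s t i j
  proof -
   have "s \<longlonglongrightarrow> 0" "t \<longlonglongrightarrow> 0"
    by (rule tendsto_sandwich[OF _ _ tendsto_const LIMSEQ_inverse_real_of_nat];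
      use b in \<open>auto intro!: always_eventually less_imp_le simp: inverse_eq_divide\<close>)+
   then have "(\<lambda>k. x + s k *\<^sub>R axis i 1 + t k *\<^sub>R axis j 1) \<longlonglongrightarrow> x + 0 *\<^sub>R axis i 1 + 0 *\<^sub>R axis j 1"
    by (intro tendsto_intros)
   then have "(\<lambda>k. x + s k *\<^sub>R axis i 1 + t k *\<^sub>R axis j 1) \<longlonglongrightarrow> x" by simp
   moreover have "isCont g x" using g by (simp add: smooth_differentiable differentiable_imp_continuous_within)
   ultimately show ?thesis by (rule isCont_tendsto_compose[rotated])
  qed
  have 1: "(\<lambda>k. partial_deriv j (partial_deriv i f) (x + s k *\<^sub>R axis i 1 + t k *\<^sub>R axis j 1)) \<longlonglongrightarrow> partial_deriv j (partial_deriv i f) x"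
   by (rule lim) (use assms st in auto)
  have 2: "(\<lambda>k. partial_deriv i (partial_deriv j f) (x + s' k *\<^sub>R axis j 1 + t' k *\<^sub>R axis i 1)) \<longlonglongrightarrow> partial_deriv i (partial_deriv j f) x"
   by (rule lim) (use assms st' in auto)
  have eq: "partial_deriv j (partial_deriv i f) (x + s k *\<^sub>R axis i 1 + t k *\<^sub>R axis j 1)
    = partial_deriv i (partial_deriv j f) (x + s' k *\<^sub>R axis j 1 + t' k *\<^sub>R axis i 1)" for k
  proof -
   define h where "h = 1 / real (Suc k)"
   have "h * h * partial_deriv j (partial_deriv i f) (x + s k *\<^sub>R axis i 1 + t k *\<^sub>R axis j 1)
    = h * h * partial_deriv i (partial_deriv j f) (x + s' k *\<^sub>R axis j 1 + t' k *\<^sub>R axis i 1)"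
   proof -
    have c: "x + h *\<^sub>R axis j 1 + h *\<^sub>R axis i 1 = x + h *\<^sub>R axis i 1 + h *\<^sub>R axis j 1" by (simp add: ac_simps)
    show ?thesis using st[of k] st'[of k] unfolding h_def[symmetric] c by linarith
   qed
   moreover have "h \<noteq> 0" by (simp add: h_def)
   ultimately show ?thesis by simp
  qed
  show "partial_deriv i (partial_deriv j f) x = partial_deriv j (partial_deriv i f) x" using LIMSEQ_unique[OF 1 2[folded eq]] by simp
qed

lemma partial_derivs_swap:
  assumes "smooth f"
  shows "partial_derivs (is @ i # js) f = partial_derivs (i # is @ js) f"
proof (induction "is")
  case (Cons a "is")
  have "partial_derivs ((a # is) @ i # js) f = partial_deriv a (partial_deriv i (partial_derivs (is @ js) f))"
   using Cons by (simp add: partial_derivs_Cons)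
  also have "\<dots> = partial_deriv i (partial_deriv a (partial_derivs (is @ js) f))" using assms by (intro partial_deriv_commute) auto
  finally show ?case by (simp add: partial_derivs_Cons)
qed simp

text \<open>Indices are moved to the front one by one with \<open>partial_derivs_swap\<close>. That
  only the multiset of indices matters is what later permits symmetric families of weak
  derivatives.\<close>

lemma partial_derivs_mset_cong:
  assumes "smooth f" "mset is = mset js"
  shows "partial_derivs is f = partial_derivs js f"
  using assms(2)
proof (induction "is" arbitrary: js)
  case (Cons a "is")
  then obtain js1 js2 where js: "js = js1 @ a # js2" by (metis list.set_intros(1) mset_eq_setD split_list)
  with Cons.prems have "mset is = mset (js1 @ js2)" by simp
  from Cons.IH[OF this] show ?case using partial_derivs_swap[OF assms(1), of js1 a js2] by (simp add: js partial_derivs_Cons)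
qed simp

section \<open>The flat exponential and smooth cut-offs\<close>

definition exp_flat :: "nat \<Rightarrow> real \<Rightarrow> real"
  where "exp_flat k t = (if t > 0 then (1 / t) ^ k * exp (- (1 / t)) else 0)"

lemma exp_flat_nonneg: "0 \<le> exp_flat k t" and exp_flat_pos: "t > 0 \<Longrightarrow> 0 < exp_flat k t"
  and exp_flat_eq_0: "t \<le> 0 \<Longrightarrow> exp_flat k t = 0"
  by (auto simp: exp_flat_def)

lemma exp_flat_0_less_1: "exp_flat 0 t < 1"
  by (auto simp: exp_flat_def)

lemma exp_flat_tendsto_0: "(exp_flat k \<longlongrightarrow> 0) (at_right 0)"
proof -
  have "((\<lambda>t::real. (inverse t) ^ k / exp (inverse t)) \<longlongrightarrow> 0) (at_right 0)"
   by (rule filterlim_compose[OF tendsto_power_div_exp_0 filterlim_inverse_at_top_right])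
  then show ?thesis by (rule Lim_transform_eventually)
    (auto simp: exp_flat_def eventually_at_filter exp_minus field_simps intro!: always_eventually)
qed

text \<open>The powers of 1 / t are carried along because they make the family closed under
  differentiation, so that all members are proved smooth by one induction.\<close>

lemma exp_flat_has_derivative:
  "(exp_flat k has_real_derivative exp_flat (k + 2) t - real k * exp_flat (k + 1) t) (at t)"
proof -
  consider "t > 0" | "t < 0" | "t = 0" by linarith
  then show ?thesis
  proof cases
   case 1
   have "((\<lambda>t. (1 / t) ^ k * exp (- (1 / t))) has_real_derivative
     exp_flat (k + 2) t - real k * exp_flat (k + 1) t) (at t)"
   proof -
    have "((\<lambda>t. (1 / t) ^ k * exp (- (1 / t))) has_real_derivative
      (real k * (1 / t) ^ (k - 1) * (- (1 / t\<^sup>2))) * exp (- (1 / t)) + (exp (- (1 / t)) * (1 / t\<^sup>2)) * (1 / t) ^ k) (at t)"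
     using 1 by (auto intro!: derivative_eq_intros simp: power2_eq_square)
    moreover have "real k * (1 / t) ^ (k - 1) * (- (1 / t\<^sup>2)) = - (real k * (1 / t) ^ (k + 1))" by (cases k) (auto simp: power2_eq_square)
    moreover have "exp_flat (k + 2) t - real k * exp_flat (k + 1) t = - (real k * (1 / t) ^ (k + 1)) * exp (- (1 / t)) + (exp (- (1 / t)) * (1 / t\<^sup>2)) * (1 / t) ^ k"
     using 1 by (simp add: exp_flat_def power2_eq_square algebra_simps)
    ultimately show ?thesis by metis
   qed
   then show ?thesis by (rule has_field_derivative_transform_within_open[where S="{0<..}"])
     (use 1 in \<open>auto simp: exp_flat_def\<close>)
  next
   case 2
   have "((\<lambda>t. 0) has_real_derivative exp_flat (k + 2) t - real k * exp_flat (k + 1) t) (at t)" using 2 by (auto simp: exp_flat_def)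
   then show ?thesis by (rule has_field_derivative_transform_within_open[where S="{..<0}"])
     (use 2 in \<open>auto simp: exp_flat_def\<close>)
  next
   case 3
   \<comment> \<open>The difference quotient at 0 is the next member of the family, whose one-sided
     limits at 0 vanish.\<close>
   have eq: "(exp_flat k (0 + h) - exp_flat k 0) / h = exp_flat (k + 1) h" for h by (auto simp: exp_flat_def)
   have "(exp_flat (k + 1) \<longlongrightarrow> 0) (at_left 0)" by (rule Lim_transform_eventually[OF tendsto_const])
     (auto simp: eventually_at_filter exp_flat_def intro!: always_eventually)
   then have "(exp_flat (k + 1) \<longlongrightarrow> 0) (at 0)" using exp_flat_tendsto_0 by (simp add: filterlim_at_split)
   then show ?thesis unfolding DERIV_def using 3 eq by (simp add: exp_flat_eq_0)
  qed
qed

lemma exp_flat_compose_has_derivative: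
  assumes "smooth p"
  shows "partial_deriv i (\<lambda>x. exp_flat k (p x)) x
    = (exp_flat (k + 2) (p x) - real k * exp_flat (k + 1) (p x)) * partial_deriv i p x"
   and "(\<lambda>x. exp_flat k (p x)) differentiable (at x)"
proof -
  have *: "((\<lambda>x. exp_flat k (p x)) has_derivative
    (\<lambda>h. (exp_flat (k + 2) (p x) - real k * exp_flat (k + 1) (p x)) * frechet_derivative p (at x) h)) (at x)"
   using has_derivative_compose[OF smooth_differentiable[OF assms, unfolded frechet_derivative_works]
     exp_flat_has_derivative[unfolded has_field_derivative_def]] .
  then show "(\<lambda>x. exp_flat k (p x)) differentiable (at x)" by (rule differentiableI)
  from partial_deriv_eq[OF *] show "partial_deriv i (\<lambda>x. exp_flat k (p x)) x
    = (exp_flat (k + 2) (p x) - real k * exp_flat (k + 1) (p x)) * partial_deriv i p x" by (simp add: partial_deriv_def)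
qed

lemma smooth_exp_flat [intro]:
  assumes "smooth p"
  shows "smooth (\<lambda>x. exp_flat k (p x))"
proof -
  have "Ck m (\<lambda>x. exp_flat k (p x))" for m
  proof (induction m arbitrary: k)
   case 0 then show ?case by (simp add: Ck_0 exp_flat_compose_has_derivative assms)
  next
   case (Suc m)
   have "partial_deriv i (\<lambda>x. exp_flat k (p x)) =
    (\<lambda>x. (exp_flat (k + 2) (p x) + (- real k) * exp_flat (k + 1) (p x)) * partial_deriv i p x)" for i
    by (rule ext) (simp add: exp_flat_compose_has_derivative assms)
   moreover have "Ck m (partial_deriv i p)" for i using assms smooth_partial_deriv smooth_iff_Ck by blast
   ultimately show ?case by (simp only: Ck_Suc) (intro conjI allI exp_flat_compose_has_derivative assms Ck_mult Ck_add Ck_const Suc)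
  qed
  then show ?thesis by (simp add: smooth_iff_Ck)
qed

lemma smooth_norm_diff_sq [intro]: "smooth (\<lambda>z. (norm (z - c))\<^sup>2)"
proof -
  have "(\<lambda>z. (norm (z - c))\<^sup>2) = (\<lambda>z. \<Sum>i\<in>UNIV. (z $ i - c $ i)\<^sup>2)"
   by (simp add: fun_eq_iff norm_vec_def L2_set_def sum_nonneg)
  moreover have "smooth \<dots>" by (intro smooth_sum smooth_power smooth_diff smooth_coord smooth_const)
  ultimately show ?thesis by simp
qed

lemma partial_deriv_norm_diff_sq: "partial_deriv i (\<lambda>z. (norm (z - c))\<^sup>2) x = 2 * (x $ i - c $ i)"
proof -
  have "((\<lambda>z. (z - c) \<bullet> (z - c)) has_derivative (\<lambda>h. (x - c) \<bullet> h + h \<bullet> (x - c))) (at x)"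
   by (auto intro!: derivative_eq_intros)
  then have "((\<lambda>z. (norm (z - c))\<^sup>2) has_derivative (\<lambda>h. (x - c) \<bullet> h + h \<bullet> (x - c))) (at x)"
   by (simp add: power2_norm_eq_inner)
  from partial_deriv_eq[OF this, of i] show ?thesis by (simp add: inner_axis inner_axis')
qed

text \<open>K is any set containing the points where \<phi> is nonzero, not necessarily its support.
  Products, and for closed K also derivatives, then keep the same K, and no closure has to be
  recomputed.\<close>

definition vanishes_off :: "'a::euclidean_space set \<Rightarrow> ('a \<Rightarrow> real) \<Rightarrow> bool"
  where "vanishes_off K \<phi> \<longleftrightarrow> (\<forall>x. x \<notin> K \<longrightarrow> \<phi> x = 0)"

lemma test_functionsI:
  assumes "smooth \<phi>" "compact K" "K \<subseteq> \<Omega>" "vanishes_off K \<phi>"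
  shows "\<phi> \<in> test_functions \<Omega>"
proof -
  have "closure {x. \<phi> x \<noteq> 0} \<subseteq> K"
   by (rule closure_minimal) (use assms in \<open>auto simp: vanishes_off_def compact_imp_closed\<close>)
  moreover then have "compact (closure {x. \<phi> x \<noteq> 0})" by (meson assms(2) bounded_subset closed_closure compact_eq_bounded_closed)
  ultimately show ?thesis using assms by (auto simp: test_functions_def smooth_def)
qed

lemma test_functionsE:
  assumes "\<phi> \<in> test_functions \<Omega>"
  obtains K where "smooth \<phi>" "compact K" "K \<subseteq> \<Omega>" "vanishes_off K \<phi>"
proof
  show "smooth \<phi>" using assms by (simp add: test_functions_def smooth_def)
  show "compact (closure {x. \<phi> x \<noteq> 0})" "closure {x. \<phi> x \<noteq> 0} \<subseteq> \<Omega>"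
   using assms by (auto simp: test_functions_def)
  show "vanishes_off (closure {x. \<phi> x \<noteq> 0}) \<phi>"
   using closure_subset[of "{x. \<phi> x \<noteq> 0}"] by (auto simp: vanishes_off_def)
qed

lemma vanishes_off_partial_deriv:
  assumes "vanishes_off K \<phi>" "closed K"
  shows "vanishes_off K (partial_deriv i \<phi>)"
  unfolding vanishes_off_def
proof (intro allI impI)
  fix x assume "x \<notin> K"
  have "(\<phi> has_derivative (\<lambda>h. 0)) (at x)"
  proof (rule has_derivative_transform_within_open)
   show "((\<lambda>x. 0) has_derivative (\<lambda>h. 0)) (at x)" by simp
   show "open (- K)" "x \<in> - K" using \<open>x \<notin> K\<close> assms(2) by auto
  qed (use assms in \<open>auto simp: vanishes_off_def\<close>)
  from partial_deriv_eq[OF this] show "partial_deriv i \<phi> x = 0" by simp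
qed

lemma vanishes_off_partial_derivs:
  assumes "vanishes_off K \<phi>" "closed K"
  shows "vanishes_off K (partial_derivs is \<phi>)"
  by (induction "is") (auto simp: assms partial_derivs_Cons intro: vanishes_off_partial_deriv)

lemma vanishes_off_mult: "vanishes_off K g \<Longrightarrow> vanishes_off K (\<lambda>x. f x * g x)"
  by (simp add: vanishes_off_def)

lemma test_functions_partial_deriv: "\<phi> \<in> test_functions \<Omega> \<Longrightarrow> partial_deriv i \<phi> \<in> test_functions \<Omega>"
  by (erule test_functionsE, rule test_functionsI)
   (erule smooth_partial_deriv, assumption+, erule vanishes_off_partial_deriv, erule compact_imp_closed)

lemma test_functions_partial_derivs: "\<phi> \<in> test_functions \<Omega> \<Longrightarrow> partial_derivs is \<phi> \<in> test_functions \<Omega>"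
  by (induction "is") (auto simp: partial_derivs_Cons intro: test_functions_partial_deriv)

lemma test_functions_mult: "smooth f \<Longrightarrow> \<phi> \<in> test_functions \<Omega> \<Longrightarrow> (\<lambda>x. f x * \<phi> x) \<in> test_functions \<Omega>"
  by (erule test_functionsE, rule test_functionsI) (erule (1) smooth_mult, assumption+, erule vanishes_off_mult)

section \<open>Integrals against functions of compact support\<close>

lemma continuous_compact_bounded_real:
  fixes \<phi> :: "'a::euclidean_space \<Rightarrow> real"
  assumes "continuous_on K \<phi>" "compact K"
  obtains B where "0 \<le> B" "\<And>x. x \<in> K \<Longrightarrow> \<bar>\<phi> x\<bar> \<le> B"
proof -
  have "bounded (\<phi> ` K)" using assms by (simp add: compact_continuous_image compact_imp_bounded)
  then obtain B where "\<And>x. x \<in> K \<Longrightarrow> \<bar>\<phi> x\<bar> \<le> B" by (auto simp: bounded_iff)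
  then have "0 \<le> max B 0" "\<And>x. x \<in> K \<Longrightarrow> \<bar>\<phi> x\<bar> \<le> max B 0" by (auto simp: le_max_iff_disj)
  then show thesis by (rule that)
qed

lemma integrable_on_compact_mult:
  fixes g \<phi> :: "'a::euclidean_space \<Rightarrow> real"
  assumes g: "integrable (lebesgue_on K) g" and \<phi>: "continuous_on K \<phi>" and K: "compact K" and v: "vanishes_off K \<phi>"
  shows "integrable lebesgue (\<lambda>x. g x * \<phi> x)"
proof -
  obtain B where B: "\<And>x. x \<in> K \<Longrightarrow> \<bar>\<phi> x\<bar> \<le> B" "0 \<le> B" using continuous_compact_bounded_real[OF \<phi> K] by blast
  have K': "K \<in> sets lebesgue" using K by (simp add: compact_imp_closed lborelD)
  have [measurable]: "\<phi> \<in> borel_measurable (lebesgue_on K)" by (rule continuous_imp_measurable_on_sets_lebesgue) (use \<phi> K' in auto)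
  have [measurable]: "g \<in> borel_measurable (lebesgue_on K)" using g by auto
  have "integrable (lebesgue_on K) (\<lambda>x. g x * \<phi> x)"
  proof (rule Bochner_Integration.integrable_bound)
   show "integrable (lebesgue_on K) (\<lambda>x. B * g x)" using g by simp
   show "AE x in lebesgue_on K. norm (g x * \<phi> x) \<le> norm (B * g x)"
    by (rule AE_I2) (use B K' in \<open>auto simp: abs_mult mult.commute mult_right_mono\<close>)
  qed measurable
  then have "integrable lebesgue (\<lambda>x. if x \<in> K then g x * \<phi> x else 0)"
   using Lebesgue_Measure.integrable_restrict_UNIV[OF K', of "\<lambda>x. g x * \<phi> x"] by blast
  moreover have "(\<lambda>x. if x \<in> K then g x * \<phi> x else 0) = (\<lambda>x. g x * \<phi> x)" using v by (auto simp: vanishes_off_def)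
  ultimately show ?thesis by simp
qed

lemma locally_integrable_mult:
  assumes "locally_integrable \<Omega> g" "continuous_on K \<phi>" "compact K" "K \<subseteq> \<Omega>" "vanishes_off K \<phi>"
  shows "integrable lebesgue (\<lambda>x. g x * \<phi> x)"
  by (rule integrable_on_compact_mult[OF _ assms(2,3,5)]) (use assms in \<open>simp add: locally_integrable_def\<close>)

lemma locally_integrable_test:
  assumes "locally_integrable \<Omega> g" "\<phi> \<in> test_functions \<Omega>"
  shows "integrable lebesgue (\<lambda>x. g x * \<phi> x)"
  using assms(2) by (elim test_functionsE) (rule locally_integrable_mult[OF assms(1) smooth_continuous])

lemma integral_on_vanishes_off:
  fixes g \<phi> :: "'a::euclidean_space \<Rightarrow> real"
  assumes "vanishes_off K \<phi>" "K \<subseteq> \<Omega>" "\<Omega> \<in> sets lebesgue"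
  shows "(\<integral>x. g x * \<phi> x \<partial>lebesgue_on \<Omega>) = (\<integral>x. g x * \<phi> x \<partial>lebesgue)"
proof -
  have "(\<lambda>x. g x * \<phi> x) = (\<lambda>x. if x \<in> \<Omega> then g x * \<phi> x else 0)"
   using assms(1,2) by (force simp: vanishes_off_def)
  then show ?thesis using Lebesgue_Measure.integral_restrict_UNIV[OF assms(3), of "\<lambda>x. g x * \<phi> x"] by simp
qed

lemma integral_on_test:
  assumes "\<phi> \<in> test_functions \<Omega>" "\<Omega> \<in> sets lebesgue"
  shows "(\<integral>x. g x * \<phi> x \<partial>lebesgue_on \<Omega>) = (\<integral>x. g x * \<phi> x \<partial>lebesgue)"
  using assms(1) by (elim test_functionsE) (rule integral_on_vanishes_off[OF _ _ assms(2)])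

text \<open>Difference quotients are dominated by D through the mean value inequality on the convex
  set T. Derivatives are taken within T, so that closed parameter intervals can be used up to their
  endpoints.\<close>

lemma has_real_derivative_integral:
  fixes f f' :: "real \<Rightarrow> 'a \<Rightarrow> real" and D :: "'a \<Rightarrow> real"
  assumes T: "convex T" "t0 \<in> T"
   and int: "\<And>t. t \<in> T \<Longrightarrow> integrable M (f t)"
   and meas: "f' t0 \<in> borel_measurable M"
   and D: "integrable M D"
   and der: "\<And>t x. t \<in> T \<Longrightarrow> x \<in> space M \<Longrightarrow> ((\<lambda>t. f t x) has_real_derivative f' t x) (at t within T)"
   and bnd: "\<And>t x. t \<in> T \<Longrightarrow> x \<in> space M \<Longrightarrow> \<bar>f' t x\<bar> \<le> D x"
  shows "((\<lambda>t. \<integral>x. f t x \<partial>M) has_real_derivative (\<integral>x. f' t0 x \<partial>M)) (at t0 within T)"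
  unfolding has_field_derivative_iff tendsto_at_iff_sequentially comp_def
proof (intro allI impI)
  fix X :: "nat \<Rightarrow> real" assume X: "\<forall>i. X i \<in> T - {t0}" "X \<longlonglongrightarrow> t0"
  define s where "s = (\<lambda>k x. (f (X k) x - f t0 x) / (X k - t0))"
  have eq: "((\<integral>x. f (X k) x \<partial>M) - (\<integral>x. f t0 x \<partial>M)) / (X k - t0) = (\<integral>x. s k x \<partial>M)" for k
   unfolding s_def using X T int by (subst integral_divide_zero) (auto simp: Bochner_Integration.integral_diff)
  have "(\<lambda>k. \<integral>x. s k x \<partial>M) \<longlonglongrightarrow> (\<integral>x. f' t0 x \<partial>M)"
  proof (rule integral_dominated_convergence[where w=D])
   show "s k \<in> borel_measurable M" for k
   proof -
    have "f (X k) \<in> borel_measurable M" "f t0 \<in> borel_measurable M" using int[of "X k"] int[of t0] X T by auto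
    then show ?thesis unfolding s_def by measurable
   qed
   show "AE x in M. (\<lambda>k. s k x) \<longlonglongrightarrow> f' t0 x"
   proof (rule AE_I2)
    fix x assume "x \<in> space M"
    from der[OF T(2) this] show "(\<lambda>k. s k x) \<longlonglongrightarrow> f' t0 x"
     unfolding has_field_derivative_iff tendsto_at_iff_sequentially comp_def s_def using X by blast
   qed
   show "AE x in M. norm (s k x) \<le> D x" for k
   proof (rule AE_I2)
    fix x assume x: "x \<in> space M"
    have "norm (f (X k) x - f t0 x) \<le> D x * norm (X k - t0)" by (rule field_differentiable_bound[OF T(1) der[OF _ x]])
      (use X T x bnd in auto)
    then show "norm (s k x) \<le> D x" using X by (auto simp: s_def divide_simps)
   qed
  qed (use meas D in auto)
  then show "(\<lambda>k. ((\<integral>x. f (X k) x \<partial>M) - (\<integral>x. f t0 x \<partial>M)) / (X k - t0)) \<longlonglongrightarrow> (\<integral>x. f' t0 x \<partial>M)"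
   by (simp add: eq)
qed

lemma integral_translate:
  fixes f :: "'a::euclidean_space \<Rightarrow> real"
  assumes [measurable]: "f \<in> borel_measurable borel"
  shows "(\<integral>x. f (x + c) \<partial>lborel) = (\<integral>x. f x \<partial>lborel)"
proof -
  have "(\<integral>x. f x \<partial>lborel) = (\<integral>x. f x \<partial>distr lborel borel ((+) c))" by (simp add: lborel_distr_plus)
  also have "\<dots> = (\<integral>x. f (c + x) \<partial>lborel)" by (subst integral_distr) auto
  finally show ?thesis by (simp add: add.commute)
qed

lemma smooth_measurable [measurable_dest]: "smooth f \<Longrightarrow> f \<in> borel_measurable borel"
  by (intro borel_measurable_continuous_onI smooth_continuous)

lemma integrable_vanishes_off:
  fixes f :: "'a::euclidean_space \<Rightarrow> real"
  assumes "continuous_on UNIV f" "compact K" "vanishes_off K f"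
  shows "integrable lborel f"
proof -
  have "integrable lborel (\<lambda>x. indicator K x *\<^sub>R f x)"
   using assms by (intro borel_integrable_compact) (auto intro: continuous_on_subset)
  moreover have "(\<lambda>x. indicator K x *\<^sub>R f x) = f" using assms(3) by (auto simp: vanishes_off_def indicator_def fun_eq_iff)
  ultimately show ?thesis by simp
qed

text \<open>By translation invariance the integral of \<phi> shifted by t in direction i does not
  depend on t; differentiation at t = 0 under the integral sign gives the claim.\<close>

lemma integral_partial_deriv_eq_0:
  fixes \<phi> :: "real^'n::finite \<Rightarrow> real"
  assumes "smooth \<phi>" "compact K" "vanishes_off K \<phi>"
  shows "(\<integral>x. partial_deriv i \<phi> x \<partial>lborel) = 0"
proof -
  obtain R where R: "\<And>x. x \<in> K \<Longrightarrow> norm x \<le> R" using compact_imp_bounded[OF assms(2)] by (auto simp: bounded_iff)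
  \<comment> \<open>Shifts by at most 1 of a function living in the ball of radius R stay in the
    ball of radius R + 1, where a constant dominates the derivative.\<close>
  let ?C = "cball (0::real^'n) (R + 1)"
  have pv: "vanishes_off K (partial_deriv i \<phi>)" using assms by (intro vanishes_off_partial_deriv compact_imp_closed)
  obtain B where B: "0 \<le> B" "\<And>x. x \<in> K \<Longrightarrow> \<bar>partial_deriv i \<phi> x\<bar> \<le> B"
   using continuous_compact_bounded_real[OF smooth_continuous[OF smooth_partial_deriv[OF assms(1)]] assms(2)] by blast
  let ?T = "{-1..1::real}"
  have "((\<lambda>t. \<integral>x. \<phi> (x + t *\<^sub>R axis i 1) \<partial>lborel) has_real_derivative (\<integral>x. partial_deriv i \<phi> (x + 0 *\<^sub>R axis i 1) \<partial>lborel)) (at 0 within ?T)"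
  proof (rule has_real_derivative_integral[where D="\<lambda>x. B * indicator ?C x" and f'="\<lambda>t x. partial_deriv i \<phi> (x + t *\<^sub>R axis i 1)"])
   fix t :: real assume "t \<in> ?T"
   have "integrable lborel (\<lambda>x. \<phi> (x + t *\<^sub>R axis i 1))"
   proof (rule integrable_vanishes_off)
    show "continuous_on UNIV (\<lambda>x. \<phi> (x + t *\<^sub>R axis i 1))"
     by (rule continuous_on_compose2[OF smooth_continuous[OF assms(1), of UNIV]]) (auto intro!: continuous_intros)
    show "compact ((\<lambda>x. x - t *\<^sub>R axis i 1) ` K)" by (intro compact_continuous_image assms continuous_intros)
    show "vanishes_off ((\<lambda>x. x - t *\<^sub>R axis i 1) ` K) (\<lambda>x. \<phi> (x + t *\<^sub>R axis i 1))"
     using assms(3) by (auto simp: vanishes_off_def image_def) (metis add_diff_cancel_right')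
   qed
   then show "integrable lborel (\<lambda>x. \<phi> (x + t *\<^sub>R axis i 1))" .
  next
   show "integrable lborel (\<lambda>x. B * indicator ?C x)"
    by (intro integrable_mult_right integrable_real_indicator) (use emeasure_compact_finite[OF compact_cball[of "0::real^'n" "R + 1"]] in \<open>auto simp: less_top\<close>)
  next
   fix t x assume t: "t \<in> ?T"
   show "\<bar>partial_deriv i \<phi> (x + t *\<^sub>R axis i 1)\<bar> \<le> B * indicator ?C x"
   proof (cases "x + t *\<^sub>R axis i 1 \<in> K")
    case True
    have "norm x \<le> norm (x + t *\<^sub>R axis i 1) + norm (t *\<^sub>R axis i (1::real))"
     using norm_triangle_ineq4[of "x + t *\<^sub>R axis i 1" "t *\<^sub>R axis i (1::real)"] by simp
    also have "\<dots> \<le> R + 1" using R[OF True] t by auto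
    finally show ?thesis using B(2)[OF True] by simp
   qed (use pv B in \<open>auto simp: vanishes_off_def\<close>)
  next
   fix t x show "((\<lambda>t. \<phi> (x + t *\<^sub>R axis i 1)) has_real_derivative partial_deriv i \<phi> (x + t *\<^sub>R axis i 1)) (at t within ?T)"
    by (rule smooth_coord_line_derivative[OF assms(1)])
  next
   show "(\<lambda>x. partial_deriv i \<phi> (x + 0 *\<^sub>R axis i 1)) \<in> borel_measurable lborel"
    using smooth_measurable[OF smooth_partial_deriv[OF assms(1)]] by simp
  qed auto
  moreover have "(\<integral>x. \<phi> (x + t *\<^sub>R axis i 1) \<partial>lborel) = (\<integral>x. \<phi> x \<partial>lborel)" for t
   by (rule integral_translate) (use assms in \<open>auto intro: smooth_measurable\<close>)
  ultimately have "((\<lambda>t. \<integral>x. \<phi> x \<partial>lborel) has_real_derivative (\<integral>x. partial_deriv i \<phi> x \<partial>lborel)) (at 0 within ?T)"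
   by simp
  moreover have "((\<lambda>t::real. \<integral>x. \<phi> x \<partial>lborel) has_real_derivative 0) (at 0 within ?T)" by simp
  ultimately show ?thesis unfolding has_real_derivative_iff_has_vector_derivative
   by (rule vector_derivative_unique_within[rotated]) (simp add: trivial_limit_within islimpt_Icc)
qed

section \<open>Weak derivatives\<close>

lemma integral_by_parts_test:
  fixes f \<phi> :: "real^'n::finite \<Rightarrow> real"
  assumes "smooth f" "\<phi> \<in> test_functions \<Omega>"
  shows "(\<integral>x. f x * partial_deriv i \<phi> x \<partial>lebesgue) = - (\<integral>x. partial_deriv i f x * \<phi> x \<partial>lebesgue)"
proof -
  obtain K where K: "smooth \<phi>" "compact K" "vanishes_off K \<phi>" using assms(2) by (rule test_functionsE)
  have pd: "partial_deriv i (\<lambda>x. f x * \<phi> x) = (\<lambda>x. partial_deriv i f x * \<phi> x + f x * partial_deriv i \<phi> x)"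
   by (rule ext, rule partial_deriv_mult) (use assms K in \<open>auto intro: smooth_differentiable\<close>)
  have 0: "(\<integral>x. partial_deriv i (\<lambda>x. f x * \<phi> x) x \<partial>lborel) = 0"
   by (rule integral_partial_deriv_eq_0[OF smooth_mult[OF assms(1) K(1)] K(2)]) (use K vanishes_off_mult in auto)
  have i1: "integrable lborel (\<lambda>x. partial_deriv i f x * \<phi> x)" by (rule integrable_vanishes_off[OF _ K(2)])
    (use assms K in \<open>auto intro!: smooth_continuous smooth_mult vanishes_off_mult\<close>)
  have i2: "integrable lborel (\<lambda>x. f x * partial_deriv i \<phi> x)" by (rule integrable_vanishes_off[OF _ K(2)])
    (use assms K in \<open>auto intro!: smooth_continuous smooth_mult vanishes_off_mult vanishes_off_partial_deriv compact_imp_closed\<close>)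
  have m: "(\<lambda>x. f x * partial_deriv i \<phi> x) \<in> borel_measurable lborel" "(\<lambda>x. partial_deriv i f x * \<phi> x) \<in> borel_measurable lborel"
   using i1 i2 by auto
  show ?thesis using 0 i1 i2 unfolding pd by (simp add: integral_completion m)
qed

text \<open>The outermost derivative of \<phi> is moved first and so reaches f first, which reverses
  the order; symmetry of mixed derivatives restores it.\<close>

lemma integral_partial_derivs_test:
  fixes f \<phi> :: "real^'n::finite \<Rightarrow> real"
  assumes "smooth f" "\<phi> \<in> test_functions \<Omega>"
  shows "(\<integral>x. f x * partial_derivs is \<phi> x \<partial>lebesgue) = (-1) ^ length is * (\<integral>x. partial_derivs is f x * \<phi> x \<partial>lebesgue)"
  using assms(1)
proof (induction "is" arbitrary: f)
  case (Cons i "is")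
  have "(\<integral>x. f x * partial_derivs (i # is) \<phi> x \<partial>lebesgue) = - (\<integral>x. partial_deriv i f x * partial_derivs is \<phi> x \<partial>lebesgue)"
   unfolding partial_derivs_Cons by (rule integral_by_parts_test[OF Cons.prems]) (rule test_functions_partial_derivs[OF assms(2)])
  also have "\<dots> = - ((-1) ^ length is * (\<integral>x. partial_derivs is (partial_deriv i f) x * \<phi> x \<partial>lebesgue))"
   using Cons.IH[OF smooth_partial_deriv[OF Cons.prems]] by simp
  also have "partial_derivs is (partial_deriv i f) = partial_derivs (i # is) f"
   using partial_derivs_swap[OF Cons.prems, of "is" i "[]"] by (simp add: partial_derivs_append)
  finally show ?case by simp
qed simp

lemma locally_integrable_continuous:
  fixes f :: "'a::euclidean_space \<Rightarrow> real"
  assumes "continuous_on \<Omega> f"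
  shows "locally_integrable \<Omega> f"
  unfolding locally_integrable_def
proof (intro allI impI)
  fix K assume K: "compact K" "K \<subseteq> \<Omega>"
  have i: "integrable lborel (\<lambda>x. indicator K x *\<^sub>R f x)"
   using K assms by (intro borel_integrable_compact) (auto intro: continuous_on_subset)
  then have "integrable lebesgue (\<lambda>x. indicator K x *\<^sub>R f x)" by (subst integrable_completion) auto
  moreover have "(\<lambda>x. indicator K x *\<^sub>R f x) = (\<lambda>x. if x \<in> K then f x else 0)" by (auto simp: fun_eq_iff indicator_def)
  ultimately show "integrable (lebesgue_on K) f"
   using K(1) by (subst Lebesgue_Measure.integrable_restrict_UNIV[symmetric]) (auto simp: compact_imp_closed lborelD)
qed

lemma has_weak_deriv_smooth:
  assumes "smooth f" "open \<Omega>"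
  shows "has_weak_deriv \<Omega> is f (partial_derivs is f)"
  unfolding has_weak_deriv_def
proof (intro conjI ballI)
  show "locally_integrable \<Omega> f" "locally_integrable \<Omega> (partial_derivs is f)"
   using assms by (auto intro!: locally_integrable_continuous smooth_continuous)
  fix \<phi> assume \<phi>: "\<phi> \<in> test_functions \<Omega>"
  show "(\<integral>x. f x * partial_derivs is \<phi> x \<partial>lebesgue_on \<Omega>)
     = (-1) ^ length is * (\<integral>x. partial_derivs is f x * \<phi> x \<partial>lebesgue_on \<Omega>)"
   using assms(2) by (simp add: integral_on_test[OF \<phi>] integral_on_test[OF test_functions_partial_derivs[OF \<phi>]]
    integral_partial_derivs_test[OF assms(1) \<phi>] lborelD)
qed

section \<open>The fundamental lemma of the calculus of variations\<close>

definition box_bump :: "real^'n::finite \<Rightarrow> real^'n \<Rightarrow> real^'n \<Rightarrow> real"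
  where "box_bump a b x = (\<Prod>i\<in>UNIV. exp_flat 0 (x $ i - a $ i) * exp_flat 0 (b $ i - x $ i))"

lemma smooth_box_bump: "smooth (box_bump a b)"
  unfolding box_bump_def by (intro smooth_prod smooth_mult smooth_exp_flat smooth_diff smooth_coord smooth_const)

lemma box_bump_pos: "x \<in> box a b \<Longrightarrow> 0 < box_bump a b x"
  unfolding box_bump_def by (intro prod_pos) (auto simp: mem_box_cart intro!: mult_pos_pos exp_flat_pos)

lemma box_bump_eq_0: "x \<notin> box a b \<Longrightarrow> box_bump a b x = 0"
proof -
  assume "x \<notin> box a b"
  then obtain i where "x $ i - a $ i \<le> 0 \<or> b $ i - x $ i \<le> 0" by (auto simp: mem_box_cart not_less)
  then have "exp_flat 0 (x $ i - a $ i) * exp_flat 0 (b $ i - x $ i) = 0" by (auto simp: exp_flat_eq_0)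
  then show ?thesis unfolding box_bump_def by (intro prod_zero) auto
qed

lemma box_bump_bounds: "0 \<le> box_bump a b x" "box_bump a b x \<le> 1"
proof -
  show "0 \<le> box_bump a b x" unfolding box_bump_def by (intro prod_nonneg) (auto simp: exp_flat_nonneg)
  show "box_bump a b x \<le> 1" unfolding box_bump_def
   by (intro prod_le_1) (auto simp: exp_flat_nonneg less_imp_le[OF exp_flat_0_less_1] intro!: mult_le_one)
qed

text \<open>\<open>box_bump\<close> is at most 1 and positive exactly on the open box, so
  \<open>1 - (1 - box_bump a b x) ^ k\<close> are test functions increasing to the indicator of the
  box. Dominated convergence, with w restricted to the closed box as majorant, carries the
  hypothesis to the limit.\<close>

lemma integral_box_eq_0:
  fixes w :: "real^'n::finite \<Rightarrow> real"
  assumes w: "locally_integrable \<Omega> w" and \<Omega>: "cbox a b \<subseteq> \<Omega>"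
   and 0: "\<And>\<phi>. \<phi> \<in> test_functions \<Omega> \<Longrightarrow> (\<integral>x. w x * \<phi> x \<partial>lebesgue) = 0"
  shows "(\<integral>x. w x * indicator (box a b) x \<partial>lebesgue) = 0"
proof -
  define \<phi> where "\<phi> = (\<lambda>k::nat. \<lambda>x. 1 - (1 - box_bump a b x) ^ k)"
  have test: "\<phi> k \<in> test_functions \<Omega>" for k
  proof (rule test_functionsI[OF _ compact_cbox \<Omega>])
   show "smooth (\<phi> k)" unfolding \<phi>_def by (intro smooth_diff smooth_const smooth_power smooth_box_bump)
   show "vanishes_off (cbox a b) (\<phi> k)" unfolding vanishes_off_def \<phi>_def
   proof (intro allI impI)
    fix x assume "x \<notin> cbox a b"
    then have "x \<notin> box a b" using box_subset_cbox[of a b] by blast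
    then show "1 - (1 - box_bump a b x) ^ k = 0" by (simp add: box_bump_eq_0)
   qed
  qed
  have w': "integrable lebesgue (\<lambda>x. indicator (cbox a b) x *\<^sub>R w x)"
  proof -
   have "integrable (lebesgue_on (cbox a b)) w" using w \<Omega> by (simp add: locally_integrable_def)
   then have "integrable lebesgue (\<lambda>x. if x \<in> cbox a b then w x else 0)" by (subst Lebesgue_Measure.integrable_restrict_UNIV) auto
   moreover have "(\<lambda>x. indicator (cbox a b) x *\<^sub>R w x) = (\<lambda>x. if x \<in> cbox a b then w x else 0)"
    by (auto simp: fun_eq_iff indicator_def)
   ultimately show ?thesis by simp
  qed
  have wm: "(\<lambda>x. indicator (cbox a b) x *\<^sub>R w x) \<in> borel_measurable lebesgue" using w' by auto
  have i: "(\<lambda>x. w x * indicator (box a b) x) = (\<lambda>x. (indicator (cbox a b) x *\<^sub>R w x) * indicator (box a b) x)"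
   using box_subset_cbox[of a b] by (auto simp: indicator_def fun_eq_iff)
  have "(\<lambda>k. \<integral>x. w x * \<phi> k x \<partial>lebesgue) \<longlonglongrightarrow> (\<integral>x. w x * indicator (box a b) x \<partial>lebesgue)"
  proof (rule integral_dominated_convergence[where w="\<lambda>x. norm (indicator (cbox a b) x *\<^sub>R w x)"])
   show "(\<lambda>x. w x * indicat_real (box a b) x) \<in> borel_measurable lebesgue"
   proof -
    have "indicat_real (box a b) \<in> borel_measurable lebesgue" by (intro borel_measurable_indicator) auto
    then show ?thesis by (subst i) (rule borel_measurable_times[OF wm])
   qed
   show "(\<lambda>x. w x * \<phi> k x) \<in> borel_measurable lebesgue" for k using locally_integrable_test[OF w test] by auto
   show "integrable lebesgue (\<lambda>x. norm (indicat_real (cbox a b) x *\<^sub>R w x))" using w' by (rule integrable_norm)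
   show "AE x in lebesgue. (\<lambda>k. w x * \<phi> k x) \<longlonglongrightarrow> w x * indicator (box a b) x"
   proof (rule AE_I2)
    fix x
    have "(\<lambda>k. \<phi> k x) \<longlonglongrightarrow> indicator (box a b) x"
    proof (cases "x \<in> box a b")
     case True
     then have "(\<lambda>k. (1 - box_bump a b x) ^ k) \<longlonglongrightarrow> 0"
      using box_bump_pos[OF True] box_bump_bounds[of a b x] by (intro LIMSEQ_power_zero) auto
     then have "(\<lambda>k. \<phi> k x) \<longlonglongrightarrow> 1 - 0" unfolding \<phi>_def by (intro tendsto_diff tendsto_const)
     then show ?thesis using True by simp
    qed (simp add: \<phi>_def box_bump_eq_0)
    then show "(\<lambda>k. w x * \<phi> k x) \<longlonglongrightarrow> w x * indicator (box a b) x" by (intro tendsto_intros)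
   qed
   show "AE x in lebesgue. norm (w x * \<phi> k x) \<le> norm (indicator (cbox a b) x *\<^sub>R w x)" for k
   proof (rule AE_I2)
    fix x
    have "\<bar>\<phi> k x\<bar> \<le> indicator (cbox a b) x"
    proof (cases "x \<in> box a b")
     case True
     then have "0 \<le> (1 - box_bump a b x) ^ k" "(1 - box_bump a b x) ^ k \<le> 1"
      using box_bump_bounds[of a b x] by (auto intro: power_le_one)
     then show ?thesis using True box_subset_cbox[of a b] by (auto simp: \<phi>_def)
    qed (simp add: \<phi>_def box_bump_eq_0)
    then show "norm (w x * \<phi> k x) \<le> norm (indicator (cbox a b) x *\<^sub>R w x)"
     by (auto simp: abs_mult indicator_def intro: mult_left_le split: if_splits)
   qed
  qed
  then have "(\<lambda>k::nat. 0::real) \<longlonglongrightarrow> (\<integral>x. w x * indicator (box a b) x \<partial>lebesgue)"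
   using 0[OF test] by simp
  then show ?thesis by (simp add: LIMSEQ_const_iff)
qed

text \<open>Open boxes are an intersection-stable generator of the Borel sets, so vanishing over
  boxes spreads to all Borel sets. The integral over the whole space is assumed separately because
  complements are computed from it.\<close>

lemma AE_eq_0_of_boxes:
  fixes f :: "'a::euclidean_space \<Rightarrow> real"
  assumes f: "integrable lborel f" and all: "(\<integral>x. f x \<partial>lborel) = 0"
   and 0: "\<And>a b. (\<integral>x. indicator (box a b) x * f x \<partial>lborel) = 0"
  shows "AE x in lborel. f x = 0"
proof (rule density_unique_real[OF f])
  have si: "set_integrable lborel A f" if "A \<in> sets lborel" for A
   unfolding set_integrable_def using that f by (rule integrable_mult_indicator)
  fix A :: "'a set" assume "A \<in> sets lborel"
  then have A: "A \<in> sigma_sets UNIV (range (\<lambda>(a, b). box a b))" by (simp add: borel_eq_box)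
  have sets: "A \<in> sets lborel" if "A \<in> sigma_sets UNIV (range (\<lambda>(a, b). box a b))" for A :: "'a set"
   using that by (simp add: borel_eq_box)
  have "(LINT x:A|lborel. f x) = 0"
  proof (rule sigma_sets_induct_disjoint[OF _ _ A, where P="\<lambda>A. (LINT x:A|lborel. f x) = 0"])
   show "Int_stable (range (\<lambda>(a, b). box a b :: 'a set))" by (force simp add: Int_stable_def box_Int_box)
  next
   fix A assume A: "A \<in> sigma_sets UNIV (range (\<lambda>(a, b). box a b))" "(LINT x:A|lborel. f x) = 0"
   have "(LINT x:A \<union> (UNIV - A)|lborel. f x) = (LINT x:A|lborel. f x) + (LINT x:UNIV - A|lborel. f x)"
    using sets[OF A(1)] by (intro set_integral_Un si) auto
   then show "(LINT x:UNIV - A|lborel. f x) = 0" using A(2) all by (simp add: set_lebesgue_integral_def)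
  next
   fix A :: "nat \<Rightarrow> 'a set"
   assume A: "disjoint_family A" "range A \<subseteq> sigma_sets UNIV (range (\<lambda>(a, b). box a b))" "\<And>i. (LINT x:A i|lborel. f x) = 0"
   then have "\<And>i. A i \<in> sets lborel" using sets by blast
   then have "(LINT x:(\<Union>i. A i)|lborel. f x) = (\<Sum>i. (LINT x:A i|lborel. f x))"
    using A(1) by (intro lebesgue_integral_countable_add si) (auto simp: disjoint_family_on_def)
   then show "(LINT x:(\<Union>i. A i)|lborel. f x) = 0" using A(3) by simp
  qed (auto simp: set_lebesgue_integral_def 0)
  then show "(LINT x:A|lborel. f x) = (LINT x:A|lborel. 0)" by simp
qed auto

text \<open>Inside one closed box in \<Omega>, w is cut off to the open box and replaced by a Borel
  function, whose integrals over boxes vanish because two boxes intersect in a box. Countably many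
  closed boxes exhaust \<Omega>, and their boundaries are null sets.\<close>

lemma weak_eq_0_imp_AE_eq_0:
  fixes w :: "real^'n::finite \<Rightarrow> real"
  assumes w: "locally_integrable \<Omega> w" and \<Omega>: "open \<Omega>"
   and 0: "\<And>\<phi>. \<phi> \<in> test_functions \<Omega> \<Longrightarrow> (\<integral>x. w x * \<phi> x \<partial>lebesgue) = 0"
  shows "AE x in lebesgue_on \<Omega>. w x = 0"
proof -
  have box: "AE x in lebesgue. x \<in> box a b \<longrightarrow> w x = 0" if ab: "cbox a b \<subseteq> \<Omega>" for a b
  proof -
   define f where "f = (\<lambda>x. indicator (box a b) x * w x)"
   have "integrable (lebesgue_on (cbox a b)) w" using w ab by (simp add: locally_integrable_def)
   then have "integrable lebesgue (\<lambda>x. if x \<in> cbox a b then w x else 0)" by (subst Lebesgue_Measure.integrable_restrict_UNIV) auto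
   then have "integrable lebesgue (\<lambda>x. indicator (box a b) x *\<^sub>R (if x \<in> cbox a b then w x else 0))"
    by (rule integrable_mult_indicator[rotated]) auto
   moreover have "(\<lambda>x. indicator (box a b) x *\<^sub>R (if x \<in> cbox a b then w x else 0)) = f"
    using box_subset_cbox[of a b] by (auto simp: f_def fun_eq_iff indicator_def)
   ultimately have f: "integrable lebesgue f" by simp
   then obtain g where g: "g \<in> borel_measurable lborel" "AE x in lborel. f x = g x"
    using completion_ex_borel_measurable_real[of f lborel] borel_measurable_integrable[OF f] by blast
   have g': "AE x in lebesgue. f x = g x" using g(2) by (rule AE_completion)
   have gl: "g \<in> borel_measurable lebesgue" using g(1) by (rule measurable_completion)
   have gi: "integrable lebesgue g" using integrable_cong_AE[OF borel_measurable_integrable[OF f] gl g'] f by blast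
   have [measurable]: "box l u \<in> sets lebesgue" for l u :: "real^'n" by auto
   have "AE x in lborel. g x = 0"
   proof (rule AE_eq_0_of_boxes)
    show gi': "integrable lborel g" using gi g(1) by (simp add: integrable_completion)
    have eq: "(\<integral>x. indicator (box l u) x * g x \<partial>lborel) = 0" for l u
    proof -
     have "(\<integral>x. indicator (box l u) x * g x \<partial>lborel) = (\<integral>x. indicator (box l u) x * g x \<partial>lebesgue)"
      using g(1) by (intro integral_completion[symmetric]) auto
     also have "\<dots> = (\<integral>x. indicator (box l u) x * f x \<partial>lebesgue)" using g' f gl by (intro integral_cong_AE) auto
     also have "\<dots> = (\<integral>x. w x * indicator (box l u \<inter> box a b) x \<partial>lebesgue)"
      by (intro Bochner_Integration.integral_cong) (auto simp: f_def indicator_def)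
     also have "\<dots> = 0"
     proof -
      obtain c d where cd: "box l u \<inter> box a b = box c d" using box_Int_box[of l u a b] by blast
      show ?thesis
      proof (cases "box c d = {}")
       case False
       \<comment> \<open>\<open>integral_box_eq_0\<close> asks for the closed box to lie in
         \<Omega>; the closure of a nonempty intersection stays in \<open>cbox a b\<close>.\<close>
       have "cbox c d = closure (box c d)" using False by (simp add: closure_box)
       also have "\<dots> \<subseteq> closure (box a b)" using cd by (intro closure_mono) auto
       also have "\<dots> \<subseteq> cbox a b" by (rule closure_minimal[OF box_subset_cbox closed_cbox])
       finally show ?thesis unfolding cd using ab by (intro integral_box_eq_0[OF w _ 0]) auto
      qed (simp add: cd)
     qed
     finally show ?thesis .
    qed
    then show "(\<integral>x. indicator (box l u) x * g x \<partial>lborel) = 0" for l u .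
    have "(\<integral>x. g x \<partial>lborel) = (\<integral>x. g x \<partial>lebesgue)" using g(1) by (simp add: integral_completion)
    also have "\<dots> = (\<integral>x. f x \<partial>lebesgue)" using g' f gl by (intro integral_cong_AE) auto
    also have "\<dots> = 0" using integral_box_eq_0[OF w ab 0] by (simp add: f_def mult.commute)
    finally show "(\<integral>x. g x \<partial>lborel) = 0" .
   qed
   then have "AE x in lebesgue. g x = 0" by (rule AE_completion)
   with g' show ?thesis by eventually_elim (auto simp: f_def)
  qed
  obtain \<D> where D: "countable \<D>" "\<And>X. X \<in> \<D> \<Longrightarrow> X \<subseteq> \<Omega>" "\<And>X. X \<in> \<D> \<Longrightarrow> \<exists>a b. X = cbox a b" "\<Union>\<D> = \<Omega>"
   by (rule open_countable_Union_open_cbox[OF \<Omega>]) blast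
  have "AE x in lebesgue. x \<in> X \<longrightarrow> w x = 0" if X: "X \<in> \<D>" for X
  proof -
   obtain a b where ab: "X = cbox a b" using D(3)[OF X] by blast
   have "AE x in lebesgue. x \<notin> cbox a b - box a b" using null_sets_completionI[OF null_sets_cbox_Diff_box] by (rule AE_not_in)
   moreover have "AE x in lebesgue. x \<in> box a b \<longrightarrow> w x = 0" using box D(2)[OF X] ab by auto
   ultimately show ?thesis by eventually_elim (auto simp: ab)
  qed
  then have "AE x in lebesgue. \<forall>X\<in>\<D>. x \<in> X \<longrightarrow> w x = 0" using D(1) by (subst AE_ball_countable) auto
  then have "AE x in lebesgue. x \<in> \<Omega> \<longrightarrow> w x = 0" by eventually_elim (use D(4) in blast)
  then show ?thesis using \<Omega> by (simp add: AE_restrict_space_iff lborelD)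
qed

lemma has_weak_deriv_unique:
  assumes "has_weak_deriv \<Omega> is u v" "has_weak_deriv \<Omega> is u w" "open \<Omega>"
  shows "AE x in lebesgue_on \<Omega>. v x = w x"
proof -
  have li: "locally_integrable \<Omega> v" "locally_integrable \<Omega> w" using assms by (auto simp: has_weak_deriv_def)
  have "AE x in lebesgue_on \<Omega>. v x - w x = 0"
  proof (rule weak_eq_0_imp_AE_eq_0[OF _ assms(3)])
   show "locally_integrable \<Omega> (\<lambda>x. v x - w x)" using li by (auto simp: locally_integrable_def)
   fix \<phi> assume \<phi>: "\<phi> \<in> test_functions \<Omega>"
   have "(-1) ^ length is * (\<integral>x. v x * \<phi> x \<partial>lebesgue) = (-1) ^ length is * (\<integral>x. w x * \<phi> x \<partial>lebesgue)"
    using assms \<phi> by (auto simp: has_weak_deriv_def integral_on_test lborelD)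
   then have "(\<integral>x. v x * \<phi> x \<partial>lebesgue) = (\<integral>x. w x * \<phi> x \<partial>lebesgue)" by simp
   then show "(\<integral>x. (v x - w x) * \<phi> x \<partial>lebesgue) = 0"
    using li by (simp add: left_diff_distrib locally_integrable_test[OF _ \<phi>])
  qed
  then show ?thesis by eventually_elim simp
qed

section \<open>A moving bump function\<close>

definition bump_mass :: "'n::finite itself \<Rightarrow> real"
  where "bump_mass _ = (\<integral>x. exp_flat 0 (1 - (norm (x::real^'n))\<^sup>2) \<partial>lborel)"

definition bump :: "real^'n::finite \<Rightarrow> real \<Rightarrow> real^'n \<Rightarrow> real"
  where "bump c s z = exp_flat 0 (1 - (norm (z - c))\<^sup>2 / s\<^sup>2) / (bump_mass TYPE('n) * s ^ CARD('n))"

lemma smooth_bump: "smooth (bump c s)"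
  unfolding bump_def[abs_def] by (intro smooth_divide_const smooth_exp_flat smooth_diff smooth_const smooth_norm_diff_sq)

lemma bump_mass_pos: "0 < bump_mass TYPE('n::finite)"
proof -
  let ?f = "\<lambda>x::real^'n. exp_flat 0 (1 - (norm (x - 0))\<^sup>2)"
  have sm: "smooth ?f" by (intro smooth_exp_flat smooth_diff smooth_const smooth_norm_diff_sq)
  have int: "integrable lborel ?f" by (rule integrable_vanishes_off[OF smooth_continuous[OF sm] compact_cball[of 0 1]])
    (auto simp: vanishes_off_def exp_flat_eq_0)
  have "(\<integral>x. ?f x \<partial>lborel) \<noteq> 0"
  proof
   assume "(\<integral>x. ?f x \<partial>lborel) = 0"
   then have ae: "AE x in lborel. ?f x = 0" using int by (subst (asm) integral_nonneg_eq_0_iff_AE) (auto simp: exp_flat_nonneg)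
   have nb: "x \<notin> ball 0 1" if "?f x = 0" for x :: "real^'n"
   proof
    assume "x \<in> ball 0 1"
    then have "(norm x)\<^sup>2 < 1" by (simp add: power_less_one_iff abs_square_less_1)
    then show False using that exp_flat_pos[of "1 - (norm x)\<^sup>2" 0] by simp
   qed
   have "AE x in lborel. x \<notin> ball (0::real^'n) 1" using ae by (rule eventually_mono) (rule nb)
   then have "emeasure lborel (ball (0::real^'n) 1) = 0" by (subst (asm) AE_iff_measurable[of "ball (0::real^'n) 1"]) auto
   moreover have "\<not> negligible (ball (0::real^'n) 1)" by (rule open_not_negligible) auto
   ultimately show False by (simp add: negligible_iff_emeasure0)
  qed
  moreover have "0 \<le> (\<integral>x. ?f x \<partial>lborel)" by (intro integral_nonneg_AE) (auto simp: exp_flat_nonneg)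
  ultimately show ?thesis by (simp add: bump_mass_def)
qed

lemma bump_nonneg: "0 \<le> s \<Longrightarrow> 0 \<le> bump c s z"
  by (simp add: bump_def exp_flat_nonneg less_imp_le[OF bump_mass_pos])

lemma bump_eq_0:
  assumes "s > 0" "z \<notin> ball c s"
  shows "bump c s z = 0"
proof -
  have "s\<^sup>2 \<le> (norm (z - c))\<^sup>2" using assms by (intro power_mono) (auto simp: dist_norm norm_minus_commute)
  then have "1 - (norm (z - c))\<^sup>2 / s\<^sup>2 \<le> 0" using assms by simp
  then show ?thesis by (simp add: bump_def exp_flat_eq_0)
qed

lemma bump_le:
  fixes c :: "real^'n::finite"
  assumes "s > 0"
  shows "bump c s z \<le> 1 / (bump_mass TYPE('n) * s ^ CARD('n))"
  unfolding bump_def using assms bump_mass_pos[where 'n='n] by (intro divide_right_mono less_imp_le[OF exp_flat_0_less_1]) auto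

lemma vanishes_off_bump: "s > 0 \<Longrightarrow> vanishes_off (cball c s) (bump c s)"
  unfolding vanishes_off_def using bump_eq_0 ball_subset_cball by blast

lemma bump_test_function: "s > 0 \<Longrightarrow> cball c s \<subseteq> \<Omega> \<Longrightarrow> bump c s \<in> test_functions \<Omega>"
  by (rule test_functionsI[OF smooth_bump compact_cball _ vanishes_off_bump])

lemma bump_integral:
  fixes c :: "real^'n::finite"
  assumes "s > 0"
  shows "(\<integral>z. bump c s z \<partial>lborel) = 1"
proof -
  have [measurable]: "bump c s \<in> borel_measurable borel" using smooth_measurable[OF smooth_bump] .
  have "(\<integral>z. bump c s z \<partial>lborel) = (\<integral>z. bump c s z \<partial>density (distr lborel borel (\<lambda>x. c + s *\<^sub>R x)) (\<lambda>_. \<bar>s\<bar>^DIM(real^'n)))"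
   using lborel_affine[of s c] assms by simp
  also have "\<dots> = (\<integral>x. s ^ CARD('n) * bump c s (c + s *\<^sub>R x) \<partial>lborel)"
   using assms by (subst integral_density) (auto simp: integral_distr)
  also have "\<dots> = (\<integral>x. exp_flat 0 (1 - (norm (x::real^'n))\<^sup>2) / bump_mass TYPE('n) \<partial>lborel)"
   using assms by (intro Bochner_Integration.integral_cong) (auto simp: bump_def power_mult_distrib)
  also have "\<dots> = 1" using bump_mass_pos[where 'n='n] by (simp add: bump_mass_def)
  finally show ?thesis .
qed

lemma bump_commute: "bump c s z = bump z s c"
  by (simp add: bump_def norm_minus_commute)

lemma partial_deriv_affine:
  assumes "f differentiable (at x)"
  shows "partial_deriv i (\<lambda>x. a + b * f x) x = b * partial_deriv i f x"
proof -
  have 1: "(\<lambda>x. b * f x) differentiable (at x)" using assms by simp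
  have "partial_deriv i (\<lambda>x. a + b * f x) x = partial_deriv i (\<lambda>x. a) x + partial_deriv i (\<lambda>x. b * f x) x"
   by (rule partial_deriv_add[OF _ 1]) simp
  also have "partial_deriv i (\<lambda>x. b * f x) x = partial_deriv i (\<lambda>x. b) x * f x + b * partial_deriv i f x"
   by (rule partial_deriv_mult[OF _ assms]) simp
  finally show ?thesis by simp
qed

lemma bump_partial_deriv:
  fixes c :: "real^'n::finite"
  shows "partial_deriv j (bump c s) z =
   - (exp_flat 2 (1 - (norm (z - c))\<^sup>2 / s\<^sup>2) * (2 * (z $ j - c $ j) / s\<^sup>2)) / (bump_mass TYPE('n) * s ^ CARD('n))"
proof -
  let ?p = "\<lambda>z. 1 + (- 1 / s\<^sup>2) * (norm (z - c))\<^sup>2"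
  let ?c = "1 / (bump_mass TYPE('n) * s ^ CARD('n))"
  have sp: "smooth ?p" by (intro smooth_add smooth_mult smooth_const smooth_norm_diff_sq)
  have p: "partial_deriv j ?p z = - (2 * (z $ j - c $ j) / s\<^sup>2)"
   by (subst partial_deriv_affine[OF smooth_differentiable[OF smooth_norm_diff_sq]])
    (simp add: partial_deriv_norm_diff_sq)
  have eq: "bump c s = (\<lambda>z. ?c * exp_flat 0 (?p z))" by (auto simp: bump_def fun_eq_iff)
  have "partial_deriv j (bump c s) z = ?c * (exp_flat 2 (?p z) * partial_deriv j ?p z)"
  proof -
   have "partial_deriv j (\<lambda>z. 0 + ?c * exp_flat 0 (?p z)) z = ?c * partial_deriv j (\<lambda>z. exp_flat 0 (?p z)) z"
    by (rule partial_deriv_affine) (rule exp_flat_compose_has_derivative(2)[OF sp])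
   then show ?thesis unfolding eq exp_flat_compose_has_derivative(1)[OF sp] by (simp add: numeral_2_eq_2)
  qed
  then show ?thesis unfolding p by simp
qed

text \<open>Transport equation for the moving bump: its time derivative is minus the divergence of
  the bump multiplied by the velocity field \<open>d + e (z - c) / s\<close>.\<close>

definition bump_flow :: "real^'n::finite \<Rightarrow> real \<Rightarrow> real^'n \<Rightarrow> real \<Rightarrow> real \<Rightarrow> 'n \<Rightarrow> real^'n \<Rightarrow> real"
  where "bump_flow c s d e t j z =
   (d $ j + e * (z $ j - (c + t *\<^sub>R d) $ j) / (s + t * e)) * bump (c + t *\<^sub>R d) (s + t * e) z"

lemma smooth_bump_flow: "smooth (bump_flow c s d e t j)"
  unfolding bump_flow_def[abs_def] by (intro smooth_mult smooth_add smooth_const smooth_divide_const smooth_diff smooth_coord smooth_bump)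

lemma bump_flow_partial_deriv:
  fixes c :: "real^'n::finite"
  shows "partial_deriv j (bump_flow c s d e t j) z =
   e / (s + t * e) * bump (c + t *\<^sub>R d) (s + t * e) z
   + (d $ j + e * (z $ j - (c + t *\<^sub>R d) $ j) / (s + t * e)) * partial_deriv j (bump (c + t *\<^sub>R d) (s + t * e)) z"
proof -
  let ?a = "e / (s + t * e)" and ?b = "d $ j - e * (c + t *\<^sub>R d) $ j / (s + t * e)"
  have eq: "bump_flow c s d e t j = (\<lambda>z. (?b + ?a * z $ j) * bump (c + t *\<^sub>R d) (s + t * e) z)"
   by (auto simp: bump_flow_def fun_eq_iff algebra_simps diff_divide_distrib)
  have lin: "(\<lambda>z::real^'n. ?b + ?a * z $ j) differentiable (at z)"
   by (rule smooth_differentiable) (intro smooth_add smooth_mult smooth_const smooth_coord)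
  have l2: "partial_deriv j (\<lambda>z::real^'n. ?b + ?a * z $ j) z = ?a"
   by (subst partial_deriv_affine[OF smooth_differentiable[OF smooth_coord]]) (simp add: partial_deriv_coord)
  have co: "?b + ?a * z $ j = d $ j + e * (z $ j - (c + t *\<^sub>R d) $ j) / (s + t * e)" by (simp add: algebra_simps diff_divide_distrib)
  show ?thesis unfolding eq by (subst partial_deriv_mult[OF lin smooth_differentiable[OF smooth_bump]]) (simp only: l2 co)
qed

text \<open>Both sides reduce to E and E0, the values of \<open>exp_flat 2\<close> and of
  \<open>exp_flat 0\<close>, the former being the derivative of the latter. The terms
  \<open>e / S\<close> of the divergence, summed over the coordinates, give the factor n that also
  comes from differentiating the normalisation \<open>S ^ n\<close>.\<close>

lemma bump_time_derivative:
  fixes c d :: "real^'n::finite"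
  assumes s: "s + t * e > 0"
  shows "((\<lambda>t. bump (c + t *\<^sub>R d) (s + t * e) z) has_real_derivative
    - (\<Sum>j\<in>UNIV. partial_deriv j (bump_flow c s d e t j) z)) (at t within T)"
proof -
  define S where "S = s + t * e"
  define y where "y = z - (c + t *\<^sub>R d)"
  define E where "E = exp_flat 2 (1 - (norm y)\<^sup>2 / S\<^sup>2)"
  define E0 where "E0 = exp_flat 0 (1 - (norm y)\<^sup>2 / S\<^sup>2)"
  let ?n = "CARD('n)" and ?Z = "bump_mass TYPE('n)"
  have Z: "?Z > 0" by (rule bump_mass_pos)
  have S: "S > 0" using s by (simp add: S_def)
  have dq: "((\<lambda>t. (norm (z - (c + t *\<^sub>R d)))\<^sup>2) has_real_derivative (- 2 * (y \<bullet> d))) (at t within T)"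
   unfolding power2_norm_eq_inner has_field_derivative_def y_def
   by (auto intro!: derivative_eq_intros simp: inner_commute fun_eq_iff algebra_simps)
  have dS: "((\<lambda>t. (s + t * e)\<^sup>2) has_real_derivative (2 * S * e)) (at t within T)"
   unfolding S_def by (auto intro!: derivative_eq_intros)
  have dp: "((\<lambda>t. 1 - (norm (z - (c + t *\<^sub>R d)))\<^sup>2 / (s + t * e)\<^sup>2) has_real_derivative
    - ((- 2 * (y \<bullet> d) * S\<^sup>2 - (norm y)\<^sup>2 * (2 * S * e)) / (S\<^sup>2 * S\<^sup>2))) (at t within T)"
   using DERIV_diff[OF DERIV_const[of 1] DERIV_divide[OF dq dS]] S by (simp add: S_def y_def)
  have dE: "((\<lambda>t. exp_flat 0 (1 - (norm (z - (c + t *\<^sub>R d)))\<^sup>2 / (s + t * e)\<^sup>2)) has_real_derivative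
    E * (- ((- 2 * (y \<bullet> d) * S\<^sup>2 - (norm y)\<^sup>2 * (2 * S * e)) / (S\<^sup>2 * S\<^sup>2)))) (at t within T)"
   using DERIV_chain2[OF exp_flat_has_derivative dp, of 0] unfolding E_def y_def S_def by (simp add: numeral_2_eq_2)
  have dn: "((\<lambda>t. ?Z * (s + t * e) ^ ?n) has_real_derivative (?Z * (?n * S ^ (?n - 1) * e))) (at t within T)"
   unfolding S_def by (auto intro!: derivative_eq_intros)
  have Sn: "S ^ ?n = S * S ^ (?n - 1)" by (simp add: power_eq_if)
  have dB: "((\<lambda>t. bump (c + t *\<^sub>R d) (s + t * e) z) has_real_derivative
    (E * (- ((- 2 * (y \<bullet> d) * S\<^sup>2 - (norm y)\<^sup>2 * (2 * S * e)) / (S\<^sup>2 * S\<^sup>2))) * (?Z * S ^ ?n)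
     - E0 * (?Z * (?n * S ^ (?n - 1) * e))) / ((?Z * S ^ ?n) * (?Z * S ^ ?n))) (at t within T)"
   unfolding bump_def using DERIV_divide[OF dE dn] Z S by (simp add: S_def y_def E0_def)
  have 1: "(E * (- ((- 2 * (y \<bullet> d) * S\<^sup>2 - (norm y)\<^sup>2 * (2 * S * e)) / (S\<^sup>2 * S\<^sup>2))) * (?Z * S ^ ?n)
     - E0 * (?Z * (?n * S ^ (?n - 1) * e))) / ((?Z * S ^ ?n) * (?Z * S ^ ?n))
   = (E * (2 * (y \<bullet> d) + 2 * e * (norm y)\<^sup>2 / S) / S\<^sup>2 - ?n * e / S * E0) / (?Z * S ^ ?n)"
   using Z S unfolding Sn by (simp add: field_simps power2_eq_square)
  have pd: "partial_deriv j (bump_flow c s d e t j) z = (e / S * E0 - (d $ j + e * y $ j / S) * (E * (2 * y $ j / S\<^sup>2))) / (?Z * S ^ ?n)" for j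
  proof -
   have yj: "z $ j - (c + t *\<^sub>R d) $ j = y $ j" by (simp add: y_def)
   show ?thesis unfolding bump_flow_partial_deriv bump_partial_deriv
    unfolding bump_def S_def[symmetric] yj unfolding y_def[symmetric] E_def[symmetric] E0_def[symmetric] by (simp add: diff_divide_distrib)
  qed
  have yd: "(\<Sum>j\<in>UNIV. d $ j * y $ j) = y \<bullet> d" by (simp add: inner_vec_def mult.commute)
  have yy: "(\<Sum>j\<in>UNIV. y $ j * y $ j) = (norm y)\<^sup>2" by (simp add: power2_norm_eq_inner inner_vec_def)
  have "(\<Sum>j\<in>UNIV. partial_deriv j (bump_flow c s d e t j) z)
    = (\<Sum>j\<in>UNIV. e / S * E0 - (2 * E / S\<^sup>2) * (d $ j * y $ j) - (2 * e * E / (S * S\<^sup>2)) * (y $ j * y $ j)) / (?Z * S ^ ?n)"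
  proof -
   have "(d $ j + e * y $ j / S) * (E * (2 * y $ j / S\<^sup>2)) = (2 * E / S\<^sup>2) * (d $ j * y $ j) + (2 * e * E / (S * S\<^sup>2)) * (y $ j * y $ j)" for j
    using S by (simp add: field_simps)
   then show ?thesis unfolding pd sum_divide_distrib by (simp only: diff_diff_eq)
  qed
  also have "\<dots> = (?n * (e / S * E0) - (2 * E / S\<^sup>2) * (y \<bullet> d) - (2 * e * E / (S * S\<^sup>2)) * (norm y)\<^sup>2) / (?Z * S ^ ?n)"
  proof -
   have s1: "(\<Sum>j\<in>UNIV. (2 * E / S\<^sup>2) * (d $ j * y $ j)) = (2 * E / S\<^sup>2) * (y \<bullet> d)"
    by (simp only: sum_distrib_left[symmetric] yd)
   have s2: "(\<Sum>j\<in>UNIV. (2 * e * E / (S * S\<^sup>2)) * (y $ j * y $ j)) = (2 * e * E / (S * S\<^sup>2)) * (norm y)\<^sup>2"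
    by (simp only: sum_distrib_left[symmetric] yy)
   have s3: "(\<Sum>j\<in>(UNIV::'n set). e / S * E0) = ?n * (e / S * E0)" by simp
   show ?thesis by (simp only: sum_subtractf s1 s2 s3)
  qed
  also have "\<dots> = - ((E * (2 * (y \<bullet> d) + 2 * e * (norm y)\<^sup>2 / S) / S\<^sup>2 - ?n * e / S * E0) / (?Z * S ^ ?n))"
  proof -
   have "?n * (e / S * E0) - (2 * E / S\<^sup>2) * (y \<bullet> d) - (2 * e * E / (S * S\<^sup>2)) * (norm y)\<^sup>2
    = - (E * (2 * (y \<bullet> d) + 2 * e * (norm y)\<^sup>2 / S) / S\<^sup>2 - ?n * e / S * E0)" using S by (simp add: field_simps)
   then show ?thesis by (simp only: minus_divide_left)
  qed
  finally show ?thesis using dB unfolding 1 by simp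
qed

text \<open>On the support of the bump the distance to the moving centre is at most the current
  radius, so the velocity is bounded by the speed of the centre plus the speed of the
  radius.\<close>

lemma bump_flow_bound:
  fixes c d :: "real^'n::finite"
  assumes "s + t * e > 0"
  shows "\<bar>bump_flow c s d e t j z\<bar> \<le> (norm d + \<bar>e\<bar>) / (bump_mass TYPE('n) * (s + t * e) ^ CARD('n)) * indicator (cball (c + t *\<^sub>R d) (s + t * e)) z"
proof (cases "z \<in> cball (c + t *\<^sub>R d) (s + t * e)")
  case True
  let ?y = "z - (c + t *\<^sub>R d)" and ?S = "s + t * e"
  have "\<bar>?y $ j\<bar> \<le> ?S" using component_le_norm_cart[of ?y j] True by (simp add: dist_norm norm_minus_commute)
  then have "\<bar>e * ?y $ j / ?S\<bar> \<le> \<bar>e\<bar>" using assms by (simp add: abs_mult divide_simps mult_left_mono)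
  then have "\<bar>d $ j + e * ?y $ j / ?S\<bar> \<le> norm d + \<bar>e\<bar>" using component_le_norm_cart[of d j] by linarith
  moreover have "\<bar>bump (c + t *\<^sub>R d) ?S z\<bar> \<le> 1 / (bump_mass TYPE('n) * ?S ^ CARD('n))"
   using bump_le[OF assms, of "c + t *\<^sub>R d" z] bump_nonneg[of ?S "c + t *\<^sub>R d" z] assms by auto
  ultimately have "\<bar>d $ j + e * ?y $ j / ?S\<bar> * \<bar>bump (c + t *\<^sub>R d) ?S z\<bar> \<le> (norm d + \<bar>e\<bar>) * (1 / (bump_mass TYPE('n) * ?S ^ CARD('n)))"
   by (intro mult_mono) auto
  then show ?thesis using True unfolding bump_flow_def abs_mult by simp
next
  case False
  then have "bump (c + t *\<^sub>R d) (s + t * e) z = 0"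
   using vanishes_off_bump[OF assms, of "c + t *\<^sub>R d"] unfolding vanishes_off_def by blast
  then show ?thesis using False by (simp add: bump_flow_def)
qed

section \<open>Averaged Taylor polynomials\<close>

text \<open>Monomials are indexed by lists, with repetition: the sum over all lists of length k,
  divided by \<open>fact k\<close>, is the Taylor term of order k without multinomial
  coefficients.\<close>

definition mon :: "'n::finite list \<Rightarrow> real^'n \<Rightarrow> real"
  where "mon is y = prod_list (map (\<lambda>i. y $ i) is)"

lemma mon_Nil [simp]: "mon [] y = 1" and mon_Cons [simp]: "mon (i # is) y = y $ i * mon is y"
  by (simp_all add: mon_def)

lemma smooth_mon: "smooth (mon is)"
proof (induction "is")
  case Nil have "mon [] = (\<lambda>y. 1)" by (simp add: fun_eq_iff)
  then show ?case by simp
next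
  case (Cons i "is")
  have "mon (i # is) = (\<lambda>y. y $ i * mon is y)" by (simp add: fun_eq_iff)
  then show ?case using Cons by (simp add: smooth_mult)
qed

lemma abs_mon_le: "\<bar>mon is y\<bar> \<le> norm y ^ length is"
  by (induction "is") (auto simp: abs_mult intro!: mult_mono component_le_norm_cart)

lemma partial_deriv_mon_Nil: "partial_deriv j (mon []) y = 0"
proof -
  have "mon [] = (\<lambda>y::real^'a. 1)" by (simp add: fun_eq_iff)
  then show ?thesis by simp
qed

lemma partial_deriv_mon_Cons:
  "partial_deriv j (mon (i # is)) y = (if j = i then mon is y else 0) + y $ i * partial_deriv j (mon is) y"
proof -
  have eq: "mon (i # is) = (\<lambda>y. y $ i * mon is y)" by (simp add: fun_eq_iff)
  show ?thesis unfolding eq by (subst partial_deriv_mult[OF smooth_differentiable[OF smooth_coord] smooth_differentiable[OF smooth_mon]])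
    (simp add: partial_deriv_coord)
qed

lemma finite_lists_length [simp]: "finite {is :: 'n::finite list. length is = k}"
  using finite_lists_length_eq[of "UNIV :: 'n set" k] by simp

lemma card_lists_length: "card {is :: 'n::finite list. length is = k} = CARD('n) ^ k"
  using card_lists_length_eq[of "UNIV :: 'n set" k] by simp

lemma sum_lists_Suc:
  fixes F :: "'n::finite list \<Rightarrow> real"
  shows "(\<Sum>is | length is = Suc k. F is) = (\<Sum>i\<in>UNIV. \<Sum>is | length is = k. F (i # is))"
proof -
  have eq: "{is :: 'n list. length is = Suc k} = (\<lambda>(i, is). i # is) ` (UNIV \<times> {is. length is = k})"
   by (auto simp: length_Suc_conv image_def)
  have "(\<Sum>is | length is = Suc k. F is) = (\<Sum>(i, is)\<in>UNIV \<times> {is. length is = k}. F (i # is))"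
   unfolding eq by (subst sum.reindex) (auto simp: inj_on_def case_prod_unfold)
  then show ?thesis by (simp add: sum.cartesian_product)
qed

lemma sum_lists_0: "(\<Sum>is :: 'n::finite list | length is = 0. F is) = F []"
proof -
  have "{is :: 'n list. length is = 0} = {[]}" by auto
  then show ?thesis by simp
qed

text \<open>Euler-type identity: a derivative of \<open>y\<^sup>i\<^sup>s\<close> removes one index, in each of \<open>k + 1\<close> positions;
  symmetry of the coefficients allows to move the removed index to the front.\<close>

lemma sum_lists_partial_deriv_mon:
  fixes W :: "'n::finite list \<Rightarrow> real"
  assumes "\<And>is js. mset is = mset js \<Longrightarrow> W is = W js"
  shows "(\<Sum>is | length is = Suc k. W is * partial_deriv j (mon is) y)
    = real (Suc k) * (\<Sum>is | length is = k. W (j # is) * mon is y)" using assms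
proof (induction k arbitrary: W)
  case 0
  have "W [i] * ((if j = i then mon [] y else 0) + y $ i * 0) = (if i = j then W [j] else 0)" for i by auto
  then show ?case unfolding sum_lists_Suc sum_lists_0 partial_deriv_mon_Cons partial_deriv_mon_Nil by simp
next
  case (Suc k)
  have IH: "(\<Sum>is | length is = Suc k. W (i # is) * partial_deriv j (mon is) y)
    = real (Suc k) * (\<Sum>is | length is = k. W (i # j # is) * mon is y)" for i by (rule Suc.IH) (auto intro: Suc.prems)
  have sw: "W (i # j # is) = W (j # i # is)" for i "is" by (rule Suc.prems) auto
  have "(\<Sum>is | length is = Suc (Suc k). W is * partial_deriv j (mon is) y)
    = (\<Sum>i\<in>UNIV. \<Sum>is | length is = Suc k. (if j = i then W (i # is) * mon is y else 0) + y $ i * (W (i # is) * partial_deriv j (mon is) y))"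
   unfolding sum_lists_Suc[of _ "Suc k"] partial_deriv_mon_Cons by (intro sum.cong) (auto simp: algebra_simps)
  also have "\<dots> = (\<Sum>i\<in>UNIV. if j = i then \<Sum>is | length is = Suc k. W (i # is) * mon is y else 0)
    + (\<Sum>i\<in>UNIV. y $ i * (\<Sum>is | length is = Suc k. W (i # is) * partial_deriv j (mon is) y))"
   unfolding sum.distrib sum_distrib_left by (intro arg_cong2[where f="(+)"] sum.cong refl) auto
  also have "\<dots> = (\<Sum>is | length is = Suc k. W (j # is) * mon is y)
    + real (Suc k) * (\<Sum>i\<in>UNIV. \<Sum>is | length is = k. W (j # i # is) * (y $ i * mon is y))"
   unfolding IH by (simp add: sum_distrib_left sw mult_ac)
  also have "(\<Sum>i\<in>UNIV. \<Sum>is | length is = k. W (j # i # is) * (y $ i * mon is y)) = (\<Sum>is | length is = Suc k. W (j # is) * mon is y)"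
   unfolding sum_lists_Suc by simp
  finally show ?case by (simp add: algebra_simps)
qed

lemma partial_deriv_reflect:
  fixes f :: "real^'n::finite \<Rightarrow> real"
  assumes "smooth f"
  shows "partial_deriv j (\<lambda>z. f (x - z)) z = - partial_deriv j f (x - z)" "smooth (\<lambda>z. f (x - z))"
proof -
  have *: "((\<lambda>z. f (x - z)) has_derivative (\<lambda>h. \<Sum>i\<in>UNIV. partial_deriv i f (x - z) * (- h) $ i)) (at z)"
   if "smooth f" for f :: "real^'n \<Rightarrow> real" and z
  proof -
   have "((\<lambda>z. x - z) has_derivative (\<lambda>h. - h)) (at z)" by (auto intro!: derivative_eq_intros)
   from has_derivative_compose[OF this smooth_has_derivative[OF that]] show ?thesis .
  qed
  have pd: "partial_deriv j (\<lambda>z. f (x - z)) z = - partial_deriv j f (x - z)" if "smooth f" for f :: "real^'n \<Rightarrow> real" and j z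
   using partial_deriv_eq[OF *[OF that], of j] by (simp add: axis_def if_distrib cong: if_cong)
  from pd[OF assms] show "partial_deriv j (\<lambda>z. f (x - z)) z = - partial_deriv j f (x - z)" .
  have "Ck k (\<lambda>z. f (x - z))" if "smooth f" for f :: "real^'n \<Rightarrow> real" and k using that
  proof (induction k arbitrary: f)
   case 0 then show ?case using *[OF 0] by (auto simp: Ck_0 intro: differentiableI)
  next
   case (Suc k)
   have "partial_deriv i (\<lambda>z. f (x - z)) = (\<lambda>z. - 1 * partial_deriv i f (x - z))" for i
    using pd[OF Suc.prems] by (simp add: fun_eq_iff)
   moreover have "Ck k (\<lambda>z. - 1 * partial_deriv i f (x - z))" for i by (intro Ck_mult Ck_const Suc.IH smooth_partial_deriv Suc.prems)
   ultimately show ?case using *[OF Suc.prems] by (auto simp: Ck_Suc intro: differentiableI)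
  qed
  then show "smooth (\<lambda>z. f (x - z))" using assms by (simp add: smooth_iff_Ck)
qed

lemma integrable_mult_bounded:
  fixes g \<phi> :: "'a \<Rightarrow> real"
  assumes "integrable M g" "\<phi> \<in> borel_measurable M" "\<And>x. \<bar>\<phi> x\<bar> \<le> B"
  shows "integrable M (\<lambda>x. g x * \<phi> x)"
proof (rule Bochner_Integration.integrable_bound)
  show "integrable M (\<lambda>x. B * g x)" using assms(1) by simp
  have "g \<in> borel_measurable M" using assms(1) by auto
  then show "(\<lambda>x. g x * \<phi> x) \<in> borel_measurable M" using assms(2) by (rule borel_measurable_times)
  have "\<bar>g x\<bar> * \<bar>\<phi> x\<bar> \<le> \<bar>B\<bar> * \<bar>g x\<bar>" for x
   using assms(3)[of x] by (subst mult.commute) (auto intro!: mult_right_mono)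
  then show "AE x in M. norm (g x * \<phi> x) \<le> norm (B * g x)" by (simp add: abs_mult)
qed

lemma continuous_measurable_lebesgue:
  fixes \<phi> :: "'a::euclidean_space \<Rightarrow> real"
  assumes "continuous_on UNIV \<phi>" shows "\<phi> \<in> borel_measurable lebesgue"
  by (rule measurable_completion) (use borel_measurable_continuous_onI[OF assms] in simp)

lemma vanishes_off_bounded:
  fixes \<phi> :: "'a::euclidean_space \<Rightarrow> real"
  assumes "continuous_on UNIV \<phi>" "compact K" "vanishes_off K \<phi>"
  obtains B where "0 \<le> B" "\<And>x. \<bar>\<phi> x\<bar> \<le> B"
proof -
  obtain B where B: "0 \<le> B" "\<And>x. x \<in> K \<Longrightarrow> \<bar>\<phi> x\<bar> \<le> B"
   using continuous_compact_bounded_real[OF continuous_on_subset[OF assms(1)] assms(2)] by blast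
  then have "\<bar>\<phi> x\<bar> \<le> B" for x using assms(3) by (cases "x \<in> K") (auto simp: vanishes_off_def)
  with B(1) show thesis by (rule that)
qed

lemma integrable_mult_test:
  assumes "integrable lebesgue g" "\<phi> \<in> test_functions \<Omega>"
  shows "integrable lebesgue (\<lambda>x. g x * \<phi> x)"
proof -
  obtain K where K: "smooth \<phi>" "compact K" "vanishes_off K \<phi>" using assms(2) by (rule test_functionsE)
  obtain B where "\<And>x. \<bar>\<phi> x\<bar> \<le> B" using vanishes_off_bounded[OF smooth_continuous[OF K(1)] K(2,3)] by blast
  then show ?thesis by (intro integrable_mult_bounded[OF assms(1)] continuous_measurable_lebesgue smooth_continuous K)
qed

text \<open>Models the weak derivatives of the single function \<open>w []\<close>, extended by zero
  outside \<Omega>. Symmetry is demanded at every point and not just almost everywhere, so that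
  identities between the polynomials hold under the integral for each z.\<close>

locale sobolev_family =
  fixes \<Omega> :: "(real^'n::finite) set" and N :: nat and w :: "'n list \<Rightarrow> real^'n \<Rightarrow> real"
  assumes open_domain: "open \<Omega>"
   and bounded_domain: "bounded \<Omega>"
   and w_integrable: "length is \<le> N \<Longrightarrow> integrable lebesgue (w is)"
   and w_off: "x \<notin> \<Omega> \<Longrightarrow> w is x = 0"
   and w_sym: "mset is = mset js \<Longrightarrow> w is = w js"
   and w_deriv: "length is < N \<Longrightarrow> \<phi> \<in> test_functions \<Omega> \<Longrightarrow>
    (\<integral>x. w is x * partial_deriv j \<phi> x \<partial>lebesgue) = - (\<integral>x. w (j # is) x * \<phi> x \<partial>lebesgue)"

text \<open>The average, against the weight \<open>\<psi>\<close> in the variable \<open>z\<close>, of the Taylor polynomials with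
  centre \<open>z\<close> and degree less than \<open>N\<close>, evaluated at \<open>x\<close>.\<close>

definition taylor_avg :: "nat \<Rightarrow> ('n::finite list \<Rightarrow> real^'n \<Rightarrow> real) \<Rightarrow> real^'n \<Rightarrow> (real^'n \<Rightarrow> real) \<Rightarrow> real"
  where "taylor_avg N w x \<psi> = (\<Sum>k<N. (\<Sum>is | length is = k. \<integral>z. w is z * (mon is (x - z) * \<psi> z) \<partial>lebesgue) / fact k)"

text \<open>The sum of absolute values is preferred to the Euclidean length because it splits
  exactly over the first index.\<close>

definition grad_sum :: "nat \<Rightarrow> ('n::finite list \<Rightarrow> real^'n \<Rightarrow> real) \<Rightarrow> real^'n \<Rightarrow> real"
  where "grad_sum N w z = (\<Sum>is | length is = N. \<bar>w is z\<bar>)"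

context sobolev_family begin

lemma grad_sum_integrable: "k \<le> N \<Longrightarrow> integrable lebesgue (grad_sum k w)"
  unfolding grad_sum_def[abs_def] by (intro Bochner_Integration.integrable_sum integrable_abs w_integrable) auto

lemma grad_sum_nonneg: "0 \<le> grad_sum k w z"
  by (simp add: grad_sum_def sum_nonneg)

lemma w_sum_partial_deriv_mon:
  "(\<Sum>is | length is = Suc k. w is z * partial_deriv j (mon is) y)
    = real (Suc k) * (\<Sum>is | length is = k. w (j # is) z * mon is y)"
  by (rule sum_lists_partial_deriv_mon[where W="\<lambda>is. w is z"]) (drule w_sym, simp)

lemma mon_test: "\<psi> \<in> test_functions \<Omega> \<Longrightarrow> (\<lambda>z. mon is (x - z) * \<psi> z) \<in> test_functions \<Omega>"
  by (intro test_functions_mult partial_deriv_reflect(2) smooth_mon)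

lemma pd_mon_test: "\<psi> \<in> test_functions \<Omega> \<Longrightarrow> (\<lambda>z. partial_deriv j (mon is) (x - z) * \<psi> z) \<in> test_functions \<Omega>"
  by (intro test_functions_mult partial_deriv_reflect(2) smooth_partial_deriv smooth_mon)

text \<open>Integration by parts takes the derivative off \<psi>. The term of order k yields
  derivatives of order k + 1 and, from the monomials, k times the corresponding sum belonging to k -
  1; after division by \<open>fact k\<close> the sum telescopes, and derivatives of order N are all
  that is left.\<close>

lemma taylor_avg_partial_deriv:
  assumes N: "N > 0" and \<psi>: "\<psi> \<in> test_functions \<Omega>"
  shows "taylor_avg N w x (partial_deriv j \<psi>)
   = - (\<Sum>is | length is = N - 1. \<integral>z. w (j # is) z * (mon is (x - z) * \<psi> z) \<partial>lebesgue) / fact (N - 1)"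
proof -
  define S where "S k = (\<Sum>is | length is = k. \<integral>z. w (j # is) z * (mon is (x - z) * \<psi> z) \<partial>lebesgue)" for k
  have sm: "smooth \<psi>" using \<psi> by (auto elim: test_functionsE)
  let ?P = "\<lambda>is. \<integral>z. w is z * (partial_deriv j (mon is) (x - z) * \<psi> z) \<partial>lebesgue"
  let ?Q = "\<lambda>is. \<integral>z. w is z * (mon is (x - z) * partial_deriv j \<psi> z) \<partial>lebesgue"
  let ?R = "\<lambda>is. \<integral>z. w (j # is) z * (mon is (x - z) * \<psi> z) \<partial>lebesgue"
  have I: "(\<Sum>is | length is = k. ?Q is)
    = - S k + (if k = 0 then 0 else real k * S (k - 1))" if k: "k < N" for k
  proof -
   have one: "?Q is
     = - ?R is + ?P is"
    if l: "length is = k" for "is"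
   proof -
    have wi: "integrable lebesgue (w is)" using l k by (intro w_integrable) auto
    have eq: "partial_deriv j (\<lambda>z. mon is (x - z) * \<psi> z) z = - partial_deriv j (mon is) (x - z) * \<psi> z + mon is (x - z) * partial_deriv j \<psi> z" for z
     by (subst partial_deriv_mult[OF smooth_differentiable[OF partial_deriv_reflect(2)[OF smooth_mon]] smooth_differentiable[OF sm]])
      (simp add: partial_deriv_reflect(1)[OF smooth_mon])
    have "- ?R is = (\<integral>z. w is z * partial_deriv j (\<lambda>z. mon is (x - z) * \<psi> z) z \<partial>lebesgue)"
     using w_deriv[OF _ mon_test[OF \<psi>], of "is" j] l k by simp
    also have "\<dots> = (\<integral>z. w is z * (mon is (x - z) * partial_deriv j \<psi> z) - w is z * (partial_deriv j (mon is) (x - z) * \<psi> z) \<partial>lebesgue)"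
     unfolding eq by (simp add: algebra_simps)
    also have "\<dots> = ?Q is - ?P is"
     by (rule Bochner_Integration.integral_diff[OF integrable_mult_test[OF wi mon_test[OF test_functions_partial_deriv[OF \<psi>]]]
        integrable_mult_test[OF wi pd_mon_test[OF \<psi>]]])
    finally show ?thesis by simp
   qed
   \<comment> \<open>Differentiating the monomials lowers their degree; the Euler-type identity,
     which rests on \<open>w_sym\<close>, rewrites the result with j as the first index.\<close>
   have two: "(\<Sum>is | length is = k. ?P is) = (if k = 0 then 0 else real k * S (k - 1))"
   proof (cases k)
    case 0 then show ?thesis by (simp add: partial_deriv_mon_Nil)
   next
    case (Suc m)
    have "(\<Sum>is | length is = k. ?P is)
     = (\<integral>z. (\<Sum>is | length is = k. w is z * (partial_deriv j (mon is) (x - z) * \<psi> z)) \<partial>lebesgue)"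
     using k by (intro Bochner_Integration.integral_sum[symmetric] integrable_mult_test[OF w_integrable pd_mon_test[OF \<psi>]]) auto
    also have "\<dots> = (\<integral>z. (\<Sum>is | length is = m. real k * (w (j # is) z * (mon is (x - z) * \<psi> z))) \<partial>lebesgue)"
    proof (rule Bochner_Integration.integral_cong[OF refl])
     fix z
     have "(\<Sum>is | length is = k. w is z * (partial_deriv j (mon is) (x - z) * \<psi> z)) = (\<Sum>is | length is = Suc m. w is z * partial_deriv j (mon is) (x - z)) * \<psi> z"
      by (simp add: Suc sum_distrib_right mult.assoc)
     also have "\<dots> = real k * (\<Sum>is | length is = m. w (j # is) z * mon is (x - z)) * \<psi> z"
      by (simp only: w_sum_partial_deriv_mon Suc)
     also have "\<dots> = (\<Sum>is | length is = m. real k * (w (j # is) z * (mon is (x - z) * \<psi> z)))"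
      by (simp add: sum_distrib_left sum_distrib_right mult.assoc)
     finally show "(\<Sum>is | length is = k. w is z * (partial_deriv j (mon is) (x - z) * \<psi> z)) = (\<Sum>is | length is = m. real k * (w (j # is) z * (mon is (x - z) * \<psi> z)))" .
    qed
    also have "\<dots> = real k * S m" unfolding S_def sum_distrib_left using k Suc
     by (subst Bochner_Integration.integral_sum) (auto intro!: integrable_mult_right integrable_mult_test[OF w_integrable mon_test[OF \<psi>]])
    finally show ?thesis by (simp add: Suc)
   qed
   have "(\<Sum>is | length is = k. ?Q is)
    = (\<Sum>is | length is = k. - ?R is + ?P is)" by (intro sum.cong) (auto simp: one)
   then show ?thesis by (simp only: sum.distrib sum_negf two S_def)
  qed
  \<comment> \<open>The second part of each term cancels the first part of the preceding one, since
    \<open>k / fact k = 1 / fact (k - 1)\<close>.\<close>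
  have tele: "(\<Sum>k<Suc m. (- S k + (if k = 0 then 0 else real k * S (k - 1))) / fact k) = - S m / fact m" for m
  proof (induction m)
   case (Suc m)
   have "real (Suc m) * S m / fact (Suc m) = S m / fact m" by (simp add: fact_Suc del: of_nat_Suc)
   then show ?case unfolding sum.lessThan_Suc[of _ "Suc m"] Suc.IH by (simp add: add_divide_distrib diff_divide_distrib del: of_nat_Suc fact_Suc)
  qed simp
  have "taylor_avg N w x (partial_deriv j \<psi>) = (\<Sum>k<Suc (N - 1). (- S k + (if k = 0 then 0 else real k * S (k - 1))) / fact k)"
   unfolding taylor_avg_def using N by (intro sum.cong) (auto simp: I)
  also have "\<dots> = - S (N - 1) / fact (N - 1)" by (rule tele)
  finally show ?thesis by (simp add: S_def)
qed

text \<open>Only the monomials depend on x, so differentiation in x lowers the degree by one and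
  puts the first derivatives of w in the place of w. The mean value theorem along the segment
  selects a single intermediate point, which is free to lie outside \<Omega>.\<close>

lemma taylor_avg_diff_x:
  assumes N: "N > 0" and \<psi>: "\<psi> \<in> test_functions \<Omega>"
  shows "\<exists>t\<in>{0<..<1}. taylor_avg N w (x + h) \<psi> - taylor_avg N w x \<psi>
    = (\<Sum>j\<in>UNIV. h $ j * taylor_avg (N - 1) (\<lambda>is. w (j # is)) (x + t *\<^sub>R h) \<psi>)"
proof -
  obtain K where K: "smooth \<psi>" "compact K" "vanishes_off K \<psi>" using \<psi> by (rule test_functionsE)
  define dm where "dm is t z = (\<Sum>j\<in>UNIV. partial_deriv j (mon is) (x - z + t *\<^sub>R h) * h $ j)" for "is" t z
  let ?m = "\<lambda>is t z. w is z * (mon is (x + t *\<^sub>R h - z) * \<psi> z)"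
  have dmd: "((\<lambda>t. mon is (x + t *\<^sub>R h - z)) has_real_derivative dm is t z) (at t within T)" for "is" t z T
   using smooth_has_line_derivative[OF smooth_mon, of "is" "x - z" h t T] unfolding dm_def by (simp add: algebra_simps)
  have dmc: "continuous_on UNIV (\<lambda>(t, z). dm is t z)" for "is" unfolding dm_def case_prod_unfold
   by (intro continuous_intros continuous_on_compose2[OF smooth_continuous[OF smooth_partial_deriv[OF smooth_mon], of UNIV]]) auto
  define D where "D t = (\<Sum>k<N. (\<Sum>is | length is = k. \<integral>z. w is z * (dm is t z * \<psi> z) \<partial>lebesgue) / fact k)" for t
  have dI: "((\<lambda>t. \<integral>z. ?m is t z \<partial>lebesgue) has_real_derivative
    (\<integral>z. w is z * (dm is t z * \<psi> z) \<partial>lebesgue)) (at t within {0..1})" if l: "length is < N" and t: "t \<in> {0..1}" for "is" t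
  proof -
   have "continuous_on ({0..1} \<times> K) (\<lambda>(t, z). dm is t z)" by (rule continuous_on_subset[OF dmc]) simp
   moreover have "compact ({0..1::real} \<times> K)" using K(2) by (intro compact_Times compact_Icc)
   ultimately have "bounded ((\<lambda>(t, z). dm is t z) ` ({0..1} \<times> K))" by (intro compact_imp_bounded compact_continuous_image)
   then obtain B where B: "\<And>t z. t \<in> {0..1} \<Longrightarrow> z \<in> K \<Longrightarrow> \<bar>dm is t z\<bar> \<le> B" by (force simp: bounded_iff)
   show ?thesis
   proof (rule has_real_derivative_integral[where D="\<lambda>z. \<bar>B\<bar> * \<bar>w is z * \<psi> z\<bar>" and f'="\<lambda>t z. w is z * (dm is t z * \<psi> z)"])
    show "integrable lebesgue (\<lambda>z. ?m is t z)" for t using l by (intro integrable_mult_test[OF w_integrable mon_test[OF \<psi>]]) auto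
    show "integrable lebesgue (\<lambda>z. \<bar>B\<bar> * \<bar>w is z * \<psi> z\<bar>)"
     using l by (intro integrable_mult_right integrable_abs integrable_mult_test[OF w_integrable \<psi>]) auto
    have "continuous_on UNIV (\<lambda>z. dm is t z)"
     using continuous_on_compose2[OF dmc, of UNIV "\<lambda>z. (t, z)"] by (simp add: continuous_intros)
    then have "dm is t \<in> borel_measurable lebesgue" by (intro continuous_measurable_lebesgue) simp
    moreover have "\<psi> \<in> borel_measurable lebesgue" by (intro continuous_measurable_lebesgue smooth_continuous K)
    moreover have "w is \<in> borel_measurable lebesgue" using w_integrable[of "is"] l by auto
    ultimately show "(\<lambda>z. w is z * (dm is t z * \<psi> z)) \<in> borel_measurable lebesgue" by (intro borel_measurable_times)
    show "((\<lambda>t. ?m is t z) has_real_derivative w is z * (dm is t z * \<psi> z)) (at t within {0..1})" for t z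
     by (intro DERIV_cmult DERIV_cmult_right dmd)
    show "\<bar>w is z * (dm is t z * \<psi> z)\<bar> \<le> \<bar>B\<bar> * \<bar>w is z * \<psi> z\<bar>" if "t \<in> {0..1}" for t z
    proof (cases "z \<in> K")
     case True
     have "\<bar>dm is t z\<bar> * \<bar>w is z * \<psi> z\<bar> \<le> \<bar>B\<bar> * \<bar>w is z * \<psi> z\<bar>"
      using B[OF that True] by (intro mult_right_mono) auto
     then show ?thesis by (simp add: abs_mult mult_ac)
    qed (use K(3) in \<open>simp add: vanishes_off_def\<close>)
   qed (use t in auto)
  qed
  have der: "((\<lambda>t. taylor_avg N w (x + t *\<^sub>R h) \<psi>) has_real_derivative D t) (at t within {0..1})" if "t \<in> {0..1}" for t
   unfolding taylor_avg_def D_def by (intro DERIV_sum DERIV_cdivide dI that) auto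
  have "\<exists>t\<in>{0<..<1::real}. taylor_avg N w (x + 1 *\<^sub>R h) \<psi> - taylor_avg N w (x + 0 *\<^sub>R h) \<psi> = D t * (1 - 0)"
   by (rule mvt_simple) (use der in \<open>auto simp: has_field_derivative_def\<close>)
  then obtain t where t: "t \<in> {0<..<1}" "taylor_avg N w (x + h) \<psi> - taylor_avg N w x \<psi> = D t" by auto
  have "D t = (\<Sum>j\<in>UNIV. h $ j * taylor_avg (N - 1) (\<lambda>is. w (j # is)) (x + t *\<^sub>R h) \<psi>)"
  proof -
   define U where "U k j = (\<Sum>is | length is = k. \<integral>z. w (j # is) z * (mon is (x + t *\<^sub>R h - z) * \<psi> z) \<partial>lebesgue)" for k j
   have A: "(\<Sum>is | length is = Suc k. \<integral>z. w is z * (dm is t z * \<psi> z) \<partial>lebesgue) = real (Suc k) * (\<Sum>j\<in>UNIV. h $ j * U k j)" if k: "Suc k < N" for k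
   proof -
    have dmt: "(\<lambda>z. dm is t z * \<psi> z) \<in> test_functions \<Omega>" for "is"
    proof (rule test_functions_mult[OF _ \<psi>])
     have "dm is t = (\<lambda>z. \<Sum>j\<in>UNIV. partial_deriv j (mon is) ((x + t *\<^sub>R h) - z) * h $ j)"
      by (simp add: dm_def fun_eq_iff algebra_simps)
     moreover have "smooth \<dots>" by (intro smooth_sum smooth_mult smooth_const partial_deriv_reflect(2) smooth_partial_deriv smooth_mon)
     ultimately show "smooth (dm is t)" by simp
    qed
    have "(\<Sum>is | length is = Suc k. \<integral>z. w is z * (dm is t z * \<psi> z) \<partial>lebesgue)
     = (\<integral>z. (\<Sum>is | length is = Suc k. w is z * (dm is t z * \<psi> z)) \<partial>lebesgue)"
     using k by (intro Bochner_Integration.integral_sum[symmetric] integrable_mult_test[OF w_integrable dmt]) auto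
    also have "\<dots> = (\<integral>z. (\<Sum>j\<in>UNIV. \<Sum>is | length is = k. real (Suc k) * h $ j * (w (j # is) z * (mon is (x + t *\<^sub>R h - z) * \<psi> z))) \<partial>lebesgue)"
    proof (rule Bochner_Integration.integral_cong[OF refl])
     fix z
     have "(\<Sum>is | length is = Suc k. w is z * (dm is t z * \<psi> z))
      = (\<Sum>is | length is = Suc k. \<Sum>j\<in>UNIV. w is z * partial_deriv j (mon is) (x - z + t *\<^sub>R h) * (h $ j * \<psi> z))"
      by (simp add: dm_def sum_distrib_left sum_distrib_right mult_ac)
     also have "\<dots> = (\<Sum>j\<in>UNIV. (\<Sum>is | length is = Suc k. w is z * partial_deriv j (mon is) (x - z + t *\<^sub>R h)) * (h $ j * \<psi> z))"
      by (subst sum.swap) (simp add: sum_distrib_right)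
     also have "\<dots> = (\<Sum>j\<in>UNIV. real (Suc k) * (\<Sum>is | length is = k. w (j # is) z * mon is (x - z + t *\<^sub>R h)) * (h $ j * \<psi> z))"
      by (simp only: w_sum_partial_deriv_mon)
     also have "\<dots> = (\<Sum>j\<in>UNIV. \<Sum>is | length is = k. real (Suc k) * h $ j * (w (j # is) z * (mon is (x + t *\<^sub>R h - z) * \<psi> z)))"
      by (simp add: sum_distrib_left sum_distrib_right algebra_simps)
     finally show "(\<Sum>is | length is = Suc k. w is z * (dm is t z * \<psi> z)) = \<dots>" .
    qed
    also have "\<dots> = (\<Sum>j\<in>UNIV. \<Sum>is | length is = k. real (Suc k) * h $ j * (\<integral>z. w (j # is) z * (mon is (x + t *\<^sub>R h - z) * \<psi> z) \<partial>lebesgue))"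
    proof -
     have i: "integrable lebesgue (\<lambda>z. real (Suc k) * h $ j * (w (j # is) z * (mon is (x + t *\<^sub>R h - z) * \<psi> z)))" if "length is = k" for j "is"
      using k that by (intro integrable_mult_right integrable_mult_test[OF w_integrable mon_test[OF \<psi>]]) auto
     have "(\<integral>z. (\<Sum>j\<in>UNIV. \<Sum>is | length is = k. real (Suc k) * h $ j * (w (j # is) z * (mon is (x + t *\<^sub>R h - z) * \<psi> z))) \<partial>lebesgue)
      = (\<Sum>j\<in>UNIV. \<integral>z. (\<Sum>is | length is = k. real (Suc k) * h $ j * (w (j # is) z * (mon is (x + t *\<^sub>R h - z) * \<psi> z))) \<partial>lebesgue)"
      by (intro Bochner_Integration.integral_sum Bochner_Integration.integrable_sum i) simp
     also have "\<dots> = (\<Sum>j\<in>UNIV. \<Sum>is | length is = k. \<integral>z. real (Suc k) * h $ j * (w (j # is) z * (mon is (x + t *\<^sub>R h - z) * \<psi> z)) \<partial>lebesgue)"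
      by (intro sum.cong refl Bochner_Integration.integral_sum i) simp
     finally show ?thesis by simp
    qed
    also have "\<dots> = real (Suc k) * (\<Sum>j\<in>UNIV. h $ j * U k j)" by (simp add: U_def sum_distrib_left mult_ac)
    finally show ?thesis .
   qed
   \<comment> \<open>The constant term of the polynomial does not depend on x; hence the shift of
     the order by one below.\<close>
   have A0: "(\<Sum>is | length is = 0. \<integral>z. w is z * (dm is t z * \<psi> z) \<partial>lebesgue) = 0"
    unfolding sum_lists_0 dm_def partial_deriv_mon_Nil by simp
   obtain M where M: "N = Suc M" using N by (cases N) auto
   have "D t = (\<Sum>k<M. (\<Sum>is | length is = Suc k. \<integral>z. w is z * (dm is t z * \<psi> z) \<partial>lebesgue) / fact (Suc k))"
    unfolding D_def M sum.lessThan_Suc_shift A0 by simp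
   also have "\<dots> = (\<Sum>k<M. (\<Sum>j\<in>UNIV. h $ j * U k j) / fact k)" by (intro sum.cong refl) (simp add: A M del: of_nat_Suc)
   also have "\<dots> = (\<Sum>j\<in>UNIV. h $ j * (\<Sum>k<M. U k j / fact k))"
    unfolding sum_divide_distrib sum_distrib_left by (subst sum.swap) simp
   finally show ?thesis unfolding taylor_avg_def U_def M by simp
  qed
  with t show ?thesis by auto
qed

end

lemma continuous_on_exp_flat [continuous_intros]:
  "continuous_on S f \<Longrightarrow> continuous_on S (\<lambda>x. exp_flat k (f x))" by (rule continuous_on_compose2[of UNIV "exp_flat k"])
   (auto intro!: continuous_at_imp_continuous_on DERIV_isCont exp_flat_has_derivative)

context sobolev_family begin

lemma domain_lebesgue: "\<Omega> \<in> sets lebesgue"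
  using open_domain by (simp add: lborelD)

lemma weighted_grad_sum_integrable:
  assumes D: "D \<in> sets lebesgue" "D \<subseteq> \<Omega>"
  shows "integrable lebesgue (\<lambda>z. norm (x - z) ^ m * grad_sum N w z * indicator D z)"
proof -
  obtain R where R: "\<And>z. z \<in> \<Omega> \<Longrightarrow> norm z \<le> R" using bounded_domain by (auto simp: bounded_iff)
  have "norm (x - z) ^ m * indicator D z \<le> (norm x + \<bar>R\<bar>) ^ m" for z
  proof (cases "z \<in> D")
   case True
   then have "norm (x - z) \<le> norm x + \<bar>R\<bar>" using R[of z] D norm_triangle_ineq4[of x z] by auto
   then show ?thesis using True by (simp add: power_mono)
  qed simp
  then have b: "\<bar>norm (x - z) ^ m * indicator D z\<bar> \<le> (norm x + \<bar>R\<bar>) ^ m" for z by simp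
  have "continuous_on UNIV (\<lambda>z. norm (x - z) ^ m)" by (intro continuous_intros)
  then have "(\<lambda>z. norm (x - z) ^ m * indicator D z) \<in> borel_measurable lebesgue"
   using D(1) by (intro borel_measurable_times continuous_measurable_lebesgue borel_measurable_indicator)
  from integrable_mult_bounded[OF grad_sum_integrable[OF order_refl] this b]
  show ?thesis by (simp add: mult_ac)
qed

text \<open>Centre and radius move linearly. By the transport equation the time derivative of the
  average is minus an average against a divergence, which \<open>taylor_avg_partial_deriv\<close>
  reduces to order N. \<open>bump_flow_bound\<close> is uniform in time because all radii on the way
  are at least m.\<close>

lemma taylor_avg_move:
  fixes x c c' :: "real^'n"
  assumes N: "N > 0" and D: "D \<in> sets lebesgue" "D \<subseteq> \<Omega>"
   and m: "0 < m" "m \<le> s" "m \<le> s'"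
   and balls: "\<And>t. t \<in> {0..1} \<Longrightarrow> cball (c + t *\<^sub>R (c' - c)) (s + t * (s' - s)) \<subseteq> D"
  shows "\<bar>taylor_avg N w x (bump c' s') - taylor_avg N w x (bump c s)\<bar>
   \<le> (norm (c' - c) + \<bar>s' - s\<bar>) / (bump_mass TYPE('n) * m ^ CARD('n))
     * (\<integral>z. norm (x - z) ^ (N - 1) * grad_sum N w z * indicator D z \<partial>lebesgue)"
proof -
  define d where "d = c' - c"
  define e where "e = s' - s"
  define \<psi> where "\<psi> t = bump (c + t *\<^sub>R d) (s + t * e)" for t
  define fl where "fl t j = bump_flow c s d e t j" for t j
  define dv where "dv t z = - (\<Sum>j\<in>UNIV. partial_deriv j (fl t j) z)" for t z
  define M where "M = (norm d + \<bar>e\<bar>) / (bump_mass TYPE('n) * m ^ CARD('n))"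
  let ?h = "\<lambda>j is z. norm (x - z) ^ (N - 1) * \<bar>w (j # is) z\<bar> * indicator D z"
  let ?P = "\<lambda>t j is. \<integral>z. w is z * (mon is (x - z) * partial_deriv j (fl t j) z) \<partial>lebesgue"
  let ?V = "\<lambda>t is. \<integral>z. w is z * (mon is (x - z) * dv t z) \<partial>lebesgue"
  let ?F = "\<lambda>t j is. \<integral>z. w (j # is) z * (mon is (x - z) * fl t j z) \<partial>lebesgue"
  have sm: "m \<le> s + t * e" if "t \<in> {0..1}" for t
  proof -
   have "m = (1 - t) * m + t * m" by (simp add: algebra_simps)
   also have "\<dots> \<le> (1 - t) * s + t * s'" using m that by (intro add_mono mult_left_mono) auto
   finally show ?thesis by (simp add: e_def algebra_simps)
  qed
  have sp: "0 < s + t * e" if "t \<in> {0..1}" for t using sm[OF that] m by linarith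
  have bD: "cball (c + t *\<^sub>R d) (s + t * e) \<subseteq> D" if "t \<in> {0..1}" for t using balls[OF that] by (simp add: d_def e_def)
  have flt: "fl t j \<in> test_functions \<Omega>" if t: "t \<in> {0..1}" for t j
   by (rule test_functionsI[of _ "cball (c + t *\<^sub>R d) (s + t * e)"])
    (use bD[OF t] D vanishes_off_bump[OF sp[OF t], of "c + t *\<^sub>R d"] in \<open>auto simp: fl_def smooth_bump_flow bump_flow_def vanishes_off_def\<close>)
  have \<psi>t: "\<psi> t \<in> test_functions \<Omega>" if t: "t \<in> {0..1}" for t
   unfolding \<psi>_def using bD[OF t] D by (intro bump_test_function sp[OF t]) auto
  obtain R where R: "\<And>z. z \<in> \<Omega> \<Longrightarrow> norm z \<le> R" using bounded_domain by (auto simp: bounded_iff)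
  define K where "K = cball (0::real^'n) R"
  have K: "compact K" "\<Omega> \<subseteq> K" using R by (auto simp: K_def)
  have dvoff: "dv t z = 0" if t: "t \<in> {0..1}" and z: "z \<notin> K" for t z
  proof -
   have "partial_deriv j (fl t j) z = 0" for j
   proof (rule test_functionsE[OF test_functions_partial_deriv[OF flt[OF t], of j j]])
    fix K' assume "K' \<subseteq> \<Omega>" "vanishes_off K' (partial_deriv j (fl t j))"
    moreover from this(1) have "z \<notin> K'" using K(2) z by blast
    ultimately show ?thesis by (simp add: vanishes_off_def)
   qed
   then show ?thesis by (simp add: dv_def)
  qed
  \<comment> \<open>Joint continuity in \<open>(t, z)\<close> on a compact set yields the majorant
    for differentiating under the integral.\<close>
  have dvc: "continuous_on ({0..1} \<times> K) (\<lambda>(t, z). dv t z)"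
  proof -
   have nz: "s + t * e \<noteq> 0" if "t \<in> {0..1}" for t using sp[OF that] by simp
   have Z: "bump_mass TYPE('n) \<noteq> 0" using bump_mass_pos[where 'n='n] by simp
   show ?thesis unfolding dv_def fl_def bump_flow_partial_deriv bump_partial_deriv bump_def case_prod_unfold
    by (intro continuous_intros ballI) (use nz Z in auto)
  qed
  obtain B where B: "\<And>t z. t \<in> {0..1} \<Longrightarrow> z \<in> K \<Longrightarrow> \<bar>dv t z\<bar> \<le> B"
  proof -
   have "bounded ((\<lambda>(t, z). dv t z) ` ({0..1} \<times> K))"
    using dvc K(1) by (intro compact_imp_bounded compact_continuous_image compact_Times compact_Icc)
   then show thesis using that by (force simp: bounded_iff)
  qed
  have B': "\<bar>dv t z\<bar> \<le> \<bar>B\<bar>" if "t \<in> {0..1}" for t z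
   using B[OF that, of z] dvoff[OF that, of z] by (cases "z \<in> K") auto
  have dvs: "smooth (dv t)" if "t \<in> {0..1}" for t
   unfolding dv_def[abs_def] fl_def by (intro smooth_minus smooth_sum smooth_partial_deriv smooth_bump_flow)
  define D' where "D' t = (\<Sum>k<N. (\<Sum>is | length is = k. ?V t is) / fact k)" for t
  have dI: "((\<lambda>t. \<integral>z. w is z * (mon is (x - z) * \<psi> t z) \<partial>lebesgue) has_real_derivative
    ?V t is) (at t within {0..1})" if l: "length is < N" and t: "t \<in> {0..1}" for "is" t
  proof -
   have wi: "integrable lebesgue (w is)" using l by (intro w_integrable) auto
   have mi: "integrable lebesgue (\<lambda>z. w is z * mon is (x - z))"
   proof -
    obtain B2 where B2: "\<And>z. z \<in> K \<Longrightarrow> \<bar>mon is (x - z)\<bar> \<le> B2"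
     using continuous_compact_bounded_real[OF smooth_continuous[OF partial_deriv_reflect(2)[OF smooth_mon]] K(1)] by blast
    have eq: "(\<lambda>z. w is z * mon is (x - z)) = (\<lambda>z. w is z * (mon is (x - z) * indicator K z))"
     using w_off K(2) by (auto simp: fun_eq_iff indicator_def)
    show ?thesis unfolding eq
    proof (rule integrable_mult_bounded[OF wi])
     show "(\<lambda>z. mon is (x - z) * indicator K z) \<in> borel_measurable lebesgue"
      by (intro borel_measurable_times continuous_measurable_lebesgue smooth_continuous partial_deriv_reflect(2) smooth_mon borel_measurable_indicator)
       (simp add: K_def)
     show "\<bar>mon is (x - z) * indicator K z\<bar> \<le> \<bar>B2\<bar>" for z using B2[of z] by (auto simp: indicator_def)
    qed
   qed
   show ?thesis
   proof (rule has_real_derivative_integral[where D="\<lambda>z. \<bar>B\<bar> * \<bar>w is z * mon is (x - z)\<bar>" and f'="\<lambda>t z. w is z * (mon is (x - z) * dv t z)"])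
    show "integrable lebesgue (\<lambda>z. w is z * (mon is (x - z) * \<psi> t z))" if "t \<in> {0..1}" for t
     by (intro integrable_mult_test[OF wi mon_test[OF \<psi>t[OF that]]])
    show "integrable lebesgue (\<lambda>z. \<bar>B\<bar> * \<bar>w is z * mon is (x - z)\<bar>)" by (intro integrable_mult_right integrable_abs mi)
    have "dv t \<in> borel_measurable lebesgue" by (intro continuous_measurable_lebesgue smooth_continuous dvs t)
    moreover have "(\<lambda>z. mon is (x - z)) \<in> borel_measurable lebesgue"
     by (intro continuous_measurable_lebesgue smooth_continuous partial_deriv_reflect(2) smooth_mon)
    moreover have "w is \<in> borel_measurable lebesgue" using wi by auto
    ultimately show "(\<lambda>z. w is z * (mon is (x - z) * dv t z)) \<in> borel_measurable lebesgue" by (intro borel_measurable_times)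
    show "((\<lambda>t. w is z * (mon is (x - z) * \<psi> t z)) has_real_derivative w is z * (mon is (x - z) * dv t z)) (at t within {0..1})"
     if "t \<in> {0..1}" for t z unfolding \<psi>_def dv_def fl_def by (intro DERIV_cmult bump_time_derivative sp[OF that])
    show "\<bar>w is z * (mon is (x - z) * dv t z)\<bar> \<le> \<bar>B\<bar> * \<bar>w is z * mon is (x - z)\<bar>" if "t \<in> {0..1}" for t z
    proof -
     have "\<bar>dv t z\<bar> * \<bar>w is z * mon is (x - z)\<bar> \<le> \<bar>B\<bar> * \<bar>w is z * mon is (x - z)\<bar>"
      using B'[OF that] by (intro mult_right_mono) auto
     then show ?thesis by (simp add: abs_mult mult_ac)
    qed
   qed (use t in auto)
  qed
  have der: "((\<lambda>t. taylor_avg N w x (\<psi> t)) has_real_derivative D' t) (at t within {0..1})" if "t \<in> {0..1}" for t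
   unfolding taylor_avg_def D'_def by (intro DERIV_sum DERIV_cdivide dI that) auto
  have "\<exists>t\<in>{0<..<1::real}. taylor_avg N w x (\<psi> 1) - taylor_avg N w x (\<psi> 0) = D' t * (1 - 0)"
   by (rule mvt_simple) (use der in \<open>auto simp: has_field_derivative_def\<close>)
  then obtain t where t: "t \<in> {0<..<1}" "taylor_avg N w x (\<psi> 1) - taylor_avg N w x (\<psi> 0) = D' t" by auto
  then have t': "t \<in> {0..1}" by auto
  have "D' t = - (\<Sum>j\<in>UNIV. taylor_avg N w x (partial_deriv j (fl t j)))"
  proof -
   have one: "?V t is = - (\<Sum>j\<in>UNIV. ?P t j is)"
    if "length is < N" for "is"
   proof -
    have "?V t is = (\<integral>z. - (\<Sum>j\<in>UNIV. w is z * (mon is (x - z) * partial_deriv j (fl t j) z)) \<partial>lebesgue)"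
     by (simp add: dv_def sum_distrib_left)
    also have "\<dots> = - (\<Sum>j\<in>UNIV. ?P t j is)"
     using that by (simp, intro Bochner_Integration.integral_sum integrable_mult_test[OF w_integrable mon_test[OF test_functions_partial_deriv[OF flt[OF t']]]]) auto
    finally show ?thesis .
   qed
   have "D' t = (\<Sum>k<N. - (\<Sum>j\<in>UNIV. (\<Sum>is | length is = k. ?P t j is) / fact k))" unfolding D'_def
   proof (intro sum.cong refl)
    fix k assume k: "k \<in> {..<N}"
    have "(\<Sum>is | length is = k. ?V t is)
     = (\<Sum>is | length is = k. - (\<Sum>j\<in>UNIV. ?P t j is))" using k by (intro sum.cong refl one) auto
    also have "\<dots> = - (\<Sum>j\<in>UNIV. \<Sum>is | length is = k. ?P t j is)" unfolding sum_negf by (subst sum.swap) simp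
    finally show "(\<Sum>is | length is = k. ?V t is) / fact k
     = - (\<Sum>j\<in>UNIV. (\<Sum>is | length is = k. ?P t j is) / fact k)" by (simp add: sum_divide_distrib)
   qed
   also have "\<dots> = - (\<Sum>j\<in>UNIV. taylor_avg N w x (partial_deriv j (fl t j)))"
    unfolding taylor_avg_def sum_negf by (subst sum.swap) simp
   finally show ?thesis .
  qed
  also have "\<dots> = (\<Sum>j\<in>UNIV. (\<Sum>is | length is = N - 1. ?F t j is) / fact (N - 1))"
   unfolding taylor_avg_partial_deriv[OF N flt[OF t']] by (simp add: sum_negf)
  finally have D't: "D' t = \<dots>" .
  have Mpos: "0 \<le> M" using m bump_mass_pos[where 'n='n] by (simp add: M_def)
  have flb: "\<bar>fl t j z\<bar> \<le> M * indicator D z" for j z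
  proof -
   have "\<bar>fl t j z\<bar> \<le> (norm d + \<bar>e\<bar>) / (bump_mass TYPE('n) * (s + t * e) ^ CARD('n)) * indicator (cball (c + t *\<^sub>R d) (s + t * e)) z"
    unfolding fl_def by (rule bump_flow_bound[OF sp[OF t']])
   also have "\<dots> \<le> M * indicator D z" unfolding M_def using bD[OF t'] m sm[OF t'] sp[OF t'] bump_mass_pos[where 'n='n]
    by (intro mult_mono divide_left_mono power_mono mult_left_mono mult_pos_pos zero_less_power) (auto simp: indicator_def)
   finally show ?thesis .
  qed
  have trm: "\<bar>?F t j is\<bar>
    \<le> (\<integral>z. M * ?h j is z \<partial>lebesgue)"
   and int: "integrable lebesgue (\<lambda>z. M * ?h j is z)"
   if l: "length is = N - 1" for j "is"
  proof -
   have wm: "w (j # is) \<in> borel_measurable lebesgue" using w_integrable[of "j # is"] l N by auto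
   have le: "\<bar>w (j # is) z\<bar> \<le> grad_sum N w z" for z
    unfolding grad_sum_def using l N by (intro member_le_sum[of "j # is" _ "\<lambda>is. \<bar>w is z\<bar>"]) auto
   have "integrable lebesgue (\<lambda>z. ?h j is z)"
   proof (rule Bochner_Integration.integrable_bound[OF weighted_grad_sum_integrable[OF D, of x "N - 1"]])
    have "continuous_on UNIV (\<lambda>z. norm (x - z) ^ (N - 1))" by (intro continuous_intros)
    then show "(\<lambda>z. ?h j is z) \<in> borel_measurable lebesgue"
     using borel_measurable_times[OF borel_measurable_times[OF continuous_measurable_lebesgue borel_measurable_abs[OF wm]] borel_measurable_indicator[OF D(1)]]
     by blast
    show "AE z in lebesgue. norm (?h j is z) \<le> norm (norm (x - z) ^ (N - 1) * grad_sum N w z * indicator D z)"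
     using le grad_sum_nonneg[of N] by (intro AE_I2) (auto simp: abs_mult indicator_def intro!: mult_left_mono)
   qed
   then show int: "integrable lebesgue (\<lambda>z. M * ?h j is z)" by simp
   show "\<bar>?F t j is\<bar>
    \<le> (\<integral>z. M * ?h j is z \<partial>lebesgue)"
   proof (rule integral_abs_bound_integral[OF _ int])
    show "integrable lebesgue (\<lambda>z. w (j # is) z * (mon is (x - z) * fl t j z))"
     using l N by (intro integrable_mult_test[OF w_integrable mon_test[OF flt[OF t']]]) auto
    fix z
    have "\<bar>w (j # is) z\<bar> * (\<bar>mon is (x - z)\<bar> * \<bar>fl t j z\<bar>) \<le> \<bar>w (j # is) z\<bar> * (norm (x - z) ^ (N - 1) * (M * indicator D z))"
     using abs_mon_le[of "is" "x - z"] flb[of j z] l by (intro mult_left_mono mult_mono) auto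
    then show "\<bar>w (j # is) z * (mon is (x - z) * fl t j z)\<bar> \<le> M * ?h j is z" by (simp add: abs_mult mult_ac)
   qed
  qed
  have "\<bar>D' t\<bar> \<le> (\<Sum>j\<in>UNIV. \<Sum>is | length is = N - 1. \<integral>z. M * ?h j is z \<partial>lebesgue)" unfolding D't
  proof (intro order_trans[OF sum_abs] sum_mono)
   fix j
   have "\<bar>(\<Sum>is | length is = N - 1. ?F t j is) / fact (N - 1)\<bar>
    \<le> \<bar>\<Sum>is | length is = N - 1. ?F t j is\<bar>"
    using fact_ge_1[of "N - 1", where 'a=real] by (simp add: divide_le_eq mult_left_le mult_le_cancel_left1)
   also have "\<dots> \<le> (\<Sum>is | length is = N - 1. \<integral>z. M * ?h j is z \<partial>lebesgue)"
    by (intro order_trans[OF sum_abs] sum_mono trm) auto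
   finally show "\<bar>(\<Sum>is | length is = N - 1. ?F t j is) / fact (N - 1)\<bar> \<le> \<dots>" .
  qed
  also have "\<dots> = (\<integral>z. (\<Sum>j\<in>UNIV. \<Sum>is | length is = N - 1. M * ?h j is z) \<partial>lebesgue)"
  proof -
   have "(\<integral>z. (\<Sum>j\<in>UNIV. \<Sum>is | length is = N - 1. M * ?h j is z) \<partial>lebesgue)
    = (\<Sum>j\<in>UNIV. \<integral>z. (\<Sum>is | length is = N - 1. M * ?h j is z) \<partial>lebesgue)"
    by (intro Bochner_Integration.integral_sum Bochner_Integration.integrable_sum int) simp
   also have "\<dots> = (\<Sum>j\<in>UNIV. \<Sum>is | length is = N - 1. \<integral>z. M * ?h j is z \<partial>lebesgue)"
    by (intro sum.cong refl Bochner_Integration.integral_sum int) simp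
   finally show ?thesis by simp
  qed
  also have "\<dots> = (\<integral>z. M * (norm (x - z) ^ (N - 1) * grad_sum N w z * indicator D z) \<partial>lebesgue)"
  proof (rule Bochner_Integration.integral_cong[OF refl])
   fix z
   have "grad_sum N w z = (\<Sum>j\<in>UNIV. \<Sum>is | length is = N - 1. \<bar>w (j # is) z\<bar>)"
    unfolding grad_sum_def using sum_lists_Suc[of "\<lambda>is. \<bar>w is z\<bar>" "N - 1"] N by simp
   then show "(\<Sum>j\<in>UNIV. \<Sum>is | length is = N - 1. M * ?h j is z)
    = M * (norm (x - z) ^ (N - 1) * grad_sum N w z * indicator D z)" by (simp only: sum_distrib_left sum_distrib_right)
  qed
  also have "\<dots> = M * (\<integral>z. norm (x - z) ^ (N - 1) * grad_sum N w z * indicator D z \<partial>lebesgue)" by simp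
  finally show ?thesis using t(2) by (simp add: \<psi>_def M_def d_def e_def)
qed

end

section \<open>Averages over shrinking balls\<close>

lemma convolution_pairing:
  fixes g \<kappa> \<phi> :: "real^'n::finite \<Rightarrow> real"
  assumes g: "integrable lebesgue g"
   and \<kappa>: "continuous_on UNIV \<kappa>" "\<And>y. \<bar>\<kappa> y\<bar> \<le> B"
   and \<phi>: "continuous_on UNIV \<phi>" "compact K" "vanishes_off K \<phi>"
  shows "(\<integral>x. (\<integral>z. g z * \<kappa> (x - z) \<partial>lebesgue) * \<phi> x \<partial>lebesgue) = (\<integral>z. g z * (\<integral>x. \<kappa> (x - z) * \<phi> x \<partial>lborel) \<partial>lebesgue)"
   and "integrable lebesgue (\<lambda>x. (\<integral>z. g z * \<kappa> (x - z) \<partial>lebesgue) * \<phi> x)"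
   and "(\<lambda>z. \<integral>x. \<kappa> (x - z) * \<phi> x \<partial>lborel) \<in> borel_measurable borel"
proof -
  let ?c = "\<lambda>z. \<integral>x. \<kappa> (x - z) * \<phi> x \<partial>lborel"
  \<comment> \<open>Fubini's theorem is applied on the product of Borel measures, so g is first
    replaced by a Borel function that agrees with it almost everywhere.\<close>
  obtain g' where g': "g' \<in> borel_measurable lborel" "AE x in lborel. g x = g' x"
   using completion_ex_borel_measurable_real[OF borel_measurable_integrable[OF g]] by blast
  have g'l: "g' \<in> borel_measurable lebesgue" using g'(1) by (rule measurable_completion)
  have AEl: "AE x in lebesgue. g x = g' x" using g'(2) by (rule AE_completion)
  have g'i: "integrable lborel g'" using integrable_cong_AE[OF borel_measurable_integrable[OF g] g'l AEl] g g'(1) integrable_completion by blast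
  have [measurable]: "g' \<in> borel_measurable borel" using g'(1) by simp
  have [measurable]: "\<kappa> \<in> borel_measurable borel" "\<phi> \<in> borel_measurable borel"
   using \<kappa>(1) \<phi>(1) by (auto intro: borel_measurable_continuous_onI)
  have \<phi>i: "integrable lborel \<phi>" by (rule integrable_vanishes_off[OF \<phi>])
  have km: "(\<lambda>z. \<kappa> (x - z)) \<in> borel_measurable borel" for x by measurable
  have in1: "(\<integral>z. g z * \<kappa> (x - z) \<partial>lebesgue) = (\<integral>z. g' z * \<kappa> (x - z) \<partial>lborel)" for x
  proof -
   have kl: "(\<lambda>z. \<kappa> (x - z)) \<in> borel_measurable lebesgue" using km[of x] by (intro measurable_completion) simp
   have "(\<integral>z. g z * \<kappa> (x - z) \<partial>lebesgue) = (\<integral>z. g' z * \<kappa> (x - z) \<partial>lebesgue)"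
   proof (rule integral_cong_AE)
    show "AE z in lebesgue. g z * \<kappa> (x - z) = g' z * \<kappa> (x - z)" using AEl by eventually_elim simp
   qed (intro borel_measurable_times kl g'l borel_measurable_integrable[OF g])+
   also have "\<dots> = (\<integral>z. g' z * \<kappa> (x - z) \<partial>lborel)" by (rule integral_completion) measurable
   finally show ?thesis .
  qed
  define f where "f = (\<lambda>x z. g' z * \<kappa> (x - z) * \<phi> x)"
  have fm [measurable]: "(\<lambda>(x, z). f x z) \<in> borel_measurable (lborel \<Otimes>\<^sub>M lborel)" unfolding f_def by measurable
  have pi: "integrable (lborel \<Otimes>\<^sub>M lborel) (\<lambda>(x, z). \<phi> x * g' z)"
  proof (rule lborel_pair.Fubini_integrable)
   show "(\<lambda>(x, z). \<phi> x * g' z) \<in> borel_measurable (lborel \<Otimes>\<^sub>M lborel)" by measurable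
   show "integrable lborel (\<lambda>x. \<integral>y. norm (case (x, y) of (x, z) \<Rightarrow> \<phi> x * g' z) \<partial>lborel)"
    using \<phi>i by (simp add: abs_mult)
   show "AE x in lborel. integrable lborel (\<lambda>y. case (x, y) of (x, z) \<Rightarrow> \<phi> x * g' z)" using g'i by simp
  qed
  have fi: "integrable (lborel \<Otimes>\<^sub>M lborel) (\<lambda>(x, z). f x z)"
  proof (rule Bochner_Integration.integrable_bound[OF _ fm])
   show "integrable (lborel \<Otimes>\<^sub>M lborel) (\<lambda>p. B * (case p of (x, z) \<Rightarrow> \<phi> x * g' z))" using pi by (rule integrable_mult_right)
   have "\<bar>f x z\<bar> \<le> \<bar>B\<bar> * \<bar>\<phi> x * g' z\<bar>" for x z
   proof -
    have "\<bar>\<kappa> (x - z)\<bar> * \<bar>\<phi> x * g' z\<bar> \<le> \<bar>B\<bar> * \<bar>\<phi> x * g' z\<bar>" using \<kappa>(2)[of "x - z"] by (intro mult_right_mono) auto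
    then show ?thesis by (simp add: f_def abs_mult mult_ac)
   qed
   then show "AE p in lborel \<Otimes>\<^sub>M lborel. norm (case p of (x, z) \<Rightarrow> f x z) \<le> norm (B * (case p of (x, z) \<Rightarrow> \<phi> x * g' z))"
    by (intro AE_I2) (auto simp: abs_mult split: prod.split)
  qed
  have m1: "(\<lambda>x. \<integral>z. f x z \<partial>lborel) \<in> borel_measurable lborel" by measurable
  show m2: "(\<lambda>z. ?c z) \<in> borel_measurable borel" by measurable
  have eq: "(\<integral>z. g z * \<kappa> (x - z) \<partial>lebesgue) * \<phi> x = (\<integral>z. f x z \<partial>lborel)" for x
   unfolding in1 f_def by simp
  have i1: "integrable lborel (\<lambda>x. \<integral>z. f x z \<partial>lborel)" using lborel_pair.integrable_fst'[OF fi] by simp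
  then show "integrable lebesgue (\<lambda>x. (\<integral>z. g z * \<kappa> (x - z) \<partial>lebesgue) * \<phi> x)"
   unfolding eq by (subst integrable_completion[OF m1])
  have "(\<integral>x. (\<integral>z. g z * \<kappa> (x - z) \<partial>lebesgue) * \<phi> x \<partial>lebesgue) = (\<integral>x. (\<integral>z. f x z \<partial>lborel) \<partial>lborel)"
   unfolding eq by (rule integral_completion[OF m1])
  also have "\<dots> = (\<integral>z. (\<integral>x. f x z \<partial>lborel) \<partial>lborel)" using lborel_pair.Fubini_integral[OF fi] by simp
  also have "\<dots> = (\<integral>z. g' z * ?c z \<partial>lborel)" by (simp add: f_def mult.assoc)
  also have "\<dots> = (\<integral>z. g' z * ?c z \<partial>lebesgue)" using m2 by (intro integral_completion[symmetric]) measurable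
  also have "\<dots> = (\<integral>z. g z * ?c z \<partial>lebesgue)"
  proof (rule integral_cong_AE)
   have m2l: "(\<lambda>z. ?c z) \<in> borel_measurable lebesgue" using m2 by (intro measurable_completion) simp
   show "(\<lambda>z. g' z * ?c z) \<in> borel_measurable lebesgue" using g'l m2l by (rule borel_measurable_times)
   show "(\<lambda>z. g z * ?c z) \<in> borel_measurable lebesgue" using borel_measurable_integrable[OF g] m2l by (rule borel_measurable_times)
   show "AE z in lebesgue. g' z * ?c z = g z * ?c z" using AEl by eventually_elim simp
  qed
  finally show "(\<integral>x. (\<integral>z. g z * \<kappa> (x - z) \<partial>lebesgue) * \<phi> x \<partial>lebesgue) = (\<integral>z. g z * ?c z \<partial>lebesgue)" .
qed

lemma bump_mult_integrable:
  fixes f :: "real^'n::finite \<Rightarrow> real"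
  assumes s: "s > 0" and f: "continuous_on UNIV f"
  shows "integrable lborel (\<lambda>x. bump z s x * f x)"
  by (rule integrable_vanishes_off[OF continuous_on_mult[OF smooth_continuous[OF smooth_bump] f] compact_cball[of z s]])
   (use vanishes_off_bump[OF s, of z] in \<open>simp add: vanishes_off_def\<close>)

lemma bump_average_bound:
  fixes f :: "real^'n::finite \<Rightarrow> real"
  assumes s: "s > 0" and f: "continuous_on UNIV f" and E: "\<And>x. norm (x - z) \<le> s \<Longrightarrow> \<bar>f x\<bar> \<le> E"
  shows "\<bar>\<integral>x. bump z s x * f x \<partial>lborel\<bar> \<le> E"
proof -
  have bi: "integrable lborel (bump z s)"
   by (rule integrable_vanishes_off[OF smooth_continuous[OF smooth_bump] compact_cball vanishes_off_bump[OF s]])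
  have "\<bar>\<integral>x. bump z s x * f x \<partial>lborel\<bar> \<le> (\<integral>x. bump z s x * E \<partial>lborel)"
  proof (rule integral_abs_bound_integral[OF bump_mult_integrable[OF s f]])
   show "integrable lborel (\<lambda>x. bump z s x * E)" using bi by simp
   fix x
   show "\<bar>bump z s x * f x\<bar> \<le> bump z s x * E"
   proof (cases "x \<in> cball z s")
    case True
    then have "\<bar>f x\<bar> \<le> E" by (intro E) (simp add: dist_norm norm_minus_commute)
    then show ?thesis using bump_nonneg[of s z x] s by (simp add: abs_mult mult_left_mono)
   qed (use vanishes_off_bump[OF s, of z] in \<open>auto simp: vanishes_off_def\<close>)
  qed
  also have "\<dots> = E" using bump_integral[OF s, of z] by simp
  finally show "\<bar>\<integral>x. bump z s x * f x \<partial>lborel\<bar> \<le> E" .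
qed

text \<open>Fubini puts the kernel onto \<phi>. Without indices this mollifies \<phi>, and the
  mollifications converge uniformly; with at least one index the monomial is at most s on the
  support of the bump, for s up to 1, and the term disappears.\<close>

lemma mollified_pairing_tendsto:
  fixes g \<phi> :: "real^'n::finite \<Rightarrow> real"
  assumes g: "integrable lebesgue g" and \<phi>: "continuous_on UNIV \<phi>" "compact K" "vanishes_off K \<phi>"
  shows "((\<lambda>s. \<integral>x. (\<integral>z. g z * (mon is (x - z) * bump x s z) \<partial>lebesgue) * \<phi> x \<partial>lebesgue) \<longlongrightarrow>
   (if is = [] then \<integral>x. g x * \<phi> x \<partial>lebesgue else 0)) (at_right 0)" unfolding tendsto_iff
proof (intro allI impI)
  fix \<epsilon> :: real assume \<epsilon>: "\<epsilon> > 0"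
  define G where "G = (\<integral>z. \<bar>g z\<bar> \<partial>lebesgue)"
  have G0: "0 \<le> G" by (simp add: G_def)
  obtain B where B: "0 \<le> B" "\<And>x. \<bar>\<phi> x\<bar> \<le> B" using vanishes_off_bounded[OF \<phi>] by blast
  \<comment> \<open>Replacing the kernel's action on \<phi> by its limit up to E costs at most
    \<open>G * E\<close>, which is below \<epsilon>; the added 1 allows for G = 0.\<close>
  define E where "E = \<epsilon> / (2 * (G + 1))"
  have E: "E > 0" using \<epsilon> G0 by (simp add: E_def)
  have "uniformly_continuous_on UNIV \<phi>"
  proof -
   have uc: "uniformly_continuous_on (cball 0 R) \<phi>" for R
    using \<phi>(1) by (intro compact_uniformly_continuous) (auto intro: continuous_on_subset)
   obtain R where R: "\<And>x. x \<in> K \<Longrightarrow> norm x \<le> R" using compact_imp_bounded[OF \<phi>(2)] by (auto simp: bounded_iff)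
   show ?thesis unfolding uniformly_continuous_on_def
   proof (intro allI impI)
    fix e :: real assume "e > 0"
    from uc[of "R + 1", unfolded uniformly_continuous_on_def, rule_format, OF this]
    obtain d where d: "d > 0" "\<forall>x\<in>cball 0 (R + 1). \<forall>x'\<in>cball 0 (R + 1). dist x' x < d \<longrightarrow> dist (\<phi> x') (\<phi> x) < e" by (elim exE conjE)
    show "\<exists>d>0. \<forall>x\<in>UNIV. \<forall>x'\<in>UNIV. dist x' x < d \<longrightarrow> dist (\<phi> x') (\<phi> x) < e"
    proof (intro exI[of _ "min d 1"] conjI ballI impI)
     fix x x' :: "real^'n" assume xx: "dist x' x < min d 1"
     show "dist (\<phi> x') (\<phi> x) < e"
     proof (cases "x \<in> K \<or> x' \<in> K")
      case True
      have "norm x \<le> norm x' + dist x' x" "norm x' \<le> norm x + dist x' x" unfolding dist_norm by norm+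
      then have "norm x \<le> R + 1" "norm x' \<le> R + 1" using True R[of x] R[of x'] xx by auto
      then show ?thesis using d(2)[rule_format, of x x'] xx by simp
     next
      case False then show ?thesis using \<phi>(3) \<open>e > 0\<close> by (simp add: vanishes_off_def)
     qed
    qed (use d in auto)
   qed
  qed
  from this[unfolded uniformly_continuous_on_def, rule_format, OF E]
  obtain d where d: "d > 0" "\<forall>x\<in>UNIV. \<forall>x'\<in>UNIV. dist x' x < d \<longrightarrow> dist (\<phi> x') (\<phi> x) < E" by (elim exE conjE)
  \<comment> \<open>The three bounds serve, in turn, to estimate powers of s by s, to use the
    uniform continuity of \<phi>, and to make \<open>s * (B + 1)\<close> at most E.\<close>
  define \<delta> where "\<delta> = min (min 1 (d / 2)) (E / (B + 1))"
  have \<delta>: "\<delta> > 0" using d E B by (simp add: \<delta>_def)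
  have main: "dist (\<integral>x. (\<integral>z. g z * (mon is (x - z) * bump x s z) \<partial>lebesgue) * \<phi> x \<partial>lebesgue)
    (if is = [] then \<integral>x. g x * \<phi> x \<partial>lebesgue else 0) < \<epsilon>" if s: "0 < s" "s < \<delta>" for s
  proof -
   define \<kappa> where "\<kappa> y = mon is y * bump 0 s y" for y :: "real^'n"
   have bsh: "bump x s z = bump 0 s (x - z)" for x z :: "real^'n" by (simp add: bump_def norm_minus_commute)
   have \<kappa>c: "continuous_on UNIV \<kappa>" unfolding \<kappa>_def by (intro continuous_on_mult smooth_continuous smooth_mon smooth_bump)
   have "vanishes_off (cball 0 s) \<kappa>" using vanishes_off_mult[OF vanishes_off_bump[OF s(1), of 0]] by (simp add: \<kappa>_def[abs_def])
   then obtain Bk where Bk: "\<And>y. \<bar>\<kappa> y\<bar> \<le> Bk" using vanishes_off_bounded[OF \<kappa>c compact_cball] by blast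
   have eq: "(\<integral>z. g z * (mon is (x - z) * bump x s z) \<partial>lebesgue) = (\<integral>z. g z * \<kappa> (x - z) \<partial>lebesgue)" for x
    by (simp only: \<kappa>_def bsh[of x])
   define c where "c z = (\<integral>x. \<kappa> (x - z) * \<phi> x \<partial>lborel)" for z
   define \<eta> where "\<eta> z = (if is = [] then \<phi> z else 0)" for z
   have \<eta>c: "continuous_on UNIV \<eta>" using \<phi>(1) unfolding \<eta>_def by (cases "is = []") auto
   have cm: "c \<in> borel_measurable lebesgue"
    unfolding c_def using convolution_pairing(3)[OF g \<kappa>c Bk \<phi>] by (intro measurable_completion) simp
   have ce: "\<bar>c z - \<eta> z\<bar> \<le> E" for z
   proof (cases "is = []")
    case True
    have "c z = (\<integral>x. bump z s x * \<phi> x \<partial>lborel)" by (simp add: c_def \<kappa>_def True bsh[symmetric] bump_commute[of z])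
    then have "c z - \<eta> z = (\<integral>x. bump z s x * \<phi> x \<partial>lborel) - (\<integral>x. bump z s x * \<phi> z \<partial>lborel)"
     using bump_integral[OF s(1), of z] True by (simp add: \<eta>_def)
    also have "\<dots> = (\<integral>x. bump z s x * (\<phi> x - \<phi> z) \<partial>lborel)"
     using bump_mult_integrable[OF s(1) \<phi>(1), of z] bump_mult_integrable[OF s(1) continuous_on_const, of z "\<phi> z"]
     by (subst Bochner_Integration.integral_diff[symmetric]) (auto simp: algebra_simps)
    finally have cz: "c z - \<eta> z = \<dots>" .
    show ?thesis unfolding cz
    proof (rule bump_average_bound[OF s(1)])
     show "continuous_on UNIV (\<lambda>x. \<phi> x - \<phi> z)" using \<phi>(1) by (intro continuous_intros)
     show "\<bar>\<phi> x - \<phi> z\<bar> \<le> E" if "norm (x - z) \<le> s" for x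
      using d(2)[rule_format, of z x] that s d(1) by (auto simp: dist_norm \<delta>_def)
    qed
   next
    case False
    have cz: "c z - \<eta> z = (\<integral>x. bump z s x * (mon is (x - z) * \<phi> x) \<partial>lborel)"
     using False by (simp add: c_def \<kappa>_def \<eta>_def bsh[symmetric] bump_commute[of z] mult_ac)
    show ?thesis unfolding cz
    proof (rule bump_average_bound[OF s(1)])
     have "smooth (\<lambda>x. mon is (x - z))"
     proof -
      have "(\<lambda>x. mon is (x - z)) = (\<lambda>x. (\<lambda>y. mon is (- y)) (z - x))" by simp
      moreover have "smooth (\<lambda>y. mon is (- y))" using partial_deriv_reflect(2)[OF smooth_mon, of "is" 0] by simp
      ultimately show ?thesis using partial_deriv_reflect(2)[of "\<lambda>y. mon is (- y)" z] by simp
     qed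
     then show "continuous_on UNIV (\<lambda>x. mon is (x - z) * \<phi> x)" using \<phi>(1) by (rule continuous_on_mult[OF smooth_continuous])
     fix x assume x: "norm (x - z) \<le> s"
     have s1: "s \<le> 1" "s * (B + 1) \<le> E" using s B(1) by (auto simp: \<delta>_def min_less_iff_conj pos_less_divide_eq)
     have "\<bar>mon is (x - z)\<bar> \<le> norm (x - z) ^ length is" by (rule abs_mon_le)
     also have "\<dots> \<le> norm (x - z) ^ 1" using False x s1 by (intro power_decreasing) (auto simp: Suc_le_eq)
     finally have "\<bar>mon is (x - z)\<bar> \<le> s" using x by simp
     then have "\<bar>mon is (x - z)\<bar> * \<bar>\<phi> x\<bar> \<le> s * (B + 1)" using B s(1) by (intro mult_mono) (auto intro: order_trans[OF B(2)])
     then show "\<bar>mon is (x - z) * \<phi> x\<bar> \<le> E" using s1 by (simp add: abs_mult)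
    qed
   qed
   have \<eta>b: "\<bar>\<eta> z\<bar> \<le> B" for z using B by (simp add: \<eta>_def)
   have cb: "\<bar>c z\<bar> \<le> B + E" for z using ce[of z] \<eta>b[of z] by linarith
   have ic: "integrable lebesgue (\<lambda>z. g z * c z)" by (rule integrable_mult_bounded[OF g cm cb])
   have i\<eta>: "integrable lebesgue (\<lambda>z. g z * \<eta> z)" by (rule integrable_mult_bounded[OF g continuous_measurable_lebesgue[OF \<eta>c] \<eta>b])
   have "(\<integral>x. (\<integral>z. g z * (mon is (x - z) * bump x s z) \<partial>lebesgue) * \<phi> x \<partial>lebesgue) = (\<integral>z. g z * c z \<partial>lebesgue)"
    unfolding eq c_def by (rule convolution_pairing(1)[OF g \<kappa>c Bk \<phi>])
   moreover have "(if is = [] then \<integral>x. g x * \<phi> x \<partial>lebesgue else 0) = (\<integral>z. g z * \<eta> z \<partial>lebesgue)"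
    by (simp add: \<eta>_def)
   moreover have "(\<integral>z. g z * c z \<partial>lebesgue) - (\<integral>z. g z * \<eta> z \<partial>lebesgue) = (\<integral>z. g z * c z - g z * \<eta> z \<partial>lebesgue)"
    using ic i\<eta> by simp
   moreover have "\<bar>\<integral>z. g z * c z - g z * \<eta> z \<partial>lebesgue\<bar> \<le> (\<integral>z. \<bar>g z\<bar> * E \<partial>lebesgue)"
   proof (rule integral_abs_bound_integral)
    show "integrable lebesgue (\<lambda>z. g z * c z - g z * \<eta> z)" using ic i\<eta> by simp
    show "integrable lebesgue (\<lambda>z. \<bar>g z\<bar> * E)" using g by simp
    show "\<bar>g z * c z - g z * \<eta> z\<bar> \<le> \<bar>g z\<bar> * E" for z
     unfolding right_diff_distrib[symmetric] abs_mult by (intro mult_left_mono ce) auto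
   qed
   moreover have "(\<integral>z. \<bar>g z\<bar> * E \<partial>lebesgue) = G * E" by (simp add: G_def)
   moreover have "G * E < \<epsilon>"
   proof -
    have "G * E \<le> (G + 1) * E" using E by simp
    also have "\<dots> = \<epsilon> / 2" using G0 unfolding E_def by (simp add: field_simps)
    finally show ?thesis using \<epsilon> by simp
   qed
   ultimately show ?thesis unfolding dist_real_def by linarith
  qed
  show "\<forall>\<^sub>F s in at_right 0. dist (\<integral>x. (\<integral>z. g z * (mon is (x - z) * bump x s z) \<partial>lebesgue) * \<phi> x \<partial>lebesgue)
    (if is = [] then \<integral>x. g x * \<phi> x \<partial>lebesgue else 0) < \<epsilon>"
   unfolding eventually_at_right_field using \<delta> main by blast
qed

text \<open>Only the term of order 0 survives. Convergence holds here in the weak sense; pointwise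
  convergence comes later from the estimates along chains.\<close>

lemma taylor_avg_weak_limit:
  fixes \<phi> :: "real^'n::finite \<Rightarrow> real"
  assumes N: "N > 0" and g: "\<And>is. length is < N \<Longrightarrow> integrable lebesgue (w is)"
   and \<phi>: "continuous_on UNIV \<phi>" "compact K" "vanishes_off K \<phi>"
  shows "((\<lambda>s. \<integral>x. taylor_avg N w x (bump x s) * \<phi> x \<partial>lebesgue) \<longlongrightarrow> (\<integral>x. w [] x * \<phi> x \<partial>lebesgue)) (at_right 0)"
   and "s > 0 \<Longrightarrow> integrable lebesgue (\<lambda>x. taylor_avg N w x (bump x s) * \<phi> x)"
proof -
  define T where "T is s x = (\<integral>z. w is z * (mon is (x - z) * bump x s z) \<partial>lebesgue) * \<phi> x" for "is" s x
  let ?S = "\<lambda>k s. \<Sum>is | length is = k. \<integral>x. T is s x \<partial>lebesgue"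
  have Ti: "integrable lebesgue (T is s)" if s: "s > 0" and l: "length is < N" for "is" s
  proof -
   have bsh: "bump x s z = bump 0 s (x - z)" for x z :: "real^'n" by (simp add: bump_def norm_minus_commute)
   have \<kappa>c: "continuous_on UNIV (\<lambda>y. mon is y * bump 0 s y)" by (intro continuous_on_mult smooth_continuous smooth_mon smooth_bump)
   obtain Bk where Bk: "\<And>y. \<bar>mon is y * bump 0 s y\<bar> \<le> Bk"
    using vanishes_off_bounded[OF \<kappa>c compact_cball vanishes_off_mult[OF vanishes_off_bump[OF s]]] by blast
   have "T is s = (\<lambda>x. (\<integral>z. w is z * (mon is (x - z) * bump 0 s (x - z)) \<partial>lebesgue) * \<phi> x)"
   proof
    fix x show "T is s x = (\<integral>z. w is z * (mon is (x - z) * bump 0 s (x - z)) \<partial>lebesgue) * \<phi> x"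
     by (simp only: T_def bsh[of x])
   qed
   then show ?thesis using convolution_pairing(2)[OF g[OF l] \<kappa>c Bk \<phi>] by simp
  qed
  have eq: "taylor_avg N w x (bump x s) * \<phi> x = (\<Sum>k<N. (\<Sum>is | length is = k. T is s x) / fact k)" for x s
   unfolding taylor_avg_def T_def by (simp add: sum_distrib_right)
  show "integrable lebesgue (\<lambda>x. taylor_avg N w x (bump x s) * \<phi> x)" if s: "s > 0" for s
   unfolding eq by (intro Bochner_Integration.integrable_sum integrable_divide_zero Ti s) auto
  have int: "(\<integral>x. taylor_avg N w x (bump x s) * \<phi> x \<partial>lebesgue) = (\<Sum>k<N. ?S k s / fact k)" if s: "s > 0" for s
  proof -
   have "(\<integral>x. taylor_avg N w x (bump x s) * \<phi> x \<partial>lebesgue) = (\<Sum>k<N. \<integral>x. (\<Sum>is | length is = k. T is s x) / fact k \<partial>lebesgue)"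
    unfolding eq by (intro Bochner_Integration.integral_sum Bochner_Integration.integrable_sum integrable_divide_zero Ti s) auto
   also have "\<dots> = (\<Sum>k<N. ?S k s / fact k)"
   proof (intro sum.cong refl)
    fix k assume k: "k \<in> {..<N}"
    have "(\<integral>x. (\<Sum>is | length is = k. T is s x) \<partial>lebesgue) = ?S k s"
     using k by (intro Bochner_Integration.integral_sum Ti s) auto
    then show "(\<integral>x. (\<Sum>is | length is = k. T is s x) / fact k \<partial>lebesgue) = ?S k s / fact k" by simp
   qed
   finally show ?thesis .
  qed
  have L: "((\<lambda>s. \<integral>x. T is s x \<partial>lebesgue) \<longlongrightarrow> (if is = [] then \<integral>x. w [] x * \<phi> x \<partial>lebesgue else 0)) (at_right 0)"
   if "length is < N" for "is" using mollified_pairing_tendsto[OF g[OF that] \<phi>, of "is"] unfolding T_def by (cases "is = []") auto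
  have "((\<lambda>s. \<Sum>k<N. ?S k s / fact k) \<longlongrightarrow>
    (\<Sum>k<N. (\<Sum>is :: 'n list | length is = k. if is = [] then \<integral>x. w [] x * \<phi> x \<partial>lebesgue else 0) / fact k)) (at_right 0)"
  proof (rule tendsto_sum, rule tendsto_divide[OF _ tendsto_const])
   show "((\<lambda>s. \<Sum>is | length is = k. \<integral>x. T is s x \<partial>lebesgue) \<longlongrightarrow>
    (\<Sum>is :: 'n list | length is = k. if is = [] then \<integral>x. w [] x * \<phi> x \<partial>lebesgue else 0)) (at_right 0)" if "k \<in> {..<N}" for k
    by (rule tendsto_sum, rule L) (use that in auto)
  qed simp
  moreover have "(\<Sum>k<N. (\<Sum>is :: 'n list | length is = k. if is = [] then \<integral>x. w [] x * \<phi> x \<partial>lebesgue else 0) / fact k) = (\<integral>x. w [] x * \<phi> x \<partial>lebesgue)"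
  proof -
   have "(\<Sum>is :: 'n list | length is = k. if is = [] then a else 0) / fact k = (if k = 0 then a else 0)" for k and a :: real
   proof (cases "k = 0")
    case True then show ?thesis using sum_lists_0[of "\<lambda>is::'n list. if is = [] then a else 0"] by simp
   next
    case False
    then have "(\<Sum>is :: 'n list | length is = k. if is = [] then a else 0) = 0" by (intro sum.neutral) auto
    then show ?thesis using False by simp
   qed
   then show ?thesis using N by simp
  qed
  ultimately have "((\<lambda>s. \<Sum>k<N. ?S k s / fact k) \<longlongrightarrow> (\<integral>x. w [] x * \<phi> x \<partial>lebesgue)) (at_right 0)"
   by simp
  then show "((\<lambda>s. \<integral>x. taylor_avg N w x (bump x s) * \<phi> x \<partial>lebesgue) \<longlongrightarrow> (\<integral>x. w [] x * \<phi> x \<partial>lebesgue)) (at_right 0)"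
   by (rule Lim_transform_eventually) (use int in \<open>auto simp: eventually_at_filter intro!: always_eventually\<close>)
qed

section \<open>Chains of balls in Jones domains\<close>

text \<open>A ball is connected: if it met both S and its complement, it would contain a frontier
  point closer to z than the distance to the frontier.\<close>

lemma ball_infdist_frontier_subset:
  fixes z :: "'a::real_normed_vector"
  assumes "z \<in> S" "frontier S \<noteq> {}"
  shows "ball z (infdist z (frontier S)) \<subseteq> S"
proof (rule ccontr)
  assume *: "\<not> ball z (infdist z (frontier S)) \<subseteq> S"
  then have ne: "0 < infdist z (frontier S)" by (metis ball_eq_empty empty_subsetI not_le)
  have "ball z (infdist z (frontier S)) \<inter> frontier S \<noteq> {}"
  proof (rule connected_Int_frontier)
   show "ball z (infdist z (frontier S)) \<inter> S \<noteq> {}" using ne assms(1) by (metis centre_in_ball disjoint_iff)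
   show "ball z (infdist z (frontier S)) - S \<noteq> {}" using * by blast
  qed simp
  then obtain y where "y \<in> frontier S" "dist z y < infdist z (frontier S)" by auto
  then show False using infdist_le[of y "frontier S" z] by simp
qed

lemma infdist_le_infdist_plus: "infdist x A \<le> infdist y A + dist x y"
  by (rule infdist_triangle)

lemma path_length_dist_le:
  assumes "t \<in> {0..1}"
  shows "ennreal (dist (\<gamma> 0) (\<gamma> t)) \<le> path_length \<gamma>"
  unfolding path_length_def by (rule SUP_upper2[of "[0, t]"]) (use assms in auto)

lemma sum_dist_le_path_length:
  assumes "K > (0::nat)"
  shows "ennreal (\<Sum>i<K. dist (\<gamma> (real i / K)) (\<gamma> (real (Suc i) / K))) \<le> path_length \<gamma>"
proof -
  let ?ts = "map (\<lambda>k. real k / K) [0..<Suc K]"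
  have "(\<Sum>i<K. ennreal (dist (\<gamma> (real i / K)) (\<gamma> (real (Suc i) / K))))
    = (\<Sum>i<length ?ts - 1. ennreal (dist (\<gamma> (?ts ! i)) (\<gamma> (?ts ! Suc i))))"
   by (intro sum.cong) (auto simp del: upt_Suc simp: nth_map)
  also have "\<dots> \<le> path_length \<gamma>" unfolding path_length_def
  proof (rule SUP_upper)
   have "sorted ?ts" by (auto simp: sorted_iff_nth_mono divide_right_mono simp del: upt_Suc)
   moreover have "set ?ts \<subseteq> {0..1}" using assms by (auto simp: divide_simps)
   ultimately show "?ts \<in> {ts. sorted ts \<and> set ts \<subseteq> {0..1}}" by simp
  qed
  finally show ?thesis by (simp add: sum_ennreal)
qed

text \<open>\<open>s0 \<le> 1 / 4\<close> ensures that two points at distance at most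
  \<open>2 * s\<close> from a common centre, with \<open>s \<le> s0\<close>, are at mutual distance
  at most 1, where \<open>arcs\<close> applies. \<open>inner_points\<close> supplies centres of
  balls at every scale, also near the frontier.\<close>

locale jones =
  fixes \<Omega> :: "(real^'n::finite) set" and \<epsilon> s0 :: real
  assumes jones_open: "open \<Omega>" and jones_frontier: "frontier \<Omega> \<noteq> {}"
   and \<epsilon>: "0 < \<epsilon>" "\<epsilon> < 1" and s0: "0 < s0" "s0 \<le> 1 / 4"
   and arcs: "x \<in> \<Omega> \<Longrightarrow> y \<in> \<Omega> \<Longrightarrow> x \<noteq> y \<Longrightarrow> dist x y \<le> 1 \<Longrightarrow>
    \<exists>\<gamma>. path \<gamma> \<and> path_image \<gamma> \<subseteq> \<Omega> \<and> pathstart \<gamma> = x \<and> pathfinish \<gamma> = y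
      \<and> path_length \<gamma> \<le> ennreal (dist x y / \<epsilon>)
      \<and> (\<forall>z\<in>path_image \<gamma>. \<epsilon> * (dist x z * dist y z / dist x y) \<le> infdist z (frontier \<Omega>))"
   and inner_points: "x \<in> \<Omega> \<Longrightarrow> 0 < s \<Longrightarrow> s \<le> s0 \<Longrightarrow>
    \<exists>p\<in>\<Omega>. dist x p \<le> s \<and> \<epsilon> / 4 * s \<le> infdist p (frontier \<Omega>)"

text \<open>A quarter of \<open>\<epsilon> * (\<epsilon> / 8) / 4\<close>, which in units of s is
  the distance from the frontier kept along an arc whose endpoints are at least
  \<open>\<epsilon> / 8 * s\<close> away from it.\<close>

definition ball_ratio :: "real \<Rightarrow> real" where "ball_ratio \<epsilon> = \<epsilon>\<^sup>2 / 128"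
text \<open>In units of s: 2 to get to the start of an arc, \<open>4 / \<epsilon>\<close> along the
  arc, and 1 for the balls around its points.\<close>

definition reach :: "real \<Rightarrow> real" where "reach \<epsilon> = 3 + 4 / \<epsilon>"

locale jones_family = sobolev_family \<Omega> N w + jones \<Omega> \<epsilon> s0
  for \<Omega> :: "(real^'n::finite) set" and N w \<epsilon> s0
begin

abbreviation "\<rho> \<equiv> ball_ratio \<epsilon>"

text \<open>The evaluation point \<open>x'\<close> is kept apart from the centre x of the region,
  since the mean value theorem in the evaluation point produces intermediate points that differ from
  the centre.\<close>

definition weight_int :: "real^'n \<Rightarrow> real^'n \<Rightarrow> real \<Rightarrow> real"
  where "weight_int x' x s = (\<integral>z. norm (x' - z) ^ (N - 1) * grad_sum N w z * indicator (\<Omega> \<inter> cball x (reach \<epsilon> * s)) z \<partial>lebesgue)"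

lemma ball_ratio: "0 < \<rho>" "\<rho> < 1 / 128" "\<rho> = \<epsilon> * (\<epsilon> / 8) / 16"
proof -
  have "\<epsilon>\<^sup>2 < 1" using \<epsilon> by (simp add: power_less_one_iff abs_square_less_1)
  then show "\<rho> < 1 / 128" by (simp add: ball_ratio_def)
qed (use \<epsilon> in \<open>auto simp: ball_ratio_def power2_eq_square\<close>)

lemma reach_pos: "3 \<le> reach \<epsilon>" using \<epsilon> by (simp add: reach_def)

lemma region_sets: "\<Omega> \<inter> cball x r \<in> sets lebesgue"
  using domain_lebesgue by (intro sets.Int) auto

lemma weight_int_nonneg: "0 \<le> weight_int x' x s"
  unfolding weight_int_def by (intro Bochner_Integration.integral_nonneg) (simp add: grad_sum_nonneg)

text \<open>The arc from p to q keeps a distance of at least \<open>4 * r\<close> from the frontier.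
  It is replaced by chords shorter than r; balls sliding along the chords remain in \<Omega>, and
  the chords add up to at most the length of the arc.\<close>

lemma link:
  assumes N: "N > 0" and pq: "p \<in> \<Omega>" "q \<in> \<Omega>" and s: "0 < s" "s \<le> s0"
   and d: "dist x p \<le> 2 * s" "dist x q \<le> 2 * s"
   and b: "\<epsilon> / 8 * s \<le> infdist p (frontier \<Omega>)" "\<epsilon> / 8 * s \<le> infdist q (frontier \<Omega>)"
  shows "\<bar>taylor_avg N w x' (bump p (\<rho> * s)) - taylor_avg N w x' (bump q (\<rho> * s))\<bar>
   \<le> (4 / \<epsilon> * s) / (bump_mass TYPE('n) * (\<rho> * s) ^ CARD('n)) * weight_int x' x s"
proof (cases "p = q")
  case True
  have "0 < bump_mass TYPE('n) * (\<rho> * s) ^ CARD('n)"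
   using s ball_ratio(1) bump_mass_pos[where 'n='n] by (intro mult_pos_pos zero_less_power) auto
  then have "0 \<le> (4 / \<epsilon> * s) / (bump_mass TYPE('n) * (\<rho> * s) ^ CARD('n)) * weight_int x' x s"
   using s \<epsilon> by (intro mult_nonneg_nonneg[OF divide_nonneg_pos weight_int_nonneg]) auto
  then show ?thesis using True by simp
next
  case False
  define r where "r = \<rho> * s"
  have r: "0 < r" using s ball_ratio by (simp add: r_def)
  have dpq: "dist p q \<le> 4 * s" using d dist_triangle3[of p q x] by linarith
  then have "dist p q \<le> 1" using s s0 by linarith
  from arcs[OF pq False this] obtain \<gamma> where \<gamma>: "path \<gamma>" "path_image \<gamma> \<subseteq> \<Omega>" "pathstart \<gamma> = p" "pathfinish \<gamma> = q"
   "path_length \<gamma> \<le> ennreal (dist p q / \<epsilon>)"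
   and \<gamma>d: "\<And>z. z \<in> path_image \<gamma> \<Longrightarrow> \<epsilon> * (dist p z * dist q z / dist p q) \<le> infdist z (frontier \<Omega>)" by blast
  have dpq0: "0 < dist p q" using False by simp
  \<comment> \<open>Close to an endpoint the distance from the frontier is inherited from that
    endpoint. Elsewhere the Jones condition applies, and one of the two distances to the endpoints
    is at least half of \<open>dist p q\<close>.\<close>
  have far: "4 * r \<le> infdist z (frontier \<Omega>)" if z: "z \<in> path_image \<gamma>" for z
  proof -
   have k: "4 * r = \<epsilon> * (\<epsilon> / 8 * s) / 4" "\<epsilon> * (\<epsilon> / 8 * s) / 4 \<le> \<epsilon> / 8 * s / 2"
    using \<epsilon> s by (auto simp: r_def ball_ratio(3) mult_le_cancel_right1)
   have tr: "dist p q \<le> dist p z + dist q z" by (metis dist_commute dist_triangle)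
   consider "dist p z \<le> \<epsilon> / 8 * s / 2" | "dist q z \<le> \<epsilon> / 8 * s / 2" | "\<epsilon> / 8 * s / 2 \<le> dist p z" "\<epsilon> / 8 * s / 2 \<le> dist q z"
    by linarith
   then show ?thesis
   proof cases
    case 1 then show ?thesis using infdist_le_infdist_plus[of p "frontier \<Omega>" z] b k by linarith
   next
    case 2 then show ?thesis using infdist_le_infdist_plus[of q "frontier \<Omega>" z] b k by linarith
   next
    case 3
    have "(\<epsilon> / 8 * s / 2) * (dist p q / 2) \<le> dist p z * dist q z"
    proof (cases "dist p q / 2 \<le> dist q z")
     case True show ?thesis using 3(1) True dpq0 by (intro mult_mono) auto
    next
     case False
     then have "dist p q / 2 \<le> dist p z" using tr by linarith
     then have "(dist p q / 2) * (\<epsilon> / 8 * s / 2) \<le> dist p z * dist q z" using 3 s \<epsilon> by (intro mult_mono) auto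
     then show ?thesis by (simp add: mult_ac)
    qed
    then have "\<epsilon> / 8 * s / 4 \<le> dist p z * dist q z / dist p q" using dpq0 by (simp add: field_simps)
    then have "\<epsilon> * (\<epsilon> / 8 * s / 4) \<le> \<epsilon> * (dist p z * dist q z / dist p q)" using \<epsilon> by (intro mult_left_mono) auto
    moreover have "\<epsilon> * (\<epsilon> / 8 * s / 4) = \<epsilon> * (\<epsilon> / 8 * s) / 4" by simp
    ultimately show ?thesis using \<gamma>d[OF z] k(1) by linarith
   qed
  qed
  have near: "dist p z \<le> 4 / \<epsilon> * s" if z: "z \<in> path_image \<gamma>" for z
  proof -
   obtain t where t: "t \<in> {0..1}" "z = \<gamma> t" using z by (auto simp: path_image_def)
   have "ennreal (dist p z) \<le> ennreal (dist p q / \<epsilon>)"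
    using path_length_dist_le[OF t(1), of \<gamma>] \<gamma>(3,5) t(2) by (auto simp: pathstart_def intro: order_trans)
   then have "dist p z \<le> dist p q / \<epsilon>" using \<epsilon> by (subst (asm) ennreal_le_iff) auto
   also have "\<dots> \<le> 4 * s / \<epsilon>" using dpq \<epsilon> by (intro divide_right_mono) auto
   finally show ?thesis by simp
  qed
  have "uniformly_continuous_on {0..1} \<gamma>" using \<gamma>(1) by (simp add: path_def compact_uniformly_continuous)
  from this[unfolded uniformly_continuous_on_def, rule_format, OF r]
  obtain \<delta> where \<delta>: "\<delta> > 0" "\<And>t t'. t \<in> {0..1} \<Longrightarrow> t' \<in> {0..1} \<Longrightarrow> dist t' t < \<delta> \<Longrightarrow> dist (\<gamma> t') (\<gamma> t) < r" by blast
  obtain K :: nat where K: "K > 0" "1 / K < \<delta>" using \<delta>(1) by (metis reals_Archimedean inverse_eq_divide zero_less_Suc)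
  define g where "g i = \<gamma> (real i / K)" for i
  have gi: "g i \<in> path_image \<gamma>" if "i \<le> K" for i using that K(1) by (auto simp: g_def path_image_def divide_simps)
  have step: "dist (g i) (g (Suc i)) < r" if i: "i < K" for i
   unfolding g_def using i K by (intro \<delta>(2)) (auto simp: divide_simps dist_real_def)
  define I where "I = weight_int x' x s"
  define Z where "Z = bump_mass TYPE('n) * r ^ CARD('n)"
  have Z: "Z > 0" using r bump_mass_pos[where 'n='n] by (simp add: Z_def)
  have move: "\<bar>taylor_avg N w x' (bump (g (Suc i)) r) - taylor_avg N w x' (bump (g i) r)\<bar> \<le> dist (g i) (g (Suc i)) / Z * I" if i: "i < K" for i
  proof -
   have "\<bar>taylor_avg N w x' (bump (g (Suc i)) r) - taylor_avg N w x' (bump (g i) r)\<bar>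
    \<le> (norm (g (Suc i) - g i) + \<bar>r - r\<bar>) / (bump_mass TYPE('n) * r ^ CARD('n))
     * (\<integral>z. norm (x' - z) ^ (N - 1) * grad_sum N w z * indicator (\<Omega> \<inter> cball x (reach \<epsilon> * s)) z \<partial>lebesgue)"
   proof (rule taylor_avg_move[OF N region_sets _ r])
    fix t :: real assume t: "t \<in> {0..1}"
    have gim: "g i \<in> path_image \<gamma>" using gi i by simp
    show "cball (g i + t *\<^sub>R (g (Suc i) - g i)) (r + t * (r - r)) \<subseteq> \<Omega> \<inter> cball x (reach \<epsilon> * s)"
    proof
     fix z assume "z \<in> cball (g i + t *\<^sub>R (g (Suc i) - g i)) (r + t * (r - r))"
     then have 1: "dist (g i + t *\<^sub>R (g (Suc i) - g i)) z \<le> r" by simp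
     have "norm (t *\<^sub>R (g (Suc i) - g i)) \<le> 1 * norm (g (Suc i) - g i)" using t unfolding norm_scaleR by (intro mult_right_mono) auto
     then have 2: "dist (g i) (g i + t *\<^sub>R (g (Suc i) - g i)) \<le> r" using step[OF i] by (simp add: dist_norm norm_minus_commute)
     have 3: "dist (g i) z \<le> 2 * r" using 1 2 dist_triangle[of "g i" z "g i + t *\<^sub>R (g (Suc i) - g i)"] by linarith
     then have "z \<in> ball (g i) (infdist (g i) (frontier \<Omega>))" using far[OF gim] r by simp
     then have "z \<in> \<Omega>" using ball_infdist_frontier_subset[OF _ jones_frontier, of "g i"] gim \<gamma>(2) by blast
     moreover have "dist x z \<le> reach \<epsilon> * s"
     proof -
      have "dist x z \<le> dist x p + dist p (g i) + dist (g i) z" using dist_triangle[of x z p] dist_triangle[of p z "g i"] by linarith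
      also have "\<dots> \<le> 2 * s + 4 / \<epsilon> * s + 2 * r" using d near[OF gim] 3 by linarith
      also have "2 * r \<le> s" using ball_ratio s by (simp add: r_def)
      finally show ?thesis by (simp add: reach_def algebra_simps)
     qed
     ultimately show "z \<in> \<Omega> \<inter> cball x (reach \<epsilon> * s)" by simp
    qed
   qed auto
   then show ?thesis by (simp add: I_def weight_int_def Z_def dist_norm norm_minus_commute)
  qed
  have "\<bar>taylor_avg N w x' (bump (g K) r) - taylor_avg N w x' (bump (g 0) r)\<bar>
    = \<bar>\<Sum>i<K. taylor_avg N w x' (bump (g (Suc i)) r) - taylor_avg N w x' (bump (g i) r)\<bar>"
   using sum_lessThan_telescope[of "\<lambda>i. taylor_avg N w x' (bump (g i) r)" K] by simp
  also have "\<dots> \<le> (\<Sum>i<K. dist (g i) (g (Suc i)) / Z * I)" by (intro order_trans[OF sum_abs] sum_mono move) auto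
  also have "\<dots> = (\<Sum>i<K. dist (g i) (g (Suc i))) / Z * I" by (simp add: sum_distrib_right sum_divide_distrib)
  also have "\<dots> \<le> (4 / \<epsilon> * s) / Z * I"
  proof (intro mult_right_mono divide_right_mono)
   have "ennreal (\<Sum>i<K. dist (g i) (g (Suc i))) \<le> ennreal (dist p q / \<epsilon>)"
    using sum_dist_le_path_length[OF K(1), of \<gamma>] \<gamma>(5) unfolding g_def by (rule order_trans)
   then have "(\<Sum>i<K. dist (g i) (g (Suc i))) \<le> dist p q / \<epsilon>" using \<epsilon> by (subst (asm) ennreal_le_iff) auto
   also have "\<dots> \<le> 4 * s / \<epsilon>" using dpq \<epsilon> by (intro divide_right_mono) auto
   finally show "(\<Sum>i<K. dist (g i) (g (Suc i))) \<le> 4 / \<epsilon> * s" by simp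
  qed (use Z weight_int_nonneg in \<open>auto simp: I_def\<close>)
  finally show ?thesis using \<gamma>(3,4) K(1) by (simp add: g_def pathstart_def pathfinish_def Z_def r_def I_def abs_minus_commute)
qed

text \<open>Serves \<open>link_same\<close> and \<open>link_half\<close> alike:
  \<open>4 / \<epsilon>\<close> for the length of the arc, 1 for halving the radius, and the power
  of 2 for the smaller ball in the denominator.\<close>

definition step_const :: real
  where "step_const = (4 / \<epsilon> + 1) * 2 ^ CARD('n) / (bump_mass TYPE('n) * \<rho> ^ CARD('n))"

lemma step_const_nonneg: "0 \<le> step_const"
  using \<epsilon> ball_ratio(1) bump_mass_pos[where 'n='n] by (simp add: step_const_def)

lemma link_same:
  assumes N: "N > 0" and pq: "p \<in> \<Omega>" "q \<in> \<Omega>" and s: "0 < s" "s \<le> s0"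
   and d: "dist x p \<le> 2 * s" "dist x q \<le> 2 * s"
   and b: "\<epsilon> / 8 * s \<le> infdist p (frontier \<Omega>)" "\<epsilon> / 8 * s \<le> infdist q (frontier \<Omega>)"
  shows "\<bar>taylor_avg N w x' (bump p (\<rho> * s)) - taylor_avg N w x' (bump q (\<rho> * s))\<bar>
   \<le> step_const * (s / s ^ CARD('n)) * weight_int x' x s"
proof (rule order_trans[OF link[OF assms]], rule mult_right_mono[OF _ weight_int_nonneg])
  let ?Z = "bump_mass TYPE('n) * \<rho> ^ CARD('n)"
  have Z: "0 < ?Z" using ball_ratio(1) bump_mass_pos[where 'n='n] by simp
  have "4 / \<epsilon> * 1 \<le> (4 / \<epsilon> + 1) * 2 ^ CARD('n)" using \<epsilon> by (intro mult_mono) auto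
  from divide_right_mono[OF this less_imp_le[OF Z]] have "4 / \<epsilon> / ?Z \<le> step_const" by (simp only: step_const_def mult_1_right)
  then have "4 / \<epsilon> / ?Z * (s / s ^ CARD('n)) \<le> step_const * (s / s ^ CARD('n))" using s by (intro mult_right_mono) auto
  then show "4 / \<epsilon> * s / (bump_mass TYPE('n) * (\<rho> * s) ^ CARD('n)) \<le> step_const * (s / s ^ CARD('n))"
   by (simp add: power_mult_distrib mult_ac)
qed

text \<open>A link at equal radii is combined with halving the radius of the ball around q, which is
  a move with fixed centre.\<close>

lemma link_half:
  assumes N: "N > 0" and pq: "p \<in> \<Omega>" "q \<in> \<Omega>" and s: "0 < s" "s \<le> s0"
   and d: "dist x p \<le> 2 * s" "dist x q \<le> 2 * s"
   and b: "\<epsilon> / 8 * s \<le> infdist p (frontier \<Omega>)" "\<epsilon> / 8 * s \<le> infdist q (frontier \<Omega>)"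
  shows "\<bar>taylor_avg N w x' (bump p (\<rho> * s)) - taylor_avg N w x' (bump q (\<rho> * (s / 2)))\<bar>
   \<le> step_const * (s / s ^ CARD('n)) * weight_int x' x s"
proof -
  let ?n = "CARD('n)"
  let ?Z = "bump_mass TYPE('n) * \<rho> ^ ?n"
  have Z: "0 < ?Z" using ball_ratio(1) bump_mass_pos[where 'n='n] by simp
  let ?r = "\<rho> * s"
  have r: "0 < ?r" using s ball_ratio by simp
  have "\<bar>taylor_avg N w x' (bump q (?r / 2)) - taylor_avg N w x' (bump q ?r)\<bar>
    \<le> (norm (q - q) + \<bar>?r / 2 - ?r\<bar>) / (bump_mass TYPE('n) * (?r / 2) ^ ?n)
     * (\<integral>z. norm (x' - z) ^ (N - 1) * grad_sum N w z * indicator (\<Omega> \<inter> cball x (reach \<epsilon> * s)) z \<partial>lebesgue)"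
  proof (rule taylor_avg_move[OF N region_sets])
   fix t :: real assume t: "t \<in> {0..1}"
   show "cball (q + t *\<^sub>R (q - q)) (?r + t * (?r / 2 - ?r)) \<subseteq> \<Omega> \<inter> cball x (reach \<epsilon> * s)"
   proof
    fix z assume "z \<in> cball (q + t *\<^sub>R (q - q)) (?r + t * (?r / 2 - ?r))"
    moreover have "t * (?r / 2 - ?r) \<le> 0" by (rule mult_nonneg_nonpos) (use t r in \<open>auto simp: mult.commute\<close>)
    ultimately have 1: "dist q z \<le> ?r" by simp
    have "?r < \<epsilon> / 8 * s" using \<epsilon> s by (simp add: ball_ratio(3))
    then have "z \<in> ball q (infdist q (frontier \<Omega>))" using 1 b by simp
    then have "z \<in> \<Omega>" using ball_infdist_frontier_subset[OF pq(2) jones_frontier] by blast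
    moreover have "dist x z \<le> reach \<epsilon> * s"
    proof -
     have "dist x z \<le> 2 * s + ?r" using 1 d dist_triangle[of x z q] by linarith
     also have "\<dots> \<le> 3 * s" using ball_ratio s by simp
     also have "\<dots> \<le> reach \<epsilon> * s" using reach_pos s by simp
     finally show ?thesis .
    qed
    ultimately show "z \<in> \<Omega> \<inter> cball x (reach \<epsilon> * s)" by simp
   qed
  qed (use r in \<open>auto simp: mult.commute\<close>)
  also have "\<dots> = (?r / 2) / (bump_mass TYPE('n) * (?r / 2) ^ ?n) * weight_int x' x s"
  proof -
   have "\<bar>?r / 2 - ?r\<bar> = ?r / 2" using r by linarith
   then show ?thesis by (simp only: weight_int_def diff_self norm_zero add_0)
  qed
  finally have A: "\<bar>taylor_avg N w x' (bump q (?r / 2)) - taylor_avg N w x' (bump q ?r)\<bar> \<le> \<dots>" .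
  have B: "(?r / 2) / (bump_mass TYPE('n) * (?r / 2) ^ ?n) \<le> 1 * 2 ^ ?n / ?Z * (s / s ^ ?n)"
  proof -
   have "(?r / 2) / (bump_mass TYPE('n) * (?r / 2) ^ ?n) = (\<rho> / 2) * (2 ^ ?n / ?Z * (s / s ^ ?n))"
    by (simp add: power_mult_distrib power_divide mult_ac)
   also have "\<dots> \<le> 1 * (2 ^ ?n / ?Z * (s / s ^ ?n))"
    using ball_ratio Z s by (intro mult_right_mono mult_nonneg_nonneg[OF divide_nonneg_pos divide_nonneg_nonneg]) auto
   finally show ?thesis by simp
  qed
  have C: "4 / \<epsilon> * s / (bump_mass TYPE('n) * ?r ^ ?n) \<le> 4 / \<epsilon> * 2 ^ ?n / ?Z * (s / s ^ ?n)"
  proof -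
   have "4 / \<epsilon> * 1 \<le> 4 / \<epsilon> * 2 ^ ?n" using \<epsilon> by (intro mult_left_mono) auto
   then have "4 / \<epsilon> / ?Z * (s / s ^ ?n) \<le> 4 / \<epsilon> * 2 ^ ?n / ?Z * (s / s ^ ?n)" using Z s by (intro mult_right_mono divide_right_mono) auto
   then show ?thesis by (simp add: power_mult_distrib mult_ac)
  qed
  have "\<bar>taylor_avg N w x' (bump p ?r) - taylor_avg N w x' (bump q (?r / 2))\<bar>
   \<le> \<bar>taylor_avg N w x' (bump p ?r) - taylor_avg N w x' (bump q ?r)\<bar> + \<bar>taylor_avg N w x' (bump q (?r / 2)) - taylor_avg N w x' (bump q ?r)\<bar>"
   by linarith
  also have "\<dots> \<le> (4 / \<epsilon> * 2 ^ ?n / ?Z * (s / s ^ ?n)) * weight_int x' x s + (1 * 2 ^ ?n / ?Z * (s / s ^ ?n)) * weight_int x' x s"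
   by (intro add_mono order_trans[OF link[OF assms]] order_trans[OF A] mult_right_mono B C weight_int_nonneg)
  also have "\<dots> = step_const * (s / s ^ ?n) * weight_int x' x s" by (simp add: step_const_def add_divide_distrib algebra_simps)
  finally show ?thesis by simp
qed

end

lemma (in sobolev_family) taylor_avg_bound:
  assumes s: "s > 0" and b: "1 \<le> b" "\<And>z. z \<in> cball c s \<Longrightarrow> norm (x - z) \<le> b"
  shows "\<bar>taylor_avg N w x (bump c s)\<bar> \<le> b ^ N / (bump_mass TYPE('n) * s ^ CARD('n)) * (\<Sum>k<N. \<integral>z. grad_sum k w z \<partial>lebesgue)"
proof -
  define M where "M = b ^ N / (bump_mass TYPE('n) * s ^ CARD('n))"
  have Z: "0 < bump_mass TYPE('n) * s ^ CARD('n)" using s bump_mass_pos[where 'n='n] by simp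
  have M0: "0 \<le> M" using Z b by (simp add: M_def)
  have mb: "\<bar>mon is (x - z) * bump c s z\<bar> \<le> M" if l: "length is < N" for "is" z
  proof (cases "z \<in> cball c s")
   case True
   have "\<bar>mon is (x - z)\<bar> \<le> norm (x - z) ^ length is" by (rule abs_mon_le)
   also have "\<dots> \<le> b ^ length is" by (intro power_mono b True) simp
   also have "\<dots> \<le> b ^ N" using l b by (intro power_increasing) auto
   finally have "\<bar>mon is (x - z)\<bar> * \<bar>bump c s z\<bar> \<le> b ^ N * (1 / (bump_mass TYPE('n) * s ^ CARD('n)))"
    using bump_le[OF s, of c z] bump_nonneg[of s c z] s b by (intro mult_mono) auto
   then show ?thesis by (simp add: M_def abs_mult)
  next
   case False
   then have "bump c s z = 0" using vanishes_off_bump[OF s, of c] unfolding vanishes_off_def by blast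
   then show ?thesis using M0 by simp
  qed
  have one: "\<bar>\<integral>z. w is z * (mon is (x - z) * bump c s z) \<partial>lebesgue\<bar> \<le> (\<integral>z. \<bar>w is z\<bar> \<partial>lebesgue) * M" if l: "length is < N" for "is"
  proof -
   have wi: "integrable lebesgue (w is)" using l by (intro w_integrable) auto
   have "(\<lambda>z. mon is (x - z) * bump c s z) \<in> borel_measurable lebesgue"
    by (intro continuous_measurable_lebesgue continuous_on_mult smooth_continuous partial_deriv_reflect(2) smooth_mon smooth_bump)
   from integrable_mult_bounded[OF wi this mb[OF l]]
   have i: "integrable lebesgue (\<lambda>z. w is z * (mon is (x - z) * bump c s z))" .
   have "\<bar>\<integral>z. w is z * (mon is (x - z) * bump c s z) \<partial>lebesgue\<bar> \<le> (\<integral>z. \<bar>w is z\<bar> * M \<partial>lebesgue)"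
   proof (rule integral_abs_bound_integral[OF i])
    show "integrable lebesgue (\<lambda>z. \<bar>w is z\<bar> * M)" using wi by simp
    show "\<bar>w is z * (mon is (x - z) * bump c s z)\<bar> \<le> \<bar>w is z\<bar> * M" for z
     unfolding abs_mult[of "w is z"] by (intro mult_left_mono mb l) simp
   qed
   then show ?thesis by simp
  qed
  have "\<bar>taylor_avg N w x (bump c s)\<bar> \<le> (\<Sum>k<N. (\<Sum>is :: 'n list | length is = k. (\<integral>z. \<bar>w is z\<bar> \<partial>lebesgue) * M))"
   unfolding taylor_avg_def
  proof (intro order_trans[OF sum_abs] sum_mono)
   fix k assume k: "k \<in> {..<N}"
   let ?S = "\<Sum>is | length is = k. \<integral>z. w is z * (mon is (x - z) * bump c s z) \<partial>lebesgue"
   have "\<bar>?S / fact k\<bar> \<le> \<bar>?S\<bar>" using fact_ge_1[of k, where 'a=real] by (simp add: divide_le_eq mult_le_cancel_left1)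
   also have "\<dots> \<le> (\<Sum>is :: 'n list | length is = k. (\<integral>z. \<bar>w is z\<bar> \<partial>lebesgue) * M)"
    using k by (intro order_trans[OF sum_abs] sum_mono one) auto
   finally show "\<bar>?S / fact k\<bar> \<le> \<dots>" .
  qed
  also have "\<dots> = M * (\<Sum>k<N. \<integral>z. grad_sum k w z \<partial>lebesgue)"
  proof -
   have "(\<integral>z. grad_sum k w z \<partial>lebesgue) = (\<Sum>is :: 'n list | length is = k. \<integral>z. \<bar>w is z\<bar> \<partial>lebesgue)" if "k < N" for k
    unfolding grad_sum_def using that by (intro Bochner_Integration.integral_sum integrable_abs w_integrable) auto
   then show ?thesis by (simp add: sum_distrib_left mult.commute)
  qed
  finally show ?thesis by (simp add: M_def)
qed

text \<open>A geometric sum over the scales not below \<rho>, in which the smallest scale dominates.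
  Here \<rho> is an arbitrary number.\<close>

lemma (in jones) dyadic_geometric_sum:
  assumes "0 \<le> \<rho>"
  shows "(\<Sum>j=J..<M. if \<rho> \<le> s0 / 2 ^ j then \<rho> / (s0 / 2 ^ j) else 0) \<le> 2"
proof -
  define sc where "sc j = s0 / 2 ^ j" for j :: nat
  have sc: "0 < sc j" "sc (Suc j) = sc j / 2" for j using s0 by (auto simp: sc_def)
  \<comment> \<open>The induction carries more than the claim: as long as \<rho> does not exceed the
    scale M, the partial sum is at most the term that would come next.\<close>
  have "(\<Sum>j=J..<M. if \<rho> \<le> sc j then \<rho> / sc j else 0) \<le> (if \<rho> \<le> sc M then \<rho> / sc M else 2)"
  proof (induction M)
   case 0 then show ?case using assms sc(1)[of 0] by auto
  next
   case (Suc M)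
   show ?case
   proof (cases "J \<le> M")
    case True
    have S: "(\<Sum>j=J..<Suc M. if \<rho> \<le> sc j then \<rho> / sc j else 0) = (\<Sum>j=J..<M. if \<rho> \<le> sc j then \<rho> / sc j else 0) + (if \<rho> \<le> sc M then \<rho> / sc M else 0)"
     using True by simp
    show ?thesis
    proof (cases "\<rho> \<le> sc (Suc M)")
     case True
     then have "\<rho> \<le> sc M" using sc[of M] by linarith
     moreover have "\<rho> / sc (Suc M) = \<rho> / sc M + \<rho> / sc M" using sc(1)[of M] by (simp add: sc(2) field_simps)
     ultimately show ?thesis using Suc True unfolding S by simp
    next
     case False
     have "\<rho> \<le> sc M \<Longrightarrow> \<rho> / sc M \<le> 1" using sc(1)[of M] by simp
     then show ?thesis using Suc False unfolding S by (auto split: if_splits)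
    qed
   next
    case False then show ?thesis using assms sc(1)[of "Suc M"] by auto
   qed
  qed
  also have "\<dots> \<le> 2" using sc(1)[of M] by (auto simp: divide_le_eq)
  finally show ?thesis unfolding sc_def .
qed

text \<open>From here on the order of differentiation equals the dimension.
  \<open>\<Theta>_lim\<close> sends the oscillation bound to 0, which makes the limit of the
  averages continuous.\<close>

locale jones_top_family = jones_family \<Omega> N w \<epsilon> s0
  for \<Omega> :: "(real^'n::finite) set" and N w \<epsilon> s0 +
  fixes \<Theta> :: "nat \<Rightarrow> real"
  assumes N: "N = CARD('n)" "2 \<le> N"
   and \<Theta>_nonneg: "0 \<le> \<Theta> j"
   and \<Theta>: "x \<in> \<Omega> \<Longrightarrow> (\<integral>z. grad_sum N w z * indicator (\<Omega> \<inter> cball x (reach \<epsilon> * (s0 / 2 ^ j))) z \<partial>lebesgue) \<le> \<Theta> j"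
   and \<Theta>_lim: "(\<lambda>J. \<Theta> J + s0 / 2 ^ J * (\<Sum>j<J. \<Theta> j / (s0 / 2 ^ j))) \<longlonglongrightarrow> 0"
begin

section \<open>Estimates when the order equals the dimension\<close>

definition sc :: "nat \<Rightarrow> real" where "sc j = s0 / 2 ^ j"

text \<open>The power of \<open>reach \<epsilon> + 2\<close> dominates the kernel in units of s for
  every link, and the factor 2 is the geometric sum over the scales.\<close>

definition chain_const :: real where "chain_const = step_const * (2 * (reach \<epsilon> + 2) ^ CARD('n))"

definition top_const :: real where "top_const = 4 ^ CARD('n) / (bump_mass TYPE('n) * (\<rho> * s0) ^ CARD('n))"

definition total :: real where "total = (\<Sum>k\<le>CARD('n). \<integral>z. grad_sum k w z \<partial>lebesgue)"

definition mass :: "real^'n \<Rightarrow> real \<Rightarrow> real"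
  where "mass x s = (\<integral>z. grad_sum N w z * indicator (\<Omega> \<inter> cball x (reach \<epsilon> * s)) z \<partial>lebesgue)"

lemma sc: "0 < sc j" "sc (Suc j) = sc j / 2" "sc j \<le> s0" "sc j \<le> 1 / 4"
proof -
  show "0 < sc j" "sc (Suc j) = sc j / 2" using s0 by (auto simp: sc_def)
  have "s0 / 2 ^ j \<le> s0 / 1" using s0 by (intro divide_left_mono) auto
  then show "sc j \<le> s0" by (simp add: sc_def)
  then show "sc j \<le> 1 / 4" using s0 by simp
qed

lemma N0: "0 < N" using N by simp

lemma divide_power_card: "s / s ^ CARD('n) = 1 / s ^ (N - 1)" if "s > 0" for s :: real
  using that N(2) unfolding N(1)[symmetric] by (cases N) auto

lemma step_le_chain: "step_const * c \<le> chain_const" if "c \<le> 2 * (reach \<epsilon> + 2) ^ CARD('n)"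
  unfolding chain_const_def by (intro mult_left_mono that step_const_nonneg)

lemma chain_const_nonneg: "0 \<le> chain_const"
  unfolding chain_const_def using step_const_nonneg reach_pos by simp

lemma top_const_nonneg: "0 \<le> top_const"
  unfolding top_const_def using ball_ratio s0 bump_mass_pos[where 'n='n] by simp

lemma mass_integrable: "integrable lebesgue (\<lambda>z. grad_sum N w z * indicator (\<Omega> \<inter> cball x r) z)"
  by (rule integrable_mult_bounded[OF grad_sum_integrable[OF order_refl] borel_measurable_indicator[OF region_sets], of _ _ 1])
   (simp add: indicator_def)

lemma mass_le: "x \<in> \<Omega> \<Longrightarrow> mass x (sc j) \<le> \<Theta> j"
  using \<Theta>[of x j] by (simp add: mass_def sc_def)

text \<open>\<open>s / s ^ CARD('n)\<close> equals \<open>1 / s ^ (N - 1)\<close> and is absorbed by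
  the kernel, as \<open>norm (x - z)\<close> is at most \<open>reach \<epsilon> * s\<close> in the
  region of integration. No power of s remains.\<close>

lemma weight_int_le:
  assumes "0 < s"
  shows "step_const * (s / s ^ CARD('n)) * weight_int x x s \<le> chain_const * mass x s"
proof -
  have "s / s ^ CARD('n) * weight_int x x s \<le> 2 * (reach \<epsilon> + 2) ^ CARD('n) * mass x s"
   unfolding weight_int_def mass_def integral_mult_right_zero[symmetric]
  proof (rule integral_mono)
   show "integrable lebesgue (\<lambda>z. s / s ^ CARD('n) * (norm (x - z) ^ (N - 1) * grad_sum N w z * indicator (\<Omega> \<inter> cball x (reach \<epsilon> * s)) z))"
    by (intro integrable_mult_right weighted_grad_sum_integrable region_sets) auto
   show "integrable lebesgue (\<lambda>z. 2 * (reach \<epsilon> + 2) ^ CARD('n) * (grad_sum N w z * indicator (\<Omega> \<inter> cball x (reach \<epsilon> * s)) z))"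
    by (intro integrable_mult_right mass_integrable)
   fix z
   show "s / s ^ CARD('n) * (norm (x - z) ^ (N - 1) * grad_sum N w z * indicator (\<Omega> \<inter> cball x (reach \<epsilon> * s)) z)
    \<le> 2 * (reach \<epsilon> + 2) ^ CARD('n) * (grad_sum N w z * indicator (\<Omega> \<inter> cball x (reach \<epsilon> * s)) z)"
   proof (cases "z \<in> \<Omega> \<inter> cball x (reach \<epsilon> * s)")
    case True
    then have d: "norm (x - z) / s \<le> reach \<epsilon>" using assms by (simp add: dist_norm divide_le_eq)
    have "s / s ^ CARD('n) * norm (x - z) ^ (N - 1) = (norm (x - z) / s) ^ (N - 1)" by (simp add: divide_power_card[OF assms] power_divide)
    also have "\<dots> \<le> (reach \<epsilon> + 2) ^ (N - 1)" using d assms by (intro power_mono) auto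
    also have "\<dots> \<le> (reach \<epsilon> + 2) ^ CARD('n)" using reach_pos N by (intro power_increasing) auto
    also have "\<dots> \<le> 2 * (reach \<epsilon> + 2) ^ CARD('n)" using reach_pos by simp
    finally have "s / s ^ CARD('n) * norm (x - z) ^ (N - 1) * grad_sum N w z \<le> 2 * (reach \<epsilon> + 2) ^ CARD('n) * grad_sum N w z"
     using grad_sum_nonneg by (rule mult_right_mono)
    then show ?thesis using True by (simp add: mult.assoc)
   qed simp
  qed
  from mult_left_mono[OF this step_const_nonneg] show ?thesis by (simp add: chain_const_def mult.assoc)
qed

text \<open>At fixed z the scale \<open>sc j\<close> contributes at most a multiple of
  \<open>r / sc j\<close>, where \<open>r = norm (x - z) / reach \<epsilon>\<close>, and only if
  \<open>r \<le> sc j\<close>. The sum is thus bounded independently of M: a descent of any length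
  costs as much as its first scale.\<close>

lemma weight_sum_le:
  "(\<Sum>j=J..<M. sc j / sc j ^ CARD('n) * weight_int x x (sc j)) \<le> 2 * (reach \<epsilon> + 2) ^ CARD('n) * mass x (sc J)"
proof -
  let ?R = "reach \<epsilon>"
  let ?t = "\<lambda>j z. sc j / sc j ^ CARD('n) * (norm (x - z) ^ (N - 1) * grad_sum N w z * indicator (\<Omega> \<inter> cball x (?R * sc j)) z)"
  let ?m = "\<lambda>z. grad_sum N w z * indicator (\<Omega> \<inter> cball x (?R * sc J)) z"
  have int: "integrable lebesgue (?t j)" for j by (intro integrable_mult_right weighted_grad_sum_integrable region_sets) auto
  have "(\<Sum>j=J..<M. sc j / sc j ^ CARD('n) * weight_int x x (sc j)) = (\<integral>z. (\<Sum>j=J..<M. ?t j z) \<partial>lebesgue)"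
   unfolding weight_int_def integral_mult_right_zero[symmetric] by (rule Bochner_Integration.integral_sum[symmetric, OF int])
  also have "\<dots> \<le> (\<integral>z. 2 * (?R + 2) ^ CARD('n) * ?m z \<partial>lebesgue)"
  proof (rule integral_mono)
   show "integrable lebesgue (\<lambda>z. \<Sum>j=J..<M. ?t j z)" by (intro Bochner_Integration.integrable_sum int)
   show "integrable lebesgue (\<lambda>z. 2 * (?R + 2) ^ CARD('n) * ?m z)" by (intro integrable_mult_right mass_integrable)
   fix z
   define r where "r = norm (x - z) / ?R"
   have r0: "0 \<le> r" using reach_pos by (simp add: r_def)
   have tj: "?t j z \<le> ?R ^ (N - 1) * (if r \<le> sc j then r / sc j else 0) * ?m z" if j: "J \<le> j" for j
   proof (cases "z \<in> \<Omega> \<inter> cball x (?R * sc j)")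
    case True
    have nz: "norm (x - z) = ?R * r" using reach_pos by (simp add: r_def)
    then have "?R * r \<le> ?R * sc j" using True by (simp add: dist_norm)
    then have rs: "r \<le> sc j" using reach_pos by simp
    have "sc j \<le> sc J" using j s0 unfolding sc_def by (intro divide_left_mono) auto
    then have "?R * sc j \<le> ?R * sc J" using reach_pos by (intro mult_left_mono) auto
    then have zJ: "z \<in> \<Omega> \<inter> cball x (?R * sc J)" using True by auto
    have "sc j / sc j ^ CARD('n) * norm (x - z) ^ (N - 1) = (?R * (r / sc j)) ^ (N - 1)"
     unfolding nz by (simp add: divide_power_card[OF sc(1)] power_divide power_mult_distrib)
    also have "\<dots> = ?R ^ (N - 1) * (r / sc j) ^ (N - 1)" by (rule power_mult_distrib)
    \<comment> \<open>Here \<open>2 \<le> N\<close> enters: the exponent N - 1 is at least 1, and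
      the base is at most 1.\<close>
    also have "\<dots> \<le> ?R ^ (N - 1) * (r / sc j) ^ 1" using N r0 rs sc(1)[of j] reach_pos by (intro mult_left_mono power_decreasing) auto
    finally have "sc j / sc j ^ CARD('n) * norm (x - z) ^ (N - 1) \<le> ?R ^ (N - 1) * (if r \<le> sc j then r / sc j else 0)" using rs by simp
    from mult_right_mono[OF this grad_sum_nonneg[of N z]] show ?thesis using True zJ by (simp add: mult.assoc)
   next
    case False
    then show ?thesis using r0 reach_pos sc(1)[of j] grad_sum_nonneg[of N z] by (auto intro!: mult_nonneg_nonneg)
   qed
   have "(\<Sum>j=J..<M. ?t j z) \<le> (\<Sum>j=J..<M. ?R ^ (N - 1) * (if r \<le> sc j then r / sc j else 0) * ?m z)" by (intro sum_mono tj) auto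
   also have "\<dots> = (?R ^ (N - 1) * (\<Sum>j=J..<M. if r \<le> sc j then r / sc j else 0)) * ?m z"
    by (simp only: sum_distrib_left sum_distrib_right)
   also have "\<dots> \<le> ((?R + 2) ^ CARD('n) * 2) * ?m z"
   proof (intro mult_right_mono mult_mono)
    have "?R ^ (N - 1) \<le> (?R + 2) ^ (N - 1)" using reach_pos by (intro power_mono) auto
    also have "\<dots> \<le> (?R + 2) ^ CARD('n)" using reach_pos N by (intro power_increasing) auto
    finally show "?R ^ (N - 1) \<le> (?R + 2) ^ CARD('n)" .
    show "(\<Sum>j=J..<M. if r \<le> sc j then r / sc j else 0) \<le> 2" unfolding sc_def by (rule dyadic_geometric_sum[OF r0])
    show "0 \<le> (\<Sum>j=J..<M. if r \<le> sc j then r / sc j else 0)" using r0 sc(1) by (intro sum_nonneg) (auto intro: divide_nonneg_pos)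
   qed (use reach_pos grad_sum_nonneg in \<open>auto intro!: mult_nonneg_nonneg\<close>)
   finally show "(\<Sum>j=J..<M. ?t j z) \<le> 2 * (?R + 2) ^ CARD('n) * ?m z" by (simp add: mult_ac)
  qed
  also have "\<dots> = 2 * (?R + 2) ^ CARD('n) * mass x (sc J)" by (simp add: mass_def)
  finally show ?thesis .
qed

text \<open>The chain uses one inner point per scale, starts at p and ends at x itself, which is an
  admissible centre once the scale M is small compared with the distance of x from the
  frontier.\<close>

lemma chain_to_centre:
  assumes x: "x \<in> \<Omega>" and p: "p \<in> \<Omega>" "dist x p \<le> sc J" "\<epsilon> / 4 * sc J \<le> infdist p (frontier \<Omega>)"
   and M: "J < M" "\<epsilon> / 4 * sc M \<le> infdist x (frontier \<Omega>)"
  shows "\<bar>taylor_avg N w x (bump p (\<rho> * sc J)) - taylor_avg N w x (bump x (\<rho> * sc M))\<bar> \<le> chain_const * \<Theta> J"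
proof -
  have "\<forall>j. \<exists>q. q \<in> \<Omega> \<and> dist x q \<le> sc j \<and> \<epsilon> / 4 * sc j \<le> infdist q (frontier \<Omega>)"
   using inner_points[OF x sc(1,3)] by blast
  then obtain Q where Q: "\<And>j. Q j \<in> \<Omega> \<and> dist x (Q j) \<le> sc j \<and> \<epsilon> / 4 * sc j \<le> infdist (Q j) (frontier \<Omega>)" by metis
  define P where "P j = (if j = J then p else if j = M then x else Q j)" for j
  have P: "P j \<in> \<Omega>" "dist x (P j) \<le> sc j" "\<epsilon> / 4 * sc j \<le> infdist (P j) (frontier \<Omega>)" for j
   using Q[of j] p x M sc(1)[of j] by (auto simp: P_def)
  define a where "a j = taylor_avg N w x (bump (P j) (\<rho> * sc j))" for j
  have step: "\<bar>a j - a (Suc j)\<bar> \<le> step_const * (sc j / sc j ^ CARD('n)) * weight_int x x (sc j)" for j unfolding a_def sc(2)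
  proof (rule link_half[OF N0 P(1) P(1) sc(1,3)])
   show "dist x (P j) \<le> 2 * sc j" "dist x (P (Suc j)) \<le> 2 * sc j" using P(2)[of j] P(2)[of "Suc j"] sc(1,2)[of j] by auto
   show "\<epsilon> / 8 * sc j \<le> infdist (P j) (frontier \<Omega>)"
    by (rule order_trans[OF _ P(3)]) (use \<epsilon> sc(1)[of j] in \<open>auto intro!: mult_right_mono\<close>)
   show "\<epsilon> / 8 * sc j \<le> infdist (P (Suc j)) (frontier \<Omega>)" using P(3)[of "Suc j"] by (simp add: sc(2))
  qed
  have "a J - a M = - (\<Sum>j=J..<M. a (Suc j) - a j)" using M(1) by (subst sum_Suc_diff') auto
  then have "\<bar>a J - a M\<bar> \<le> (\<Sum>j=J..<M. \<bar>a j - a (Suc j)\<bar>)"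
   using sum_abs[of "\<lambda>j. a (Suc j) - a j" "{J..<M}"] by (simp add: abs_minus_commute)
  also have "\<dots> \<le> (\<Sum>j=J..<M. step_const * (sc j / sc j ^ CARD('n)) * weight_int x x (sc j))" by (intro sum_mono step)
  also have "\<dots> = step_const * (\<Sum>j=J..<M. sc j / sc j ^ CARD('n) * weight_int x x (sc j))" by (simp add: sum_distrib_left mult.assoc)
  also have "\<dots> \<le> step_const * (2 * (reach \<epsilon> + 2) ^ CARD('n) * mass x (sc J))"
   by (intro mult_left_mono weight_sum_le step_const_nonneg)
  also have "\<dots> = chain_const * mass x (sc J)" by (simp add: chain_const_def)
  also have "\<dots> \<le> chain_const * \<Theta> J" by (intro mult_left_mono mass_le x chain_const_nonneg)
  finally show ?thesis using M(1) by (simp add: a_def P_def)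
qed

text \<open>A fixed first index shifts the order by one. \<open>w_sym\<close> commutes it with the
  index that integration by parts adds in front.\<close>

lemma deriv_family: "jones_family \<Omega> (N - 1) (\<lambda>is. w (i # is)) \<epsilon> s0"
proof (unfold_locales)
  fix "is" js :: "'n list" and x \<phi> j
  show "length is \<le> N - 1 \<Longrightarrow> integrable lebesgue (w (i # is))" using N0 by (intro w_integrable) auto
  show "x \<notin> \<Omega> \<Longrightarrow> w (i # is) x = 0" by (rule w_off)
  show "mset is = mset js \<Longrightarrow> w (i # is) = w (i # js)" by (rule w_sym) simp
  assume l: "length is < N - 1" and \<phi>: "\<phi> \<in> test_functions \<Omega>"
  have "w (j # i # is) = w (i # j # is)" by (rule w_sym) simp
  then show "(\<integral>x. w (i # is) x * partial_deriv j \<phi> x \<partial>lebesgue) = - (\<integral>x. w (i # j # is) x * \<phi> x \<partial>lebesgue)"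
   using w_deriv[of "i # is" \<phi> j] l \<phi> by simp
qed (rule open_domain bounded_domain)+

lemma grad_sum_deriv_le: "grad_sum k (\<lambda>is. w (i # is)) z \<le> grad_sum (Suc k) w z"
  unfolding grad_sum_def sum_lists_Suc
  by (rule member_le_sum[of i UNIV "\<lambda>i. \<Sum>is | length is = k. \<bar>w (i # is) z\<bar>"]) (auto intro: sum_nonneg)

text \<open>This chain runs upwards from scale J to scale 0. With one order less, the kernel has
  exponent N - 2, so that a link leaves the factor \<open>1 / sc j\<close>; at scale 0
  \<open>taylor_avg_bound\<close> ends the chain.\<close>

lemma deriv_bound:
  assumes y: "y \<in> \<Omega>" and q: "q \<in> \<Omega>" "dist y q \<le> sc J" "\<epsilon> / 4 * sc J \<le> infdist q (frontier \<Omega>)"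
   and x': "dist y x' \<le> sc J"
  shows "\<bar>taylor_avg (N - 1) (\<lambda>is. w (i # is)) x' (bump q (\<rho> * sc J))\<bar>
   \<le> chain_const * (\<Sum>j<J. \<Theta> j / sc j) + top_const * total"
proof -
  interpret D: jones_family \<Omega> "N - 1" "\<lambda>is. w (i # is)" \<epsilon> s0 by (rule deriv_family)
  let ?w = "\<lambda>is. w (i # is)"
  have "\<forall>j. \<exists>q. q \<in> \<Omega> \<and> dist y q \<le> sc j \<and> \<epsilon> / 4 * sc j \<le> infdist q (frontier \<Omega>)"
   using inner_points[OF y sc(1,3)] by blast
  then obtain Q where Q: "\<And>j. Q j \<in> \<Omega> \<and> dist y (Q j) \<le> sc j \<and> \<epsilon> / 4 * sc j \<le> infdist (Q j) (frontier \<Omega>)" by metis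
  define P where "P j = (if j = J then q else Q j)" for j
  have P: "P j \<in> \<Omega>" "dist y (P j) \<le> sc j" "\<epsilon> / 4 * sc j \<le> infdist (P j) (frontier \<Omega>)" for j
   using Q[of j] q by (auto simp: P_def)
  define a where "a j = taylor_avg (N - 1) ?w x' (bump (P j) (\<rho> * sc j))" for j
  have step: "\<bar>a j - a (Suc j)\<bar> \<le> chain_const * (\<Theta> j / sc j)" if j: "j < J" for j
  proof -
   have "\<bar>a j - a (Suc j)\<bar> \<le> step_const * (sc j / sc j ^ CARD('n)) * D.weight_int x' y (sc j)" unfolding a_def sc(2)
   proof (rule D.link_half[OF _ P(1) P(1) sc(1,3)])
    show "dist y (P j) \<le> 2 * sc j" "dist y (P (Suc j)) \<le> 2 * sc j" using P(2)[of j] P(2)[of "Suc j"] sc(1,2)[of j] by auto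
    show "\<epsilon> / 8 * sc j \<le> infdist (P j) (frontier \<Omega>)"
     by (rule order_trans[OF _ P(3)]) (use \<epsilon> sc(1)[of j] in \<open>auto intro!: mult_right_mono\<close>)
    show "\<epsilon> / 8 * sc j \<le> infdist (P (Suc j)) (frontier \<Omega>)" using P(3)[of "Suc j"] by (simp add: sc(2))
    show "0 < N - 1" using N by simp
   qed
   also have "\<dots> \<le> step_const * (sc j / sc j ^ CARD('n)) * (((reach \<epsilon> + 2) * sc j) ^ (N - 2) * mass y (sc j))"
   proof (rule mult_left_mono)
    show "D.weight_int x' y (sc j) \<le> ((reach \<epsilon> + 2) * sc j) ^ (N - 2) * mass y (sc j)"
     unfolding D.weight_int_def mass_def integral_mult_right_zero[symmetric]
    proof (rule integral_mono)
     show "integrable lebesgue (\<lambda>z. norm (x' - z) ^ (N - 1 - 1) * grad_sum (N - 1) ?w z * indicator (\<Omega> \<inter> cball y (reach \<epsilon> * sc j)) z)"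
      by (intro D.weighted_grad_sum_integrable region_sets) auto
     show "integrable lebesgue (\<lambda>z. ((reach \<epsilon> + 2) * sc j) ^ (N - 2) * (grad_sum N w z * indicator (\<Omega> \<inter> cball y (reach \<epsilon> * sc j)) z))"
      by (intro integrable_mult_right mass_integrable)
     fix z
     show "norm (x' - z) ^ (N - 1 - 1) * grad_sum (N - 1) ?w z * indicator (\<Omega> \<inter> cball y (reach \<epsilon> * sc j)) z
      \<le> ((reach \<epsilon> + 2) * sc j) ^ (N - 2) * (grad_sum N w z * indicator (\<Omega> \<inter> cball y (reach \<epsilon> * sc j)) z)"
     proof (cases "z \<in> \<Omega> \<inter> cball y (reach \<epsilon> * sc j)")
      case True
      have "sc J \<le> sc j" using j s0 unfolding sc_def by (intro divide_left_mono) auto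
      then have "norm (x' - z) \<le> sc j + reach \<epsilon> * sc j" using x' True dist_triangle3[of x' z y] by (simp add: dist_norm)
      also have "\<dots> \<le> (reach \<epsilon> + 2) * sc j" using sc(1)[of j] by (simp add: algebra_simps)
      finally have "norm (x' - z) ^ (N - 2) \<le> ((reach \<epsilon> + 2) * sc j) ^ (N - 2)" by (intro power_mono) auto
      moreover have "grad_sum (N - 1) ?w z \<le> grad_sum N w z" using grad_sum_deriv_le[of "N - 1" i z] N0 by simp
      ultimately have "norm (x' - z) ^ (N - 2) * grad_sum (N - 1) ?w z \<le> ((reach \<epsilon> + 2) * sc j) ^ (N - 2) * grad_sum N w z"
       using D.grad_sum_nonneg reach_pos sc(1)[of j] by (intro mult_mono) auto
      then show ?thesis using True by (simp add: numeral_2_eq_2)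
     qed simp
    qed
   qed (use step_const_nonneg sc(1)[of j] in \<open>auto intro!: mult_nonneg_nonneg\<close>)
   \<comment> \<open>With s for the scale and N equal to the dimension:
     \<open>s / s ^ N * s ^ (N - 2) = 1 / s\<close>.\<close>
   also have "\<dots> = step_const * (reach \<epsilon> + 2) ^ (N - 2) * (mass y (sc j) / sc j)"
   proof -
    obtain m where m: "N = Suc (Suc m)" using N by (metis Suc_le_D numeral_2_eq_2 Suc_le_mono)
    show ?thesis unfolding N(1)[symmetric] m using sc(1)[of j] by (simp add: power_mult_distrib)
   qed
   also have "\<dots> \<le> chain_const * (\<Theta> j / sc j)"
   proof (intro mult_mono step_le_chain divide_right_mono mass_le y)
    have "(reach \<epsilon> + 2) ^ (N - 2) \<le> (reach \<epsilon> + 2) ^ CARD('n)" using reach_pos N by (intro power_increasing) auto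
    also have "\<dots> \<le> 2 * (reach \<epsilon> + 2) ^ CARD('n)" using reach_pos by simp
    finally show "(reach \<epsilon> + 2) ^ (N - 2) \<le> \<dots>" .
    show "0 \<le> mass y (sc j) / sc j" unfolding mass_def
     using sc(1)[of j] by (intro divide_nonneg_pos Bochner_Integration.integral_nonneg) (auto simp: grad_sum_nonneg)
   qed (use chain_const_nonneg sc(1)[of j] in auto)
   finally show ?thesis .
  qed
  have "a J = a 0 + (\<Sum>j<J. a (Suc j) - a j)" by (subst sum_lessThan_telescope) simp
  then have "\<bar>a J\<bar> \<le> \<bar>a 0\<bar> + (\<Sum>j<J. \<bar>a j - a (Suc j)\<bar>)"
   using sum_abs[of "\<lambda>j. a (Suc j) - a j" "{..<J}"] by (simp add: abs_minus_commute)
  also have "\<dots> \<le> top_const * total + (\<Sum>j<J. chain_const * (\<Theta> j / sc j))"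
  proof (intro add_mono sum_mono step)
   \<comment> \<open>The number 4 is a generous bound for the distance from \<open>x'\<close> to the
     points of the ball at scale 0, all scales being at most 1 / 4.\<close>
   have "\<bar>a 0\<bar> \<le> 4 ^ (N - 1) / (bump_mass TYPE('n) * (\<rho> * sc 0) ^ CARD('n)) * (\<Sum>k<N - 1. \<integral>z. grad_sum k ?w z \<partial>lebesgue)"
    unfolding a_def
   proof (rule D.taylor_avg_bound)
    fix z assume "z \<in> cball (P 0) (\<rho> * sc 0)"
    moreover have "\<rho> * sc 0 \<le> 1 * 1" using ball_ratio sc(1,4)[of 0] by (intro mult_mono) auto
    ultimately have "dist (P 0) z \<le> 1" by simp
    moreover have "dist x' z \<le> dist y x' + dist y (P 0) + dist (P 0) z"
     using dist_triangle[of x' z "P 0"] dist_triangle3[of x' "P 0" y] by linarith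
    ultimately show "norm (x' - z) \<le> 4" using x' P(2)[of 0] sc(4)[of J] sc(4)[of 0] by (simp add: dist_norm)
   qed (use ball_ratio sc(1)[of 0] in auto)
   also have "\<dots> \<le> top_const * total"
   proof (rule mult_mono)
    have "0 < bump_mass TYPE('n) * (\<rho> * s0) ^ CARD('n)"
     using ball_ratio(1) s0 bump_mass_pos[where 'n='n] by (intro mult_pos_pos zero_less_power) auto
    then show "4 ^ (N - 1) / (bump_mass TYPE('n) * (\<rho> * sc 0) ^ CARD('n)) \<le> top_const"
     unfolding top_const_def sc_def using N by (intro divide_mono power_increasing) auto
    have "(\<Sum>k<N - 1. \<integral>z. grad_sum k ?w z \<partial>lebesgue) \<le> (\<Sum>k<N - 1. \<integral>z. grad_sum (Suc k) w z \<partial>lebesgue)"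
     by (intro sum_mono integral_mono D.grad_sum_integrable grad_sum_integrable grad_sum_deriv_le) auto
    also have "\<dots> \<le> (\<integral>z. grad_sum 0 w z \<partial>lebesgue) + (\<Sum>k<N - 1. \<integral>z. grad_sum (Suc k) w z \<partial>lebesgue)"
     by (simp add: grad_sum_nonneg)
    also have "\<dots> = (\<Sum>k<Suc (N - 1). \<integral>z. grad_sum k w z \<partial>lebesgue)" by (subst sum.lessThan_Suc_shift) simp
    also have "\<dots> \<le> total" unfolding total_def using N
     by (intro sum_mono2) (auto simp: grad_sum_nonneg intro!: Bochner_Integration.integral_nonneg)
    finally show "(\<Sum>k<N - 1. \<integral>z. grad_sum k ?w z \<partial>lebesgue) \<le> total" .
   qed (auto simp: top_const_nonneg D.grad_sum_nonneg intro!: sum_nonneg Bochner_Integration.integral_nonneg)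
   finally show "\<bar>a 0\<bar> \<le> top_const * total" .
  qed auto
  also have "\<dots> = chain_const * (\<Sum>j<J. \<Theta> j / sc j) + top_const * total" by (simp add: sum_distrib_left)
  finally show ?thesis by (simp add: a_def P_def)
qed

end

section \<open>The continuous representative\<close>

context jones_top_family begin

definition limit_fn :: "real^'n \<Rightarrow> real"
  where "limit_fn x = lim (\<lambda>j. taylor_avg N w x (bump x (\<rho> * sc j)))"

lemma sc_tendsto: "sc \<longlonglongrightarrow> 0"
proof -
  have "(\<lambda>j. s0 * (1 / 2) ^ j) \<longlonglongrightarrow> s0 * 0" by (intro tendsto_intros LIMSEQ_power_zero) auto
  then show ?thesis by (simp add: sc_def[abs_def] power_divide)
qed

lemma \<Theta>_tendsto: "\<Theta> \<longlonglongrightarrow> 0"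
proof (rule tendsto_sandwich[OF _ _ tendsto_const \<Theta>_lim])
  show "\<forall>\<^sub>F J in sequentially. \<Theta> J \<le> \<Theta> J + s0 / 2 ^ J * (\<Sum>j<J. \<Theta> j / (s0 / 2 ^ j))"
  proof (intro always_eventually allI)
   fix J
   have "0 \<le> s0 / 2 ^ J * (\<Sum>j<J. \<Theta> j / (s0 / 2 ^ j))"
    using s0 \<Theta>_nonneg by (intro mult_nonneg_nonneg sum_nonneg divide_nonneg_pos) auto
   then show "\<Theta> J \<le> \<Theta> J + s0 / 2 ^ J * (\<Sum>j<J. \<Theta> j / (s0 / 2 ^ j))" by simp
  qed
qed (auto simp: \<Theta>_nonneg)

text \<open>Eventually x itself is an admissible centre. \<open>chain_to_centre\<close> then
  compares all later averages with the one at scale J at the cost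
  \<open>chain_const * \<Theta> J\<close>, so the averages form a Cauchy sequence.\<close>

lemma limit_fn_converges:
  assumes x: "x \<in> \<Omega>"
  shows "(\<lambda>j. taylor_avg N w x (bump x (\<rho> * sc j))) \<longlonglongrightarrow> limit_fn x"
proof -
  let ?a = "\<lambda>j. taylor_avg N w x (bump x (\<rho> * sc j))"
  have "x \<notin> frontier \<Omega>" using jones_open x by (simp add: frontier_def interior_open)
  then have pos: "0 < infdist x (frontier \<Omega>)" using jones_frontier by (simp add: infdist_pos_not_in_closed frontier_closed)
  have "(\<lambda>j. \<epsilon> / 4 * sc j) \<longlonglongrightarrow> \<epsilon> / 4 * 0" by (intro tendsto_intros sc_tendsto)
  then have "\<forall>\<^sub>F j in sequentially. \<epsilon> / 4 * sc j < infdist x (frontier \<Omega>)"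
   by (rule order_tendstoD) (use pos in simp)
  then obtain j0 where "\<forall>j\<ge>j0. \<epsilon> / 4 * sc j < infdist x (frontier \<Omega>)" unfolding eventually_sequentially by blast
  then have j0: "\<And>j. j \<ge> j0 \<Longrightarrow> \<epsilon> / 4 * sc j \<le> infdist x (frontier \<Omega>)" by (simp add: less_imp_le)
  have "Cauchy ?a"
  proof (rule CauchyI)
   fix e :: real assume e: "e > 0"
   have "(\<lambda>j. chain_const * \<Theta> j) \<longlonglongrightarrow> chain_const * 0" by (intro tendsto_intros \<Theta>_tendsto)
   then have "\<forall>\<^sub>F j in sequentially. chain_const * \<Theta> j < e / 2" by (rule order_tendstoD) (use e in simp)
   then obtain j1 where j1: "\<And>j. j \<ge> j1 \<Longrightarrow> chain_const * \<Theta> j < e / 2" by (auto simp: eventually_sequentially)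
   define J where "J = max j0 j1"
   have near: "\<bar>?a J - ?a m\<bar> < e / 2" if "m \<ge> J" for m
   proof (cases "m = J")
    case False
    have "\<bar>?a J - ?a m\<bar> \<le> chain_const * \<Theta> J" using False that sc(1)[of J] by (intro chain_to_centre x j0) (auto simp: J_def)
    also have "\<dots> < e / 2" by (rule j1) (simp add: J_def)
    finally show ?thesis .
   qed (use e in simp)
   have "norm (?a m - ?a k) < e" if "m \<ge> J" "k \<ge> J" for m k using near[OF that(1)] near[OF that(2)] unfolding real_norm_def by linarith
   then show "\<exists>M. \<forall>m\<ge>M. \<forall>n\<ge>M. norm (?a m - ?a n) < e" by blast
  qed
  then show ?thesis unfolding limit_fn_def by (simp add: Cauchy_convergent_iff convergent_LIMSEQ_iff)
qed

text \<open>The estimate of \<open>chain_to_centre\<close> is uniform in the final index M, which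
  tends to infinity here.\<close>

lemma limit_fn_near:
  assumes x: "x \<in> \<Omega>" and p: "p \<in> \<Omega>" "dist x p \<le> sc J" "\<epsilon> / 4 * sc J \<le> infdist p (frontier \<Omega>)"
  shows "\<bar>taylor_avg N w x (bump p (\<rho> * sc J)) - limit_fn x\<bar> \<le> chain_const * \<Theta> J"
proof (rule tendsto_upperbound)
  let ?a = "\<lambda>j. taylor_avg N w x (bump x (\<rho> * sc j))"
  show "(\<lambda>j. \<bar>taylor_avg N w x (bump p (\<rho> * sc J)) - ?a j\<bar>) \<longlonglongrightarrow> \<bar>taylor_avg N w x (bump p (\<rho> * sc J)) - limit_fn x\<bar>"
   by (intro tendsto_intros limit_fn_converges x)
  have "x \<notin> frontier \<Omega>" using jones_open x by (simp add: frontier_def interior_open)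
  then have pos: "0 < infdist x (frontier \<Omega>)" using jones_frontier by (simp add: infdist_pos_not_in_closed frontier_closed)
  have "(\<lambda>j. \<epsilon> / 4 * sc j) \<longlonglongrightarrow> \<epsilon> / 4 * 0" by (intro tendsto_intros sc_tendsto)
  then have "\<forall>\<^sub>F j in sequentially. \<epsilon> / 4 * sc j < infdist x (frontier \<Omega>)"
   by (rule order_tendstoD) (use pos in simp)
  then show "\<forall>\<^sub>F j in sequentially. \<bar>taylor_avg N w x (bump p (\<rho> * sc J)) - ?a j\<bar> \<le> chain_const * \<Theta> J"
   using eventually_gt_at_top[of J] by eventually_elim (intro chain_to_centre x p, auto)
qed simp

text \<open>Four comparisons: \<open>limit_fn x\<close> with the ball at p; the ball at p with the
  ball at q, both evaluated at x; evaluation at x with evaluation at y, for the ball at q; and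
  finally \<open>limit_fn y\<close>. Only the third involves larger scales, the others cost a
  multiple of \<open>\<Theta> J\<close> each.\<close>

lemma limit_fn_modulus:
  assumes x: "x \<in> \<Omega>" and y: "y \<in> \<Omega>" and d: "dist x y \<le> sc J"
  shows "\<bar>limit_fn x - limit_fn y\<bar>
   \<le> (3 * chain_const + CARD('n) * (chain_const + top_const)) * (\<Theta> J + sc J * (\<Sum>j<J. \<Theta> j / sc j) + sc J * total)"
proof -
  obtain p where p: "p \<in> \<Omega>" "dist x p \<le> sc J" "\<epsilon> / 4 * sc J \<le> infdist p (frontier \<Omega>)"
   using inner_points[OF x sc(1,3)] by blast
  obtain q where q: "q \<in> \<Omega>" "dist y q \<le> sc J" "\<epsilon> / 4 * sc J \<le> infdist q (frontier \<Omega>)"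
   using inner_points[OF y sc(1,3)] by blast
  let ?A = "\<lambda>x p. taylor_avg N w x (bump p (\<rho> * sc J))"
  define S where "S = (\<Sum>j<J. \<Theta> j / sc j)"
  have S0: "0 \<le> S" using sc(1) \<Theta>_nonneg unfolding S_def by (intro sum_nonneg divide_nonneg_pos) auto
  have T0: "0 \<le> total" unfolding total_def by (intro sum_nonneg Bochner_Integration.integral_nonneg) (simp add: grad_sum_nonneg)
  have e84: "\<epsilon> / 8 * sc J \<le> \<epsilon> / 4 * sc J" using \<epsilon> sc(1)[of J] by (intro mult_right_mono) auto
  have dxq: "dist x q \<le> 2 * sc J" using d q(2) dist_triangle[of x q y] by linarith
  have 1: "\<bar>?A x p - limit_fn x\<bar> \<le> chain_const * \<Theta> J" by (rule limit_fn_near[OF x p])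
  have 2: "\<bar>?A y q - limit_fn y\<bar> \<le> chain_const * \<Theta> J" by (rule limit_fn_near[OF y q])
  have 3: "\<bar>?A x p - ?A x q\<bar> \<le> chain_const * \<Theta> J"
  proof -
   have "\<bar>?A x p - ?A x q\<bar> \<le> step_const * (sc J / sc J ^ CARD('n)) * weight_int x x (sc J)"
    using p q e84 dxq sc(1)[of J] by (intro link_same[OF N0] sc(1,3)) auto
   also have "\<dots> \<le> chain_const * mass x (sc J)" by (rule weight_int_le[OF sc(1)])
   also have "\<dots> \<le> chain_const * \<Theta> J" by (intro mult_left_mono mass_le x chain_const_nonneg)
   finally show ?thesis .
  qed
  have 4: "\<bar>?A x q - ?A y q\<bar> \<le> CARD('n) * (sc J * (chain_const * S + top_const * total))"
  proof -
   have r: "0 < \<rho> * sc J" using ball_ratio(1) sc(1)[of J] by simp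
   have "\<rho> * sc J < \<epsilon> / 4 * sc J"
   proof (rule mult_strict_right_mono[OF _ sc(1)])
    have "\<epsilon> * (\<epsilon> / 8) / 16 < \<epsilon> / 4" using \<epsilon> by simp
    then show "\<rho> < \<epsilon> / 4" by (simp only: ball_ratio(3))
   qed
   then have "cball q (\<rho> * sc J) \<subseteq> ball q (infdist q (frontier \<Omega>))" using q(3) by auto
   also have "\<dots> \<subseteq> \<Omega>" by (rule ball_infdist_frontier_subset[OF q(1) jones_frontier])
   finally have t: "bump q (\<rho> * sc J) \<in> test_functions \<Omega>" by (rule bump_test_function[OF r])
   from taylor_avg_diff_x[OF N0 t, of y "x - y"]
   obtain t where t: "t \<in> {0<..<1}" and eq: "?A x q - ?A y q = (\<Sum>i\<in>UNIV. (x - y) $ i * taylor_avg (N - 1) (\<lambda>is. w (i # is)) (y + t *\<^sub>R (x - y)) (bump q (\<rho> * sc J)))"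
    by auto
   have dy: "dist y (y + t *\<^sub>R (x - y)) \<le> sc J"
   proof -
    have "dist y (y + t *\<^sub>R (x - y)) = t * dist x y" using t by (simp add: dist_norm)
    also have "\<dots> \<le> 1 * dist x y" using t by (intro mult_right_mono) auto
    finally show ?thesis using d by simp
   qed
   have "\<bar>?A x q - ?A y q\<bar> \<le> (\<Sum>i\<in>(UNIV :: 'n set). sc J * (chain_const * S + top_const * total))" unfolding eq
   proof (intro order_trans[OF sum_abs] sum_mono)
    fix i :: 'n
    have "\<bar>(x - y) $ i\<bar> \<le> sc J" using component_le_norm_cart[of "x - y" i] d by (simp add: dist_norm)
    moreover have "\<bar>taylor_avg (N - 1) (\<lambda>is. w (i # is)) (y + t *\<^sub>R (x - y)) (bump q (\<rho> * sc J))\<bar> \<le> chain_const * S + top_const * total"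
     unfolding S_def by (rule deriv_bound[OF y q dy])
    ultimately show "\<bar>(x - y) $ i * taylor_avg (N - 1) (\<lambda>is. w (i # is)) (y + t *\<^sub>R (x - y)) (bump q (\<rho> * sc J))\<bar>
     \<le> sc J * (chain_const * S + top_const * total)" unfolding abs_mult using sc(1)[of J] by (intro mult_mono) auto
   qed
   then show ?thesis by simp
  qed
  have "\<bar>limit_fn x - limit_fn y\<bar> \<le> 3 * (chain_const * \<Theta> J) + CARD('n) * (sc J * (chain_const * S + top_const * total))"
   using 1 2 3 4 by linarith
  also have "\<dots> \<le> (3 * chain_const + CARD('n) * (chain_const + top_const)) * (\<Theta> J + sc J * S + sc J * total)"
  proof -
   let ?c = chain_const and ?t = top_const and ?n = "real CARD('n)"
   have c: "0 \<le> ?c" "0 \<le> ?t" using chain_const_nonneg top_const_nonneg by auto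
   define X where "X = \<Theta> J + sc J * S + sc J * total"
   have SX: "0 \<le> sc J * S" "0 \<le> sc J * total" using S0 T0 sc(1)[of J] by auto
   have X: "\<Theta> J \<le> X" "sc J * S \<le> X" "sc J * total \<le> X" unfolding X_def using SX \<Theta>_nonneg[of J] by linarith+
   have 5: "?c * \<Theta> J \<le> ?c * X" "?c * (sc J * S) \<le> ?c * X" "?t * (sc J * total) \<le> ?t * X"
    using X c by (auto intro: mult_left_mono)
   have "sc J * (?c * S + ?t * total) = ?c * (sc J * S) + ?t * (sc J * total)" by (simp only: distrib_left mult.left_commute)
   also have "\<dots> \<le> (?c + ?t) * X" using 5 by (simp only: distrib_right add_mono)
   finally have "?n * (sc J * (?c * S + ?t * total)) \<le> ?n * ((?c + ?t) * X)" by (intro mult_left_mono) auto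
   then have "3 * (?c * \<Theta> J) + ?n * (sc J * (?c * S + ?t * total)) \<le> 3 * (?c * X) + ?n * ((?c + ?t) * X)" using 5 by linarith
   also have "\<dots> = (3 * ?c + ?n * (?c + ?t)) * X" by (simp only: distrib_right mult.assoc)
   finally show ?thesis by (simp only: X_def)
  qed
  finally show ?thesis by (simp add: S_def)
qed

lemma limit_fn_bound:
  assumes x: "x \<in> \<Omega>"
  shows "\<bar>limit_fn x\<bar> \<le> (chain_const + top_const) * (\<Theta> 0 + total)"
proof -
  obtain p where p: "p \<in> \<Omega>" "dist x p \<le> sc 0" "\<epsilon> / 4 * sc 0 \<le> infdist p (frontier \<Omega>)"
   using inner_points[OF x sc(1,3)] by blast
  have T0: "0 \<le> total" unfolding total_def by (intro sum_nonneg Bochner_Integration.integral_nonneg) (simp add: grad_sum_nonneg)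
  have "\<bar>taylor_avg N w x (bump p (\<rho> * sc 0))\<bar> \<le> 4 ^ N / (bump_mass TYPE('n) * (\<rho> * sc 0) ^ CARD('n)) * (\<Sum>k<N. \<integral>z. grad_sum k w z \<partial>lebesgue)"
  proof (rule taylor_avg_bound)
   fix z assume "z \<in> cball p (\<rho> * sc 0)"
   moreover have "\<rho> * sc 0 \<le> 1 * 1" using ball_ratio sc(1,4)[of 0] by (intro mult_mono) auto
   ultimately have "dist p z \<le> 1" by simp
   then show "norm (x - z) \<le> 4" using p(2) sc(4)[of 0] dist_triangle[of x z p] by (simp add: dist_norm)
  qed (use ball_ratio sc(1)[of 0] in auto)
  also have "\<dots> \<le> top_const * total"
  proof (rule mult_mono)
   show "4 ^ N / (bump_mass TYPE('n) * (\<rho> * sc 0) ^ CARD('n)) \<le> top_const" unfolding top_const_def sc_def using N by simp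
   show "(\<Sum>k<N. \<integral>z. grad_sum k w z \<partial>lebesgue) \<le> total" unfolding total_def using N
    by (intro sum_mono2) (auto simp: grad_sum_nonneg intro!: Bochner_Integration.integral_nonneg)
  qed (auto simp: top_const_nonneg grad_sum_nonneg intro!: sum_nonneg Bochner_Integration.integral_nonneg)
  finally have "\<bar>taylor_avg N w x (bump p (\<rho> * sc 0))\<bar> \<le> top_const * total" .
  moreover have "\<bar>taylor_avg N w x (bump p (\<rho> * sc 0)) - limit_fn x\<bar> \<le> chain_const * \<Theta> 0" by (rule limit_fn_near[OF x p])
  ultimately have "\<bar>limit_fn x\<bar> \<le> chain_const * \<Theta> 0 + top_const * total" by linarith
  also have "\<dots> \<le> (chain_const + top_const) * (\<Theta> 0 + total)"
   using chain_const_nonneg top_const_nonneg \<Theta>_nonneg[of 0] T0 by (simp add: algebra_simps)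
  finally show ?thesis .
qed

lemma limit_fn_continuous: "continuous_on \<Omega> limit_fn"
proof -
  let ?C = "3 * chain_const + CARD('n) * (chain_const + top_const)"
  have lim: "(\<lambda>J. ?C * ((\<Theta> J + s0 / 2 ^ J * (\<Sum>j<J. \<Theta> j / (s0 / 2 ^ j))) + sc J * total)) \<longlonglongrightarrow> ?C * (0 + 0 * total)"
   by (intro tendsto_intros \<Theta>_lim sc_tendsto)
  show ?thesis unfolding continuous_on_iff
  proof (intro ballI allI impI)
   fix x and e :: real assume x: "x \<in> \<Omega>" and e: "e > 0"
   have "\<forall>\<^sub>F J in sequentially. ?C * ((\<Theta> J + s0 / 2 ^ J * (\<Sum>j<J. \<Theta> j / (s0 / 2 ^ j))) + sc J * total) < e"
    using lim by (rule order_tendstoD) (use e in simp)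
   then obtain J where J: "?C * ((\<Theta> J + s0 / 2 ^ J * (\<Sum>j<J. \<Theta> j / (s0 / 2 ^ j))) + sc J * total) < e"
    by (auto simp: eventually_sequentially)
   show "\<exists>d>0. \<forall>x'\<in>\<Omega>. dist x' x < d \<longrightarrow> dist (limit_fn x') (limit_fn x) < e"
   proof (intro exI[of _ "sc J"] conjI ballI impI)
    fix x' assume x': "x' \<in> \<Omega>" "dist x' x < sc J"
    then have "\<bar>limit_fn x' - limit_fn x\<bar> \<le> ?C * (\<Theta> J + sc J * (\<Sum>j<J. \<Theta> j / sc j) + sc J * total)"
     by (intro limit_fn_modulus x) auto
    then show "dist (limit_fn x') (limit_fn x) < e" using J by (simp add: dist_real_def sc_def)
   qed (rule sc(1))
  qed
qed

text \<open>Tested against \<phi>, the averages tend to \<open>w []\<close> by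
  \<open>taylor_avg_weak_limit\<close> and to \<open>limit_fn\<close> by
  \<open>limit_fn_near\<close>. The latter is uniform on K: since K has positive distance from the
  frontier, all its points become admissible centres at a common scale.\<close>

lemma limit_fn_AE_eq: "AE x in lebesgue_on \<Omega>. limit_fn x = w [] x"
proof -
  have lv: "locally_integrable \<Omega> limit_fn" by (rule locally_integrable_continuous[OF limit_fn_continuous])
  have wi: "integrable lebesgue (w [])" by (rule w_integrable) simp
  have lw: "locally_integrable \<Omega> (w [])" unfolding locally_integrable_def
  proof (intro allI impI)
   fix K :: "(real^'n) set" assume "compact K"
   then have K: "K \<in> sets lebesgue" by (simp add: compact_imp_closed lborelD)
   have "integrable lebesgue (\<lambda>x. indicator K x *\<^sub>R w [] x)" using K wi by (rule integrable_mult_indicator)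
   moreover have "(\<lambda>x. indicator K x *\<^sub>R w [] x) = (\<lambda>x. if x \<in> K then w [] x else 0)" by (auto simp: fun_eq_iff indicator_def)
   ultimately show "integrable (lebesgue_on K) (w [])" using Lebesgue_Measure.integrable_restrict_UNIV[OF K, of "w []"] by simp
  qed
  have "AE x in lebesgue_on \<Omega>. limit_fn x - w [] x = 0"
  proof (rule weak_eq_0_imp_AE_eq_0[OF _ open_domain])
   show "locally_integrable \<Omega> (\<lambda>x. limit_fn x - w [] x)" using lv lw by (auto simp: locally_integrable_def)
   fix \<phi> assume \<phi>: "\<phi> \<in> test_functions \<Omega>"
   then obtain K where K: "smooth \<phi>" "compact K" "K \<subseteq> \<Omega>" "vanishes_off K \<phi>" by (rule test_functionsE)
   let ?A = "\<lambda>j x. taylor_avg N w x (bump x (\<rho> * sc j))"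
   have cont: "continuous_on UNIV \<phi>" using K(1) by (rule smooth_continuous)
   have lim1: "(\<lambda>j. \<integral>x. ?A j x * \<phi> x \<partial>lebesgue) \<longlonglongrightarrow> (\<integral>x. w [] x * \<phi> x \<partial>lebesgue)"
   proof (rule filterlim_compose[OF taylor_avg_weak_limit(1)[OF N0 w_integrable cont K(2,4)]])
    have "(\<lambda>j. \<rho> * sc j) \<longlonglongrightarrow> \<rho> * 0" by (intro tendsto_intros sc_tendsto)
    then show "filterlim (\<lambda>j. \<rho> * sc j) (at_right 0) sequentially"
     using ball_ratio(1) sc(1)[THEN less_imp_neq, symmetric] less_imp_le[OF sc(1)] by (auto simp: filterlim_at less_le intro!: always_eventually)
   qed simp
   have Ai: "integrable lebesgue (\<lambda>x. ?A j x * \<phi> x)" for j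
    using ball_ratio(1) sc(1)[of j] by (intro taylor_avg_weak_limit(2)[OF N0 w_integrable cont K(2,4)]) auto
   have vi: "integrable lebesgue (\<lambda>x. limit_fn x * \<phi> x)" by (rule locally_integrable_test[OF lv \<phi>])
   have \<phi>i: "integrable lebesgue \<phi>"
    using integrable_vanishes_off[OF cont K(2,4)] cont by (subst integrable_completion) (auto intro: borel_measurable_continuous_onI)
   obtain d where d: "d > 0" "\<And>x y. x \<in> K \<Longrightarrow> y \<in> frontier \<Omega> \<Longrightarrow> d \<le> dist x y"
   proof -
    have "K \<inter> frontier \<Omega> = {}" using K(3) jones_open by (auto simp: frontier_def interior_open)
    from separate_compact_closed[OF K(2) frontier_closed this] show thesis using that by blast
   qed
   have "(\<lambda>j. \<epsilon> / 4 * sc j) \<longlonglongrightarrow> \<epsilon> / 4 * 0" by (intro tendsto_intros sc_tendsto)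
   then have "\<forall>\<^sub>F j in sequentially. \<epsilon> / 4 * sc j < d" by (rule order_tendstoD) (use d in simp)
   then have ev: "\<forall>\<^sub>F j in sequentially. \<bar>(\<integral>x. ?A j x * \<phi> x \<partial>lebesgue) - (\<integral>x. limit_fn x * \<phi> x \<partial>lebesgue)\<bar> \<le> chain_const * \<Theta> j * (\<integral>x. \<bar>\<phi> x\<bar> \<partial>lebesgue)"
   proof eventually_elim
    case (elim j)
    have pt: "\<bar>?A j x - limit_fn x\<bar> \<le> chain_const * \<Theta> j" if "x \<in> K" for x
    proof (rule limit_fn_near)
     show "x \<in> \<Omega>" "x \<in> \<Omega>" using that K(3) by auto
     show "dist x x \<le> sc j" using sc(1)[of j] by simp
     have "d \<le> infdist x (frontier \<Omega>)"
      unfolding infdist_notempty[OF jones_frontier] using d(2)[OF that] jones_frontier by (intro cINF_greatest) auto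
     then show "\<epsilon> / 4 * sc j \<le> infdist x (frontier \<Omega>)" using elim by simp
    qed
    have "(\<integral>x. ?A j x * \<phi> x \<partial>lebesgue) - (\<integral>x. limit_fn x * \<phi> x \<partial>lebesgue) = (\<integral>x. ?A j x * \<phi> x - limit_fn x * \<phi> x \<partial>lebesgue)"
     using Ai vi by simp
    also have "\<bar>\<dots>\<bar> \<le> (\<integral>x. chain_const * \<Theta> j * \<bar>\<phi> x\<bar> \<partial>lebesgue)"
    proof (rule integral_abs_bound_integral)
     show "integrable lebesgue (\<lambda>x. ?A j x * \<phi> x - limit_fn x * \<phi> x)" using Ai vi by simp
     show "integrable lebesgue (\<lambda>x. chain_const * \<Theta> j * \<bar>\<phi> x\<bar>)" using \<phi>i by simp
     fix x
     show "\<bar>?A j x * \<phi> x - limit_fn x * \<phi> x\<bar> \<le> chain_const * \<Theta> j * \<bar>\<phi> x\<bar>"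
     proof (cases "x \<in> K")
      case True
      then show ?thesis unfolding left_diff_distrib[symmetric] abs_mult by (intro mult_right_mono pt) auto
     qed (use K(4) in \<open>simp add: vanishes_off_def\<close>)
    qed
    finally show ?case by simp
   qed
   have "(\<lambda>j. (\<integral>x. ?A j x * \<phi> x \<partial>lebesgue) - (\<integral>x. limit_fn x * \<phi> x \<partial>lebesgue)) \<longlonglongrightarrow> 0"
   proof (rule Lim_null_comparison)
    show "\<forall>\<^sub>F j in sequentially. norm ((\<integral>x. ?A j x * \<phi> x \<partial>lebesgue) - (\<integral>x. limit_fn x * \<phi> x \<partial>lebesgue)) \<le> chain_const * \<Theta> j * (\<integral>x. \<bar>\<phi> x\<bar> \<partial>lebesgue)"
     using ev by simp
    have "(\<lambda>j. chain_const * \<Theta> j * (\<integral>x. \<bar>\<phi> x\<bar> \<partial>lebesgue)) \<longlonglongrightarrow> chain_const * 0 * (\<integral>x. \<bar>\<phi> x\<bar> \<partial>lebesgue)"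
     by (intro tendsto_intros \<Theta>_tendsto)
    then show "(\<lambda>j. chain_const * \<Theta> j * (\<integral>x. \<bar>\<phi> x\<bar> \<partial>lebesgue)) \<longlonglongrightarrow> 0" by simp
   qed
   then have "(\<lambda>j. \<integral>x. ?A j x * \<phi> x \<partial>lebesgue) \<longlonglongrightarrow> (\<integral>x. limit_fn x * \<phi> x \<partial>lebesgue)" by (rule LIM_zero_cancel)
   then have "(\<integral>x. limit_fn x * \<phi> x \<partial>lebesgue) = (\<integral>x. w [] x * \<phi> x \<partial>lebesgue)" using lim1 by (rule LIMSEQ_unique)
   then show "(\<integral>x. (limit_fn x - w [] x) * \<phi> x \<partial>lebesgue) = 0"
    using vi integrable_mult_test[OF wi \<phi>] by (simp add: left_diff_distrib)
  qed
  then show ?thesis by eventually_elim simp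
qed

end

text \<open>The constants depend on \<Omega>, \<epsilon> and s0 only. They are written out again
  before w and \<Theta> are introduced, so that one C serves all functions, as a continuous
  embedding requires.\<close>

lemma jones_oscillation:
  fixes \<Omega> :: "(real^'n::finite) set"
  assumes J: "jones \<Omega> \<epsilon> s0" and n: "2 \<le> CARD('n)"
  shows "\<exists>C\<ge>0. \<forall>w \<Theta>. sobolev_family \<Omega> CARD('n) w \<longrightarrow> (\<forall>j. 0 \<le> \<Theta> j) \<longrightarrow>
   (\<forall>x\<in>\<Omega>. \<forall>j. (\<integral>z. grad_sum CARD('n) w z * indicator (\<Omega> \<inter> cball x (reach \<epsilon> * (s0 / 2 ^ j))) z \<partial>lebesgue) \<le> \<Theta> j) \<longrightarrow>
   (\<lambda>J. \<Theta> J + s0 / 2 ^ J * (\<Sum>j<J. \<Theta> j / (s0 / 2 ^ j))) \<longlonglongrightarrow> 0 \<longrightarrow>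
   (\<exists>v. continuous_on \<Omega> v \<and> (AE x in lebesgue_on \<Omega>. v x = w [] x)
    \<and> (\<forall>x\<in>\<Omega>. \<bar>v x\<bar> \<le> C * (\<Theta> 0 + (\<Sum>k\<le>CARD('n). \<integral>z. grad_sum k w z \<partial>lebesgue)))
    \<and> (\<forall>J. \<forall>x\<in>\<Omega>. \<forall>y\<in>\<Omega>. dist x y \<le> s0 / 2 ^ J \<longrightarrow>
      \<bar>v x - v y\<bar> \<le> C * (\<Theta> J + s0 / 2 ^ J * (\<Sum>j<J. \<Theta> j / (s0 / 2 ^ j))
        + s0 / 2 ^ J * (\<Sum>k\<le>CARD('n). \<integral>z. grad_sum k w z \<partial>lebesgue))))"
proof -
  interpret J: jones \<Omega> \<epsilon> s0 by (rule J)
  define st where "st = (4 / \<epsilon> + 1) * 2 ^ CARD('n) / (bump_mass TYPE('n) * ball_ratio \<epsilon> ^ CARD('n))"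
  define ch where "ch = st * (2 * (reach \<epsilon> + 2) ^ CARD('n))"
  define tp where "tp = 4 ^ CARD('n) / (bump_mass TYPE('n) * (ball_ratio \<epsilon> * s0) ^ CARD('n))"
  have "0 \<le> st" using J.\<epsilon> bump_mass_pos[where 'n='n] unfolding st_def ball_ratio_def by (intro divide_nonneg_pos) auto
  then have ch: "0 \<le> ch" using J.\<epsilon> unfolding ch_def reach_def by (intro mult_nonneg_nonneg) auto
  have tp: "0 \<le> tp" using J.\<epsilon> J.s0 bump_mass_pos[where 'n='n] unfolding tp_def ball_ratio_def by (intro divide_nonneg_pos) auto
  define C where "C = 3 * ch + CARD('n) * (ch + tp)"
  show ?thesis
  proof (intro exI[of _ C] conjI allI impI)
   show "0 \<le> C" using ch tp by (simp add: C_def)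
  next
   fix w :: "'n list \<Rightarrow> real^'n \<Rightarrow> real" and \<Theta> :: "nat \<Rightarrow> real"
   assume w: "sobolev_family \<Omega> CARD('n) w" and t0: "\<forall>j. 0 \<le> \<Theta> j"
    and tb: "\<forall>x\<in>\<Omega>. \<forall>j. (\<integral>z. grad_sum CARD('n) w z * indicator (\<Omega> \<inter> cball x (reach \<epsilon> * (s0 / 2 ^ j))) z \<partial>lebesgue) \<le> \<Theta> j"
    and tl: "(\<lambda>J. \<Theta> J + s0 / 2 ^ J * (\<Sum>j<J. \<Theta> j / (s0 / 2 ^ j))) \<longlonglongrightarrow> 0"
   interpret w: sobolev_family \<Omega> "CARD('n)" w by (rule w)
   interpret T: jones_top_family \<Omega> "CARD('n)" w \<epsilon> s0 \<Theta> by unfold_locales (use n t0 tb tl in auto)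
   have ceq: "T.chain_const = ch" "T.top_const = tp" by (simp_all add: T.chain_const_def T.step_const_def T.top_const_def ch_def tp_def st_def)
   have c1: "ch + tp \<le> C" using ch tp n mult_right_mono[of 1 "real CARD('n)" "ch + tp"] by (simp add: C_def)
   have T0: "0 \<le> T.total" unfolding T.total_def by (intro sum_nonneg Bochner_Integration.integral_nonneg) (simp add: w.grad_sum_nonneg)
   show "\<exists>v. continuous_on \<Omega> v \<and> (AE x in lebesgue_on \<Omega>. v x = w [] x)
    \<and> (\<forall>x\<in>\<Omega>. \<bar>v x\<bar> \<le> C * (\<Theta> 0 + (\<Sum>k\<le>CARD('n). \<integral>z. grad_sum k w z \<partial>lebesgue)))
    \<and> (\<forall>J. \<forall>x\<in>\<Omega>. \<forall>y\<in>\<Omega>. dist x y \<le> s0 / 2 ^ J \<longrightarrow>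
      \<bar>v x - v y\<bar> \<le> C * (\<Theta> J + s0 / 2 ^ J * (\<Sum>j<J. \<Theta> j / (s0 / 2 ^ j))
        + s0 / 2 ^ J * (\<Sum>k\<le>CARD('n). \<integral>z. grad_sum k w z \<partial>lebesgue)))"
   proof (intro exI[of _ T.limit_fn] conjI allI ballI impI)
    show "continuous_on \<Omega> T.limit_fn" by (rule T.limit_fn_continuous)
    show "AE x in lebesgue_on \<Omega>. T.limit_fn x = w [] x" by (rule T.limit_fn_AE_eq)
   next
    fix x assume "x \<in> \<Omega>"
    then have "\<bar>T.limit_fn x\<bar> \<le> (ch + tp) * (\<Theta> 0 + T.total)" using T.limit_fn_bound ceq by simp
    also have "\<dots> \<le> C * (\<Theta> 0 + T.total)" using c1 t0 T0 by (intro mult_right_mono) auto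
    finally show "\<bar>T.limit_fn x\<bar> \<le> C * (\<Theta> 0 + (\<Sum>k\<le>CARD('n). \<integral>z. grad_sum k w z \<partial>lebesgue))" by (simp add: T.total_def)
   next
    fix J x y assume "x \<in> \<Omega>" "y \<in> \<Omega>" "dist x y \<le> s0 / 2 ^ J"
    then show "\<bar>T.limit_fn x - T.limit_fn y\<bar> \<le> C * (\<Theta> J + s0 / 2 ^ J * (\<Sum>j<J. \<Theta> j / (s0 / 2 ^ j))
        + s0 / 2 ^ J * (\<Sum>k\<le>CARD('n). \<integral>z. grad_sum k w z \<partial>lebesgue))"
     using T.limit_fn_modulus[of x y J] by (simp only: ceq C_def T.sc_def T.total_def)
   qed
  qed
qed

text \<open>An inner point for the scale s is found on an arc from x to some y at distance s0: where
  the arc is at distance s / 2 from x, the Jones condition bounds the distance from the frontier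
  below by \<open>\<epsilon> / 4 * s\<close>.\<close>

lemma Jones_domain_imp_jones:
  fixes \<Omega> :: "(real^'n::finite) set"
  assumes "Jones_domain \<Omega>" "bounded \<Omega>" "\<Omega> \<noteq> {}"
  shows "\<exists>\<epsilon> s0. jones \<Omega> \<epsilon> s0"
proof -
  obtain \<epsilon> \<delta> where \<epsilon>: "0 < \<epsilon>" "\<epsilon> < 1" and \<delta>: "(1::ereal) < \<delta>"
   and op: "open \<Omega>" and con: "connected \<Omega>"
   and arcs: "\<And>x y. x \<in> \<Omega> \<Longrightarrow> y \<in> \<Omega> \<Longrightarrow> x \<noteq> y \<and> ereal (dist x y) < \<delta> \<longrightarrow>
     (\<exists>\<gamma>. arc \<gamma> \<and> rectifiable \<gamma> \<and> path_image \<gamma> \<subseteq> \<Omega> \<and> pathstart \<gamma> = x \<and> pathfinish \<gamma> = y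
      \<and> path_length \<gamma> \<le> ennreal (dist x y / \<epsilon>)
      \<and> (\<forall>z\<in>path_image \<gamma>. frontier \<Omega> \<noteq> {} \<longrightarrow>
         \<epsilon> * (dist x z * dist y z / dist x y) \<le> infdist z (frontier \<Omega>)))" using assms(1) unfolding Jones_domain_def by blast
  have fr: "frontier \<Omega> \<noteq> {}" using assms(2,3) by (metis frontier_eq_empty not_bounded_UNIV)
  have arcs': "\<exists>\<gamma>. path \<gamma> \<and> path_image \<gamma> \<subseteq> \<Omega> \<and> pathstart \<gamma> = x \<and> pathfinish \<gamma> = y
      \<and> path_length \<gamma> \<le> ennreal (dist x y / \<epsilon>)
      \<and> (\<forall>z\<in>path_image \<gamma>. \<epsilon> * (dist x z * dist y z / dist x y) \<le> infdist z (frontier \<Omega>))"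
   if xy: "x \<in> \<Omega>" "y \<in> \<Omega>" "x \<noteq> y" "dist x y \<le> 1" for x y
  proof -
   have "ereal (dist x y) \<le> 1" using xy(4) by (simp add: one_ereal_def)
   then have "ereal (dist x y) < \<delta>" using \<delta> by (rule le_less_trans)
   with arcs[OF xy(1,2)] xy(3) obtain \<gamma> where "arc \<gamma>" "path_image \<gamma> \<subseteq> \<Omega>" "pathstart \<gamma> = x" "pathfinish \<gamma> = y"
    "path_length \<gamma> \<le> ennreal (dist x y / \<epsilon>)" "\<forall>z\<in>path_image \<gamma>. \<epsilon> * (dist x z * dist y z / dist x y) \<le> infdist z (frontier \<Omega>)"
    using fr by blast
   then show ?thesis using arc_imp_path by blast
  qed
  obtain a where a: "a \<in> \<Omega>" using assms(3) by blast
  then obtain r where r: "r > 0" "cball a r \<subseteq> \<Omega>" using op open_contains_cball by blast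
  \<comment> \<open>\<Omega> contains two points at distance r, and one of them is at least r / 2
    away from x. Connectedness then gives a point at distance exactly s0 from x.\<close>
  define s0 where "s0 = min (1 / 4) (r / 4)"
  have s0: "0 < s0" "s0 \<le> 1 / 4" "s0 \<le> r / 4" using r by (auto simp: s0_def)
  define b where "b = a + r *\<^sub>R axis undefined 1"
  have b2: "dist a b = r" using r by (simp add: b_def dist_norm)
  then have b: "b \<in> \<Omega>" "dist a b = r" using r(2) by auto
  have far: "\<exists>y\<in>\<Omega>. dist x y = s0" if x: "x \<in> \<Omega>" for x
  proof -
   have "r \<le> dist x a + dist x b" using b(2) dist_triangle3[of a b x] by simp
   then have "s0 \<le> dist x a \<or> s0 \<le> dist x b" using s0 r(1) by linarith
   then obtain c where c: "c \<in> \<Omega>" "s0 \<le> dist x c" using a b(1) by blast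
   have 1: "connected ((\<lambda>y. dist x y) ` \<Omega>)" by (intro connected_continuous_image con continuous_intros)
   have 2: "dist x x \<in> (\<lambda>y. dist x y) ` \<Omega>" "dist x c \<in> (\<lambda>y. dist x y) ` \<Omega>" using x c by auto
   have "s0 \<in> (\<lambda>y. dist x y) ` \<Omega>" by (rule connectedD_interval[OF 1 2]) (use c(2) s0(1) in simp_all)
   then show ?thesis by auto
  qed
  have inner: "\<exists>p\<in>\<Omega>. dist x p \<le> s \<and> \<epsilon> / 4 * s \<le> infdist p (frontier \<Omega>)"
   if x: "x \<in> \<Omega>" and s: "0 < s" "s \<le> s0" for x s
  proof -
   obtain y where y: "y \<in> \<Omega>" "dist x y = s0" using far[OF x] by blast
   have "x \<noteq> y" "dist x y \<le> 1" using y s0 by auto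
   from arcs'[OF x y(1) this] obtain \<gamma> where \<gamma>: "path \<gamma>" "path_image \<gamma> \<subseteq> \<Omega>" "pathstart \<gamma> = x" "pathfinish \<gamma> = y"
    "\<And>z. z \<in> path_image \<gamma> \<Longrightarrow> \<epsilon> * (dist x z * dist y z / dist x y) \<le> infdist z (frontier \<Omega>)" by blast
   have 1: "connected ((\<lambda>z. dist x z) ` path_image \<gamma>)"
    by (intro connected_continuous_image connected_path_image \<gamma> continuous_intros)
   have 2: "dist x x \<in> (\<lambda>z. dist x z) ` path_image \<gamma>" "dist x y \<in> (\<lambda>z. dist x z) ` path_image \<gamma>"
    using pathstart_in_path_image[of \<gamma>] pathfinish_in_path_image[of \<gamma>] \<gamma> by auto
   have "s / 2 \<in> (\<lambda>z. dist x z) ` path_image \<gamma>" by (rule connectedD_interval[OF 1 2]) (use s y in simp_all)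
   then obtain p where p: "p \<in> path_image \<gamma>" "dist x p = s / 2" by auto
   have "s0 / 2 \<le> dist y p" using dist_triangle[of x y p] p(2) y(2) s by (simp add: dist_commute)
   then have "s / 2 * (s0 / 2) \<le> dist x p * dist y p" using p(2) s s0 by (intro mult_mono) auto
   then have "s / 4 \<le> dist x p * dist y p / dist x y" using y(2) s0 by (simp add: field_simps)
   then have "\<epsilon> * (s / 4) \<le> \<epsilon> * (dist x p * dist y p / dist x y)" using \<epsilon> by (intro mult_left_mono) auto
   then have "\<epsilon> / 4 * s \<le> infdist p (frontier \<Omega>)"     proof -
    have "\<epsilon> / 4 * s = \<epsilon> * (s / 4)" by simp
    then show ?thesis using \<gamma>(5)[OF p(1)] \<open>\<epsilon> * (s / 4) \<le> \<epsilon> * (dist x p * dist y p / dist x y)\<close> by linarith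
   qed
   moreover have "dist x p \<le> s" using p(2) s by simp
   ultimately show ?thesis using \<gamma>(2) p(1) by blast
  qed
  have "jones \<Omega> \<epsilon> s0" by (rule jones.intro[OF op fr \<epsilon> s0(1,2) arcs' inner])
  then show ?thesis by blast
qed

text \<open>\<open>weak_deriv\<close> makes an independent choice for each list, so permuted indices
  give functions that agree only almost everywhere. One list per multiset makes the family symmetric
  at every point, as \<open>sobolev_family\<close> demands.\<close>

definition weak_rep :: "(real^'n::finite) set \<Rightarrow> (real^'n \<Rightarrow> real) \<Rightarrow> 'n list \<Rightarrow> real^'n \<Rightarrow> real"
  where "weak_rep \<Omega> u is x = (if x \<in> \<Omega> then weak_deriv \<Omega> (SOME js. mset js = mset is) u x else 0)"

lemma has_weak_deriv_mset_cong:
  assumes "mset is = mset js" "has_weak_deriv \<Omega> is u v"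
  shows "has_weak_deriv \<Omega> js u v"
proof -
  have "partial_derivs is \<phi> = partial_derivs js \<phi>" if "\<phi> \<in> test_functions \<Omega>" for \<phi>
   using that assms(1) by (intro partial_derivs_mset_cong) (auto elim: test_functionsE)
  moreover have "length is = length js" using mset_eq_length[OF assms(1)] .
  ultimately show ?thesis using assms(2) unfolding has_weak_deriv_def by simp
qed

lemma sobolev_family_weak_rep:
  fixes u :: "real^'n::finite \<Rightarrow> real"
  assumes op: "open \<Omega>" and bd: "bounded \<Omega>" and wd: "weakly_differentiable \<Omega> N u"
   and int: "\<And>is. length is \<le> N \<Longrightarrow> integrable (lebesgue_on \<Omega>) (weak_deriv \<Omega> is u)"
  shows "sobolev_family \<Omega> N (weak_rep \<Omega> u)"
   and "AE x in lebesgue_on \<Omega>. weak_rep \<Omega> u [] x = u x"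
proof -
  define c where "c is = (SOME js :: 'n list. mset js = mset is)" for "is"
  have c: "mset (c is) = mset is" for "is" unfolding c_def by (rule someI[of _ "is"]) simp
  have lc: "length (c is) = length is" for "is" using mset_eq_length[OF c[of "is"]] .
  have rep: "weak_rep \<Omega> u is = (\<lambda>x. if x \<in> \<Omega> then weak_deriv \<Omega> (c is) u x else 0)" for "is"
   unfolding weak_rep_def[abs_def] c_def by (rule refl)
  have ls: "\<Omega> \<in> sets lebesgue" using op by (simp add: lborelD)
  have hw: "has_weak_deriv \<Omega> (c is) u (weak_deriv \<Omega> (c is) u)" if "length is \<le> N" for "is"
  proof -
   have "\<exists>v. has_weak_deriv \<Omega> (c is) u v" using wd that lc by (auto simp: weakly_differentiable_def)
   then show ?thesis unfolding weak_deriv_def by (rule someI_ex)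
  qed
  have hw': "has_weak_deriv \<Omega> is u (weak_deriv \<Omega> (c is) u)" if "length is \<le> N" for "is"
   using has_weak_deriv_mset_cong[OF c hw[OF that]] .
  have pair: "(\<integral>x. weak_rep \<Omega> u is x * \<phi> x \<partial>lebesgue) = (-1) ^ length is * (\<integral>x. u x * partial_derivs is \<phi> x \<partial>lebesgue_on \<Omega>)"
   if l: "length is \<le> N" and \<phi>: "\<phi> \<in> test_functions \<Omega>" for "is" \<phi>
  proof -
   obtain K where K: "K \<subseteq> \<Omega>" "vanishes_off K \<phi>" using \<phi> by (rule test_functionsE)
   have "(\<integral>x. weak_rep \<Omega> u is x * \<phi> x \<partial>lebesgue) = (\<integral>x. weak_deriv \<Omega> (c is) u x * \<phi> x \<partial>lebesgue)"
    using K by (intro Bochner_Integration.integral_cong) (auto simp: rep vanishes_off_def)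
   also have "\<dots> = (\<integral>x. weak_deriv \<Omega> (c is) u x * \<phi> x \<partial>lebesgue_on \<Omega>)" using integral_on_test[OF \<phi> ls] by simp
   also have "\<dots> = (-1) ^ length is * (\<integral>x. u x * partial_derivs is \<phi> x \<partial>lebesgue_on \<Omega>)"
    using hw'[OF l] \<phi> by (simp add: has_weak_deriv_def mult.assoc[symmetric] power_add[symmetric])
   finally show ?thesis .
  qed
  show "sobolev_family \<Omega> N (weak_rep \<Omega> u)"
  proof
   show "open \<Omega>" "bounded \<Omega>" by fact+
   fix "is" js :: "'n list" and x \<phi> j
   show "integrable lebesgue (weak_rep \<Omega> u is)" if "length is \<le> N"
    using int[of "c is"] that lc unfolding rep by (subst Lebesgue_Measure.integrable_restrict_UNIV[OF ls]) simp
   show "x \<notin> \<Omega> \<Longrightarrow> weak_rep \<Omega> u is x = 0" by (simp add: weak_rep_def)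
   show "mset is = mset js \<Longrightarrow> weak_rep \<Omega> u is = weak_rep \<Omega> u js" by (rule ext) (auto simp: weak_rep_def)
   assume l: "length is < N" and \<phi>: "\<phi> \<in> test_functions \<Omega>"
   have sm: "smooth \<phi>" using \<phi> by (auto elim: test_functionsE)
   have "partial_derivs (j # is) \<phi> = partial_derivs is (partial_deriv j \<phi>)"
    using partial_derivs_swap[OF sm, of "is" j "[]"] by (simp add: partial_derivs_append)
   then show "(\<integral>x. weak_rep \<Omega> u is x * partial_deriv j \<phi> x \<partial>lebesgue) = - (\<integral>x. weak_rep \<Omega> u (j # is) x * \<phi> x \<partial>lebesgue)"
    using pair[of "is" "partial_deriv j \<phi>"] pair[of "j # is" \<phi>] l \<phi> test_functions_partial_deriv[OF \<phi>] by simp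
  qed
  have lu: "locally_integrable \<Omega> u" using hw'[of "[]"] by (simp add: has_weak_deriv_def)
  have "has_weak_deriv \<Omega> [] u u" using lu by (simp add: has_weak_deriv_def)
  then have "AE x in lebesgue_on \<Omega>. weak_deriv \<Omega> (c []) u x = u x"
   using hw'[of "[]"] op by (intro has_weak_deriv_unique[of \<Omega> "[]" u]) auto
  moreover have "AE x in lebesgue_on \<Omega>. x \<in> \<Omega>" using ls by (intro AE_I2) simp
  ultimately show "AE x in lebesgue_on \<Omega>. weak_rep \<Omega> u [] x = u x" by eventually_elim (simp add: rep)
qed

section \<open>Rearrangements and integrals over small sets\<close>

lemma down_closed_borel:
  fixes S :: "real set"
  assumes "\<And>x y. y \<in> S \<Longrightarrow> x \<le> y \<Longrightarrow> x \<in> S"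
  shows "S \<in> sets borel"
proof (cases "S = {} \<or> \<not> bdd_above S")
  case True
  then have "S = {} \<or> S = UNIV" using assms unfolding bdd_above_def by (metis UNIV_eq_I linear)
  then show ?thesis by auto
next
  case False
  then have ne: "S \<noteq> {}" "bdd_above S" by auto
  have "{..<Sup S} \<subseteq> S" using less_cSup_iff[OF ne] assms by (meson lessThan_iff less_imp_le subsetI)
  moreover have "S \<subseteq> {..Sup S}" using cSup_upper[OF _ ne(2)] by auto
  ultimately have "S = {..<Sup S} \<or> S = {..Sup S}" by (metis atMost_iff lessThan_iff order_le_less subset_antisym subset_iff)
  then show ?thesis by (metis atMost_borel lessThan_borel)
qed

lemma antimono_borel_measurable:
  fixes f :: "real \<Rightarrow> ennreal"
  assumes "\<And>x y. x \<le> y \<Longrightarrow> f y \<le> f x"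
  shows "f \<in> borel_measurable borel"
proof (rule borel_measurableI_greater)
  fix c
  have "{x. c < f x} \<in> sets borel" by (rule down_closed_borel) (use assms in \<open>auto intro: less_le_trans\<close>)
  then show "{x \<in> space borel. c < f x} \<in> sets borel" by simp
qed

lemma rearr_antimono: "s \<le> s' \<Longrightarrow> rearr M f s' \<le> rearr M f s"
  unfolding rearr_def by (rule Inf_superset_mono) (auto intro: order_trans ennreal_leI)

lemma rearr_borel_measurable [measurable]: "rearr M f \<in> borel_measurable borel"
  by (rule antimono_borel_measurable) (rule rearr_antimono)

lemma rearr_ge:
  assumes "f \<in> borel_measurable M" "ennreal s < emeasure M {x \<in> space M. c \<le> f x}"
  shows "c \<le> rearr M f s"
  unfolding rearr_def
proof (rule Inf_greatest, rule ccontr)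
  fix t assume t: "t \<in> {t. emeasure M {x \<in> space M. t < f x} \<le> ennreal s}" "\<not> c \<le> t"
  have "emeasure M {x \<in> space M. c \<le> f x} \<le> emeasure M {x \<in> space M. t < f x}" using t(2) assms(1) by (intro emeasure_mono) auto
  then show False using t(1) assms(2) by (auto dest: order_trans)
qed

lemma emeasure_upto_ennreal: "emeasure lborel {l. 0 \<le> l \<and> ennreal l \<le> a} = a"
proof (cases a)
  case (real r)
  then have "{l. 0 \<le> l \<and> ennreal l \<le> a} = {0..r}" by auto
  then show ?thesis using real by simp
next
  case top
  then have eq: "{l::real. 0 \<le> l \<and> ennreal l \<le> a} = {0..}" by auto
  have "of_nat k \<le> emeasure lborel {0::real..}" for k :: nat
  proof -
   have "emeasure lborel {0..real k} \<le> emeasure lborel {0::real..}" by (intro emeasure_mono) auto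
   then show ?thesis by (simp add: ennreal_of_nat_eq_real_of_nat)
  qed
  then have "(SUP k::nat. of_nat k) \<le> emeasure lborel {0::real..}" by (rule SUP_least)
  then have "emeasure lborel {0::real..} = top" by (simp add: ennreal_SUP_of_nat_eq_top top_unique)
  then show ?thesis using eq top by simp
qed

text \<open>Fubini for the region below the graph. Levels are real, and closed superlevel sets are
  used so as to match \<open>rearr_ge\<close>; the value \<infinity> is covered as well.\<close>

lemma layer_cake:
  assumes M: "sigma_finite_measure M" and [measurable]: "h \<in> borel_measurable M"
  shows "(\<integral>\<^sup>+x. h x \<partial>M) = (\<integral>\<^sup>+l. emeasure M {x \<in> space M. ennreal l \<le> h x} * indicator {0..} l \<partial>lborel)"
proof -
  interpret M: sigma_finite_measure M by fact
  interpret P: pair_sigma_finite M lborel ..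
  have [measurable]: "(\<lambda>p. indicator {0..} (snd p) * (if ennreal (snd p) \<le> h (fst p) then 1 else 0) :: ennreal) \<in> borel_measurable (M \<Otimes>\<^sub>M lborel)"
   by measurable
  have "(\<integral>\<^sup>+x. h x \<partial>M) = (\<integral>\<^sup>+x. \<integral>\<^sup>+l. indicator {0..} l * (if ennreal l \<le> h x then 1 else 0) \<partial>lborel \<partial>M)"
  proof (intro nn_integral_cong)
   fix x
   have "(\<integral>\<^sup>+l. indicator {0..} l * (if ennreal l \<le> h x then 1 else 0) \<partial>lborel) = (\<integral>\<^sup>+l. indicator {l. 0 \<le> l \<and> ennreal l \<le> h x} l \<partial>lborel)"
    by (intro nn_integral_cong) (auto simp: indicator_def)
   also have "\<dots> = h x" by (subst nn_integral_indicator) (auto simp: emeasure_upto_ennreal)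
   finally show "h x = (\<integral>\<^sup>+l. indicator {0..} l * (if ennreal l \<le> h x then 1 else 0) \<partial>lborel)" by simp
  qed
  also have "\<dots> = (\<integral>\<^sup>+l. \<integral>\<^sup>+x. indicator {0..} l * (if ennreal l \<le> h x then 1 else 0) \<partial>M \<partial>lborel)"
   by (rule P.Fubini'[symmetric]) measurable
  also have "\<dots> = (\<integral>\<^sup>+l. emeasure M {x \<in> space M. ennreal l \<le> h x} * indicator {0..} l \<partial>lborel)"
  proof (intro nn_integral_cong)
   fix l :: real
   have "(\<integral>\<^sup>+x. indicator {0..} l * (if ennreal l \<le> h x then 1 else 0) \<partial>M) = (\<integral>\<^sup>+x. indicator {0..} l * indicator {x \<in> space M. ennreal l \<le> h x} x \<partial>M)"
    by (intro nn_integral_cong) (auto simp: indicator_def)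
   also have "\<dots> = indicator {0..} l * emeasure M {x \<in> space M. ennreal l \<le> h x}" by (subst nn_integral_cmult) auto
   finally show "(\<integral>\<^sup>+x. indicator {0..} l * (if ennreal l \<le> h x then 1 else 0) \<partial>M) = emeasure M {x \<in> space M. ennreal l \<le> h x} * indicator {0..} l"
    by (simp add: mult.commute)
  qed
  finally show ?thesis .
qed

definition rearr_scaled :: "'a::euclidean_space set \<Rightarrow> ('a \<Rightarrow> real) \<Rightarrow> real \<Rightarrow> ennreal"
  where "rearr_scaled \<Omega> u s = rearr (lebesgue_on \<Omega>) (\<lambda>x. ennreal \<bar>u x\<bar>) (measure lebesgue \<Omega> * s)"

abbreviation unit_meas :: "real measure" where "unit_meas \<equiv> lebesgue_on {0<..<1}"

text \<open>The norm rearranges twice: \<open>rearr_scaled\<close> is already a rearrangement, and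
  \<open>rearr_avg\<close> rearranges it again on the unit interval. The present integral is t times
  that average. Level sets of both rearrangements are compared directly instead of identifying the
  two.\<close>

definition rearr_int :: "'a::euclidean_space set \<Rightarrow> ('a \<Rightarrow> real) \<Rightarrow> real \<Rightarrow> ennreal"
  where "rearr_int \<Omega> u t = (\<integral>\<^sup>+s\<in>{0<..<t}. rearr unit_meas (rearr_scaled \<Omega> u) s \<partial>lborel)"

lemma rearr_scaled_measurable [measurable]: "rearr_scaled \<Omega> u \<in> borel_measurable borel"
  unfolding rearr_scaled_def by measurable

lemma LZ_norm_on_eq:
  "LZ_norm_on \<Omega> q \<alpha> \<beta> u = Lq_norm unit_meas q
    (\<lambda>s. ennreal (s powr (1 - recip q) * ell s powr \<alpha> * ellell s powr \<beta>) * (rearr_int \<Omega> u s / ennreal s))"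
  by (simp add: LZ_norm_on_def LZ_norm_def rearr_avg_def rearr_int_def rearr_scaled_def[abs_def])

lemma emeasure_unit_meas: "A \<in> sets lebesgue \<Longrightarrow> A \<subseteq> {0<..<1} \<Longrightarrow> emeasure unit_meas A = emeasure lebesgue A"
  by (rule emeasure_restrict_space) (auto simp: inf.absorb1)

text \<open>A Hardy-Littlewood inequality, proved level by level. The part of a superlevel set in D
  has measure at most \<open>t * measure lebesgue \<Omega>\<close> and at most that of the whole
  superlevel set, and on an interval of the corresponding length inside \<open>(0, t)\<close> the
  rearrangement reaches the level.\<close>

lemma nn_integral_le_rearr_int:
  fixes \<Omega> :: "'a::euclidean_space set" and u :: "'a \<Rightarrow> real"
  assumes \<Omega>: "\<Omega> \<in> lmeasurable" "0 < measure lebesgue \<Omega>"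
   and u: "u \<in> borel_measurable (lebesgue_on \<Omega>)"
   and D: "D \<in> sets lebesgue" "D \<subseteq> \<Omega>" "measure lebesgue D \<le> t * measure lebesgue \<Omega>"
  shows "(\<integral>\<^sup>+x\<in>D. ennreal \<bar>u x\<bar> \<partial>lebesgue_on \<Omega>) \<le> ennreal (measure lebesgue \<Omega>) * rearr_int \<Omega> u t"
proof -
  let ?V = "measure lebesgue \<Omega>" and ?M = "lebesgue_on \<Omega>"
  define g where "g = rearr_scaled \<Omega> u"
  have \<Omega>s: "\<Omega> \<in> sets lebesgue" using \<Omega>(1) by auto
  have fm: "finite_measure ?M" by (rule finite_measure_lebesgue_on[OF \<Omega>(1)])
  interpret F: finite_measure ?M by (rule fm)
  have um: "(\<lambda>x. ennreal \<bar>u x\<bar>) \<in> borel_measurable ?M" using u by measurable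
  have DM: "D \<in> sets ?M" using D \<Omega>s by (simp add: sets_restrict_space_iff)
  define h where "h x = ennreal \<bar>u x\<bar> * indicator D x" for x
  have hm: "h \<in> borel_measurable ?M" unfolding h_def using um DM by measurable
  define gs where "gs s = rearr unit_meas g s * indicator {0<..<t} s" for s
  let ?E = "\<lambda>l. emeasure lborel {s. ennreal l \<le> gs s}"
  have gsm: "gs \<in> borel_measurable lborel" unfolding gs_def by measurable
  define m where "m l = emeasure ?M {x \<in> \<Omega>. ennreal l \<le> ennreal \<bar>u x\<bar>}" for l
  have mV: "m l \<le> ennreal ?V" for l
  proof -
   have "m l \<le> emeasure ?M (space ?M)" unfolding m_def by (rule emeasure_space)
   also have "\<dots> = emeasure lebesgue \<Omega>" using \<Omega>s by (simp add: emeasure_restrict_space)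
   also have "\<dots> = ennreal ?V" by (rule emeasure_eq_measure2[OF \<Omega>(1)])
   finally show ?thesis .
  qed
  \<comment> \<open>\<open>rearr_ge\<close> is used twice, once for each rearrangement.\<close>
  have key: "ennreal l \<le> rearr unit_meas g s" if s: "0 < s" "ennreal (?V * s) < m l" for l s
  proof (rule rearr_ge)
   show "g \<in> borel_measurable unit_meas" unfolding g_def by (intro measurable_restrict_space1 measurable_completion) measurable
   define r where "r = enn2real (m l) / ?V"
   have mfin: "m l = ennreal (enn2real (m l))" using le_less_trans[OF mV[of l] ennreal_less_top] by simp
   have r1: "r \<le> 1" using mV[of l] \<Omega>(2) unfolding r_def by (subst (asm) mfin) simp
   have sr: "s < r" using s \<Omega>(2) unfolding r_def by (subst (asm) mfin) (simp add: ennreal_less_iff field_simps)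
   have gl: "ennreal l \<le> g \<sigma>" if \<sigma>: "0 < \<sigma>" "\<sigma> < r" for \<sigma>
   proof -
    have "?V * \<sigma> < enn2real (m l)" using \<sigma> \<Omega>(2) by (simp add: r_def field_simps)
    then have "ennreal (?V * \<sigma>) < m l" using \<sigma> \<Omega>(2) by (subst mfin) (simp add: ennreal_less_iff)
    then show ?thesis unfolding g_def rearr_scaled_def using um by (intro rearr_ge) (auto simp: m_def)
   qed
   have "ennreal s < ennreal r" using sr s by (simp add: ennreal_less_iff)
   also have "\<dots> = emeasure unit_meas {0<..<r}" using r1 sr s by (subst emeasure_unit_meas) auto
   also have "\<dots> \<le> emeasure unit_meas {x \<in> space unit_meas. ennreal l \<le> g x}"
   proof (rule emeasure_mono)
    show "{0<..<r} \<subseteq> {x \<in> space unit_meas. ennreal l \<le> g x}" using gl r1 by auto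
    have [measurable]: "g \<in> borel_measurable unit_meas"
     unfolding g_def by (intro measurable_restrict_space1 measurable_completion) measurable
    show "{x \<in> space unit_meas. ennreal l \<le> g x} \<in> sets unit_meas" by measurable
   qed
   finally show "ennreal s < emeasure unit_meas {x \<in> space unit_meas. ennreal l \<le> g x}" .
  qed
  \<comment> \<open>The level 0 is left out, because its superlevel set is all of \<Omega> and not a
    part of D. A single level does not affect the integral.\<close>
  have lev: "emeasure ?M {x \<in> \<Omega>. ennreal l \<le> h x} * indicator {0..} l \<le> ennreal ?V * (?E l * indicator {0..} l)"
   if l: "l \<noteq> 0" for l
  proof (cases "l > 0")
   case True
   define a where "a = emeasure ?M {x \<in> \<Omega>. ennreal l \<le> h x}"
   have sub: "{x \<in> \<Omega>. ennreal l \<le> h x} \<subseteq> D" using True by (auto simp: h_def indicator_def split: if_splits)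
   have aD: "a \<le> ennreal (measure lebesgue D)"
   proof -
    have "a \<le> emeasure ?M D" unfolding a_def using sub DM by (intro emeasure_mono) auto
    also have "\<dots> = emeasure lebesgue D" using \<Omega>s D by (intro emeasure_restrict_space) (auto simp: inf.absorb1)
    also have "\<dots> = ennreal (measure lebesgue D)" by (rule emeasure_eq_measure2[OF fmeasurableI2[OF \<Omega>(1) D(2,1)]])
    finally show ?thesis .
   qed
   have am: "a \<le> m l" unfolding a_def m_def
   proof (rule emeasure_mono)
    show "{x \<in> \<Omega>. ennreal l \<le> h x} \<subseteq> {x \<in> \<Omega>. ennreal l \<le> ennreal \<bar>u x\<bar>}"
    proof
     fix x assume x: "x \<in> {x \<in> \<Omega>. ennreal l \<le> h x}"
     then show "x \<in> {x \<in> \<Omega>. ennreal l \<le> ennreal \<bar>u x\<bar>}" using True by (cases "x \<in> D") (auto simp: h_def)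
    qed
    have "{x \<in> space ?M. ennreal l \<le> ennreal \<bar>u x\<bar>} \<in> sets ?M" using um by measurable
    then show "{x \<in> \<Omega>. ennreal l \<le> ennreal \<bar>u x\<bar>} \<in> sets ?M" by (simp only: space_lebesgue_on)
   qed
   define r where "r = enn2real a"
   have ar: "a = ennreal r" using le_less_trans[OF aD ennreal_less_top] unfolding r_def by simp
   have "ennreal r \<le> ennreal (measure lebesgue D)" using aD by (simp only: ar)
   then have "r \<le> measure lebesgue D" by (simp add: ennreal_le_iff)
   then have r: "0 \<le> r" "r \<le> t * ?V" using D(3) by (auto simp: r_def)
   have "{0<..<r / ?V} \<subseteq> {s. ennreal l \<le> gs s}"
   proof
    fix s assume s: "s \<in> {0<..<r / ?V}"
    then have "?V * s < r" using \<Omega>(2) by (simp add: field_simps)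
    then have "ennreal (?V * s) < a" using s \<Omega>(2) unfolding ar by (simp add: ennreal_less_iff)
    then have "ennreal (?V * s) < m l" using am by (rule less_le_trans)
    moreover have "s < t"
    proof -
     have "?V * s < ?V * t" using \<open>?V * s < r\<close> r(2) by (simp add: mult.commute)
     then show ?thesis using \<Omega>(2) by simp
    qed
    ultimately show "s \<in> {s. ennreal l \<le> gs s}" using key[of s l] s by (simp add: gs_def)
   qed
   then have "emeasure lborel {0<..<r / ?V} \<le> ?E l" using gsm by (intro emeasure_mono) auto
   then have "ennreal (r / ?V) \<le> ?E l" using r \<Omega>(2) by simp
   then have "ennreal ?V * ennreal (r / ?V) \<le> ennreal ?V * ?E l" by (rule mult_left_mono) simp
   then show ?thesis using True \<Omega>(2) r ar unfolding a_def[symmetric] by (simp add: ennreal_mult[symmetric])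
  qed (use l in auto)
  have "(\<integral>\<^sup>+x\<in>D. ennreal \<bar>u x\<bar> \<partial>?M) = (\<integral>\<^sup>+l. emeasure ?M {x \<in> \<Omega>. ennreal l \<le> h x} * indicator {0..} l \<partial>lborel)"
   using layer_cake[OF F.sigma_finite_measure_axioms hm] by (simp add: h_def)
  also have "\<dots> \<le> (\<integral>\<^sup>+l. ennreal ?V * (?E l * indicator {0..} l) \<partial>lborel)"
   by (rule nn_integral_mono_AE, use AE_lborel_singleton[of "0::real"] in eventually_elim) (rule lev)
  also have "\<dots> = ennreal ?V * (\<integral>\<^sup>+l. ?E l * indicator {0..} l \<partial>lborel)"
  proof (rule nn_integral_cmult)
   have "(\<lambda>l. ?E l) \<in> borel_measurable borel"
   proof (rule antimono_borel_measurable)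
    fix x y :: real assume "x \<le> y"
    then show "emeasure lborel {s. ennreal y \<le> gs s} \<le> emeasure lborel {s. ennreal x \<le> gs s}"
     using gsm by (intro emeasure_mono) (auto intro: order_trans ennreal_leI)
   qed
   then show "(\<lambda>l. ?E l * indicator {0..} l) \<in> borel_measurable lborel" by measurable
  qed
  also have "(\<integral>\<^sup>+l. ?E l * indicator {0..} l \<partial>lborel) = (\<integral>\<^sup>+s. gs s \<partial>lborel)"
   using layer_cake[OF sigma_finite_lborel gsm] by simp
  also have "\<dots> = rearr_int \<Omega> u t" by (simp add: gs_def rearr_int_def g_def)
  finally show ?thesis .
qed

lemma rearr_int_mono: "t \<le> t' \<Longrightarrow> rearr_int \<Omega> u t \<le> rearr_int \<Omega> u t'"
  unfolding rearr_int_def by (intro nn_integral_mono) (auto simp: indicator_def)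

text \<open>The rearrangement is decreasing: beyond t it is at most its value at t, and this is at
  most its average over \<open>(0, t)\<close>. The factor obtained is 1 + 1 / t.\<close>

lemma rearr_int_1_le:
  assumes t: "0 < t" "t \<le> 1"
  shows "rearr_int \<Omega> u 1 \<le> ennreal (2 / t) * rearr_int \<Omega> u t"
proof -
  let ?g = "rearr unit_meas (rearr_scaled \<Omega> u)"
  have "rearr_int \<Omega> u 1 \<le> (\<integral>\<^sup>+s. ?g s * indicator {0<..<t} s + ?g t * indicator {t..1} s \<partial>lborel)"
   unfolding rearr_int_def
  proof (rule nn_integral_mono)
   fix s show "?g s * indicator {0<..<1} s \<le> ?g s * indicator {0<..<t} s + ?g t * indicator {t..1} s"
    using rearr_antimono[of t s unit_meas "rearr_scaled \<Omega> u"] by (auto simp: indicator_def)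
  qed
  also have "\<dots> = rearr_int \<Omega> u t + ?g t * ennreal (1 - t)"
   using t by (subst nn_integral_add) (auto simp: rearr_int_def nn_integral_cmult_indicator)
  also have "\<dots> \<le> rearr_int \<Omega> u t + ?g t * 1" using t by (intro add_left_mono mult_left_mono) auto
  also have "?g t * 1 \<le> ennreal (1 / t) * rearr_int \<Omega> u t"
  proof -
   have "?g t * ennreal t = (\<integral>\<^sup>+s. ?g t * indicator {0<..<t} s \<partial>lborel)"
    using t by (subst nn_integral_cmult_indicator) auto
   also have "\<dots> \<le> rearr_int \<Omega> u t" unfolding rearr_int_def
    by (intro nn_integral_mono) (auto simp: indicator_def intro!: rearr_antimono)
   finally have "ennreal (1 / t) * (?g t * ennreal t) \<le> ennreal (1 / t) * rearr_int \<Omega> u t" by (rule mult_left_mono) simp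
   moreover have "ennreal (1 / t) * ennreal t = 1" using t by (simp add: ennreal_mult[symmetric])
   moreover have "ennreal (1 / t) * (?g t * ennreal t) = ?g t * (ennreal (1 / t) * ennreal t)" by (simp only: mult_ac)
   ultimately show ?thesis by simp
  qed
  also have "rearr_int \<Omega> u t + ennreal (1 / t) * rearr_int \<Omega> u t = (ennreal 1 + ennreal (1 / t)) * rearr_int \<Omega> u t"
   by (simp add: distrib_right)
  also have "\<dots> \<le> ennreal (2 / t) * rearr_int \<Omega> u t"
  proof (rule mult_right_mono)
   have "ennreal 1 + ennreal (1 / t) = ennreal (1 + 1 / t)" using t by (intro ennreal_plus[symmetric]) auto
   also have "\<dots> \<le> ennreal (2 / t)" using t by (intro ennreal_leI) (simp add: field_simps)
   finally show "ennreal 1 + ennreal (1 / t) \<le> ennreal (2 / t)" .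
  qed simp
  finally show ?thesis by (simp add: add_left_mono)
qed

lemma rearr_le:
  assumes "emeasure M {x \<in> space M. c < f x} \<le> ennreal s"
  shows "rearr M f s \<le> c"
  unfolding rearr_def by (rule Inf_lower) (use assms in simp)

text \<open>Both rearrangements are at most c and vanish from b on, because c bounds u and the set
  where u is nonzero lies in D up to a null set.\<close>

lemma rearr_int_le_bump:
  fixes \<Omega> :: "'a::euclidean_space set" and u :: "'a \<Rightarrow> real"
  assumes \<Omega>: "\<Omega> \<in> lmeasurable" "0 < measure lebesgue \<Omega>"
   and D: "D \<in> sets lebesgue" "D \<subseteq> \<Omega>" "measure lebesgue D \<le> b * measure lebesgue \<Omega>"
   and u: "AE x in lebesgue_on \<Omega>. \<bar>u x\<bar> \<le> c * indicator D x" "u \<in> borel_measurable (lebesgue_on \<Omega>)" and c: "0 \<le> c" and t: "0 \<le> t"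
  shows "rearr_int \<Omega> u t \<le> ennreal (c * min t b)"
proof -
  let ?V = "measure lebesgue \<Omega>" and ?M = "lebesgue_on \<Omega>"
  have \<Omega>s: "\<Omega> \<in> sets lebesgue" using \<Omega>(1) by auto
  have um: "(\<lambda>x. ennreal \<bar>u x\<bar>) \<in> borel_measurable ?M" using u by measurable
  have DM: "D \<in> sets ?M" using D \<Omega>s by (simp add: sets_restrict_space_iff)
  have b0: "0 \<le> b" using D(3) \<Omega>(2) measure_nonneg[of lebesgue D] by (metis linorder_not_less mult_neg_pos order_less_le_trans)
  have gc: "rearr_scaled \<Omega> u s \<le> ennreal c" if "0 \<le> s" for s unfolding rearr_scaled_def
  proof (rule rearr_le)
   have "AE x in ?M. x \<notin> {x \<in> space ?M. ennreal c < ennreal \<bar>u x\<bar>}" using u(1)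
   proof eventually_elim
    case (elim x) then show ?case using c by (cases "x \<in> D") (auto simp: ennreal_less_iff)
   qed
   moreover have "{x \<in> space ?M. ennreal c < ennreal \<bar>u x\<bar>} \<in> sets ?M" using um by measurable
   ultimately have "{x \<in> space ?M. ennreal c < ennreal \<bar>u x\<bar>} \<in> null_sets ?M" using AE_iff_null_sets by blast
   then have "emeasure ?M {x \<in> space ?M. ennreal c < ennreal \<bar>u x\<bar>} = 0" by (rule null_setsD1)
   then show "emeasure ?M {x \<in> space ?M. ennreal c < ennreal \<bar>u x\<bar>} \<le> ennreal (?V * s)" by simp
  qed
  have g0: "rearr_scaled \<Omega> u s \<le> 0" if s: "b \<le> s" for s unfolding rearr_scaled_def
  proof (rule rearr_le)
   have "emeasure ?M {x \<in> space ?M. 0 < ennreal \<bar>u x\<bar>} \<le> emeasure ?M D"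
   proof (rule emeasure_mono_AE[OF _ DM])
    show "AE x in ?M. x \<in> {x \<in> space ?M. 0 < ennreal \<bar>u x\<bar>} \<longrightarrow> x \<in> D" using u(1)
    proof eventually_elim
     case (elim x) then show ?case by (cases "x \<in> D") auto
    qed
   qed
   also have "\<dots> = emeasure lebesgue D" using \<Omega>s D by (intro emeasure_restrict_space) (auto simp: inf.absorb1)
   also have "\<dots> = ennreal (measure lebesgue D)" by (rule emeasure_eq_measure2[OF fmeasurableI2[OF \<Omega>(1) D(2,1)]])
   also have "\<dots> \<le> ennreal (?V * s)"
   proof (rule ennreal_leI)
    have "b * ?V \<le> s * ?V" using s \<Omega>(2) by simp
    then show "measure lebesgue D \<le> ?V * s" using D(3) by (simp add: mult.commute)
   qed
   finally show "emeasure ?M {x \<in> space ?M. 0 < ennreal \<bar>u x\<bar>} \<le> ennreal (?V * s)" .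
  qed
  have h: "rearr unit_meas (rearr_scaled \<Omega> u) s \<le> ennreal c * indicator {..<b} s" if s: "0 < s" for s
  proof (cases "s < b")
   case True
   have "rearr unit_meas (rearr_scaled \<Omega> u) s \<le> ennreal c"
   proof (rule rearr_le)
    have e: "{x \<in> space unit_meas. ennreal c < rearr_scaled \<Omega> u x} = {}"
    proof -
     have "\<not> ennreal c < rearr_scaled \<Omega> u x" if "x \<in> {0<..<1}" for x using gc[of x] that by (simp add: not_less)
     then show ?thesis by auto
    qed
    show "emeasure unit_meas {x \<in> space unit_meas. ennreal c < rearr_scaled \<Omega> u x} \<le> ennreal s" unfolding e by simp
   qed
   then show ?thesis using True by simp
  next
   case False
   have "rearr unit_meas (rearr_scaled \<Omega> u) s \<le> 0"
   proof (rule rearr_le)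
    have "{x \<in> space unit_meas. 0 < rearr_scaled \<Omega> u x} \<subseteq> {0<..<min b 1}"
    proof
     fix x assume x: "x \<in> {x \<in> space unit_meas. 0 < rearr_scaled \<Omega> u x}"
     then have "\<not> b \<le> x" using g0[of x] by auto
     then show "x \<in> {0<..<min b 1}" using x by auto
    qed
    then have "emeasure unit_meas {x \<in> space unit_meas. 0 < rearr_scaled \<Omega> u x} \<le> emeasure unit_meas {0<..<min b 1}"
     by (intro emeasure_mono) (auto simp: sets_restrict_space_iff)
    also have "\<dots> = emeasure lebesgue {0<..<min b 1}" by (rule emeasure_unit_meas) auto
    also have "\<dots> = ennreal (min b 1)" using b0 by simp
    also have "\<dots> \<le> ennreal s" using False by (intro ennreal_leI) auto
    finally show "emeasure unit_meas {x \<in> space unit_meas. 0 < rearr_scaled \<Omega> u x} \<le> ennreal s" .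
   qed
   then show ?thesis by simp
  qed
  have "rearr_int \<Omega> u t \<le> (\<integral>\<^sup>+s. ennreal c * indicator {0<..<min t b} s \<partial>lborel)" unfolding rearr_int_def
  proof (rule nn_integral_mono)
   fix s show "rearr unit_meas (rearr_scaled \<Omega> u) s * indicator {0<..<t} s \<le> ennreal c * indicator {0<..<min t b} s"
    using h[of s] by (auto simp: indicator_def split: if_splits)
  qed
  also have "\<dots> = ennreal c * ennreal (min t b)" using t b0 by (subst nn_integral_cmult_indicator) auto
  also have "\<dots> = ennreal (c * min t b)" using c t b0 by (simp add: ennreal_mult)
  finally show ?thesis .
qed

section \<open>The reciprocal of the modulus\<close>

text \<open>The absolute value of p covers both signs of the exponent. That c is at least 1 follows
  from the hypotheses.\<close>

lemma powr_ratio: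
  fixes A A' c p :: real
  assumes "1 \<le> A" "A \<le> A'" "A' \<le> c * A"
  shows "A' powr p \<le> c powr \<bar>p\<bar> * A powr p" "A powr p \<le> c powr \<bar>p\<bar> * A' powr p"
proof -
  have c1: "1 \<le> c"
  proof (rule ccontr)
   assume "\<not> 1 \<le> c"
   then have "c * A < 1 * A" using assms by (intro mult_strict_right_mono) auto
   then show False using assms by linarith
  qed
  have cp: "1 \<le> c powr \<bar>p\<bar>" using c1 by (intro ge_one_powr_ge_zero) auto
  show "A' powr p \<le> c powr \<bar>p\<bar> * A powr p"
  proof (cases "0 \<le> p")
   case True
   then have "A' powr p \<le> (c * A) powr p" using assms by (intro powr_mono2) auto
   then show ?thesis using True assms c1 by (simp add: powr_mult)
  next
   case False
   then have "A' powr p \<le> A powr p" using assms by (intro powr_mono2') auto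
   also have "\<dots> \<le> c powr \<bar>p\<bar> * A powr p" using cp by (simp add: mult_le_cancel_right1)
   finally show ?thesis .
  qed
  show "A powr p \<le> c powr \<bar>p\<bar> * A' powr p"
  proof (cases "0 \<le> p")
   case True
   then have "A powr p \<le> A' powr p" using assms by (intro powr_mono2) auto
   also have "\<dots> \<le> c powr \<bar>p\<bar> * A' powr p" using cp by (simp add: mult_le_cancel_right1)
   finally show ?thesis .
  next
   case False
   have "(c * A) powr p \<le> A' powr p" using False assms by (intro powr_mono2') auto
   then have "c powr (- p) * (c * A) powr p \<le> c powr (- p) * A' powr p" by (intro mult_left_mono) auto
   moreover have "c powr (- p) * (c * A) powr p = A powr p" using c1 assms by (simp add: powr_mult powr_minus field_simps)
   ultimately show ?thesis using False by simp
  qed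
qed

text \<open>As \<open>1 + ln c \<le> c\<close>, a ratio bound survives the passage from A to 1 + ln
  A with the same c. The conclusions have the form of the hypotheses, so that the lemma can be
  chained for iterated logarithms.\<close>

lemma one_plus_ln_ratio:
  fixes A A' c :: real
  assumes "1 \<le> A" "A \<le> A'" "A' \<le> c * A"
  shows "1 \<le> 1 + ln A" "1 + ln A \<le> 1 + ln A'" "1 + ln A' \<le> c * (1 + ln A)"
proof -
  have c1: "1 \<le> c"
  proof (rule ccontr)
   assume "\<not> 1 \<le> c"
   then have "c * A < 1 * A" using assms by (intro mult_strict_right_mono) auto
   then show False using assms by linarith
  qed
  show "1 \<le> 1 + ln A" using assms by simp
  show "1 + ln A \<le> 1 + ln A'" using assms by simp
  have "ln A' \<le> ln (c * A)" using assms by (intro ln_mono) auto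
  also have "\<dots> = ln c + ln A" using c1 assms by (simp add: ln_mult)
  finally have "1 + ln A' \<le> 1 + ln c + ln A" by simp
  also have "\<dots> \<le> c + ln A" using ln_le_minus_one[of c] c1 by simp
  also have "ln A \<le> c * ln A" using c1 assms by (simp add: mult_le_cancel_right1)
  finally show "1 + ln A' \<le> c * (1 + ln A)" by (simp add: algebra_simps)
qed

definition pow_log :: "real \<Rightarrow> real \<Rightarrow> real \<Rightarrow> real"
  where "pow_log a b y = y powr a * (1 + ln y) powr b"

text \<open>The reciprocal of \<open>\<omega> r\<close>, up to constants, as a function of \<open>y = 1 - ln r\<close>. Adding \<open>1\<close> to the iterated
  logarithms makes it positive for all \<open>y \<ge> 1\<close>.\<close>

definition gauge :: "ennreal \<Rightarrow> real \<Rightarrow> real \<Rightarrow> real \<Rightarrow> real"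
  where "gauge q \<alpha> \<beta> y =
   (if \<alpha> > - recip q then pow_log (recip q + \<alpha>) \<beta> y
    else if \<beta> > - recip q then pow_log 0 (recip q + \<beta>) y
    else (1 + ln (1 + ln y)) powr recip q)"

lemma recip_nonneg: "0 \<le> recip q" by (simp add: recip_def)

lemma pow_log_pos: "1 \<le> y \<Longrightarrow> 0 < pow_log a b y"
proof -
  assume "1 \<le> y"
  then have "0 < y" "0 < 1 + ln y" using ln_ge_zero[of y] by linarith+
  then show ?thesis by (simp add: pow_log_def)
qed

lemma pow_log_inverse: "1 \<le> y \<Longrightarrow> pow_log (- a) (- b) y = 1 / pow_log a b y"
  by (simp add: pow_log_def powr_minus field_simps)


lemma pow_log_powr: "1 \<le> y \<Longrightarrow> pow_log a b y powr p = pow_log (a * p) (b * p) y"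
proof -
  assume "1 \<le> y"
  then have "0 < y" "0 < 1 + ln y" using ln_ge_zero[of y] by linarith+
  then show ?thesis by (simp add: pow_log_def powr_mult powr_powr)
qed

lemma gauge_pos: "1 \<le> y \<Longrightarrow> 0 < gauge q \<alpha> \<beta> y"
proof -
  assume y: "1 \<le> y"
  then have "1 \<le> 1 + ln y" by simp
  then have "0 < 1 + ln (1 + ln y)" using ln_ge_zero[of "1 + ln y"] by linarith
  then show ?thesis using pow_log_pos[OF y] by (simp add: gauge_def)
qed

lemma pow_log_ratio:
  assumes "1 \<le> y" "y \<le> y'" "y' \<le> c * y"
  shows "pow_log a b y' \<le> c powr (\<bar>a\<bar> + \<bar>b\<bar>) * pow_log a b y" "pow_log a b y \<le> c powr (\<bar>a\<bar> + \<bar>b\<bar>) * pow_log a b y'"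
proof -
  note l = one_plus_ln_ratio[OF assms]
  have "y' powr a * (1 + ln y') powr b \<le> (c powr \<bar>a\<bar> * y powr a) * (c powr \<bar>b\<bar> * (1 + ln y) powr b)"
   by (intro mult_mono powr_ratio assms l) auto
  then show "pow_log a b y' \<le> c powr (\<bar>a\<bar> + \<bar>b\<bar>) * pow_log a b y" by (simp add: pow_log_def powr_add mult_ac)
  have "y powr a * (1 + ln y) powr b \<le> (c powr \<bar>a\<bar> * y' powr a) * (c powr \<bar>b\<bar> * (1 + ln y') powr b)"
   by (intro mult_mono powr_ratio assms l) auto
  then show "pow_log a b y \<le> c powr (\<bar>a\<bar> + \<bar>b\<bar>) * pow_log a b y'" by (simp add: pow_log_def powr_add mult_ac)
qed

text \<open>Each case is a product of powers of y and of its iterated logarithms, and by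
  \<open>one_plus_ln_ratio\<close> each of these changes by a factor of at most c.\<close>

lemma gauge_ratio:
  "\<exists>M\<ge>0. \<forall>y y' c. 1 \<le> y \<longrightarrow> y \<le> y' \<longrightarrow> y' \<le> c * y \<longrightarrow>
   gauge q \<alpha> \<beta> y' \<le> c powr M * gauge q \<alpha> \<beta> y \<and> gauge q \<alpha> \<beta> y \<le> c powr M * gauge q \<alpha> \<beta> y'"
proof -
  consider "\<alpha> > - recip q" | "\<not> \<alpha> > - recip q" "\<beta> > - recip q" | "\<not> \<alpha> > - recip q" "\<not> \<beta> > - recip q" by blast
  then show ?thesis
  proof cases
   case 1
   then show ?thesis using pow_log_ratio[of _ _ _ "recip q + \<alpha>" \<beta>] by (intro exI[of _ "\<bar>recip q + \<alpha>\<bar> + \<bar>\<beta>\<bar>"]) (auto simp: gauge_def)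
  next
   case 2
   then show ?thesis using pow_log_ratio[of _ _ _ 0 "recip q + \<beta>"] by (intro exI[of _ "\<bar>0\<bar> + \<bar>recip q + \<beta>\<bar>"]) (auto simp: gauge_def)
  next
   case 3
   have "(1 + ln (1 + ln y')) powr recip q \<le> c powr \<bar>recip q\<bar> * (1 + ln (1 + ln y)) powr recip q
    \<and> (1 + ln (1 + ln y)) powr recip q \<le> c powr \<bar>recip q\<bar> * (1 + ln (1 + ln y')) powr recip q"
    if "1 \<le> y" "y \<le> y'" "y' \<le> c * y" for y y' c :: real
    using powr_ratio[OF one_plus_ln_ratio[OF one_plus_ln_ratio[OF that]]] by blast
   then show ?thesis using 3 by (intro exI[of _ "\<bar>recip q\<bar>"]) (auto simp: gauge_def)
  qed
qed

lemma poly_le_exp: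
  fixes M \<eta> :: real
  assumes "0 \<le> M" "0 < \<eta>"
  shows "\<exists>K\<ge>1. \<forall>d\<ge>0. (1 + d) powr M \<le> K * exp (\<eta> * d)"
proof -
  define M' where "M' = M + 1"
  have M': "0 < M'" "M \<le> M'" using assms by (auto simp: M'_def)
  \<comment> \<open>Read off from \<open>ln x \<le> x - 1\<close> at
    \<open>x = (1 + d) * \<eta> / M'\<close>. The exponent M is raised by 1 because it has to be
    positive here.\<close>
  define K where "K = exp (\<eta> + M' * \<bar>ln (M' / \<eta>)\<bar>)"
  have "(1 + d) powr M \<le> K * exp (\<eta> * d)" if d: "d \<ge> 0" for d
  proof -
   have "ln (1 + d) = ln ((1 + d) * \<eta> / M') + ln (M' / \<eta>)" using d M' assms by (subst ln_mult_pos[symmetric]) auto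
   also have "\<dots> \<le> (1 + d) * \<eta> / M' + \<bar>ln (M' / \<eta>)\<bar>"
    using ln_le_minus_one[of "(1 + d) * \<eta> / M'"] d M' assms by (intro add_mono) auto
   finally have "M' * ln (1 + d) \<le> M' * ((1 + d) * \<eta> / M' + \<bar>ln (M' / \<eta>)\<bar>)" using M' by (intro mult_left_mono) auto
   also have "\<dots> = \<eta> * d + (\<eta> + M' * \<bar>ln (M' / \<eta>)\<bar>)" using M' by (simp add: field_simps)
   finally have "M' * ln (1 + d) \<le> \<dots>" .
   moreover have "M * ln (1 + d) \<le> M' * ln (1 + d)" using M' d by (intro mult_right_mono) auto
   ultimately have "exp (M * ln (1 + d)) \<le> exp (\<eta> * d + (\<eta> + M' * \<bar>ln (M' / \<eta>)\<bar>))" by simp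
   then show ?thesis using d by (simp add: powr_def K_def exp_add mult.commute)
  qed
  moreover have "1 \<le> K" using M' assms by (simp add: K_def)
  ultimately show ?thesis by blast
qed

lemma ratio_le_one_plus_diff: "1 \<le> y \<Longrightarrow> y \<le> y' \<Longrightarrow> y' \<le> (1 + (y' - y)) * y" for y y' :: real
proof -
  assume "1 \<le> y" "y \<le> y'"
  then have "(y' - y) * 1 \<le> (y' - y) * y" by (intro mult_left_mono) auto
  then show ?thesis by (simp add: algebra_simps)
qed

text \<open>In terms of radii, with y = 1 - ln r, the gauge grows at most like the square root of
  their ratio. That 1 / 2 is below 1 makes the dyadic sums geometric.\<close>

lemma gauge_growth:
  "\<exists>K\<ge>1. \<forall>y y'. 1 \<le> y \<longrightarrow> y \<le> y' \<longrightarrow> gauge q \<alpha> \<beta> y' \<le> K * exp ((y' - y) / 2) * gauge q \<alpha> \<beta> y"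
proof -
  obtain M where M: "0 \<le> M" "\<And>y y' c. 1 \<le> y \<Longrightarrow> y \<le> y' \<Longrightarrow> y' \<le> c * y \<Longrightarrow> gauge q \<alpha> \<beta> y' \<le> c powr M * gauge q \<alpha> \<beta> y"
   using gauge_ratio[of q \<alpha> \<beta>] by blast
  obtain K where K: "1 \<le> K" "\<And>d. 0 \<le> d \<Longrightarrow> (1 + d) powr M \<le> K * exp (1 / 2 * d)"
   using poly_le_exp[OF M(1), of "1/2"] by auto
  have "gauge q \<alpha> \<beta> y' \<le> K * exp ((y' - y) / 2) * gauge q \<alpha> \<beta> y" if y: "1 \<le> y" "y \<le> y'" for y y'
  proof -
   have "gauge q \<alpha> \<beta> y' \<le> (1 + (y' - y)) powr M * gauge q \<alpha> \<beta> y" by (rule M(2)[OF y ratio_le_one_plus_diff[OF y]])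
   also have "\<dots> \<le> (K * exp (1 / 2 * (y' - y))) * gauge q \<alpha> \<beta> y"
    using K(2)[of "y' - y"] y gauge_pos[of y q \<alpha> \<beta>] by (intro mult_right_mono) auto
   finally show ?thesis by simp
  qed
  then show ?thesis using K(1) by blast
qed

lemma pow_log_growth:
  "\<exists>K\<ge>1. \<forall>y y'. 1 \<le> y \<longrightarrow> y \<le> y' \<longrightarrow> pow_log a b y' \<le> K * exp ((y' - y) / 2) * pow_log a b y"
proof -
  obtain K where K: "1 \<le> K" "\<And>d. 0 \<le> d \<Longrightarrow> (1 + d) powr (\<bar>a\<bar> + \<bar>b\<bar>) \<le> K * exp (1 / 2 * d)"
   using poly_le_exp[of "\<bar>a\<bar> + \<bar>b\<bar>" "1/2"] by auto
  have "pow_log a b y' \<le> K * exp ((y' - y) / 2) * pow_log a b y" if y: "1 \<le> y" "y \<le> y'" for y y'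
  proof -
   have "pow_log a b y' \<le> (1 + (y' - y)) powr (\<bar>a\<bar> + \<bar>b\<bar>) * pow_log a b y" by (rule pow_log_ratio[OF y ratio_le_one_plus_diff[OF y]])
   also have "\<dots> \<le> (K * exp (1 / 2 * (y' - y))) * pow_log a b y"
    using K(2)[of "y' - y"] y pow_log_pos[of y a b] by (intro mult_right_mono) auto
   finally show ?thesis by simp
  qed
  then show ?thesis using K(1) by blast
qed

text \<open>A negative power of the logarithm is outweighed by the power of y: for
  \<open>y' = exp d * y\<close> the former loses at most the factor
  \<open>(1 + d) powr \<bar>b\<bar>\<close>, while the latter gains
  \<open>exp (a * d)\<close>.\<close>

lemma pow_log_almost_increasing:
  assumes "0 < a \<or> a = 0 \<and> 0 \<le> b"
  shows "\<exists>K\<ge>1. \<forall>y y'. 1 \<le> y \<longrightarrow> y \<le> y' \<longrightarrow> pow_log a b y \<le> K * pow_log a b y'"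
proof (cases "0 \<le> b")
  case True
  have "pow_log a b y \<le> 1 * pow_log a b y'" if "1 \<le> y" "y \<le> y'" for y y'
   unfolding pow_log_def mult_1 using that True assms by (intro mult_mono powr_mono2) auto
  then show ?thesis by blast
next
  case False
  then have a: "0 < a" using assms by auto
  obtain K where K: "1 \<le> K" "\<And>d. 0 \<le> d \<Longrightarrow> (1 + d) powr \<bar>b\<bar> \<le> K * exp (a * d)"
   using poly_le_exp[of "\<bar>b\<bar>" a] a by auto
  have "pow_log a b y \<le> K * pow_log a b y'" if y: "1 \<le> y" "y \<le> y'" for y y'
  proof -
   define d where "d = ln (y' / y)"
   have d: "0 \<le> d" "y' = exp d * y" using y by (auto simp: d_def)
   have ly: "ln y' = d + ln y" using y by (simp add: d(2) ln_mult)
   have "d * 1 \<le> d * (1 + ln y)" using d y by (intro mult_left_mono) auto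
   then have l: "1 + ln y' \<le> (1 + d) * (1 + ln y)" unfolding ly by (simp add: algebra_simps)
   have "(1 + ln y) powr b \<le> (1 + d) powr \<bar>b\<bar> * (1 + ln y') powr b" by (rule powr_ratio(2)[OF _ _ l]) (use y in auto)
   also have "\<dots> \<le> (K * exp (a * d)) * (1 + ln y') powr b" using K(2)[OF d(1)] by (intro mult_right_mono) auto
   finally have "y powr a * (1 + ln y) powr b \<le> y powr a * ((K * exp (a * d)) * (1 + ln y') powr b)" by (intro mult_left_mono) auto
   also have "\<dots> = K * ((exp (a * d) * y powr a) * (1 + ln y') powr b)" by (simp add: mult_ac)
   also have "exp (a * d) * y powr a = y' powr a" using y unfolding d(2) by (subst powr_mult) (auto simp: exp_powr_real mult.commute)
   finally show ?thesis by (simp add: pow_log_def)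
  qed
  then show ?thesis using K(1) by blast
qed

lemma gauge_almost_increasing:
  assumes adm: "L1_admissible q \<alpha> \<beta>"
  shows "\<exists>K\<ge>1. \<forall>y y'. 1 \<le> y \<longrightarrow> y \<le> y' \<longrightarrow> gauge q \<alpha> \<beta> y \<le> K * gauge q \<alpha> \<beta> y'"
proof -
  consider "\<alpha> > - recip q" | "\<not> \<alpha> > - recip q" "\<beta> > - recip q" | "\<not> \<alpha> > - recip q" "\<not> \<beta> > - recip q" by blast
  then show ?thesis
  proof cases
   case 1 then show ?thesis using pow_log_almost_increasing[of "recip q + \<alpha>" \<beta>] by (simp add: gauge_def)
  next
   case 2 then show ?thesis using pow_log_almost_increasing[of 0 "recip q + \<beta>"] by (simp add: gauge_def)
  next
   case 3
   have "(1 + ln (1 + ln y)) powr recip q \<le> 1 * (1 + ln (1 + ln y')) powr recip q" if y: "1 \<le> y" "y \<le> y'" for y y' :: real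
   proof -
    have "0 \<le> ln y" "ln y \<le> ln y'" using y by auto
    then have "0 \<le> ln (1 + ln y)" "ln (1 + ln y) \<le> ln (1 + ln y')" by auto
    then show ?thesis unfolding mult_1 using recip_nonneg[of q] by (intro powr_mono2) auto
   qed
   then show ?thesis using 3 by (auto simp: gauge_def intro!: exI[of _ "1::real"])
  qed
qed

lemma recip_eq:
  assumes "1 \<le> q" "q < \<infinity>"
  shows "recip q = 1 / enn2real q" "1 \<le> enn2real q" "q = ennreal (enn2real q)"
proof -
  show q: "q = ennreal (enn2real q)" using assms(2) by simp
  show r1: "1 \<le> enn2real q" using assms q by (metis ennreal_1 ennreal_le_iff enn2real_nonneg)
  have "1 / q = ennreal (1 / enn2real q)" using r1 by (subst q) (simp add: divide_ennreal[symmetric])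
  then show "recip q = 1 / enn2real q" unfolding recip_def by simp
qed

lemma gauge_at_top:
  assumes adm: "L1_admissible q \<alpha> \<beta>"
  shows "filterlim (gauge q \<alpha> \<beta>) at_top at_top"
proof -
  have lnt: "filterlim (\<lambda>y::real. 1 + ln y) at_top at_top" by (rule filterlim_tendsto_add_at_top[OF tendsto_const ln_at_top])
  have pw: "filterlim (\<lambda>y::real. y powr p) at_top at_top" if "p > 0" for p
  proof -
   have "filterlim (\<lambda>y::real. p * ln y) at_top at_top" by (rule filterlim_tendsto_pos_mult_at_top[OF tendsto_const that ln_at_top])
   from filterlim_compose[OF exp_at_top this] show ?thesis
   proof (rule filterlim_at_top_mono)
    show "\<forall>\<^sub>F y in at_top. exp (p * ln y) \<le> y powr p" using eventually_gt_at_top[of 0] by eventually_elim (simp add: powr_def)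
   qed
  qed
  consider "\<alpha> > - recip q" | "\<not> \<alpha> > - recip q" "\<beta> > - recip q" | "\<not> \<alpha> > - recip q" "\<not> \<beta> > - recip q" by blast
  then show ?thesis
  proof cases
   case 1
   \<comment> \<open>Half of the exponent makes up for a possibly decreasing logarithmic factor; the
     other half tends to infinity.\<close>
   define p where "p = (recip q + \<alpha>) / 2"
   have p: "0 < p" using 1 by (simp add: p_def)
   obtain K where K: "1 \<le> K" "\<And>y y'. 1 \<le> y \<Longrightarrow> y \<le> y' \<Longrightarrow> pow_log p \<beta> y \<le> K * pow_log p \<beta> y'"
    using pow_log_almost_increasing[of p \<beta>] p by blast
   have "filterlim (\<lambda>y. (1 / K) * y powr p) at_top at_top"
    by (rule filterlim_tendsto_pos_mult_at_top[OF tendsto_const _ pw[OF p]]) (use K in simp)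
   moreover have "\<forall>\<^sub>F y in at_top. (1 / K) * y powr p \<le> gauge q \<alpha> \<beta> y" using eventually_ge_at_top[of 1]
   proof eventually_elim
    case (elim y)
    have "1 / K \<le> pow_log p \<beta> y" using K(2)[of 1 y] elim K(1) by (simp add: pow_log_def field_simps)
    then have "(1 / K) * y powr p \<le> pow_log p \<beta> y * y powr p" by (intro mult_right_mono) auto
    also have "\<dots> = gauge q \<alpha> \<beta> y" using 1 by (simp add: gauge_def pow_log_def p_def powr_add[symmetric] mult_ac)
    finally show ?case .
   qed
   ultimately show ?thesis by (rule filterlim_at_top_mono)
  next
   case 2
   then have "0 < recip q + \<beta>" by simp
   from filterlim_compose[OF pw[OF this] lnt]
   have "filterlim (\<lambda>y. (1 + ln y) powr (recip q + \<beta>)) at_top at_top" .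
   then show ?thesis
   proof (rule filterlim_at_top_mono)
    show "\<forall>\<^sub>F y in at_top. (1 + ln y) powr (recip q + \<beta>) \<le> gauge q \<alpha> \<beta> y"
     using eventually_ge_at_top[of 1] by eventually_elim (use 2 in \<open>simp add: gauge_def pow_log_def\<close>)
   qed
  next
   case 3
   then have "1 \<le> q" "q < \<infinity>" using adm by (auto simp: L1_admissible_def)
   then have "recip q = 1 / enn2real q" "1 \<le> enn2real q" by (rule recip_eq)+
   then have "0 < recip q" by simp
   from filterlim_compose[OF pw[OF this] filterlim_compose[OF lnt lnt]] show ?thesis using 3 by (simp add: gauge_def[abs_def])
  qed
qed

text \<open>The prescribed moduli use iterated logarithms without the added 1. They are compared
  with the reciprocal gauge where all logarithms that occur are at least 1, so that adding 1 changes
  them by bounded factors.\<close>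

lemma gauge_equiv:
  assumes adm: "L1_admissible q \<alpha> \<beta>"
   and 1: "\<alpha> > - recip q \<Longrightarrow>
    equiv_near_0 \<omega> (\<lambda>r. ln (exp 1 / r) powr (- recip q - \<alpha>) * ln (ln (exp 1 / r)) powr (- \<beta>))"
   and 2: "\<alpha> = - recip q \<Longrightarrow> \<beta> > - recip q \<Longrightarrow>
    equiv_near_0 \<omega> (\<lambda>r. ln (ln (exp 1 / r)) powr (- recip q - \<beta>))"
   and 3: "q < \<infinity> \<Longrightarrow> \<alpha> = - recip q \<Longrightarrow> \<beta> = - recip q \<Longrightarrow>
    equiv_near_0 \<omega> (\<lambda>r. ln (ln (ln (exp 1 / r))) powr (- recip q))"
  shows "\<exists>c>0. \<exists>r0>0. r0 \<le> 1 \<and> (\<forall>r\<in>{0<..<r0}. 1 / (c * gauge q \<alpha> \<beta> (1 - ln r)) \<le> \<omega> r \<and> \<omega> r \<le> c / gauge q \<alpha> \<beta> (1 - ln r))"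
proof -
  let ?\<gamma> = "gauge q \<alpha> \<beta>"
  have comb: ?thesis
   if eq: "equiv_near_0 \<omega> E" and K: "1 \<le> K" "0 < R" "R \<le> 1"
    "\<And>r. 0 < r \<Longrightarrow> r < R \<Longrightarrow> 1 / (K * ?\<gamma> (1 - ln r)) \<le> E r \<and> E r \<le> K / ?\<gamma> (1 - ln r)" for E K R
  proof -
   obtain c r0 where c: "c > 0" "r0 > 0" "\<And>r. r \<in> {0<..<r0} \<Longrightarrow> inverse c * E r \<le> \<omega> r \<and> \<omega> r \<le> c * E r"
    using eq unfolding equiv_near_0_def by blast
   have "\<forall>r\<in>{0<..<min r0 R}. 1 / (c * K * ?\<gamma> (1 - ln r)) \<le> \<omega> r \<and> \<omega> r \<le> c * K / ?\<gamma> (1 - ln r)"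
   proof (intro ballI conjI)
    fix r assume r: "r \<in> {0<..<min r0 R}"
    have w: "inverse c * E r \<le> \<omega> r" "\<omega> r \<le> c * E r" using c(3)[of r] r by auto
    have e: "1 / (K * ?\<gamma> (1 - ln r)) \<le> E r" "E r \<le> K / ?\<gamma> (1 - ln r)" using K(4)[of r] r by auto
    have "inverse c * (1 / (K * ?\<gamma> (1 - ln r))) \<le> inverse c * E r" using e c by (intro mult_left_mono) auto
    then show "1 / (c * K * ?\<gamma> (1 - ln r)) \<le> \<omega> r" using w by (simp add: field_simps)
    have "c * E r \<le> c * (K / ?\<gamma> (1 - ln r))" using e c by (intro mult_left_mono) auto
    then show "\<omega> r \<le> c * K / ?\<gamma> (1 - ln r)" using w by simp
   qed
   then have "\<exists>r0>0. r0 \<le> 1 \<and> (\<forall>r\<in>{0<..<r0}. 1 / (c * K * ?\<gamma> (1 - ln r)) \<le> \<omega> r \<and> \<omega> r \<le> c * K / ?\<gamma> (1 - ln r))"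
    using c K by (intro exI[of _ "min r0 R"]) auto
   moreover have "0 < c * K" using c K by simp
   ultimately show ?thesis by blast
  qed
  \<comment> \<open>For r below R the number 1 - ln r is at least \<open>exp (exp 1)\<close>, hence
    its logarithm is at least \<open>exp 1\<close> and its iterated logarithm at least 1.\<close>
  define R where "R = exp (1 - exp (exp 1) :: real)"
  have ee: "exp 1 \<ge> (2::real)" using exp_ge_add_one_self[of 1] by simp
  have eee: "exp (exp 1) \<ge> (3::real)" using exp_ge_add_one_self[of "exp 1::real"] ee by linarith
  have R: "0 < R" "R \<le> 1" using eee by (auto simp: R_def)
  have y: "ln (exp 1 / r) = 1 - ln r" "exp (exp 1) \<le> 1 - ln r" if "0 < r" "r < R" for r
  proof -
   show "ln (exp 1 / r) = 1 - ln r" using that by (simp add: ln_div)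
   have "ln r < ln R" using that by simp
   then show "exp (exp 1) \<le> 1 - ln r" by (simp add: R_def)
  qed
  have ly: "exp 1 \<le> ln (1 - ln r)" if "0 < r" "r < R" for r
  proof -
   have "ln (exp (exp 1)) \<le> ln (1 - ln r)" using y(2)[OF that] eee by (intro ln_mono) auto
   then show ?thesis by simp
  qed
  have pr: "1 / (2 powr \<bar>p\<bar> * (1 + l) powr p) \<le> l powr (- p) \<and> l powr (- p) \<le> 2 powr \<bar>p\<bar> / (1 + l) powr p" if l: "1 \<le> l" for l p :: real
  proof -
   note r = powr_ratio[of l "1 + l" 2 p]
   have "l powr p > 0" "(1 + l) powr p > 0" using l by auto
   then show ?thesis using r l by (auto simp: powr_minus field_simps)
  qed
  have qc: "1 \<le> q" using adm by (auto simp: L1_admissible_def)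
  consider "\<alpha> > - recip q" | "\<alpha> = - recip q" "\<beta> > - recip q" | "q < \<infinity>" "\<alpha> = - recip q" "\<beta> = - recip q"
   using adm by (auto simp: L1_admissible_def)
  then show ?thesis
  proof cases
   case A: 1
   show ?thesis
   proof (rule comb[OF 1[OF A] _ R, of "2 powr \<bar>\<beta>\<bar>"])
    fix r assume r: "0 < r" "r < R"
    let ?y = "1 - ln r"
    have l1: "1 \<le> ln ?y" using ly[OF r] ee by linarith
    have y0: "0 < ?y" using y(2)[OF r] eee by linarith
    note p = pr[OF l1, of \<beta>]
    have yp: "0 < ?y powr (- recip q - \<alpha>)" using y0 by simp
    have g: "?\<gamma> ?y = (1 + ln ?y) powr \<beta> / ?y powr (- recip q - \<alpha>)"
     using A y0 by (simp add: gauge_def pow_log_def powr_minus[symmetric] divide_inverse mult.commute add.commute)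
    show "1 / (2 powr \<bar>\<beta>\<bar> * ?\<gamma> ?y) \<le> ln (exp 1 / r) powr (- recip q - \<alpha>) * ln (ln (exp 1 / r)) powr (- \<beta>) \<and>
     ln (exp 1 / r) powr (- recip q - \<alpha>) * ln (ln (exp 1 / r)) powr (- \<beta>) \<le> 2 powr \<bar>\<beta>\<bar> / ?\<gamma> ?y"
     unfolding y(1)[OF r] g using mult_left_mono[OF conjunct1[OF p] less_imp_le[OF yp]] mult_left_mono[OF conjunct2[OF p] less_imp_le[OF yp]]
     by (simp add: field_simps)
   qed (auto intro: ge_one_powr_ge_zero)
  next
   case B: 2
   show ?thesis
   proof (rule comb[OF 2[OF B] _ R, of "2 powr \<bar>recip q + \<beta>\<bar>"])
    fix r assume r: "0 < r" "r < R"
    let ?y = "1 - ln r"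
    have l1: "1 \<le> ln ?y" using ly[OF r] ee by linarith
    have y0: "0 < ?y" using y(2)[OF r] eee by linarith
    note p = pr[OF l1, of "recip q + \<beta>"]
    have g: "?\<gamma> ?y = (1 + ln ?y) powr (recip q + \<beta>)" using B y0 by (simp add: gauge_def pow_log_def)
    show "1 / (2 powr \<bar>recip q + \<beta>\<bar> * ?\<gamma> ?y) \<le> ln (ln (exp 1 / r)) powr (- recip q - \<beta>) \<and>
     ln (ln (exp 1 / r)) powr (- recip q - \<beta>) \<le> 2 powr \<bar>recip q + \<beta>\<bar> / ?\<gamma> ?y"
     unfolding y(1)[OF r] g using p by simp
   qed (auto intro: ge_one_powr_ge_zero)
  next
   case C: 3
   show ?thesis
   proof (rule comb[OF 3[OF C] _ R, of "3 powr \<bar>recip q\<bar>"])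
    fix r assume r: "0 < r" "r < R"
    let ?y = "1 - ln r" and ?p = "recip q"
    define l where "l = ln ?y"
    have l1: "exp 1 \<le> l" using ly[OF r] by (simp add: l_def)
    have ll: "1 \<le> ln l" using l1 ee ln_mono[of "exp 1" l] by simp
    \<comment> \<open>With one more logarithm the constant becomes 3:
      \<open>1 + ln (1 + l) \<le> 1 + ln 2 + ln l \<le> 3 * ln l\<close>.\<close>
    have "ln (1 + l) \<le> ln (2 * l)" using l1 ee by (intro ln_mono) auto
    also have "\<dots> = ln 2 + ln l" using l1 ee by (simp add: ln_mult)
    finally have "1 + ln (1 + l) \<le> 3 * ln l" using ll ln_2_less_1 by linarith
    moreover have "ln l \<le> 1 + ln (1 + l)" using l1 ee ln_mono[of l "1 + l"] by linarith
    ultimately have "(1 + ln (1 + l)) powr ?p \<le> 3 powr \<bar>?p\<bar> * ln l powr ?p" "ln l powr ?p \<le> 3 powr \<bar>?p\<bar> * (1 + ln (1 + l)) powr ?p"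
     using powr_ratio[of "ln l" "1 + ln (1 + l)" 3 ?p] ll by auto
    moreover have "ln l powr ?p > 0" "(1 + ln (1 + l)) powr ?p > 0" using ll \<open>ln l \<le> 1 + ln (1 + l)\<close> by auto
    moreover have g: "?\<gamma> ?y = (1 + ln (1 + l)) powr ?p" using C by (simp add: gauge_def l_def)
    ultimately show "1 / (3 powr \<bar>?p\<bar> * ?\<gamma> ?y) \<le> ln (ln (ln (exp 1 / r))) powr (- ?p) \<and>
     ln (ln (ln (exp 1 / r))) powr (- ?p) \<le> 3 powr \<bar>?p\<bar> / ?\<gamma> ?y"
     unfolding y(1)[OF r] l_def[symmetric] g by (auto simp: powr_minus field_simps)
   qed (auto intro: ge_one_powr_ge_zero)
  qed
qed

section \<open>Lorentz--Zygmund norms\<close>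

lemma ennreal_powr_mono: "x \<le> y \<Longrightarrow> 0 \<le> p \<Longrightarrow> ennreal_powr x p \<le> ennreal_powr y p"
proof -
  assume xy: "x \<le> y" and p: "0 \<le> p"
  show ?thesis
  proof (cases "y = \<infinity>")
   case False
   then have x: "x \<noteq> \<infinity>" using xy by (auto simp: top_unique)
   have "enn2real x \<le> enn2real y" using xy False by (simp add: enn2real_mono less_top)
   then have "enn2real x powr p \<le> enn2real y powr p" using p by (intro powr_mono2) auto
   then show ?thesis using False x by (simp add: ennreal_powr_def ennreal_leI)
  qed (simp add: ennreal_powr_def)
qed

lemma ennreal_powr_ennreal: "0 \<le> r \<Longrightarrow> ennreal_powr (ennreal r) p = ennreal (r powr p)"
  by (simp add: ennreal_powr_def)

lemma ennreal_powr_cmult: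
  assumes "0 < r" "0 < p"
  shows "ennreal_powr (ennreal r * x) p = ennreal (r powr p) * ennreal_powr x p"
proof (cases x)
  case (real s)
  then show ?thesis using assms by (simp add: ennreal_mult[symmetric] ennreal_powr_ennreal powr_mult)
next
  case top
  then show ?thesis using assms by (simp add: ennreal_powr_def ennreal_mult_top)
qed

lemma ennreal_powr_inverse:
  assumes "0 < p"
  shows "ennreal_powr (ennreal_powr x p) (1 / p) = x"
proof (cases x)
  case (real s)
  then show ?thesis using assms by (simp add: ennreal_powr_ennreal powr_powr)
qed (simp add: ennreal_powr_def)

lemma nn_integral_unit: "(\<integral>\<^sup>+s. f s \<partial>unit_meas) = (\<integral>\<^sup>+s. f s * indicator {0<..<1} s \<partial>lborel)"
  by (subst nn_integral_restrict_space) (auto simp: nn_integral_completion)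

definition LZ_weight :: "ennreal \<Rightarrow> real \<Rightarrow> real \<Rightarrow> real \<Rightarrow> real"
  where "LZ_weight q \<alpha> \<beta> s = s powr (1 - recip q) * pow_log \<alpha> \<beta> (1 - ln s)"

lemma LZ_weight_eq:
  "0 < s \<Longrightarrow> s < 1 \<Longrightarrow> s powr (1 - recip q) * ell s powr \<alpha> * ellell s powr \<beta> = LZ_weight q \<alpha> \<beta> s"
  by (simp add: LZ_weight_def pow_log_def ell_def ellell_def)

lemma ex_pos2:
  fixes a b :: real
  shows "0 < a \<Longrightarrow> 0 < b \<Longrightarrow> P a b \<Longrightarrow> \<exists>x>0. \<exists>y>0. P x y"
  by blast

lemma ex_pos3:
  fixes a b c :: real
  shows "0 < a \<Longrightarrow> 0 < b \<Longrightarrow> 0 < c \<Longrightarrow> P a b c \<Longrightarrow> \<exists>x>0. \<exists>y>0. \<exists>z>0. P x y z"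
  by blast

lemma one_le_one_minus_ln: "0 < (s::real) \<Longrightarrow> s \<le> 1 \<Longrightarrow> 1 \<le> 1 - ln s"
  using ln_le_zero_iff[of s] by linarith

lemma LZ_weight_pos: "0 < s \<Longrightarrow> s < 1 \<Longrightarrow> 0 < LZ_weight q \<alpha> \<beta> s"
  by (simp add: LZ_weight_def pow_log_pos)

text \<open>The exponent 1 - 1 / q is such that the q-th power of the weight divided by s becomes a
  purely logarithmic factor against the scale-invariant measure ds / s.\<close>

lemma LZ_weight_powr:
  assumes q: "1 \<le> q" "q < \<infinity>" and s: "0 < s" "s < 1"
  shows "(LZ_weight q \<alpha> \<beta> s / s) powr enn2real q = pow_log (\<alpha> * enn2real q) (\<beta> * enn2real q) (1 - ln s) / s"
proof -
  let ?Q = "enn2real q"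
  note r = recip_eq[OF q]
  have "LZ_weight q \<alpha> \<beta> s / s = s powr (- (1 / ?Q)) * pow_log \<alpha> \<beta> (1 - ln s)"
   using s by (simp add: LZ_weight_def r(1) powr_diff powr_minus divide_inverse)
  then have "(LZ_weight q \<alpha> \<beta> s / s) powr ?Q = (s powr (- (1 / ?Q))) powr ?Q * pow_log \<alpha> \<beta> (1 - ln s) powr ?Q"
   using s pow_log_pos[of "1 - ln s" \<alpha> \<beta>] by (simp add: powr_mult)
  also have "(s powr (- (1 / ?Q))) powr ?Q = 1 / s"
  proof -
   have "- (1 / ?Q) * ?Q = - 1" using r(2) by simp
   then show ?thesis using s by (simp only: powr_powr) (simp add: powr_minus divide_inverse)
  qed
  finally show ?thesis using s by (simp add: pow_log_powr)
qed

section \<open>Integrals of the weight\<close>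

definition weight_integral :: "real \<Rightarrow> real \<Rightarrow> real \<Rightarrow> ennreal"
  where "weight_integral a b t = (\<integral>\<^sup>+s. ennreal (pow_log a b (1 - ln s) / s) * indicator {t<..<1} s \<partial>lborel)"

text \<open>The substitution y = 1 - ln s, for which ds / s becomes - dy, carried out with the
  fundamental theorem of calculus.\<close>

lemma nn_integral_log_FTC:
  assumes t: "0 < t" "t < 1"
   and D: "\<And>y. 1 \<le> y \<Longrightarrow> (\<Phi> has_real_derivative \<phi> y) (at y)" and nn: "\<And>y. 1 \<le> y \<Longrightarrow> 0 \<le> \<phi> y"
  shows "(\<integral>\<^sup>+s. ennreal (\<phi> (1 - ln s) / s) * indicator {t<..<1} s \<partial>lborel) = ennreal (\<Phi> (1 - ln t) - \<Phi> 1)"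
proof -
  have "((\<lambda>s. \<phi> (1 - ln s) / s) has_integral (- \<Phi> (1 - ln 1) - - \<Phi> (1 - ln t))) {t..1}"
  proof (rule fundamental_theorem_of_calculus)
   fix s assume s: "s \<in> {t..1}"
   have "((\<lambda>s. 1 - ln s) has_real_derivative - (1 / s)) (at s)" using s t by (auto intro!: derivative_eq_intros)
   from DERIV_chain2[OF D this] have "((\<lambda>s. \<Phi> (1 - ln s)) has_real_derivative \<phi> (1 - ln s) * - (1 / s)) (at s)" using s t by simp
   then have "((\<lambda>s. - \<Phi> (1 - ln s)) has_real_derivative \<phi> (1 - ln s) / s) (at s)" by (auto intro: DERIV_minus[THEN DERIV_cong])
   then show "((\<lambda>s. - \<Phi> (1 - ln s)) has_vector_derivative \<phi> (1 - ln s) / s) (at s within {t..1})"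
    by (simp add: has_real_derivative_iff_has_vector_derivative has_vector_derivative_at_within)
  qed (use t in simp)
  then have "integral\<^sup>N lborel (\<lambda>s. ennreal (\<phi> (1 - ln s) / s) * indicator {t..1} s) = ennreal (- \<Phi> (1 - ln 1) - - \<Phi> (1 - ln t))"
   using t by (intro nn_integral_has_integral_lebesgue') (auto intro!: divide_nonneg_pos nn)
  moreover have "(\<integral>\<^sup>+s. ennreal (\<phi> (1 - ln s) / s) * indicator {t<..<1} s \<partial>lborel) = (\<integral>\<^sup>+s. ennreal (\<phi> (1 - ln s) / s) * indicator {t..1} s \<partial>lborel)"
   by (rule nn_integral_cong_AE, use AE_lborel_singleton[of t] AE_lborel_singleton[of "1::real"] in eventually_elim)
    (auto simp: indicator_def)
  ultimately show ?thesis by simp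
qed

text \<open>Up to equivalence for large y, the q-th power of the gauge is an antiderivative of
  \<open>pow_log (\<alpha> * Q) (\<beta> * Q)\<close>: the exponent of y grows by 1, or that of its
  logarithm if the former was -1, or a further logarithm appears if both were -1.\<close>

lemma gauge_powr_cases:
  assumes adm: "L1_admissible q \<alpha> \<beta>" and q: "q < \<infinity>"
  defines "Q \<equiv> enn2real q"
  obtains (gt) "- 1 < \<alpha> * Q" "\<And>y. 1 \<le> y \<Longrightarrow> gauge q \<alpha> \<beta> y powr Q = pow_log (\<alpha> * Q + 1) (\<beta> * Q) y"
  | (eq) "\<alpha> * Q = - 1" "- 1 < \<beta> * Q" "\<And>y. 1 \<le> y \<Longrightarrow> gauge q \<alpha> \<beta> y powr Q = pow_log 0 (\<beta> * Q + 1) y"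
  | (eqeq) "\<alpha> * Q = - 1" "\<beta> * Q = - 1" "\<And>y. 1 \<le> y \<Longrightarrow> gauge q \<alpha> \<beta> y powr Q = 1 + ln (1 + ln y)"
proof -
  have q1: "1 \<le> q" using adm by (auto simp: L1_admissible_def)
  note r = recip_eq[OF q1 q]
  have Q: "0 < Q" "recip q = 1 / Q" using r by (auto simp: Q_def)
  have mQ: "x > - recip q \<longleftrightarrow> - 1 < x * Q" "x = - recip q \<longleftrightarrow> x * Q = - 1" for x unfolding Q(2) using Q(1) by (auto simp: field_simps)
  have rq: "(recip q + x) * Q = x * Q + 1" for x unfolding Q(2) using Q(1) by (simp add: field_simps)
  consider "\<alpha> > - recip q" | "\<alpha> = - recip q" "\<beta> > - recip q" | "\<alpha> = - recip q" "\<beta> = - recip q"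
   using adm by (auto simp: L1_admissible_def)
  then show thesis
  proof cases
   case 1
   show thesis
   proof (rule gt)
    show "- 1 < \<alpha> * Q" using 1 mQ by simp
    show "gauge q \<alpha> \<beta> y powr Q = pow_log (\<alpha> * Q + 1) (\<beta> * Q) y" if "1 \<le> y" for y
     using 1 that by (simp add: gauge_def pow_log_powr rq)
   qed
  next
   case 2
   show thesis
   proof (rule eq)
    show "\<alpha> * Q = - 1" "- 1 < \<beta> * Q" using 2 mQ by auto
    show "gauge q \<alpha> \<beta> y powr Q = pow_log 0 (\<beta> * Q + 1) y" if "1 \<le> y" for y
     using 2 that by (simp add: gauge_def pow_log_powr rq)
   qed
  next
   case 3
   show thesis
   proof (rule eqeq)
    show "\<alpha> * Q = - 1" "\<beta> * Q = - 1" using 3 mQ by auto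
    show "gauge q \<alpha> \<beta> y powr Q = 1 + ln (1 + ln y)" if y: "1 \<le> y" for y
    proof -
     have "1 \<le> 1 + ln y" using y by simp
     then have "0 < 1 + ln (1 + ln y)" using ln_ge_zero[of "1 + ln y"] by linarith
     then show ?thesis using 3 Q by (simp add: gauge_def powr_powr)
    qed
   qed
  qed
qed

lemma DERIV_one_plus_ln_powr:
  assumes "1 \<le> y" "p \<noteq> 0"
  shows "((\<lambda>y. (1 + ln y) powr p / p) has_real_derivative pow_log (- 1) (p - 1) y) (at y)"
proof -
  have "0 < y" "0 < 1 + ln y" using assms ln_ge_zero[of y] by linarith+
  then show ?thesis using assms
   by (auto intro!: derivative_eq_intros simp: pow_log_def powr_minus field_simps powr_diff) (simp add: distrib_left[symmetric])
qed

lemma DERIV_ln_one_plus_ln: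
  assumes "1 \<le> y"
  shows "((\<lambda>y. ln (1 + ln y)) has_real_derivative pow_log (- 1) (- 1) y) (at y)"
proof -
  have "0 < y" "0 < 1 + ln y" using assms ln_ge_zero[of y] by linarith+
  then show ?thesis using assms by (auto intro!: derivative_eq_intros simp: pow_log_def powr_minus field_simps)
qed

text \<open>Where \<alpha> * Q = -1 the antiderivative is explicit. Otherwise the integrand is
  compared with pure powers of y, the logarithmic factor being replaced by a multiple determined at
  the endpoint L = 1 - ln t.\<close>

lemma weight_integral_bounds:
  assumes adm: "L1_admissible q \<alpha> \<beta>" and q: "q < \<infinity>"
  defines "Q \<equiv> enn2real q"
  shows "\<exists>c>0. \<exists>C>0. \<exists>t1>0. t1 \<le> 1/2 \<and> (\<forall>t. 0 < t \<longrightarrow> t \<le> t1 \<longrightarrow>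
   ennreal (c * gauge q \<alpha> \<beta> (1 - ln t) powr Q) \<le> weight_integral (\<alpha> * Q) (\<beta> * Q) t
   \<and> weight_integral (\<alpha> * Q) (\<beta> * Q) t \<le> ennreal (C * gauge q \<alpha> \<beta> (1 - ln t) powr Q))" using adm q
proof (cases rule: gauge_powr_cases)
  case gt
  define a b where "a = \<alpha> * Q" and "b = \<beta> * Q"
  have a: "- 1 < a" using gt(1) by (simp add: a_def Q_def)
  have G: "gauge q \<alpha> \<beta> y powr Q = pow_log (a + 1) b y" if "1 \<le> y" for y using gt(2)[OF that] by (simp add: a_def b_def Q_def)
  \<comment> \<open>Then M0 - a is positive, so \<open>pow_log (a - M0) b\<close> is almost
    decreasing; up to a constant, its value at L bounds it below on the whole interval.\<close>
  define M0 where "M0 = \<bar>a\<bar> + 1"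
  obtain K1 where K1: "1 \<le> K1" "\<And>y y'. 1 \<le> y \<Longrightarrow> y \<le> y' \<Longrightarrow> pow_log (M0 - a) (- b) y \<le> K1 * pow_log (M0 - a) (- b) y'"
  proof -
   have "0 < M0 - a" by (simp add: M0_def)
   then show ?thesis using pow_log_almost_increasing[of "M0 - a" "- b"] that by blast
  qed
  \<comment> \<open>The integrand splits as \<open>pow_log p b y * y powr (p - 1)\<close>: the first
    factor is almost increasing, the second has the antiderivative
    \<open>y powr p / p\<close>.\<close>
  define p where "p = (a + 1) / 2"
  have p: "0 < p" using a by (simp add: p_def)
  obtain K2 where K2: "1 \<le> K2" "\<And>y y'. 1 \<le> y \<Longrightarrow> y \<le> y' \<Longrightarrow> pow_log p b y \<le> K2 * pow_log p b y'"
   using pow_log_almost_increasing[of p b] p by blast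
  have M0: "1 \<le> M0" by (simp add: M0_def)
  show ?thesis
  proof (rule ex_pos3[of "1 / (2 * K1 * (M0 + 1))" "K2 / p" "exp (- 1)"]; (intro conjI allI impI)?)
   show "0 < 1 / (2 * K1 * (M0 + 1))" "0 < K2 / p" using K1 K2 M0 p by auto
   have "exp (1::real) \<ge> 2" using exp_ge_add_one_self[of 1] by simp
   then show "exp (- 1) \<le> (1 / 2 :: real)" by (simp add: exp_minus field_simps)
   fix t :: real assume t: "0 < t" "t \<le> exp (- 1)"
   define L where "L = 1 - ln t"
   have "ln t \<le> - 1" using t by (metis ln_exp ln_mono)
   then have L: "2 \<le> L" by (simp add: L_def)
   have t1: "t < 1" using t(2) by (rule le_less_trans) simp
   have yL: "1 - ln s \<le> L" "1 \<le> 1 - ln s" if "s \<in> {t<..<1}" for s using that t by (auto simp: L_def)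
   define k1 where "k1 = pow_log (a - M0) b L / K1"
   have k1: "0 < k1" using pow_log_pos[of L "a - M0" b] L K1 by (simp add: k1_def)
   show "ennreal (1 / (2 * K1 * (M0 + 1)) * gauge q \<alpha> \<beta> (1 - ln t) powr Q) \<le> weight_integral (\<alpha> * Q) (\<beta> * Q) t"
   proof -
    \<comment> \<open>As L is at least 2, the contribution of the lower endpoint is absorbed at the
      price of a factor 2.\<close>
    have "L powr 1 \<le> L powr (M0 + 1)" using L M0 by (intro powr_mono) auto
    then have L2: "2 \<le> L powr (M0 + 1)" using L by simp
    have "1 / (2 * K1 * (M0 + 1)) * pow_log (a + 1) b L = k1 * (L powr (M0 + 1) / 2) / (M0 + 1)"
    proof -
     have "pow_log (a + 1) b L = pow_log (a - M0) b L * L powr (M0 + 1)" by (simp add: pow_log_def powr_add[symmetric] mult_ac)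
     then show ?thesis by (simp add: k1_def)
    qed
    also have "\<dots> \<le> k1 * (L powr (M0 + 1) - 1) / (M0 + 1)" using k1 M0 L2 by (intro divide_right_mono mult_left_mono) auto
    also have "\<dots> = k1 * L powr (M0 + 1) / (M0 + 1) - k1 * 1 powr (M0 + 1) / (M0 + 1)" by (simp add: diff_divide_distrib algebra_simps)
    finally have "ennreal (1 / (2 * K1 * (M0 + 1)) * gauge q \<alpha> \<beta> (1 - ln t) powr Q)
     \<le> ennreal (k1 * L powr (M0 + 1) / (M0 + 1) - k1 * 1 powr (M0 + 1) / (M0 + 1))" using G[of L] L by (intro ennreal_leI) (simp add: L_def)
    also have "\<dots> = (\<integral>\<^sup>+s. ennreal (k1 * (1 - ln s) powr M0 / s) * indicator {t<..<1} s \<partial>lborel)"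
     unfolding L_def using M0 k1
     by (intro nn_integral_log_FTC[symmetric, where \<Phi>="\<lambda>y. k1 * y powr (M0 + 1) / (M0 + 1)" and \<phi>="\<lambda>y. k1 * y powr M0"] t(1) t1)
      (auto intro!: derivative_eq_intros simp: powr_diff)
    also have "\<dots> \<le> weight_integral (\<alpha> * Q) (\<beta> * Q) t" unfolding weight_integral_def
    proof (rule nn_integral_mono)
     fix s show "ennreal (k1 * (1 - ln s) powr M0 / s) * indicator {t<..<1} s \<le> ennreal (pow_log (\<alpha> * Q) (\<beta> * Q) (1 - ln s) / s) * indicator {t<..<1} s"
     proof (cases "s \<in> {t<..<1}")
      case True
      let ?y = "1 - ln s"
      note y = yL[OF True]
      have "pow_log (M0 - a) (- b) ?y \<le> K1 * pow_log (M0 - a) (- b) L" using K1(2) y by blast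
      then have "1 / pow_log (a - M0) b ?y \<le> K1 / pow_log (a - M0) b L"
       using pow_log_inverse[of ?y "a - M0" b] pow_log_inverse[of L "a - M0" b] y L by simp
      then have "k1 \<le> pow_log (a - M0) b ?y"
       using pow_log_pos[of L "a - M0" b] pow_log_pos[of ?y "a - M0" b] y L K1(1) by (simp add: k1_def field_simps)
      then have "k1 * ?y powr M0 \<le> pow_log (a - M0) b ?y * ?y powr M0" by (intro mult_right_mono) auto
      also have "\<dots> = pow_log a b ?y" by (simp add: pow_log_def powr_add[symmetric] mult_ac)
      finally show ?thesis using True t by (simp add: a_def b_def ennreal_leI divide_right_mono)
     qed simp
    qed
    finally show ?thesis .
   qed
   define k2 where "k2 = K2 * pow_log p b L"
   have k2: "0 < k2" using pow_log_pos[of L p b] L K2 by (simp add: k2_def)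
   show "weight_integral (\<alpha> * Q) (\<beta> * Q) t \<le> ennreal (K2 / p * gauge q \<alpha> \<beta> (1 - ln t) powr Q)"
   proof -
    have "weight_integral (\<alpha> * Q) (\<beta> * Q) t \<le> (\<integral>\<^sup>+s. ennreal (k2 * (1 - ln s) powr (p - 1) / s) * indicator {t<..<1} s \<partial>lborel)"
     unfolding weight_integral_def
    proof (rule nn_integral_mono)
     fix s show "ennreal (pow_log (\<alpha> * Q) (\<beta> * Q) (1 - ln s) / s) * indicator {t<..<1} s \<le> ennreal (k2 * (1 - ln s) powr (p - 1) / s) * indicator {t<..<1} s"
     proof (cases "s \<in> {t<..<1}")
      case True
      let ?y = "1 - ln s"
      note y = yL[OF True]
      have "pow_log a b ?y = pow_log p b ?y * ?y powr (p - 1)" by (simp add: pow_log_def p_def powr_add[symmetric] mult_ac) (simp add: field_simps)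
      also have "\<dots> \<le> k2 * ?y powr (p - 1)" unfolding k2_def using K2(2)[of ?y L] y by (intro mult_right_mono) auto
      finally show ?thesis using True t by (simp add: a_def b_def ennreal_leI divide_right_mono)
     qed simp
    qed
    also have "\<dots> = ennreal (k2 * L powr p / p - k2 * 1 powr p / p)" unfolding L_def using p k2
     by (intro nn_integral_log_FTC[where \<Phi>="\<lambda>y. k2 * y powr p / p" and \<phi>="\<lambda>y. k2 * y powr (p - 1)"] t(1) t1)
      (auto intro!: derivative_eq_intros simp: powr_diff)
    also have "\<dots> \<le> ennreal (K2 / p * gauge q \<alpha> \<beta> (1 - ln t) powr Q)"
    proof (rule ennreal_leI)
     have "pow_log (a + 1) b L = pow_log p b L * L powr p" by (simp add: pow_log_def p_def powr_add[symmetric] mult_ac)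
     then have "K2 / p * gauge q \<alpha> \<beta> (1 - ln t) powr Q = k2 * L powr p / p" using G[of L] L by (simp add: L_def k2_def)
     moreover have "0 \<le> k2 * 1 powr p / p" using k2 p by simp
     ultimately show "k2 * L powr p / p - k2 * 1 powr p / p \<le> K2 / p * gauge q \<alpha> \<beta> (1 - ln t) powr Q" by linarith
    qed
    finally show ?thesis .
   qed
  qed simp
next
  case eq
  define p where "p = \<beta> * Q + 1"
  have p: "0 < p" using eq(2) by (simp add: p_def Q_def)
  \<comment> \<open>Chosen so that \<open>(1 + ln L) powr p\<close> is at least 2 for small t, which
    absorbs the lower endpoint.\<close>
  define Y where "Y = 2 powr (1 / p)"
  have Y: "1 \<le> Y" using p by (simp add: Y_def ge_one_powr_ge_zero)
  have a: "\<alpha> * Q = - 1" "\<beta> * Q = p - 1" using eq(1) by (auto simp: Q_def p_def)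
  have G: "gauge q \<alpha> \<beta> y powr Q = (1 + ln y) powr p" if "1 \<le> y" for y using eq(3)[OF that] that by (simp add: p_def Q_def pow_log_def)
  show ?thesis
  proof (rule ex_pos3[of "1 / (2 * p)" "1 / p" "min (1 / 2) (exp (1 - exp Y))"]; (intro conjI allI impI)?)
   show "0 < 1 / (2 * p)" "0 < 1 / p" using p by auto
   fix t :: real assume t: "0 < t" "t \<le> min (1 / 2) (exp (1 - exp Y))"
   define L where "L = 1 - ln t"
   have "ln t \<le> ln (exp (1 - exp Y))" using t by (intro ln_mono) auto
   then have LY: "exp Y \<le> L" by (simp add: L_def)
   have L1: "1 \<le> L" using t by (simp add: L_def)
   have "ln (exp Y) \<le> ln L" using LY L1 by (intro ln_mono) auto
   then have "Y \<le> 1 + ln L" by simp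
   then have "Y powr p \<le> (1 + ln L) powr p" using Y p by (intro powr_mono2) auto
   then have two: "2 \<le> (1 + ln L) powr p" using p by (simp add: Y_def powr_powr)
   have I: "weight_integral (\<alpha> * Q) (\<beta> * Q) t = ennreal ((1 + ln L) powr p / p - (1 + ln 1) powr p / p)"
    unfolding weight_integral_def L_def a using t p
    by (intro nn_integral_log_FTC DERIV_one_plus_ln_powr) (auto intro: less_imp_le[OF pow_log_pos])
   show "ennreal (1 / (2 * p) * gauge q \<alpha> \<beta> (1 - ln t) powr Q) \<le> weight_integral (\<alpha> * Q) (\<beta> * Q) t"
    unfolding I using two p G[OF L1] by (intro ennreal_leI) (simp add: L_def field_simps)
   show "weight_integral (\<alpha> * Q) (\<beta> * Q) t \<le> ennreal (1 / p * gauge q \<alpha> \<beta> (1 - ln t) powr Q)"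
    unfolding I using p G[OF L1] by (intro ennreal_leI) (simp add: L_def)
  qed auto
next
  case eqeq
  have a: "\<alpha> * Q = - 1" "\<beta> * Q = - 1" using eqeq(1,2) by (auto simp: Q_def)
  have G: "gauge q \<alpha> \<beta> y powr Q = 1 + ln (1 + ln y)" if "1 \<le> y" for y using eqeq(3)[OF that] by (simp add: Q_def)
  show ?thesis
  proof (rule ex_pos3[of "1 / 2 :: real" "1 :: real" "min (1 / 2) (exp (1 - exp (exp 1)))"]; (intro conjI allI impI)?)
   fix t :: real assume t: "0 < t" "t \<le> min (1 / 2) (exp (1 - exp (exp 1)))"
   define L where "L = 1 - ln t"
   have "ln t \<le> ln (exp (1 - exp (exp 1)))" using t by (intro ln_mono) auto
   then have LY: "exp (exp 1) \<le> L" by (simp add: L_def)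
   have L1: "1 \<le> L" using t by (simp add: L_def)
   have "ln (exp (exp 1)) \<le> ln L" using LY L1 by (intro ln_mono) auto
   then have l1: "exp 1 \<le> ln L" by simp
   have "ln (exp 1) \<le> ln (1 + ln L)" using l1 by (intro ln_mono) auto
   then have two: "1 \<le> ln (1 + ln L)" by simp
   have I: "weight_integral (\<alpha> * Q) (\<beta> * Q) t = ennreal (ln (1 + ln L) - ln (1 + ln 1))"
    unfolding weight_integral_def L_def a using t by (intro nn_integral_log_FTC DERIV_ln_one_plus_ln) (auto intro: less_imp_le[OF pow_log_pos])
   show "ennreal (1 / 2 * gauge q \<alpha> \<beta> (1 - ln t) powr Q) \<le> weight_integral (\<alpha> * Q) (\<beta> * Q) t"
    unfolding I using two G[OF L1] by (intro ennreal_leI) (simp add: L_def)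
   show "weight_integral (\<alpha> * Q) (\<beta> * Q) t \<le> ennreal (1 * gauge q \<alpha> \<beta> (1 - ln t) powr Q)"
    unfolding I using G[OF L1] by (intro ennreal_leI) (simp add: L_def)
  qed auto
qed

section \<open>The norm from below and from above\<close>

lemma gauge_infinity:
  assumes "L1_admissible \<infinity> \<alpha> \<beta>" "1 \<le> y"
  shows "gauge \<infinity> \<alpha> \<beta> y = pow_log \<alpha> \<beta> y"
proof -
  have r: "recip top = 0" by (simp add: recip_def)
  show ?thesis using assms by (auto simp: gauge_def r L1_admissible_def pow_log_def)
qed

lemma LZ_norm_on_finite:
  assumes "q < \<infinity>"
  shows "LZ_norm_on \<Omega> q \<alpha> \<beta> u = ennreal_powr (\<integral>\<^sup>+s. ennreal_powr (ennreal (LZ_weight q \<alpha> \<beta> s) * (rearr_int \<Omega> u s / ennreal s)) (enn2real q) * indicator {0<..<1} s \<partial>lborel) (1 / enn2real q)"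
  using assms unfolding LZ_norm_on_eq Lq_norm_def nn_integral_unit
  by (auto intro!: arg_cong2[where f=ennreal_powr] nn_integral_cong simp: indicator_def LZ_weight_eq)

lemma LZ_norm_on_infinity:
  "LZ_norm_on \<Omega> \<infinity> \<alpha> \<beta> u = esssup unit_meas (\<lambda>s. ennreal (s powr (1 - recip \<infinity>) * ell s powr \<alpha> * ellell s powr \<beta>) * (rearr_int \<Omega> u s / ennreal s))"
  unfolding LZ_norm_on_eq Lq_norm_def by simp

text \<open>\<open>rearr_int\<close> increases with its argument, so for s > t it may be replaced by
  its value at t. What remains of the q-th power of the norm over \<open>(t, 1)\<close> is
  \<open>weight_integral\<close>, comparable to the q-th power of the gauge. For q = \<infinity> a
  single s between t and 2 t suffices.\<close>

lemma LZ_norm_lower_bound: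
  assumes adm: "L1_admissible q \<alpha> \<beta>"
  shows "\<exists>c>0. \<exists>t1>0. t1 \<le> 1/2 \<and> (\<forall>\<Omega> :: 'a::euclidean_space set. \<forall>u t. 0 < t \<longrightarrow> t \<le> t1 \<longrightarrow>
   ennreal (c * gauge q \<alpha> \<beta> (1 - ln t)) * rearr_int \<Omega> u t \<le> LZ_norm_on \<Omega> q \<alpha> \<beta> u)"
proof (cases "q = \<infinity>")
  case False
  then have q: "q < \<infinity>" by (simp add: less_top)
  have q1: "1 \<le> q" using adm by (auto simp: L1_admissible_def)
  define Q where "Q = enn2real q"
  have Q: "1 \<le> Q" using recip_eq[OF q1 q] by (simp add: Q_def)
  obtain c t1 where c: "c > 0" "t1 > 0" "t1 \<le> 1/2" and I: "\<And>t. 0 < t \<Longrightarrow> t \<le> t1 \<Longrightarrow> ennreal (c * gauge q \<alpha> \<beta> (1 - ln t) powr Q) \<le> weight_integral (\<alpha> * Q) (\<beta> * Q) t"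
   using weight_integral_bounds[OF adm q] unfolding Q_def by blast
  show ?thesis
  proof (rule ex_pos2[of "c powr (1 / Q)" "t1"]; (intro conjI allI impI)?)
   fix \<Omega> :: "'a set" and u t assume t: "0 < t" "t \<le> t1"
   let ?F = "rearr_int \<Omega> u"
   let ?g = "gauge q \<alpha> \<beta> (1 - ln t)"
   have g: "0 < ?g" using t c by (intro gauge_pos) auto
   have "ennreal (c powr (1 / Q) * ?g) * ?F t = ennreal_powr (ennreal (c * ?g powr Q) * ennreal_powr (?F t) Q) (1 / Q)"
   proof -
    have "(c * ?g powr Q) powr (1 / Q) = c powr (1 / Q) * ?g" using c g Q by (simp add: powr_mult powr_powr)
    then show ?thesis using c g Q ennreal_powr_inverse[of Q "?F t"] by (subst ennreal_powr_cmult) auto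
   qed
   also have "\<dots> \<le> ennreal_powr (weight_integral (\<alpha> * Q) (\<beta> * Q) t * ennreal_powr (?F t) Q) (1 / Q)"
    using Q by (intro ennreal_powr_mono mult_right_mono I t) auto
   also have "\<dots> \<le> LZ_norm_on \<Omega> q \<alpha> \<beta> u" unfolding LZ_norm_on_finite[OF q] Q_def[symmetric]
   proof (rule ennreal_powr_mono)
    have "weight_integral (\<alpha> * Q) (\<beta> * Q) t * ennreal_powr (?F t) Q
     = (\<integral>\<^sup>+s. ennreal (pow_log (\<alpha> * Q) (\<beta> * Q) (1 - ln s) / s) * indicator {t<..<1} s * ennreal_powr (?F t) Q \<partial>lborel)"
     unfolding weight_integral_def by (rule nn_integral_multc[symmetric]) (unfold pow_log_def, measurable)
    also have "\<dots> \<le> (\<integral>\<^sup>+s. ennreal_powr (ennreal (LZ_weight q \<alpha> \<beta> s) * (?F s / ennreal s)) Q * indicator {0<..<1} s \<partial>lborel)"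
    proof (rule nn_integral_mono)
     fix s
     show "ennreal (pow_log (\<alpha> * Q) (\<beta> * Q) (1 - ln s) / s) * indicator {t<..<1} s * ennreal_powr (?F t) Q
      \<le> ennreal_powr (ennreal (LZ_weight q \<alpha> \<beta> s) * (?F s / ennreal s)) Q * indicator {0<..<1} s"
     proof (cases "s \<in> {t<..<1}")
      case True
      then have s: "0 < s" "s < 1" "t \<le> s" using t by auto
      have W: "0 < LZ_weight q \<alpha> \<beta> s" by (rule LZ_weight_pos[OF s(1,2)])
      have e: "ennreal (LZ_weight q \<alpha> \<beta> s) * (?F s / ennreal s) = ennreal (LZ_weight q \<alpha> \<beta> s / s) * ?F s"
       using s W by (simp add: divide_ennreal_def inverse_ennreal divide_inverse ennreal_mult mult_ac)
      have "ennreal (pow_log (\<alpha> * Q) (\<beta> * Q) (1 - ln s) / s) * ennreal_powr (?F t) Q = ennreal_powr (ennreal (LZ_weight q \<alpha> \<beta> s / s) * ?F t) Q"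
       using W s Q LZ_weight_powr[OF q1 q s(1,2), of \<alpha> \<beta>] by (subst ennreal_powr_cmult) (auto simp: Q_def)
      also have "\<dots> \<le> ennreal_powr (ennreal (LZ_weight q \<alpha> \<beta> s / s) * ?F s) Q"
       using Q by (intro ennreal_powr_mono mult_left_mono rearr_int_mono s) auto
      finally show ?thesis using True s by (simp add: e)
     qed simp
    qed
    finally show "weight_integral (\<alpha> * Q) (\<beta> * Q) t * ennreal_powr (?F t) Q
     \<le> (\<integral>\<^sup>+s. ennreal_powr (ennreal (LZ_weight q \<alpha> \<beta> s) * (?F s / ennreal s)) Q * indicator {0<..<1} s \<partial>lborel)" .
   qed (use Q in simp)
   finally show "ennreal (c powr (1 / Q) * ?g) * ?F t \<le> LZ_norm_on \<Omega> q \<alpha> \<beta> u" .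
  qed (use c in auto)
next
  case True
  let ?k = "\<lambda>s. s powr (1 - recip \<infinity>) * ell s powr \<alpha> * ellell s powr \<beta>"
  have r: "recip top = 0" by (simp add: recip_def)
  obtain M where M: "0 \<le> M" "\<And>y y' c. 1 \<le> y \<Longrightarrow> y \<le> y' \<Longrightarrow> y' \<le> c * y \<Longrightarrow> gauge q \<alpha> \<beta> y' \<le> c powr M * gauge q \<alpha> \<beta> y"
   using gauge_ratio[of q \<alpha> \<beta>] by blast
  show ?thesis
  proof (rule ex_pos2[of "1 / 2 powr M" "1/4 :: real"]; (intro conjI allI impI)?)
   fix \<Omega> :: "'a set" and u and t :: real assume t: "0 < t" "t \<le> 1/4"
   let ?F = "rearr_int \<Omega> u"
   let ?N = "LZ_norm_on \<Omega> q \<alpha> \<beta> u"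
   have "AE s in unit_meas. ennreal (?k s) * (?F s / ennreal s) \<le> ?N" unfolding True LZ_norm_on_infinity by (rule esssup_AE)
   then have ae: "AE s in lebesgue. s \<in> {0<..<1} \<longrightarrow> ennreal (?k s) * (?F s / ennreal s) \<le> ?N"
    by (subst (asm) AE_restrict_space_iff) auto
   \<comment> \<open>The essential supremum controls almost every s only; an interval of positive
     measure contains such a point, and there the gauge is comparable to its value for t.\<close>
   have "\<exists>s\<in>{t<..<2 * t}. ennreal (?k s) * (?F s / ennreal s) \<le> ?N"
   proof (rule ccontr)
    assume no: "\<not> ?thesis"
    have "AE s in lebesgue. s \<notin> {t<..<2 * t}" using ae by eventually_elim (use no t in auto)
    then have "{t<..<2 * t} \<in> null_sets lebesgue" by (subst (asm) AE_iff_null_sets[symmetric]) auto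
    then have "emeasure lebesgue {t<..<2 * t} = 0" by (rule null_setsD1)
    then show False using t by simp
   qed
   then obtain s where s: "t < s" "s < 2 * t" and le: "ennreal (?k s) * (?F s / ennreal s) \<le> ?N" by auto
   have s1: "0 < s" "s < 1" using s t by auto
   let ?y = "1 - ln s" and ?L = "1 - ln t"
   have y: "1 \<le> ?y" "?y \<le> ?L" using s s1 t by auto
   have "ln s \<le> ln (2 * t)" using s s1 by (intro ln_mono) auto
   then have "?L \<le> ?y + ln 2" using t by (simp add: ln_mult)
   moreover have "a \<le> 2 * b" if "a \<le> b + c" "1 \<le> b" "c < 1" for a b c :: real using that by linarith
   ultimately have "?L \<le> 2 * ?y" using y(1) ln_2_less_1 by blast
   then have gl: "gauge q \<alpha> \<beta> ?L \<le> 2 powr M * gauge q \<alpha> \<beta> ?y" by (rule M(2)[OF y])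
   have gy: "gauge q \<alpha> \<beta> ?y = pow_log \<alpha> \<beta> ?y" using adm y(1) unfolding True by (rule gauge_infinity)
   have "ennreal (1 / 2 powr M * gauge q \<alpha> \<beta> ?L) * ?F t \<le> ennreal (pow_log \<alpha> \<beta> ?y) * ?F s"
    using gl s unfolding gy by (intro mult_mono ennreal_leI rearr_int_mono) (auto simp: field_simps)
   also have "\<dots> = ennreal (?k s) * (?F s / ennreal s)"
   proof -
    have "?k s = pow_log \<alpha> \<beta> ?y * s" unfolding LZ_weight_eq[OF s1] using s1 by (simp add: LZ_weight_def r)
    moreover have sx: "x * s * inverse s = x" for x using s1 by simp
    ultimately show ?thesis using s1 pow_log_pos[OF y(1), of \<alpha> \<beta>]
     by (simp add: sx divide_ennreal_def inverse_ennreal ennreal_mult[symmetric] mult.assoc[symmetric] mult.commute[of "?F s"])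
   qed
   also note le
   finally show "ennreal (1 / 2 powr M * gauge q \<alpha> \<beta> ?L) * ?F t \<le> ?N" .
  qed auto
qed

text \<open>The weight at a single scale is dominated by the gauge, because passing to the
  antiderivative only raises exponents for arguments of at least 1. This controls the part of the
  norm below b.\<close>

lemma pow_log_le_gauge_powr:
  assumes adm: "L1_admissible q \<alpha> \<beta>" and q: "q < \<infinity>" and y: "1 \<le> y"
  shows "pow_log (\<alpha> * enn2real q) (\<beta> * enn2real q) y \<le> gauge q \<alpha> \<beta> y powr enn2real q"
proof -
  have l: "1 \<le> 1 + ln y" using y by simp
  have y0: "0 < y" using y by simp
  show ?thesis using adm q
  proof (cases rule: gauge_powr_cases)
   case gt
   have "y powr (\<alpha> * enn2real q) * (1 + ln y) powr (\<beta> * enn2real q) \<le> y powr (\<alpha> * enn2real q + 1) * (1 + ln y) powr (\<beta> * enn2real q)"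
    using y by (intro mult_right_mono powr_mono) auto
   then show ?thesis using gt(2)[OF y] by (simp add: pow_log_def)
  next
   case eq
   have "y powr (- 1) \<le> y powr 0" using y by (intro powr_mono) auto
   then have "y powr (- 1) * (1 + ln y) powr (\<beta> * enn2real q) \<le> y powr 0 * (1 + ln y) powr (\<beta> * enn2real q + 1)"
    using l y by (intro mult_mono powr_mono) auto
   then show ?thesis using eq(1) eq(3)[OF y] by (simp add: pow_log_def)
  next
   case eqeq
   have "y powr (- 1) * (1 + ln y) powr (- 1) \<le> y powr 0 * (1 + ln y) powr 0" using y l by (intro mult_mono powr_mono) auto
   also have "\<dots> \<le> 1 + ln (1 + ln y)" using y0 l by simp
   finally show ?thesis using eqeq(1,2) eqeq(3)[OF y] by (simp add: pow_log_def)
  qed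
qed

lemma mono_borel_measurable:
  fixes f :: "real \<Rightarrow> ennreal"
  assumes "\<And>x y. x \<le> y \<Longrightarrow> f x \<le> f y"
  shows "f \<in> borel_measurable borel"
proof -
  have "(\<lambda>x. f (- x)) \<in> borel_measurable borel" by (rule antimono_borel_measurable) (rule assms, simp)
  from measurable_compose[OF borel_measurable_uminus[OF measurable_ident] this] show ?thesis by simp
qed

text \<open>The unit interval is split at b. Below b the average is at most c, and slow growth of
  the weight bounds the integral by the weight at b; above b the average is at most
  \<open>c * b / s\<close>, which leads to \<open>weight_integral\<close>.\<close>

lemma LZ_norm_upper_bound:
  assumes adm: "L1_admissible q \<alpha> \<beta>"
  shows "\<exists>C>0. \<exists>b1>0. b1 \<le> 1/2 \<and> (\<forall>\<Omega> :: 'a::euclidean_space set. \<forall>u c b. 0 < c \<longrightarrow> 0 < b \<longrightarrow> b \<le> b1 \<longrightarrow>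
   (\<forall>s\<in>{0<..<1}. rearr_int \<Omega> u s \<le> ennreal (c * min s b)) \<longrightarrow>
   LZ_norm_on \<Omega> q \<alpha> \<beta> u \<le> ennreal (C * c * b * gauge q \<alpha> \<beta> (1 - ln b)))"
proof (cases "q = \<infinity>")
  case False
  then have q: "q < \<infinity>" by (simp add: less_top)
  have q1: "1 \<le> q" using adm by (auto simp: L1_admissible_def)
  define Q where "Q = enn2real q"
  have Q: "1 \<le> Q" using recip_eq[OF q1 q] by (simp add: Q_def)
  obtain C t1 where C: "C > 0" "t1 > 0" "t1 \<le> 1/2" and I: "\<And>t. 0 < t \<Longrightarrow> t \<le> t1 \<Longrightarrow> weight_integral (\<alpha> * Q) (\<beta> * Q) t \<le> ennreal (C * gauge q \<alpha> \<beta> (1 - ln t) powr Q)"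
   using weight_integral_bounds[OF adm q] unfolding Q_def by blast
  obtain K where K: "1 \<le> K" "\<And>y y'. 1 \<le> y \<Longrightarrow> y \<le> y' \<Longrightarrow> pow_log (\<alpha> * Q) (\<beta> * Q) y' \<le> K * exp ((y' - y) / 2) * pow_log (\<alpha> * Q) (\<beta> * Q) y"
   using pow_log_growth[of "\<alpha> * Q" "\<beta> * Q"] by blast
  show ?thesis
  proof (rule ex_pos2[of "(2 * K + C) powr (1 / Q)" "t1"]; (intro conjI allI impI)?)
   show "0 < (2 * K + C) powr (1 / Q)" using K C by simp
   fix \<Omega> :: "'a set" and u c b assume c: "0 < c" and b: "0 < b" "b \<le> t1"
    and F: "\<forall>s\<in>{0<..<1}. rearr_int \<Omega> u s \<le> ennreal (c * min s b)"
   let ?L = "1 - ln b" and ?P = "pow_log (\<alpha> * Q) (\<beta> * Q)" and ?W = "LZ_weight q \<alpha> \<beta>"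
   let ?g = "gauge q \<alpha> \<beta> ?L"
   have L: "1 \<le> ?L" using b C by simp
   have g: "0 < ?g" by (rule gauge_pos[OF L])
   \<comment> \<open>The coefficient left after \<open>?P\<close> at 1 - ln s has been bounded by
     its value at \<open>?L\<close> times K times the square root of b / s.\<close>
   define A where "A = c powr Q * K * ?P ?L * b powr (1/2)"
   have A0: "0 < A" using c K b pow_log_pos[OF L] by (simp add: A_def)
   have pt: "ennreal_powr (ennreal (?W s) * (rearr_int \<Omega> u s / ennreal s)) Q * indicator {0<..<1} s
    \<le> ennreal (A * s powr (Q - 3/2)) * indicator {0..b} s + ennreal ((c * b) powr Q) * (ennreal (?P (1 - ln s) / s) * indicator {b<..<1} s)" for s
   proof (cases "s \<in> {0<..<1}")
    case True
    then have s: "0 < s" "s < 1" by auto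
    have W: "0 < ?W s" by (rule LZ_weight_pos[OF s])
    have Wp: "(?W s / s) powr Q = ?P (1 - ln s) / s" using LZ_weight_powr[OF q1 q s] by (simp add: Q_def)
    have P: "0 < ?P (1 - ln s)" using s by (intro pow_log_pos) auto
    have "ennreal (?W s) * (rearr_int \<Omega> u s / ennreal s) \<le> ennreal (?W s) * (ennreal (c * min s b) / ennreal s)"
     using F True by (intro mult_left_mono divide_right_mono_ennreal) auto
    also have "\<dots> = ennreal (?W s / s * (c * min s b))" using s W c b by (simp add: divide_ennreal ennreal_mult[symmetric])
    finally have "ennreal_powr (ennreal (?W s) * (rearr_int \<Omega> u s / ennreal s)) Q \<le> ennreal_powr (ennreal (?W s / s * (c * min s b))) Q"
     using Q by (intro ennreal_powr_mono) auto
    also have "\<dots> = ennreal (?P (1 - ln s) / s * (c * min s b) powr Q)"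
    proof -
     have "(?W s / s * (c * min s b)) powr Q = (?W s / s) powr Q * (c * min s b) powr Q" by (rule powr_mult)
     then show ?thesis using s W c b Wp by (simp add: ennreal_powr_ennreal)
    qed
    finally have *: "ennreal_powr (ennreal (?W s) * (rearr_int \<Omega> u s / ennreal s)) Q \<le> \<dots>" .
    show ?thesis
    proof (cases "s \<le> b")
     case sb: True
     have "?P (1 - ln s) \<le> K * exp (((1 - ln s) - ?L) / 2) * ?P ?L" using sb s b by (intro K(2) L) auto
     also have "exp (((1 - ln s) - ?L) / 2) = b powr (1/2) * s powr (- (1/2))"
      using s b by (simp add: powr_def exp_add[symmetric] diff_divide_distrib)
     finally have "?P (1 - ln s) / s * (c * min s b) powr Q \<le> (K * (b powr (1/2) * s powr (- (1/2))) * ?P ?L) / s * (c * s) powr Q"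
      using s sb c K(1) pow_log_pos[OF L, of "\<alpha> * Q" "\<beta> * Q"]
      by (intro mult_mono divide_right_mono divide_nonneg_nonneg mult_nonneg_nonneg) auto
     also have "\<dots> = A * (s powr (- (1/2)) * s powr (- 1) * s powr Q)"
     proof -
      have e: "(c * s) powr Q = c powr Q * s powr Q" "s powr (- 1) = 1 / s" using s by (auto simp: powr_mult powr_minus divide_inverse)
      have "K * (B * x) * P / s * (cq * sq) = cq * K * P * B * (x * (1 / s) * sq)" for B x P cq sq :: real by simp
      then show ?thesis unfolding e A_def by blast
     qed
     also have "s powr (- (1/2)) * s powr (- 1) * s powr Q = s powr (Q - 3/2)" unfolding powr_add[symmetric] by (simp add: field_simps)
     finally have "ennreal (?P (1 - ln s) / s * (c * min s b) powr Q) \<le> ennreal (A * s powr (Q - 3/2))" by (rule ennreal_leI)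
     with * show ?thesis using True sb by (auto intro: order_trans)
    next
     case sb: False
     then have "?P (1 - ln s) / s * (c * min s b) powr Q = (c * b) powr Q * (?P (1 - ln s) / s)" by simp
     moreover have "ennreal ((c * b) powr Q * (?P (1 - ln s) / s)) = ennreal ((c * b) powr Q) * ennreal (?P (1 - ln s) / s)"
      using P s by (intro ennreal_mult) auto
     ultimately have "ennreal (?P (1 - ln s) / s * (c * min s b) powr Q) = ennreal ((c * b) powr Q) * ennreal (?P (1 - ln s) / s)" by (simp only:)
     with * show ?thesis using True sb by simp
    qed
   qed simp
   have i1: "(\<integral>\<^sup>+s. ennreal (A * s powr (Q - 3/2)) * indicator {0..b} s \<partial>lborel) \<le> ennreal (2 * K * ((c * b) powr Q * ?g powr Q))"
   proof -
    have "((\<lambda>s. A * s powr (Q - 3/2)) has_integral (A * (b powr (Q - 3/2 + 1) / (Q - 3/2 + 1)))) {0..b}"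
     using Q b by (intro has_integral_mult_right has_integral_powr_from_0) auto
    then have "(\<integral>\<^sup>+s. ennreal (A * s powr (Q - 3/2)) * indicator {0..b} s \<partial>lborel) = ennreal (A * (b powr (Q - 3/2 + 1) / (Q - 3/2 + 1)))"
     using A0 by (intro nn_integral_has_integral_lebesgue') auto
    also have "\<dots> \<le> ennreal (2 * K * ((c * b) powr Q * ?g powr Q))"
    proof (rule ennreal_leI)
     \<comment> \<open>As Q is at least 1, the denominator is at least 1 / 2.\<close>
     have "b powr (Q - 3/2 + 1) / (Q - 3/2 + 1) \<le> b powr (Q - 1/2) / (1/2)" using Q b by (intro frac_le) auto
     then have "A * (b powr (Q - 3/2 + 1) / (Q - 3/2 + 1)) \<le> A * (2 * b powr (Q - 1/2))" using A0 by (intro mult_left_mono) auto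
     also have "\<dots> = 2 * K * (c powr Q * (b powr (1/2) * b powr (Q - 1/2)) * ?P ?L)" by (simp add: A_def mult_ac)
     also have "b powr (1/2) * b powr (Q - 1/2) = b powr Q" by (simp add: powr_add[symmetric])
     also have "2 * K * (c powr Q * b powr Q * ?P ?L) \<le> 2 * K * (c powr Q * b powr Q * ?g powr Q)"
      using K pow_log_le_gauge_powr[OF adm q L] by (intro mult_left_mono) (auto simp: Q_def)
     finally show "A * (b powr (Q - 3/2 + 1) / (Q - 3/2 + 1)) \<le> 2 * K * ((c * b) powr Q * ?g powr Q)" using c b by (simp add: powr_mult)
    qed
    finally show ?thesis .
   qed
   have i2: "(\<integral>\<^sup>+s. ennreal ((c * b) powr Q) * (ennreal (?P (1 - ln s) / s) * indicator {b<..<1} s) \<partial>lborel) \<le> ennreal (C * ((c * b) powr Q * ?g powr Q))"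
   proof -
    have "(\<integral>\<^sup>+s. ennreal ((c * b) powr Q) * (ennreal (?P (1 - ln s) / s) * indicator {b<..<1} s) \<partial>lborel) = ennreal ((c * b) powr Q) * weight_integral (\<alpha> * Q) (\<beta> * Q) b"
     unfolding weight_integral_def by (rule nn_integral_cmult) (unfold pow_log_def, measurable)
    also have "\<dots> \<le> ennreal ((c * b) powr Q) * ennreal (C * ?g powr Q)" by (intro mult_left_mono I b) auto
    also have "\<dots> = ennreal (C * ((c * b) powr Q * ?g powr Q))" using C by (simp add: ennreal_mult[symmetric] mult_ac)
    finally show ?thesis .
   qed
   have "(\<integral>\<^sup>+s. ennreal_powr (ennreal (?W s) * (rearr_int \<Omega> u s / ennreal s)) Q * indicator {0<..<1} s \<partial>lborel)
    \<le> (\<integral>\<^sup>+s. ennreal (A * s powr (Q - 3/2)) * indicator {0..b} s + ennreal ((c * b) powr Q) * (ennreal (?P (1 - ln s) / s) * indicator {b<..<1} s) \<partial>lborel)"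
    by (intro nn_integral_mono pt)
   also have "\<dots> = (\<integral>\<^sup>+s. ennreal (A * s powr (Q - 3/2)) * indicator {0..b} s \<partial>lborel) + (\<integral>\<^sup>+s. ennreal ((c * b) powr Q) * (ennreal (?P (1 - ln s) / s) * indicator {b<..<1} s) \<partial>lborel)"
    by (rule nn_integral_add) (unfold pow_log_def, measurable)
   also have "\<dots> \<le> ennreal (2 * K * ((c * b) powr Q * ?g powr Q)) + ennreal (C * ((c * b) powr Q * ?g powr Q))" by (intro add_mono i1 i2)
   also have "\<dots> = ennreal ((2 * K + C) * ((c * b) powr Q * ?g powr Q))"
    using K C by (simp add: ennreal_plus[symmetric] distrib_right del: ennreal_plus)
   finally have "LZ_norm_on \<Omega> q \<alpha> \<beta> u \<le> ennreal_powr (ennreal ((2 * K + C) * ((c * b) powr Q * ?g powr Q))) (1 / Q)"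
    unfolding LZ_norm_on_finite[OF q] Q_def[symmetric] using Q by (intro ennreal_powr_mono) auto
   also have "\<dots> = ennreal (((2 * K + C) * ((c * b) powr Q * ?g powr Q)) powr (1 / Q))" using K C by (intro ennreal_powr_ennreal) auto
   also have "((2 * K + C) * ((c * b) powr Q * ?g powr Q)) powr (1 / Q) = (2 * K + C) powr (1 / Q) * c * b * ?g"
    using K C c b g Q by (simp add: powr_mult powr_powr)
   finally show "LZ_norm_on \<Omega> q \<alpha> \<beta> u \<le> ennreal ((2 * K + C) powr (1 / Q) * c * b * ?g)" .
  qed (use C in auto)
next
  case True
  have r: "recip top = 0" by (simp add: recip_def)
  obtain K where K: "1 \<le> K" "\<And>y y'. 1 \<le> y \<Longrightarrow> y \<le> y' \<Longrightarrow> gauge q \<alpha> \<beta> y' \<le> K * exp ((y' - y) / 2) * gauge q \<alpha> \<beta> y"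
   using gauge_growth[of q \<alpha> \<beta>] by blast
  obtain K2 where K2: "1 \<le> K2" "\<And>y y'. 1 \<le> y \<Longrightarrow> y \<le> y' \<Longrightarrow> gauge q \<alpha> \<beta> y \<le> K2 * gauge q \<alpha> \<beta> y'"
   using gauge_almost_increasing[OF adm] by blast
  show ?thesis
  proof (rule ex_pos2[of "K + K2" "1/2 :: real"]; (intro conjI allI impI)?)
   fix \<Omega> :: "'a set" and u and c b :: real assume c: "0 < c" and b: "0 < b" "b \<le> 1/2"
    and F: "\<forall>s\<in>{0<..<1}. rearr_int \<Omega> u s \<le> ennreal (c * min s b)"
   let ?L = "1 - ln b"
   let ?g = "gauge q \<alpha> \<beta> ?L"
   have L: "1 \<le> ?L" using b by simp
   have g: "0 < ?g" by (rule gauge_pos[OF L])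
   have pt: "ennreal (s powr (1 - recip \<infinity>) * ell s powr \<alpha> * ellell s powr \<beta>) * (rearr_int \<Omega> u s / ennreal s) \<le> ennreal ((K + K2) * c * b * ?g)"
    if "s \<in> {0<..<1}" for s
   proof -
    have s: "0 < s" "s < 1" using that by auto
    let ?y = "1 - ln s"
    have y: "1 \<le> ?y" using s by simp
    have gy: "gauge q \<alpha> \<beta> ?y = pow_log \<alpha> \<beta> ?y" using adm y unfolding True by (rule gauge_infinity)
    have w: "s powr (1 - recip \<infinity>) * ell s powr \<alpha> * ellell s powr \<beta> = s * gauge q \<alpha> \<beta> ?y"
     unfolding LZ_weight_eq[OF s] gy using s by (simp add: LZ_weight_def r)
    have "ennreal (s * gauge q \<alpha> \<beta> ?y) * (rearr_int \<Omega> u s / ennreal s) \<le> ennreal (s * gauge q \<alpha> \<beta> ?y) * (ennreal (c * min s b) / ennreal s)"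
     using F that by (intro mult_left_mono divide_right_mono_ennreal) auto
    also have "\<dots> = ennreal (gauge q \<alpha> \<beta> ?y * (c * min s b))"
     using s c b gauge_pos[OF y, of q \<alpha> \<beta>] by (simp add: divide_ennreal ennreal_mult[symmetric])
    also have "\<dots> \<le> ennreal ((K + K2) * c * b * ?g)"
    proof (rule ennreal_leI)
     show "gauge q \<alpha> \<beta> ?y * (c * min s b) \<le> (K + K2) * c * b * ?g"
     proof (cases "s \<le> b")
      case sb: True
      have "gauge q \<alpha> \<beta> ?y \<le> K * exp ((?y - ?L) / 2) * ?g" using sb s b by (intro K(2) L) auto
      also have "exp ((?y - ?L) / 2) \<le> exp (?y - ?L)" using sb s b by simp
      also have "exp (?y - ?L) = b / s" using s b by (simp add: exp_diff)
      finally have "gauge q \<alpha> \<beta> ?y \<le> K * (b / s) * ?g" using K g by simp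
      then have "gauge q \<alpha> \<beta> ?y * (c * s) \<le> K * (b / s) * ?g * (c * s)" using c s by (intro mult_right_mono) auto
      also have "\<dots> = K * (c * b * ?g)" using s by simp
      also have "\<dots> \<le> (K + K2) * (c * b * ?g)" using K2 c b g by (intro mult_right_mono) auto
      finally show ?thesis using sb by (simp add: mult_ac)
     next
      case sb: False
      have "gauge q \<alpha> \<beta> ?y \<le> K2 * ?g" using sb s b y by (intro K2(2)) auto
      then have "gauge q \<alpha> \<beta> ?y * (c * b) \<le> K2 * ?g * (c * b)" using c b by (intro mult_right_mono) auto
      also have "\<dots> = K2 * (c * b * ?g)" by simp
      also have "\<dots> \<le> (K + K2) * (c * b * ?g)" using K c b g by (intro mult_right_mono) auto
      finally show ?thesis using sb by (simp add: mult_ac)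
     qed
    qed
    finally show ?thesis unfolding w .
   qed
   have m: "(\<lambda>s. ennreal (s powr (1 - recip \<infinity>) * ell s powr \<alpha> * ellell s powr \<beta>) * (rearr_int \<Omega> u s / ennreal s)) \<in> borel_measurable unit_meas"
   proof -
    have [measurable]: "rearr_int \<Omega> u \<in> borel_measurable borel" by (rule mono_borel_measurable) (rule rearr_int_mono)
    have "(\<lambda>s. ennreal (s powr (1 - recip \<infinity>) * ell s powr \<alpha> * ellell s powr \<beta>) * (rearr_int \<Omega> u s / ennreal s)) \<in> borel_measurable borel"
     unfolding ell_def ellell_def by measurable
    then show ?thesis by (intro measurable_restrict_space1 measurable_completion) simp
   qed
   show "LZ_norm_on \<Omega> q \<alpha> \<beta> u \<le> ennreal ((K + K2) * c * b * ?g)"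
    unfolding True LZ_norm_on_infinity unfolding True[symmetric]
   proof (rule esssup_I)
    show "AE s in unit_meas. ennreal (s powr (1 - recip q) * ell s powr \<alpha> * ellell s powr \<beta>) * (rearr_int \<Omega> u s / ennreal s) \<le> ennreal ((K + K2) * c * b * ?g)"
     unfolding True by (rule AE_I2) (use pt in \<open>simp add: True\<close>)
   qed (use m True in simp)
  qed (use K K2 in auto)
qed

section \<open>Embeddings and optimality\<close>

lemma AE_continuous_le:
  fixes f :: "'a::euclidean_space \<Rightarrow> real"
  assumes "open \<Omega>" "continuous_on \<Omega> f" "AE x in lebesgue_on \<Omega>. f x \<le> c" "x \<in> \<Omega>"
  shows "f x \<le> c"
proof (rule ccontr)
  assume "\<not> f x \<le> c"
  define U where "U = \<Omega> \<inter> f -` {c<..}"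
  have U: "open U" unfolding U_def using assms(1,2) by (intro continuous_open_preimage) auto
  have "\<Omega> \<in> sets lebesgue" using assms(1) by (simp add: lborelD)
  then have "AE x in lebesgue. x \<in> \<Omega> \<longrightarrow> f x \<le> c" using assms(3) by (subst (asm) AE_restrict_space_iff) auto
  then have "AE x in lebesgue. x \<notin> U" by eventually_elim (auto simp: U_def)
  then have "U \<in> null_sets lebesgue" using U by (subst (asm) AE_iff_null_sets[symmetric]) (auto simp: lborelD)
  then have "negligible U" by (simp add: negligible_iff_null_sets)
  moreover have "x \<in> U" using \<open>\<not> f x \<le> c\<close> assms(4) by (simp add: U_def)
  ultimately show False using open_not_negligible[OF U] by blast
qed

lemma AE_continuous_eq:
  fixes f g :: "'a::euclidean_space \<Rightarrow> real"
  assumes "open \<Omega>" "continuous_on \<Omega> f" "continuous_on \<Omega> g" "AE x in lebesgue_on \<Omega>. f x = g x" "x \<in> \<Omega>"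
  shows "f x = g x"
proof -
  have "\<bar>f x - g x\<bar> \<le> 0" by (rule AE_continuous_le[OF assms(1) _ _ assms(5)])
    (use assms in \<open>auto intro!: continuous_intros elim!: eventually_mono\<close>)
  then show ?thesis by simp
qed

lemma continuous_le_esssup:
  fixes f :: "'a::euclidean_space \<Rightarrow> real"
  assumes "open \<Omega>" "continuous_on \<Omega> f" "x \<in> \<Omega>"
  shows "ennreal \<bar>f x\<bar> \<le> esssup (lebesgue_on \<Omega>) (\<lambda>x. ennreal \<bar>f x\<bar>)"
proof -
  let ?e = "esssup (lebesgue_on \<Omega>) (\<lambda>x. ennreal \<bar>f x\<bar>)"
  have ae: "AE x in lebesgue_on \<Omega>. ennreal \<bar>f x\<bar> \<le> ?e" by (rule esssup_AE)
  show ?thesis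
  proof (cases ?e)
   case (real c)
   have "AE x in lebesgue_on \<Omega>. \<bar>f x\<bar> \<le> c" using ae unfolding real(2) by eventually_elim (simp add: real(1))
   then have "\<bar>f x\<bar> \<le> c" by (intro AE_continuous_le[OF assms(1) _ _ assms(3)]) (use assms in \<open>auto intro!: continuous_intros\<close>)
   then show ?thesis unfolding real(2) by (rule ennreal_leI)
  qed simp
qed

section \<open>Measurability and norms of smooth functions\<close>

lemma locally_integrable_measurable:
  fixes u :: "'a::euclidean_space \<Rightarrow> real"
  assumes op: "open \<Omega>" and u: "locally_integrable \<Omega> u"
  shows "u \<in> borel_measurable (lebesgue_on \<Omega>)"
proof -
  obtain D where D: "countable D" "D \<subseteq> Pow \<Omega>" "\<And>X. X \<in> D \<Longrightarrow> \<exists>a b. X = cbox a b" "\<Union>D = \<Omega>"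
   using open_countable_Union_open_cbox[OF op] by metis
  show ?thesis
  proof (rule measurable_piecewise_restrict[OF D(1)])
   fix X assume X: "X \<in> D"
   then obtain a b where ab: "X = cbox a b" using D(3) by blast
   have sub: "X \<subseteq> \<Omega>" using X D(2) by blast
   show "X \<inter> space (lebesgue_on \<Omega>) \<in> sets (lebesgue_on \<Omega>)"
    using sub ab by (auto simp: sets_restrict_space intro!: image_eqI[of _ _ X])
   have "integrable (lebesgue_on X) u" using u sub ab by (auto simp: locally_integrable_def)
   moreover have "restrict_space (lebesgue_on \<Omega>) X = lebesgue_on X"
    using sub op ab by (subst restrict_restrict_space) (auto simp: lborelD Int_absorb1)
   ultimately show "u \<in> borel_measurable (restrict_space (lebesgue_on \<Omega>) X)" by simp
  qed (use D in auto)
qed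

lemma has_weak_deriv_weak_deriv:
  assumes "weakly_differentiable \<Omega> m u" "length is \<le> m"
  shows "has_weak_deriv \<Omega> is u (weak_deriv \<Omega> is u)"
proof -
  have "\<exists>v. has_weak_deriv \<Omega> is u v" using assms by (simp add: weakly_differentiable_def)
  then show ?thesis unfolding weak_deriv_def by (rule someI_ex)
qed

lemma weak_deriv_measurable:
  assumes "open \<Omega>" "weakly_differentiable \<Omega> m u" "length is \<le> m"
  shows "weak_deriv \<Omega> is u \<in> borel_measurable (lebesgue_on \<Omega>)"
  using has_weak_deriv_weak_deriv[OF assms(2,3)] by (intro locally_integrable_measurable[OF assms(1)]) (simp add: has_weak_deriv_def)

lemma abs_weak_grad_measurable:
  assumes "open \<Omega>" "weakly_differentiable \<Omega> m u" "k \<le> m"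
  shows "abs_weak_grad \<Omega> k u \<in> borel_measurable (lebesgue_on \<Omega>)"
proof -
  have [measurable]: "weak_deriv \<Omega> is u \<in> borel_measurable (lebesgue_on \<Omega>)" if "is \<in> {is. length is = k}" for "is"
   using weak_deriv_measurable[OF assms(1,2)] assms(3) that by simp
  show ?thesis unfolding abs_weak_grad_def[abs_def] by measurable
qed

lemma abs_weak_grad_eq_L2_set: "abs_weak_grad \<Omega> k u x = L2_set (\<lambda>is. weak_deriv \<Omega> is u x) {is. length is = k}"
  by (simp add: abs_weak_grad_def L2_set_def)

lemma abs_weak_grad_nonneg [simp]: "0 \<le> abs_weak_grad \<Omega> k u x"
  by (simp add: abs_weak_grad_eq_L2_set)

lemma weak_deriv_le_abs_weak_grad: "length is = k \<Longrightarrow> \<bar>weak_deriv \<Omega> is u x\<bar> \<le> abs_weak_grad \<Omega> k u x"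
proof -
  assume l: "length is = k"
  have "\<bar>weak_deriv \<Omega> is u x\<bar> \<le> L2_set (\<lambda>is. \<bar>weak_deriv \<Omega> is u x\<bar>) {is. length is = k}"
   using l by (intro member_le_L2_set) auto
  then show ?thesis by (simp add: abs_weak_grad_eq_L2_set L2_set_def)
qed

lemma smooth_weakly_differentiable:
  assumes "smooth f" "open \<Omega>"
  shows "weakly_differentiable \<Omega> m f"
   and "AE x in lebesgue_on \<Omega>. weak_deriv \<Omega> is f x = partial_derivs is f x"
proof -
  show wd: "weakly_differentiable \<Omega> m f" for m unfolding weakly_differentiable_def using has_weak_deriv_smooth[OF assms] by blast
  show "AE x in lebesgue_on \<Omega>. weak_deriv \<Omega> is f x = partial_derivs is f x"
   by (rule has_weak_deriv_unique[OF has_weak_deriv_weak_deriv[OF wd order_refl] has_weak_deriv_smooth[OF assms] assms(2)])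
qed

lemma smooth_abs_weak_grad_le:
  fixes f :: "real^'n::finite \<Rightarrow> real"
  assumes f: "smooth f" "open \<Omega>" and B: "\<And>is x. length is = k \<Longrightarrow> x \<in> \<Omega> \<Longrightarrow> \<bar>partial_derivs is f x\<bar> \<le> c * indicator D x"
  shows "AE x in lebesgue_on \<Omega>. \<bar>abs_weak_grad \<Omega> k f x\<bar> \<le> real CARD('n) ^ k * c * indicator D x"
proof -
  have "AE x in lebesgue_on \<Omega>. \<forall>is\<in>{is :: 'n list. length is = k}. weak_deriv \<Omega> is f x = partial_derivs is f x"
   by (intro eventually_ball_finite ballI smooth_weakly_differentiable(2)[OF f]) simp
  moreover have "AE x in lebesgue_on \<Omega>. x \<in> \<Omega>" by (rule AE_I2) simp
  ultimately show ?thesis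
  proof eventually_elim
   case (elim x)
   have "abs_weak_grad \<Omega> k f x \<le> (\<Sum>is | length is = k. \<bar>weak_deriv \<Omega> is f x\<bar>)"
    unfolding abs_weak_grad_eq_L2_set by (rule L2_set_le_sum_abs)
   also have "\<dots> \<le> (\<Sum>is :: 'n list | length is = k. c * indicator D x)" using elim B by (intro sum_mono) auto
   also have "\<dots> = real CARD('n) ^ k * c * indicator D x" by (simp add: card_lists_length)
   finally show ?case by simp
  qed
qed

text \<open>The gradients are bounded functions living on D, to which
  \<open>rearr_int_le_bump\<close> and \<open>LZ_norm_upper_bound\<close> apply. The factor k is
  separated from b because b has to stay below a threshold, while D may be as large as
  \<Omega>.\<close>

lemma smooth_sobolev_norm_le:
  fixes \<Omega> :: "(real^'n::finite) set"
  assumes adm: "L1_admissible q \<alpha> \<beta>" and op: "open \<Omega>" and bd: "bounded \<Omega>" and ne: "\<Omega> \<noteq> {}"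
  shows "\<exists>C>0. \<exists>b1>0. b1 \<le> 1/2 \<and> (\<forall>f D b c k. smooth f \<longrightarrow> D \<in> sets lebesgue \<longrightarrow> D \<subseteq> \<Omega> \<longrightarrow>
   0 < b \<longrightarrow> b \<le> b1 \<longrightarrow> 1 \<le> k \<longrightarrow> 0 < c \<longrightarrow> measure lebesgue D \<le> k * b * measure lebesgue \<Omega> \<longrightarrow>
   (\<forall>is x. length is \<le> m \<longrightarrow> x \<in> \<Omega> \<longrightarrow> \<bar>partial_derivs is f x\<bar> \<le> c * indicator D x) \<longrightarrow>
   f \<in> sobolev_LZ_space \<Omega> m q \<alpha> \<beta> \<and> sobolev_LZ_norm \<Omega> m q \<alpha> \<beta> f \<le> ennreal (C * c * k * b * gauge q \<alpha> \<beta> (1 - ln b)))"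
proof -
  have lm: "\<Omega> \<in> lmeasurable" using op bd by (simp add: lmeasurable_open)
  have V: "0 < measure lebesgue \<Omega>" using open_not_negligible[OF op ne] lm by (simp add: negligible_iff_measure zero_less_measure_iff)
  obtain C b1 where C: "0 < C" "0 < b1" "b1 \<le> 1/2"
   and LZ: "\<And>u c b. 0 < c \<Longrightarrow> 0 < b \<Longrightarrow> b \<le> b1 \<Longrightarrow> (\<forall>s\<in>{0<..<1}. rearr_int \<Omega> u s \<le> ennreal (c * min s b)) \<Longrightarrow>
    LZ_norm_on \<Omega> q \<alpha> \<beta> u \<le> ennreal (C * c * b * gauge q \<alpha> \<beta> (1 - ln b))"
   using LZ_norm_upper_bound[OF adm, where 'a="real^'n"] by blast
  define S where "S = (\<Sum>j=0..m. real CARD('n) ^ j)"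
  have S: "0 < S" unfolding S_def by (intro sum_pos) auto
  show ?thesis
  proof (rule ex_pos2[of "S * C" b1]; (intro conjI allI impI)?)
   fix f :: "real^'n \<Rightarrow> real" and D b c k
   assume f: "smooth f" and D: "D \<in> sets lebesgue" "D \<subseteq> \<Omega>" and b: "0 < b" "b \<le> b1" and k: "1 \<le> k" and c: "0 < c"
    and mD: "measure lebesgue D \<le> k * b * measure lebesgue \<Omega>"
    and B: "\<forall>is x. length is \<le> m \<longrightarrow> x \<in> \<Omega> \<longrightarrow> \<bar>partial_derivs is f x\<bar> \<le> c * indicator D x"
   let ?g = "gauge q \<alpha> \<beta> (1 - ln b)"
   have g: "0 < ?g" using b C by (intro gauge_pos one_le_one_minus_ln) auto
   have wd: "weakly_differentiable \<Omega> m f" by (rule smooth_weakly_differentiable(1)[OF f op])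
   have meas: "abs_weak_grad \<Omega> j f \<in> borel_measurable (lebesgue_on \<Omega>)" if "j \<le> m" for j
    by (rule abs_weak_grad_measurable[OF op wd that])
   have bound: "LZ_norm_on \<Omega> q \<alpha> \<beta> (abs_weak_grad \<Omega> j f) \<le> ennreal (real CARD('n) ^ j * (C * c * k * b * ?g))" if j: "j \<le> m" for j
   proof -
    let ?c = "real CARD('n) ^ j * c"
    have ae: "AE x in lebesgue_on \<Omega>. \<bar>abs_weak_grad \<Omega> j f x\<bar> \<le> ?c * indicator D x"
     using B j by (intro smooth_abs_weak_grad_le[OF f op]) auto
    have "rearr_int \<Omega> (abs_weak_grad \<Omega> j f) s \<le> ennreal ((?c * k) * min s b)" if s: "s \<in> {0<..<1}" for s
    proof -
     have "rearr_int \<Omega> (abs_weak_grad \<Omega> j f) s \<le> ennreal (?c * min s (k * b))"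
      using c s by (intro rearr_int_le_bump[OF lm V D mD ae meas[OF j]]) auto
     also have "\<dots> \<le> ennreal ((?c * k) * min s b)"
     proof (rule ennreal_leI)
      have "1 * s \<le> k * s" "1 * b \<le> k * b" using k s b by (auto intro!: mult_right_mono)
      then have "min s (k * b) \<le> k * min s b" using k by (auto simp: min_def)
      then have "?c * min s (k * b) \<le> ?c * (k * min s b)" using c by (intro mult_left_mono) auto
      then show "?c * min s (k * b) \<le> (?c * k) * min s b" by simp
     qed
     finally show ?thesis .
    qed
    then have "LZ_norm_on \<Omega> q \<alpha> \<beta> (abs_weak_grad \<Omega> j f) \<le> ennreal (C * (?c * k) * b * ?g)"
     using c k by (intro LZ b) auto
    then show ?thesis by (simp add: mult_ac)
   qed
   have "sobolev_LZ_norm \<Omega> m q \<alpha> \<beta> f \<le> (\<Sum>j=0..m. ennreal (real CARD('n) ^ j * (C * c * k * b * ?g)))"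
    unfolding sobolev_LZ_norm_def by (intro sum_mono bound) auto
   also have "\<dots> = ennreal (\<Sum>j=0..m. real CARD('n) ^ j * (C * c * k * b * ?g))" using C c k b g by (intro sum_ennreal) auto
   also have "(\<Sum>j=0..m. real CARD('n) ^ j * (C * c * k * b * ?g)) = S * C * c * k * b * ?g"
    unfolding S_def sum_distrib_right[symmetric] by simp
   finally show "sobolev_LZ_norm \<Omega> m q \<alpha> \<beta> f \<le> ennreal (S * C * c * k * b * ?g)" .
   have "LZ_norm_on \<Omega> q \<alpha> \<beta> (abs_weak_grad \<Omega> j f) < \<infinity>" if "j \<le> m" for j
    by (rule le_less_trans[OF bound[OF that]]) simp
   then show "f \<in> sobolev_LZ_space \<Omega> m q \<alpha> \<beta>" using wd meas by (simp add: sobolev_LZ_space_def LZ_space_def)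
  qed (use S C in simp_all)
qed

lemma smooth_scale:
  fixes f :: "real^'n::finite \<Rightarrow> real"
  assumes "smooth f"
  shows "partial_derivs is (\<lambda>z. f (a *\<^sub>R (z - c))) = (\<lambda>z. a ^ length is * partial_derivs is f (a *\<^sub>R (z - c)))"
   and "smooth (\<lambda>z. f (a *\<^sub>R (z - c)))"
proof -
  have der: "((\<lambda>z. k * g (a *\<^sub>R (z - c))) has_derivative (\<lambda>h. k * frechet_derivative g (at (a *\<^sub>R (z - c))) (a *\<^sub>R h))) (at z)"
   if "smooth g" for g :: "real^'n \<Rightarrow> real" and k z
  proof -
   have "(g has_derivative frechet_derivative g (at (a *\<^sub>R (z - c)))) (at (a *\<^sub>R (z - c)))"
    using smooth_differentiable[OF that] frechet_derivative_works by blast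
   moreover have "((\<lambda>z. a *\<^sub>R (z - c)) has_derivative (\<lambda>h. a *\<^sub>R h)) (at z)" by (auto intro!: derivative_eq_intros)
   ultimately have "((\<lambda>z. g (a *\<^sub>R (z - c))) has_derivative (\<lambda>h. frechet_derivative g (at (a *\<^sub>R (z - c))) (a *\<^sub>R h))) (at z)"
    by (rule has_derivative_compose[rotated])
   then show ?thesis by (rule has_derivative_mult_right)
  qed
  have pd: "partial_deriv i (\<lambda>z. k * g (a *\<^sub>R (z - c))) = (\<lambda>z. a * k * partial_deriv i g (a *\<^sub>R (z - c)))"
   if "smooth g" for g :: "real^'n \<Rightarrow> real" and k i
  proof
   fix z
   have "linear (frechet_derivative g (at (a *\<^sub>R (z - c))))" using smooth_differentiable[OF that] linear_frechet_derivative by blast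
   then show "partial_deriv i (\<lambda>z. k * g (a *\<^sub>R (z - c))) z = a * k * partial_deriv i g (a *\<^sub>R (z - c))"
    by (simp add: partial_deriv_eq[OF der[OF that]] linear_scale partial_deriv_def)
  qed
  show eq: "partial_derivs is (\<lambda>z. f (a *\<^sub>R (z - c))) = (\<lambda>z. a ^ length is * partial_derivs is f (a *\<^sub>R (z - c)))" for "is"
  proof (induction "is")
   case (Cons i "is")
   then show ?case by (simp add: partial_derivs_Cons pd[OF smooth_partial_derivs[OF assms]])
  qed simp
  show "smooth (\<lambda>z. f (a *\<^sub>R (z - c)))"
   unfolding smooth_def eq using der[OF smooth_partial_derivs[OF assms]] differentiable_def by blast
qed

text \<open>The embedding supplies some representative v. As u is continuous, v agrees with u
  everywhere on \<Omega>, so the bound concerns u itself.\<close>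

lemma embeds_hoelder_oscillation:
  fixes \<Omega> :: "'a::euclidean_space set"
  assumes op: "open \<Omega>" and emb: "embeds \<Omega> A nA (hoelder_space \<Omega> \<sigma>) (hoelder_norm \<Omega> \<sigma>)" and \<sigma>: "\<And>r. 0 < r \<Longrightarrow> 0 < \<sigma> r"
  shows "\<exists>C>0. \<forall>u\<in>A. \<forall>B\<ge>0. continuous_on \<Omega> u \<longrightarrow> nA u \<le> ennreal B \<longrightarrow>
   (\<forall>x\<in>\<Omega>. \<forall>y\<in>\<Omega>. x \<noteq> y \<longrightarrow> \<bar>u x - u y\<bar> \<le> C * B * \<sigma> (dist x y))"
proof -
  obtain C where C: "C > 0" and E: "\<forall>u\<in>A. \<exists>v\<in>hoelder_space \<Omega> \<sigma>. (AE x in lebesgue_on \<Omega>. v x = u x) \<and> hoelder_norm \<Omega> \<sigma> v \<le> ennreal C * nA u"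
   using emb unfolding embeds_def by blast
  have "\<bar>u x - u y\<bar> \<le> C * B * \<sigma> (dist x y)"
   if u: "u \<in> A" "continuous_on \<Omega> u" and B: "0 \<le> B" "nA u \<le> ennreal B" and xy: "x \<in> \<Omega>" "y \<in> \<Omega>" "x \<noteq> y" for u B x y
  proof -
   obtain v where v: "v \<in> hoelder_space \<Omega> \<sigma>" "AE x in lebesgue_on \<Omega>. v x = u x" "hoelder_norm \<Omega> \<sigma> v \<le> ennreal C * nA u"
    using E u(1) by blast
   have eq: "v z = u z" if "z \<in> \<Omega>" for z using v u(2) that by (intro AE_continuous_eq[OF op]) (auto simp: hoelder_space_def)
   have "ennreal (\<bar>v x - v y\<bar> / \<sigma> (dist x y)) \<le> (SUP (x, y)\<in>{(x, y). x \<in> \<Omega> \<and> y \<in> \<Omega> \<and> x \<noteq> y}. ennreal (\<bar>v x - v y\<bar> / \<sigma> (dist x y)))"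
    using xy by (intro SUP_upper2[of "(x, y)"]) auto
   also have "\<dots> \<le> hoelder_norm \<Omega> \<sigma> v" by (simp add: hoelder_norm_def)
   also have "\<dots> \<le> ennreal C * ennreal B" using v(3) B(2) by (meson mult_left_mono order_trans zero_le)
   also have "\<dots> = ennreal (C * B)" using C B by (simp add: ennreal_mult)
   finally have "\<bar>v x - v y\<bar> / \<sigma> (dist x y) \<le> C * B" using C B by simp
   then show ?thesis using \<sigma>[of "dist x y"] xy eq by (simp add: pos_divide_le_eq)
  qed
  then show ?thesis using C by blast
qed

text \<open>Close pairs of points are compared through the moduli, distant ones through the supremum
  of u. The latter requires \<sigma> to be bounded below at distances of at least r.\<close>

lemma hoelder_embeds:
  fixes \<Omega> :: "'a::euclidean_space set"
  assumes op: "open \<Omega>" and pos: "\<And>r. 0 < r \<Longrightarrow> 0 < \<omega> r" "\<And>r. 0 < r \<Longrightarrow> 0 < \<sigma> r"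
   and C: "0 < C" "\<And>x y. x \<in> \<Omega> \<Longrightarrow> y \<in> \<Omega> \<Longrightarrow> x \<noteq> y \<Longrightarrow> dist x y < r \<Longrightarrow> \<omega> (dist x y) \<le> C * \<sigma> (dist x y)"
   and m: "0 < m" "\<And>x y. x \<in> \<Omega> \<Longrightarrow> y \<in> \<Omega> \<Longrightarrow> r \<le> dist x y \<Longrightarrow> m \<le> \<sigma> (dist x y)"
  shows "embeds \<Omega> (hoelder_space \<Omega> \<omega>) (hoelder_norm \<Omega> \<omega>) (hoelder_space \<Omega> \<sigma>) (hoelder_norm \<Omega> \<sigma>)"
  unfolding embeds_def
proof (intro exI[of _ "1 + (C + 2 / m)"] conjI ballI)
  show "0 < 1 + (C + 2 / m)" using C m by (simp add: add_pos_pos)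
  fix u assume u: "u \<in> hoelder_space \<Omega> \<omega>"
  then have cont: "continuous_on \<Omega> u" and bdd: "bounded (u ` \<Omega>)" and fin: "hoelder_norm \<Omega> \<omega> u < \<infinity>" by (auto simp: hoelder_space_def)
  define H where "H = enn2real (hoelder_norm \<Omega> \<omega> u)"
  have H: "hoelder_norm \<Omega> \<omega> u = ennreal H" "0 \<le> H" using fin by (auto simp: H_def less_top)
  have sup: "\<bar>u x\<bar> \<le> H" if "x \<in> \<Omega>" for x
  proof -
   have "ennreal \<bar>u x\<bar> \<le> hoelder_norm \<Omega> \<omega> u"
    using continuous_le_esssup[OF op cont that] by (simp add: hoelder_norm_def Lq_norm_def add_increasing2)
   then show ?thesis unfolding H(1) using H(2) by simp
  qed
  have osc: "\<bar>u x - u y\<bar> \<le> H * \<omega> (dist x y)" if "x \<in> \<Omega>" "y \<in> \<Omega>" "x \<noteq> y" for x y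
  proof -
   have "ennreal (\<bar>u x - u y\<bar> / \<omega> (dist x y)) \<le> (SUP (x, y)\<in>{(x, y). x \<in> \<Omega> \<and> y \<in> \<Omega> \<and> x \<noteq> y}. ennreal (\<bar>u x - u y\<bar> / \<omega> (dist x y)))"
    using that by (intro SUP_upper2[of "(x, y)"]) auto
   also have "\<dots> \<le> ennreal H" unfolding H(1)[symmetric] by (simp add: hoelder_norm_def)
   finally have "\<bar>u x - u y\<bar> / \<omega> (dist x y) \<le> H" using H(2) by simp
   then show ?thesis using pos(1)[of "dist x y"] that by (simp add: pos_divide_le_eq)
  qed
  have osc': "\<bar>u x - u y\<bar> / \<sigma> (dist x y) \<le> (C + 2 / m) * H" if xy: "x \<in> \<Omega>" "y \<in> \<Omega>" "x \<noteq> y" for x y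
  proof (cases "dist x y < r")
   case True
   have \<sigma>: "0 < \<sigma> (dist x y)" using pos(2) xy by simp
   have "\<bar>u x - u y\<bar> \<le> H * (C * \<sigma> (dist x y))" using osc[OF xy] mult_left_mono[OF C(2)[OF xy True] H(2)] by linarith
   then have "\<bar>u x - u y\<bar> / \<sigma> (dist x y) \<le> C * H" using \<sigma> by (simp add: pos_divide_le_eq mult_ac)
   also have "\<dots> \<le> (C + 2 / m) * H" using m H(2) by (intro mult_right_mono) auto
   finally show ?thesis .
  next
   case False
   have "\<bar>u x - u y\<bar> \<le> 2 * H" using sup[OF xy(1)] sup[OF xy(2)] by linarith
   then have "\<bar>u x - u y\<bar> / \<sigma> (dist x y) \<le> 2 * H / m" using m(1) m(2)[OF xy(1,2)] False H(2) by (intro frac_le) auto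
   also have "\<dots> = (2 / m) * H" by simp
   also have "\<dots> \<le> (C + 2 / m) * H" using C H(2) by (intro mult_right_mono) auto
   finally show ?thesis .
  qed
  have le: "hoelder_norm \<Omega> \<sigma> u \<le> ennreal (1 + (C + 2 / m)) * hoelder_norm \<Omega> \<omega> u"
  proof -
   have "Lq_norm (lebesgue_on \<Omega>) \<infinity> (\<lambda>x. ennreal \<bar>u x\<bar>) \<le> ennreal H"
    unfolding H(1)[symmetric] by (simp add: hoelder_norm_def)
   moreover have "(SUP (x, y)\<in>{(x, y). x \<in> \<Omega> \<and> y \<in> \<Omega> \<and> x \<noteq> y}. ennreal (\<bar>u x - u y\<bar> / \<sigma> (dist x y))) \<le> ennreal ((C + 2 / m) * H)"
    by (intro SUP_least) (auto intro!: ennreal_leI osc')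
   ultimately have "hoelder_norm \<Omega> \<sigma> u \<le> ennreal H + ennreal ((C + 2 / m) * H)" unfolding hoelder_norm_def by (rule add_mono)
   also have "\<dots> = ennreal (H + (C + 2 / m) * H)" using H(2) C m by (intro ennreal_plus[symmetric]) auto
   also have "H + (C + 2 / m) * H = (1 + (C + 2 / m)) * H" by (simp add: distrib_right)
   also have "ennreal ((1 + (C + 2 / m)) * H) = ennreal (1 + (C + 2 / m)) * ennreal H" using H(2) C m by (intro ennreal_mult) auto
   finally show ?thesis unfolding H(1) .
  qed
  show "\<exists>v\<in>hoelder_space \<Omega> \<sigma>. (AE x in lebesgue_on \<Omega>. v x = u x) \<and> hoelder_norm \<Omega> \<sigma> v \<le> ennreal (1 + (C + 2 / m)) * hoelder_norm \<Omega> \<omega> u"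
  proof (intro bexI[of _ u] conjI le)
   have "hoelder_norm \<Omega> \<sigma> u < \<infinity>" using fin by (intro le_less_trans[OF le]) (simp add: ennreal_mult_less_top)
   then show "u \<in> hoelder_space \<Omega> \<sigma>" using cont bdd by (simp add: hoelder_space_def)
  qed simp
qed

text \<open>\<open>gauge_growth\<close> starting from y = 1. It absorbs the linear term of the
  oscillation bound and gives the condition on \<open>\<omega> r / r\<close> in
  \<open>modulus_of_continuity\<close>.\<close>

lemma le_inverse_gauge:
  "\<exists>K>0. \<forall>r. 0 < r \<longrightarrow> r \<le> 1 \<longrightarrow> r * gauge q \<alpha> \<beta> (1 - ln r) \<le> K"
proof -
  obtain K where K: "1 \<le> K" "\<And>y y'. 1 \<le> y \<Longrightarrow> y \<le> y' \<Longrightarrow> gauge q \<alpha> \<beta> y' \<le> K * exp ((y' - y) / 2) * gauge q \<alpha> \<beta> y"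
   using gauge_growth[of q \<alpha> \<beta>] by blast
  have g1: "0 < gauge q \<alpha> \<beta> 1" by (rule gauge_pos) simp
  have "r * gauge q \<alpha> \<beta> (1 - ln r) \<le> K * gauge q \<alpha> \<beta> 1" if r: "0 < r" "r \<le> 1" for r
  proof -
   have l: "ln r \<le> 0" using r by simp
   have "gauge q \<alpha> \<beta> (1 - ln r) \<le> K * exp ((1 - ln r - 1) / 2) * gauge q \<alpha> \<beta> 1" using l by (intro K(2)) auto
   also have "\<dots> \<le> K * exp (- ln r) * gauge q \<alpha> \<beta> 1" using l K(1) g1 by (intro mult_right_mono mult_left_mono) auto
   also have "exp (- ln r) = 1 / r" using r by (simp add: exp_minus divide_inverse)
   finally show ?thesis using r by (simp add: field_simps)
  qed
  then show ?thesis using K(1) g1 by (intro exI[of _ "K * gauge q \<alpha> \<beta> 1"]) auto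
qed

lemma modulus_of_continuity_gauge:
  assumes adm: "L1_admissible q \<alpha> \<beta>" and pos: "\<forall>r>0. 0 < \<omega> r" and c: "0 < c" and r0: "0 < r0" "r0 \<le> 1"
   and eq: "\<And>r. r \<in> {0<..<r0} \<Longrightarrow> 1 / (c * gauge q \<alpha> \<beta> (1 - ln r)) \<le> \<omega> r \<and> \<omega> r \<le> c / gauge q \<alpha> \<beta> (1 - ln r)"
  shows "modulus_of_continuity \<omega>"
proof -
  let ?\<gamma> = "gauge q \<alpha> \<beta>"
  let ?G = "\<lambda>r. ?\<gamma> (1 - ln r)"
  obtain K where K: "1 \<le> K" "\<And>y y'. 1 \<le> y \<Longrightarrow> y \<le> y' \<Longrightarrow> ?\<gamma> y \<le> K * ?\<gamma> y'"
   using gauge_almost_increasing[OF adm] by blast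
  have Gpos: "0 < ?G r" if "0 < r" "r \<le> 1" for r using that by (intro gauge_pos one_le_one_minus_ln)
  have GK: "1 / ?G s \<le> K / ?G r" if "0 < s" "s \<le> r" "r \<le> 1" for r s
  proof -
   have "?G r \<le> K * ?G s" using that by (intro K(2) one_le_one_minus_ln) auto
   then show ?thesis using Gpos[of s] Gpos[of r] that by (simp add: field_simps)
  qed
  \<comment> \<open>The reciprocal gauge need not be monotone, because a logarithmic factor may act
    in the opposite direction. Its running supremum is monotone and, by almost monotonicity,
    comparable to it; cutting at 1 keeps the argument of the gauge at least 1.\<close>
  define \<tau> where "\<tau> r = (SUP s\<in>{0<..min r 1}. 1 / ?G s)" for r
  have bdd: "bdd_above ((\<lambda>s. 1 / ?G s) ` {0<..min r 1})" for r
  proof (rule bdd_aboveI2[where M="K / ?G 1"])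
   show "1 / ?G s \<le> K / ?G 1" if "s \<in> {0<..min r 1}" for s using that by (intro GK) auto
  qed
  have "mono_on {0<..} \<tau>"
  proof (rule mono_onI)
   fix r s :: real assume "r \<in> {0<..}" "s \<in> {0<..}" "r \<le> s"
   then show "\<tau> r \<le> \<tau> s" unfolding \<tau>_def by (intro cSUP_subset_mono bdd) auto
  qed
  moreover have "equiv_near_0 \<omega> \<tau>" unfolding equiv_near_0_def
  proof (rule exI[of _ "c * K"], rule conjI)
   show "0 < c * K" using c K by simp
   show "\<exists>r0>0. \<forall>r\<in>{0<..<r0}. inverse (c * K) * \<tau> r \<le> \<omega> r \<and> \<omega> r \<le> c * K * \<tau> r"
   proof (intro exI[of _ r0] conjI ballI r0)
    fix r assume r: "r \<in> {0<..<r0}"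
    then have r1: "0 < r" "r \<le> 1" using r0 by auto
    note G = Gpos[OF r1]
    have up: "\<tau> r \<le> K / ?G r" unfolding \<tau>_def using r1 by (intro cSUP_least GK) auto
    have lo: "1 / ?G r \<le> \<tau> r" unfolding \<tau>_def using r1 by (intro cSUP_upper2[OF bdd]) auto
    have "\<tau> r \<le> c * K * (1 / (c * ?G r))" using up c by simp
    also have "\<dots> \<le> c * K * \<omega> r" using eq[OF r] c K by (intro mult_left_mono) auto
    finally show "inverse (c * K) * \<tau> r \<le> \<omega> r" using c K by (simp add: field_simps)
    have "\<omega> r \<le> c * (1 / ?G r)" using eq[OF r] by simp
    also have "\<dots> \<le> c * \<tau> r" using c lo by (intro mult_left_mono) auto
    also have "\<dots> \<le> c * (K * \<tau> r)"
    proof -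
     have "0 \<le> \<tau> r" using lo G by (meson divide_nonneg_pos le_numeral_extra(1) order_trans zero_le_one)
     then have "1 * \<tau> r \<le> K * \<tau> r" using K by (intro mult_right_mono) auto
     then show ?thesis using c by simp
    qed
    finally show "\<omega> r \<le> c * K * \<tau> r" by simp
   qed
  qed
  moreover have "(\<omega> \<longlongrightarrow> 0) (at_right 0)"
  proof (rule tendsto_sandwich[of "\<lambda>_. 0" \<omega> "at_right 0" "\<lambda>r. c / ?G r"])
   have ev: "eventually (\<lambda>r. r \<in> {0<..<r0}) (at_right 0)" by (rule eventually_at_right_real[OF r0(1)])
   show "eventually (\<lambda>r. 0 \<le> \<omega> r) (at_right 0)" using ev by eventually_elim (meson greaterThanLessThan_iff less_imp_le pos)
   show "eventually (\<lambda>r. \<omega> r \<le> c / ?G r) (at_right 0)" using ev by eventually_elim (use eq in blast)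
   have "filterlim (\<lambda>r::real. - ln r) at_top (at_right 0)" using ln_at_0 by (simp add: filterlim_uminus_at_bot)
   then have "filterlim (\<lambda>r::real. 1 + - ln r) at_top (at_right 0)" by (rule filterlim_tendsto_add_at_top[OF tendsto_const])
   from filterlim_compose[OF gauge_at_top[OF adm] this] have "filterlim ?G at_top (at_right 0)" by simp
   then show "((\<lambda>r. c / ?G r) \<longlongrightarrow> 0) (at_right 0)"
    by (intro tendsto_divide_0[OF tendsto_const] filterlim_at_top_imp_at_infinity)
  qed simp
  moreover have "0 < Liminf (at_right 0) (\<lambda>r. ereal (\<omega> r / r))"
  proof -
   obtain L where L: "0 < L" "\<And>r. 0 < r \<Longrightarrow> r \<le> 1 \<Longrightarrow> r * ?G r \<le> L" using le_inverse_gauge[of q \<alpha> \<beta>] by blast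
   have "eventually (\<lambda>r. r \<in> {0<..<r0}) (at_right 0)" by (rule eventually_at_right_real[OF r0(1)])
   then have "eventually (\<lambda>r. ereal (1 / (c * L)) \<le> ereal (\<omega> r / r)) (at_right 0)"
   proof eventually_elim
    case (elim r)
    then have r1: "0 < r" "r \<le> 1" using r0 by auto
    have "1 / (c * L) \<le> 1 / (c * (r * ?G r))" using c L Gpos[OF r1] r1 by (intro divide_left_mono mult_left_mono L(2) mult_pos_pos) auto
    also have "\<dots> = 1 / (c * ?G r) / r" by (simp add: mult_ac)
    also have "\<dots> \<le> \<omega> r / r" using eq[OF elim] r1 by (intro divide_right_mono) auto
    finally show ?case by simp
   qed
   then have "ereal (1 / (c * L)) \<le> Liminf (at_right 0) (\<lambda>r. ereal (\<omega> r / r))" by (rule Liminf_bounded)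
   moreover have "0 < ereal (1 / (c * L))" using c L by simp
   ultimately show ?thesis by (rule less_le_trans[rotated])
  qed
  ultimately show ?thesis using pos unfolding modulus_of_continuity_def by blast
qed

lemma partial_derivs_bounded:
  fixes f :: "real^'n::finite \<Rightarrow> real"
  assumes "smooth f" "compact K"
  shows "\<exists>c>0. \<forall>is x. length is \<le> m \<longrightarrow> x \<in> K \<longrightarrow> \<bar>partial_derivs is f x\<bar> \<le> c"
proof -
  have "\<exists>B\<ge>0. \<forall>x\<in>K. \<bar>partial_derivs is f x\<bar> \<le> B" for "is"
   using continuous_compact_bounded_real[OF smooth_continuous[OF smooth_partial_derivs[OF assms(1)]] assms(2)] by metis
  then obtain B where B: "\<And>is. 0 \<le> B is" "\<And>is x. x \<in> K \<Longrightarrow> \<bar>partial_derivs is f x\<bar> \<le> B is" by metis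
  have fin: "finite {is :: 'n list. length is \<le> m}" using finite_lists_length_le[of "UNIV :: 'n set" m] by simp
  define c where "c = 1 + sum B {is. length is \<le> m}"
  have "0 < c" using sum_nonneg[of "{is. length is \<le> m}" B] B(1) by (simp add: c_def add_pos_nonneg)
  moreover have "\<bar>partial_derivs is f x\<bar> \<le> c" if "length is \<le> m" "x \<in> K" for "is" x
  proof -
   have "B is \<le> sum B {is. length is \<le> m}" using that fin B(1) by (intro member_le_sum) auto
   then show ?thesis using B(2)[OF that(2), of "is"] by (simp add: c_def)
  qed
  ultimately show ?thesis by blast
qed

lemma measure_cball_cart:
  "0 \<le> r \<Longrightarrow> measure lebesgue (cball (c :: real^'n::finite) r) = unit_ball_vol (real CARD('n)) * r ^ CARD('n)"
  using content_cball[of r c] by (simp add: measure_completion)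

lemma gauge_comparable:
  "\<exists>M\<ge>0. \<forall>y y' c. 1 \<le> y \<longrightarrow> 1 \<le> y' \<longrightarrow> y \<le> c * y' \<longrightarrow> y' \<le> c * y \<longrightarrow> gauge q \<alpha> \<beta> y' \<le> c powr M * gauge q \<alpha> \<beta> y"
proof -
  obtain M where M: "0 \<le> M" "\<And>y y' c. 1 \<le> y \<Longrightarrow> y \<le> y' \<Longrightarrow> y' \<le> c * y \<Longrightarrow>
    gauge q \<alpha> \<beta> y' \<le> c powr M * gauge q \<alpha> \<beta> y \<and> gauge q \<alpha> \<beta> y \<le> c powr M * gauge q \<alpha> \<beta> y'"
   using gauge_ratio[of q \<alpha> \<beta>] by blast
  have "gauge q \<alpha> \<beta> y' \<le> c powr M * gauge q \<alpha> \<beta> y"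
   if "1 \<le> y" "1 \<le> y'" "y \<le> c * y'" "y' \<le> c * y" for y y' c using M(2)[of y y' c] M(2)[of y' y c] that linear[of y y'] by blast
  then show ?thesis using M(1) by blast
qed

text \<open>Bumps of width r and fixed height have derivatives up to order n of size at most 1 / r ^
  n on a set of measure of order r ^ n; the powers of r cancel and the gauge remains. Coordinate
  functions serve distant points, where \<sigma> is otherwise known only to be positive.\<close>

lemma embedding_modulus_lower_bound:
  fixes \<Omega> :: "(real^'n::finite) set"
  assumes adm: "L1_admissible q \<alpha> \<beta>" and op: "open \<Omega>" and bd: "bounded \<Omega>" and ne: "\<Omega> \<noteq> {}"
   and pos: "\<And>r. 0 < r \<Longrightarrow> 0 < \<sigma> r"
   and emb: "embeds \<Omega> (sobolev_LZ_space \<Omega> CARD('n) q \<alpha> \<beta>) (sobolev_LZ_norm \<Omega> CARD('n) q \<alpha> \<beta>)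
    (hoelder_space \<Omega> \<sigma>) (hoelder_norm \<Omega> \<sigma>)"
  shows "\<exists>C>0. \<exists>r1>0. \<forall>r. 0 < r \<longrightarrow> r < r1 \<longrightarrow> 1 / gauge q \<alpha> \<beta> (1 - ln r) \<le> C * \<sigma> r"
   and "\<exists>C>0. \<forall>x\<in>\<Omega>. \<forall>y\<in>\<Omega>. x \<noteq> y \<longrightarrow> dist x y \<le> C * \<sigma> (dist x y)"
proof -
  let ?\<gamma> = "gauge q \<alpha> \<beta>"
  let ?n = "CARD('n)"
  let ?W = "sobolev_LZ_space \<Omega> ?n q \<alpha> \<beta>" and ?N = "sobolev_LZ_norm \<Omega> ?n q \<alpha> \<beta>"
  have n1: "1 \<le> ?n" by (simp add: Suc_leI)
  have lm: "\<Omega> \<in> lmeasurable" using op bd by (simp add: lmeasurable_open)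
  have V: "0 < measure lebesgue \<Omega>" using open_not_negligible[OF op ne] lm by (simp add: negligible_iff_measure zero_less_measure_iff)
  obtain C0 where C0: "0 < C0" and osc: "\<And>u B x y. u \<in> ?W \<Longrightarrow> 0 \<le> B \<Longrightarrow> continuous_on \<Omega> u \<Longrightarrow> ?N u \<le> ennreal B \<Longrightarrow>
    x \<in> \<Omega> \<Longrightarrow> y \<in> \<Omega> \<Longrightarrow> x \<noteq> y \<Longrightarrow> \<bar>u x - u y\<bar> \<le> C0 * B * \<sigma> (dist x y)"
   using embeds_hoelder_oscillation[OF op emb pos] by blast
  obtain C b1 where C: "0 < C" "0 < b1" "b1 \<le> 1/2"
   and SN: "\<And>f D b c k. smooth f \<Longrightarrow> D \<in> sets lebesgue \<Longrightarrow> D \<subseteq> \<Omega> \<Longrightarrow> 0 < b \<Longrightarrow> b \<le> b1 \<Longrightarrow> 1 \<le> k \<Longrightarrow> 0 < c \<Longrightarrow>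
    measure lebesgue D \<le> k * b * measure lebesgue \<Omega> \<Longrightarrow>
    (\<forall>is x. length is \<le> ?n \<longrightarrow> x \<in> \<Omega> \<longrightarrow> \<bar>partial_derivs is f x\<bar> \<le> c * indicator D x) \<Longrightarrow>
    f \<in> ?W \<and> ?N f \<le> ennreal (C * c * k * b * ?\<gamma> (1 - ln b))" using smooth_sobolev_norm_le[OF adm op bd ne, of ?n] by blast
  show "\<exists>C>0. \<exists>r1>0. \<forall>r. 0 < r \<longrightarrow> r < r1 \<longrightarrow> 1 / ?\<gamma> (1 - ln r) \<le> C * \<sigma> r"
  proof -
   let ?\<psi> = "bump (0 :: real^'n) 1"
   have \<psi>0: "0 < ?\<psi> 0" by (simp add: bump_def exp_flat_pos bump_mass_pos)
   obtain C1 where C1: "0 < C1" "\<And>is x. length is \<le> ?n \<Longrightarrow> x \<in> cball 0 1 \<Longrightarrow> \<bar>partial_derivs is ?\<psi> x\<bar> \<le> C1"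
    using partial_derivs_bounded[OF smooth_bump compact_cball[of "0::real^'n" 1], of ?n 0 1] by blast
   have off: "partial_derivs is ?\<psi> x = 0" if "x \<notin> cball 0 1" for "is" x
    using vanishes_off_partial_derivs[OF vanishes_off_bump[of 1 "0::real^'n"] closed_cball] that by (simp add: vanishes_off_def)
   obtain z0 where z0: "z0 \<in> \<Omega>" using ne by blast
   obtain \<rho> where \<rho>: "0 < \<rho>" "cball z0 \<rho> \<subseteq> \<Omega>" using op z0 open_contains_cball by blast
   obtain M where M: "0 \<le> M" "\<And>y y' c. 1 \<le> y \<Longrightarrow> y \<le> y' \<Longrightarrow> y' \<le> c * y \<Longrightarrow> ?\<gamma> y' \<le> c powr M * ?\<gamma> y"
    using gauge_ratio[of q \<alpha> \<beta>] by blast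
   define V1 where "V1 = unit_ball_vol (real ?n)"
   \<comment> \<open>With this k, a ball of radius r occupies at most the fraction
     \<open>k * r ^ ?n\<close> of \<Omega>, and k is at least 1 as the norm estimate asks.\<close>
   define k where "k = max 1 (V1 / measure lebesgue \<Omega>)"
   have "1 \<le> k" "V1 / measure lebesgue \<Omega> \<le> k" by (simp_all add: k_def)
   then have k: "1 \<le> k" "V1 \<le> k * measure lebesgue \<Omega>" using V by (simp_all add: pos_divide_le_eq)
   define E where "E = C * C1 * k * real ?n powr M"
   have E: "0 < E" using C C1 k n1 by (simp add: E_def)
   have main: "1 / ?\<gamma> (1 - ln r) \<le> C0 * E / ?\<psi> 0 * \<sigma> r" if r: "0 < r" "r < min \<rho> b1" for r
   proof -
    let ?g = "?\<gamma> (1 - ln r)"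
    have r1: "r \<le> 1" "r \<le> b1" "r \<le> \<rho>" using r C by auto
    have g: "0 < ?g" using r(1) r1(1) by (intro gauge_pos one_le_one_minus_ln)
    define f where "f = (\<lambda>z. ?\<psi> ((1 / r) *\<^sub>R (z - z0)))"
    have f: "smooth f" unfolding f_def by (rule smooth_scale(2)[OF smooth_bump])
    have "r ^ ?n \<le> r ^ 1" using n1 r(1) r1(1) by (intro power_decreasing) auto
    then have b: "0 < r ^ ?n" "r ^ ?n \<le> b1" using r(1) r1(2) by auto
    have B: "\<bar>partial_derivs is f z\<bar> \<le> (C1 * (1 / r) ^ ?n) * indicator (cball z0 r) z" if l: "length is \<le> ?n" for "is" z
    proof (cases "z \<in> cball z0 r")
     case True
     then have "(1 / r) *\<^sub>R (z - z0) \<in> cball 0 1" using r(1) by (simp add: dist_norm norm_minus_commute)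
     then have "\<bar>partial_derivs is ?\<psi> ((1 / r) *\<^sub>R (z - z0))\<bar> \<le> C1" by (rule C1(2)[OF l])
     moreover have "(1 / r) ^ length is \<le> (1 / r) ^ ?n" using l r(1) r1(1) by (intro power_increasing) auto
     ultimately have "(1 / r) ^ length is * \<bar>partial_derivs is ?\<psi> ((1 / r) *\<^sub>R (z - z0))\<bar> \<le> (1 / r) ^ ?n * C1"
      using r(1) by (intro mult_mono) auto
     then show ?thesis using True r(1) unfolding f_def smooth_scale(1)[OF smooth_bump] by (simp add: abs_mult mult.commute)
    next
     case False
     then have "(1 / r) *\<^sub>R (z - z0) \<notin> cball 0 1" using r(1) by (simp add: dist_norm norm_minus_commute)
     then show ?thesis using False off unfolding f_def smooth_scale(1)[OF smooth_bump] by simp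
    qed
    have mD: "measure lebesgue (cball z0 r) \<le> k * r ^ ?n * measure lebesgue \<Omega>"
    proof -
     have "V1 * r ^ ?n \<le> (k * measure lebesgue \<Omega>) * r ^ ?n" using k(2) b by (intro mult_right_mono) auto
     then show ?thesis unfolding measure_cball_cart[OF less_imp_le[OF r(1)]] V1_def by (simp add: mult_ac)
    qed
    have "cball z0 r \<subseteq> \<Omega>" using \<rho>(2) r1(3) subset_cball by blast
    from SN[OF f _ this b k(1) _ mD, of "C1 * (1 / r) ^ ?n"] B C1(1) r(1)
    have fW: "f \<in> ?W" and fN: "?N f \<le> ennreal (C * (C1 * (1 / r) ^ ?n) * k * r ^ ?n * ?\<gamma> (1 - ln (r ^ ?n)))"
     by (auto simp: lborelD)
    have "C * (C1 * (1 / r) ^ ?n) * k * r ^ ?n * ?\<gamma> (1 - ln (r ^ ?n)) = C * C1 * k * ?\<gamma> (1 - ln (r ^ ?n))"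
     using r(1) by (simp add: power_divide)
    \<comment> \<open>Passing from r to \<open>r ^ ?n\<close> multiplies 1 - ln r by at most the
      dimension, which changes the gauge by a constant factor.\<close>
    also have "\<dots> \<le> C * C1 * k * (real ?n powr M * ?g)"
    proof (rule mult_left_mono)
     have l: "ln r \<le> 0" using r(1) r1(1) by simp
     have e: "ln (r ^ ?n) = real ?n * ln r" using r(1) by (simp add: ln_realpow)
     have "real ?n * ln r \<le> 1 * ln r" using n1 l by (intro mult_right_mono_neg) auto
     then show "?\<gamma> (1 - ln (r ^ ?n)) \<le> real ?n powr M * ?g" using l n1 unfolding e by (intro M(2)) (auto simp: algebra_simps)
    qed (use C C1 k in auto)
    finally have "?N f \<le> ennreal (E * ?g)" using fN by (auto intro: order_trans ennreal_leI simp: E_def mult_ac)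
    then have o: "x \<in> \<Omega> \<Longrightarrow> y \<in> \<Omega> \<Longrightarrow> x \<noteq> y \<Longrightarrow> \<bar>f x - f y\<bar> \<le> C0 * (E * ?g) * \<sigma> (dist x y)" for x y
     using E g by (intro osc fW smooth_continuous[OF f]) auto
    obtain i :: 'n where True by blast
    define y where "y = z0 + r *\<^sub>R axis i (1::real)"
    have d: "dist z0 y = r" using r(1) by (simp add: y_def dist_norm norm_axis_1)
    have "y \<in> \<Omega>" using \<rho>(2) d r1(3) by auto
    then have "\<bar>f z0 - f y\<bar> \<le> C0 * (E * ?g) * \<sigma> (dist z0 y)" using d r(1) by (intro o z0) auto
    moreover have "f y = 0" using r(1) unfolding f_def by (intro bump_eq_0) (auto simp: y_def norm_axis_1)
    moreover have "f z0 = ?\<psi> 0" by (simp add: f_def)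
    ultimately have "?\<psi> 0 \<le> C0 * (E * ?g) * \<sigma> r" using \<psi>0 d by simp
    then show ?thesis using g \<psi>0 by (simp add: field_simps)
   qed
   show ?thesis by (rule ex_pos2[of "C0 * E / ?\<psi> 0" "min \<rho> b1"]) (use C0 E \<psi>0 \<rho> C main in auto)
  qed
  show "\<exists>C>0. \<forall>x\<in>\<Omega>. \<forall>y\<in>\<Omega>. x \<noteq> y \<longrightarrow> dist x y \<le> C * \<sigma> (dist x y)"
  proof -
   have "\<exists>B\<ge>0. \<forall>x\<in>\<Omega>. \<forall>y\<in>\<Omega>. x \<noteq> y \<longrightarrow> \<bar>x $ i - y $ i\<bar> \<le> B * \<sigma> (dist x y)" for i
   proof -
    let ?f = "\<lambda>z::real^'n. z $ i"
    have K: "compact (closure \<Omega>)" using bd by simp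
    obtain c where c: "0 < c" "\<And>is x. length is \<le> ?n \<Longrightarrow> x \<in> closure \<Omega> \<Longrightarrow> \<bar>partial_derivs is ?f x\<bar> \<le> c"
     using partial_derivs_bounded[OF smooth_coord[of i] K, of ?n] by blast
    have B: "\<forall>is x. length is \<le> ?n \<longrightarrow> x \<in> \<Omega> \<longrightarrow> \<bar>partial_derivs is ?f x\<bar> \<le> c * indicator \<Omega> x"
     using c(2) closure_subset[of \<Omega>] by auto
    \<comment> \<open>D is all of \<Omega> here: b sits at its threshold b1, and k = 1 / b1 makes
      \<open>k * b\<close> equal to 1.\<close>
    define B where "B = C * c * (1 / b1) * b1 * ?\<gamma> (1 - ln b1)"
    have f: "?f \<in> ?W" "?N ?f \<le> ennreal B"
     using SN[OF smooth_coord[of i] _ order_refl C(2) order_refl _ c(1) _ B, of "1 / b1"] C lm by (auto simp: B_def)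
    have B0: "0 \<le> B" using C c(1) gauge_pos[of "1 - ln b1" q \<alpha> \<beta>] one_le_one_minus_ln[of b1] by (simp add: B_def)
    have "\<bar>x $ i - y $ i\<bar> \<le> C0 * B * \<sigma> (dist x y)" if "x \<in> \<Omega>" "y \<in> \<Omega>" "x \<noteq> y" for x y
     by (rule osc[OF f(1) B0 _ f(2) that]) (intro continuous_intros)
    then show ?thesis using B0 C0 by (intro exI[of _ "C0 * B"]) auto
   qed
   then obtain B where B: "\<And>i. 0 \<le> B i" "\<And>i x y. x \<in> \<Omega> \<Longrightarrow> y \<in> \<Omega> \<Longrightarrow> x \<noteq> y \<Longrightarrow> \<bar>x $ i - y $ i\<bar> \<le> B i * \<sigma> (dist x y)" by metis
   have "dist x y \<le> (1 + sum B UNIV) * \<sigma> (dist x y)" if xy: "x \<in> \<Omega>" "y \<in> \<Omega>" "x \<noteq> y" for x y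
   proof -
    have "dist x y \<le> (\<Sum>i\<in>UNIV. \<bar>(x - y) $ i\<bar>)" unfolding dist_norm by (rule norm_le_l1_cart)
    also have "\<dots> \<le> (\<Sum>i\<in>UNIV. B i * \<sigma> (dist x y))" using B(2)[OF xy] by (intro sum_mono) simp
    also have "\<dots> = sum B UNIV * \<sigma> (dist x y)" by (simp add: sum_distrib_right)
    also have "\<dots> \<le> (1 + sum B UNIV) * \<sigma> (dist x y)" using pos[of "dist x y"] xy by (intro mult_right_mono) auto
    finally show ?thesis .
   qed
   moreover have "0 < 1 + sum B UNIV" using B(1) by (intro add_pos_nonneg sum_nonneg) auto
   ultimately show ?thesis by blast
  qed
qed

section \<open>The embedding\<close>

lemma ennreal_le_divide_of_mult_le:
  assumes "ennreal a * R \<le> ennreal b" "0 < a" "0 \<le> b"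
  shows "R \<le> ennreal (b / a)"
proof (cases R)
  case (real r)
  then have "a * r \<le> b" using assms by (simp add: ennreal_mult[symmetric])
  then show ?thesis using real assms by (auto intro!: ennreal_leI simp: field_simps)
next
  case top
  then show ?thesis using assms by (auto simp: ennreal_mult_top top_unique)
qed

text \<open>The integral over D is bounded by \<open>rearr_int\<close> at \<open>a * r ^ n\<close>,
  and \<open>LZ_norm_lower_bound\<close> bounds this by the norm divided by the gauge. Since 1 - ln
  of that argument is comparable to 1 - ln r, the gauge may be taken at r.\<close>

lemma nn_integral_le_gauge:
  fixes \<Omega> :: "'a::euclidean_space set"
  assumes adm: "L1_admissible q \<alpha> \<beta>" and \<Omega>: "\<Omega> \<in> lmeasurable" "0 < measure lebesgue \<Omega>" and n: "1 \<le> (n::nat)"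
  shows "\<exists>C>0. \<forall>u D r U. u \<in> borel_measurable (lebesgue_on \<Omega>) \<longrightarrow> LZ_norm_on \<Omega> q \<alpha> \<beta> u \<le> ennreal U \<longrightarrow> 0 \<le> U \<longrightarrow>
   D \<in> sets lebesgue \<longrightarrow> D \<subseteq> \<Omega> \<longrightarrow> 0 < r \<longrightarrow> r \<le> 1 \<longrightarrow> measure lebesgue D \<le> A * r ^ n \<longrightarrow>
   (\<integral>\<^sup>+x\<in>D. ennreal \<bar>u x\<bar> \<partial>lebesgue_on \<Omega>) \<le> ennreal (C * U / gauge q \<alpha> \<beta> (1 - ln r))"
proof -
  let ?\<gamma> = "gauge q \<alpha> \<beta>"
  define m where "m = measure lebesgue \<Omega>"
  have m: "0 < m" using \<Omega>(2) by (simp add: m_def)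
  define a where "a = max 1 (A / m)"
  have "1 \<le> a" "A / m \<le> a" by (simp_all add: a_def)
  then have a: "1 \<le> a" "A \<le> a * m" using m by (simp_all add: pos_divide_le_eq)
  obtain c t1 where c: "0 < c" "0 < t1" "t1 \<le> 1/2"
   and LB: "\<And>u t. 0 < t \<Longrightarrow> t \<le> t1 \<Longrightarrow> ennreal (c * ?\<gamma> (1 - ln t)) * rearr_int \<Omega> u t \<le> LZ_norm_on \<Omega> q \<alpha> \<beta> u"
   using LZ_norm_lower_bound[OF adm, where 'a='a] by blast
  obtain M where M: "0 \<le> M" "\<And>y y' c. 1 \<le> y \<Longrightarrow> 1 \<le> y' \<Longrightarrow> y \<le> c * y' \<Longrightarrow> y' \<le> c * y \<Longrightarrow> ?\<gamma> y' \<le> c powr M * ?\<gamma> y"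
   using gauge_comparable[of q \<alpha> \<beta>] by blast
  \<comment> \<open>One number above all ratios of 1 - ln t and 1 - ln r that occur: n comes from
    the power of r, \<open>ln a\<close> from the factor a, the other terms from the threshold
    t1.\<close>
  define b where "b = real n + 1 + ln a + ln (a / t1) + (1 - ln t1)"
  define \<kappa> where "\<kappa> = b powr M"
  have lna: "0 \<le> ln a" "0 \<le> ln (a / t1)" "1 \<le> 1 - ln t1"
  proof -
   have "t1 \<le> a" using a c by linarith
   then show "0 \<le> ln a" "0 \<le> ln (a / t1)" using a c by (auto simp: pos_le_divide_eq)
   show "1 \<le> 1 - ln t1" using c by (intro one_le_one_minus_ln) auto
  qed
  have b: "0 < b" "1 \<le> b" "real n \<le> b" "1 + ln a \<le> b" "1 + ln (a / t1) \<le> b" "1 - ln t1 \<le> b" using lna by (auto simp: b_def)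
  have \<kappa>: "0 < \<kappa>" using b by (simp add: \<kappa>_def)
  define C where "C = m * (2 / t1) * \<kappa> / c"
  have C: "0 < C" using m c \<kappa> by (simp add: C_def)
  have key: "rearr_int \<Omega> u t \<le> ennreal (\<kappa> * U / (c * ?\<gamma> (1 - ln r)))"
   if u: "LZ_norm_on \<Omega> q \<alpha> \<beta> u \<le> ennreal U" "0 \<le> U" and t: "0 < t" "t \<le> t1" and r: "0 < r" "r \<le> 1"
    and cmp: "1 - ln t \<le> b * (1 - ln r)" "1 - ln r \<le> b * (1 - ln t)" for u U t r
  proof -
   have y: "1 \<le> 1 - ln t" "1 \<le> 1 - ln r" using t r c by (auto intro!: one_le_one_minus_ln)
   have g: "0 < ?\<gamma> (1 - ln t)" "0 < ?\<gamma> (1 - ln r)" using y by (auto intro: gauge_pos)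
   have le: "?\<gamma> (1 - ln r) \<le> \<kappa> * ?\<gamma> (1 - ln t)" unfolding \<kappa>_def by (intro M(2) y cmp)
   have "ennreal (c * ?\<gamma> (1 - ln t)) * rearr_int \<Omega> u t \<le> ennreal U" using LB[OF t] u(1) by (rule order_trans)
   then have "rearr_int \<Omega> u t \<le> ennreal (U / (c * ?\<gamma> (1 - ln t)))" using c g u by (intro ennreal_le_divide_of_mult_le) auto
   also have "\<dots> \<le> ennreal (\<kappa> * U / (c * ?\<gamma> (1 - ln r)))"
   proof (rule ennreal_leI)
    have "U * ?\<gamma> (1 - ln r) \<le> U * (\<kappa> * ?\<gamma> (1 - ln t))" using u le by (intro mult_left_mono) auto
    then show "U / (c * ?\<gamma> (1 - ln t)) \<le> \<kappa> * U / (c * ?\<gamma> (1 - ln r))"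
     using c g by (simp add: frac_le_eq divide_le_eq pos_le_divide_eq mult_ac)
   qed
   finally show ?thesis .
  qed
  have "(\<integral>\<^sup>+x\<in>D. ennreal \<bar>u x\<bar> \<partial>lebesgue_on \<Omega>) \<le> ennreal (C * U / ?\<gamma> (1 - ln r))"
   if u: "u \<in> borel_measurable (lebesgue_on \<Omega>)" "LZ_norm_on \<Omega> q \<alpha> \<beta> u \<le> ennreal U" "0 \<le> U"
    and D: "D \<in> sets lebesgue" "D \<subseteq> \<Omega>" and r: "0 < r" "r \<le> 1" and mD: "measure lebesgue D \<le> A * r ^ n" for u D r U
  proof -
   define t where "t = a * r ^ n"
   have t0: "0 < t" using a r by (simp add: t_def)
   have lnt: "ln t = ln a + real n * ln r" using a r by (simp add: t_def ln_mult ln_realpow)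
   have lr: "ln r \<le> 0" using r by simp
   have nl: "real n * ln r \<le> 1 * ln r" using n lr by (intro mult_right_mono_neg) auto
   let ?g = "?\<gamma> (1 - ln r)"
   have g: "0 < ?g" using r by (intro gauge_pos one_le_one_minus_ln)
   have R: "rearr_int \<Omega> u (min t 1) \<le> ennreal (2 / t1) * ennreal (\<kappa> * U / (c * ?g))"
   proof (cases "t \<le> t1")
    case True
    have y: "1 \<le> 1 - ln t" "1 \<le> 1 - ln r" using t0 True r c by (auto intro!: one_le_one_minus_ln)
    have "1 - ln t \<le> 1 - real n * ln r" using lnt lna by linarith
    also have "\<dots> \<le> real n * (1 - ln r)" using n by (simp add: algebra_simps)
    also have "\<dots> \<le> b * (1 - ln r)" using b y by (intro mult_right_mono) auto
    finally have c1: "1 - ln t \<le> b * (1 - ln r)" .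
    have "1 - ln r \<le> (1 - ln t) + ln a * 1" using lnt nl by linarith
    also have "\<dots> \<le> (1 - ln t) + ln a * (1 - ln t)" using lna y by (intro add_left_mono mult_left_mono) auto
    also have "\<dots> = (1 + ln a) * (1 - ln t)" by (simp add: algebra_simps)
    also have "\<dots> \<le> b * (1 - ln t)" using b y by (intro mult_right_mono) auto
    finally have c2: "1 - ln r \<le> b * (1 - ln t)" .
    have "min t 1 = t" using True c by simp
    then have "rearr_int \<Omega> u (min t 1) \<le> 1 * ennreal (\<kappa> * U / (c * ?g))" using key[OF u(2,3) t0 True r c1 c2] by simp
    also have "\<dots> \<le> ennreal (2 / t1) * ennreal (\<kappa> * U / (c * ?g))"
    proof (rule mult_right_mono)
     have "1 \<le> 2 / t1" using c by (simp add: pos_le_divide_eq)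
     then show "1 \<le> ennreal (2 / t1)" by simp
    qed simp
    finally show ?thesis .
   next
    \<comment> \<open>Beyond the threshold \<open>rearr_int\<close> is enlarged to the whole unit
      interval and then reduced to t1. In this case r is bounded away from 0, so that t1 can take
      the role of t in the comparison with r.\<close>
    case False
    then have "ln t1 \<le> ln t" using c by (intro ln_mono) auto
    then have "- ln r \<le> ln (a / t1)" using lnt nl a c by (simp add: ln_div)
    then have "1 - ln r \<le> b * 1" using b by linarith
    also have "\<dots> \<le> b * (1 - ln t1)" using b lna by (intro mult_left_mono) auto
    finally have c2: "1 - ln r \<le> b * (1 - ln t1)" .
    have "1 - ln t1 \<le> b * 1" using b by simp
    also have "\<dots> \<le> b * (1 - ln r)" using b lr by (intro mult_left_mono) auto
    finally have c1: "1 - ln t1 \<le> b * (1 - ln r)" .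
    have "rearr_int \<Omega> u (min t 1) \<le> rearr_int \<Omega> u 1" by (rule rearr_int_mono) simp
    also have "\<dots> \<le> ennreal (2 / t1) * rearr_int \<Omega> u t1" using c by (intro rearr_int_1_le) auto
    also have "\<dots> \<le> ennreal (2 / t1) * ennreal (\<kappa> * U / (c * ?g))"
     using key[OF u(2,3) c(2) order_refl r c1 c2] by (intro mult_left_mono) auto
    finally show ?thesis .
   qed
   have "measure lebesgue D \<le> min t 1 * m"
   proof -
    have "A * r ^ n \<le> (a * m) * r ^ n" using a r by (intro mult_right_mono) auto
    then have "measure lebesgue D \<le> t * m" using mD by (simp add: t_def mult_ac)
    moreover have "measure lebesgue D \<le> m" unfolding m_def using D \<Omega>(1) by (intro measure_mono_fmeasurable) auto
    ultimately show ?thesis by (auto simp: min_def)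
   qed
   then have "(\<integral>\<^sup>+x\<in>D. ennreal \<bar>u x\<bar> \<partial>lebesgue_on \<Omega>) \<le> ennreal m * rearr_int \<Omega> u (min t 1)"
    unfolding m_def by (intro nn_integral_le_rearr_int \<Omega> u D)
   also have "\<dots> \<le> ennreal m * (ennreal (2 / t1) * ennreal (\<kappa> * U / (c * ?g)))" by (intro mult_left_mono R) auto
   also have "\<dots> = ennreal (m * ((2 / t1) * (\<kappa> * U / (c * ?g))))" using m c \<kappa> u(3) g by (simp add: ennreal_mult[symmetric])
   also have "m * ((2 / t1) * (\<kappa> * U / (c * ?g))) = C * U / ?g" by (simp add: C_def)
   finally show ?thesis .
  qed
  then show ?thesis using C by blast
qed

lemma grad_sum_weak_rep_integral_le:
  fixes \<Omega> :: "(real^'n::finite) set"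
  assumes \<Omega>: "\<Omega> \<in> sets lebesgue" and D: "D \<in> sets lebesgue" "D \<subseteq> \<Omega>"
   and meas: "abs_weak_grad \<Omega> k u \<in> borel_measurable (lebesgue_on \<Omega>)"
   and le: "(\<integral>\<^sup>+x\<in>D. ennreal \<bar>abs_weak_grad \<Omega> k u x\<bar> \<partial>lebesgue_on \<Omega>) \<le> ennreal B" and B: "0 \<le> B"
  shows "(\<integral>z. grad_sum k (weak_rep \<Omega> u) z * indicator D z \<partial>lebesgue) \<le> real CARD('n) ^ k * B"
proof (rule integral_real_bounded)
  show "0 \<le> real CARD('n) ^ k * B" using B by simp
  let ?f = "\<lambda>z. ennreal \<bar>abs_weak_grad \<Omega> k u z\<bar> * indicator D z"
  have pt: "grad_sum k (weak_rep \<Omega> u) z \<le> real CARD('n) ^ k * abs_weak_grad \<Omega> k u z" if "z \<in> \<Omega>" for z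
  proof -
   have "\<bar>weak_rep \<Omega> u is z\<bar> \<le> abs_weak_grad \<Omega> k u z" if "length is = k" for "is"
   proof -
    have "mset (SOME js. mset js = mset is) = mset is" by (rule someI[of _ "is"]) simp
    then have "length (SOME js. mset js = mset is) = k" using that by (metis size_mset)
    then show ?thesis using \<open>z \<in> \<Omega>\<close> by (simp add: weak_rep_def weak_deriv_le_abs_weak_grad)
   qed
   then have "grad_sum k (weak_rep \<Omega> u) z \<le> (\<Sum>is :: 'n list | length is = k. abs_weak_grad \<Omega> k u z)"
    unfolding grad_sum_def by (intro sum_mono) auto
   then show ?thesis by (simp add: card_lists_length)
  qed
  have "(\<integral>\<^sup>+z. ennreal (grad_sum k (weak_rep \<Omega> u) z * indicator D z) \<partial>lebesgue)
   \<le> (\<integral>\<^sup>+z. (ennreal (real CARD('n) ^ k) * ?f z) * indicator \<Omega> z \<partial>lebesgue)"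
  proof (rule nn_integral_mono)
   fix z show "ennreal (grad_sum k (weak_rep \<Omega> u) z * indicator D z) \<le> (ennreal (real CARD('n) ^ k) * ?f z) * indicator \<Omega> z"
   proof (cases "z \<in> D")
    case True
    then have "z \<in> \<Omega>" using D by blast
    then have "ennreal (grad_sum k (weak_rep \<Omega> u) z) \<le> ennreal (real CARD('n) ^ k * abs_weak_grad \<Omega> k u z)"
     by (intro ennreal_leI pt)
    also have "\<dots> = ennreal (real CARD('n) ^ k) * ennreal \<bar>abs_weak_grad \<Omega> k u z\<bar>" by (subst ennreal_mult) auto
    finally show ?thesis using True \<open>z \<in> \<Omega>\<close> by simp
   qed simp
  qed
  also have "\<dots> = (\<integral>\<^sup>+z. ennreal (real CARD('n) ^ k) * ?f z \<partial>lebesgue_on \<Omega>)"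
   using \<Omega> by (subst nn_integral_restrict_space) auto
  also have "\<dots> = ennreal (real CARD('n) ^ k) * (\<integral>\<^sup>+z. ?f z \<partial>lebesgue_on \<Omega>)"
  proof (rule nn_integral_cmult)
   have "indicator D \<in> borel_measurable (lebesgue_on \<Omega>)" using D by (intro measurable_restrict_space1 borel_measurable_indicator)
   then show "?f \<in> borel_measurable (lebesgue_on \<Omega>)" using meas by measurable
  qed
  also have "\<dots> \<le> ennreal (real CARD('n) ^ k) * ennreal B" by (intro mult_left_mono le) auto
  also have "\<dots> = ennreal (real CARD('n) ^ k * B)" using B by (subst ennreal_mult) auto
  finally show "(\<integral>\<^sup>+z. ennreal (grad_sum k (weak_rep \<Omega> u) z * indicator D z) \<partial>lebesgue) \<le> ennreal (real CARD('n) ^ k * B)" .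
qed

text \<open>Over J - j dyadic steps the gauge grows by at most K times the power J - j of the square
  root of 2, while the radius shrinks by \<open>2 ^ (J - j)\<close>. The terms decay geometrically
  away from J, with a ratio of at most 3 / 4.\<close>

lemma gauge_dyadic_sum:
  "\<exists>K>0. \<forall>s J. 0 < s \<longrightarrow> s \<le> 1 \<longrightarrow>
   s / 2 ^ J * (\<Sum>j<J. 1 / gauge q \<alpha> \<beta> (1 - ln (s / 2 ^ j)) / (s / 2 ^ j)) \<le> K / gauge q \<alpha> \<beta> (1 - ln (s / 2 ^ J))"
proof -
  let ?\<gamma> = "gauge q \<alpha> \<beta>"
  obtain K where K: "1 \<le> K" "\<And>y y'. 1 \<le> y \<Longrightarrow> y \<le> y' \<Longrightarrow> ?\<gamma> y' \<le> K * exp ((y' - y) / 2) * ?\<gamma> y"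
   using gauge_growth[of q \<alpha> \<beta>] by blast
  have geo: "(\<Sum>j<J. (3/4 :: real) ^ (J - j)) \<le> 3" for J
  proof (induction J)
   case (Suc J)
   have "(\<Sum>j<Suc J. (3/4 :: real) ^ (Suc J - j)) = (\<Sum>j<J. 3/4 * (3/4) ^ (J - j)) + 3/4" by (auto simp: Suc_diff_le intro!: sum.cong)
   also have "\<dots> = 3/4 * (\<Sum>j<J. (3/4) ^ (J - j)) + 3/4" by (simp add: sum_distrib_left)
   finally show ?case using Suc by simp
  qed simp
  have h: "exp (ln 2 / 2) / 2 \<le> (3/4 :: real)"
  proof (rule ccontr)
   assume "\<not> ?thesis"
   then have "(3/2 :: real) \<le> exp (ln 2 / 2)" by simp
   then have "(3/2)\<^sup>2 \<le> (exp (ln 2 / 2) :: real)\<^sup>2" by (intro power_mono) auto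
   also have "(exp (ln 2 / 2) :: real)\<^sup>2 = 2" by (simp add: power2_eq_square exp_add[symmetric])
   finally show False by (simp add: power2_eq_square)
  qed
  have "s / 2 ^ J * (\<Sum>j<J. 1 / ?\<gamma> (1 - ln (s / 2 ^ j)) / (s / 2 ^ j)) \<le> (3 * K) / ?\<gamma> (1 - ln (s / 2 ^ J))"
   if s: "0 < s" "s \<le> 1" for s J
  proof -
   let ?L = "\<lambda>j. 1 - ln (s / 2 ^ j)"
   let ?G = "\<lambda>j. ?\<gamma> (?L j)"
   have sj: "0 < s / 2 ^ j" "s / 2 ^ j \<le> 1" for j
   proof -
    have "s \<le> 2 ^ j" using s one_le_power[of "2::real" j] by linarith
    then show "0 < s / 2 ^ j" "s / 2 ^ j \<le> 1" using s by auto
   qed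
   have L: "1 \<le> ?L j" for j by (rule one_le_one_minus_ln[OF sj])
   have G: "0 < ?G j" for j by (rule gauge_pos[OF L])
   have lnj: "ln (s / 2 ^ j) = ln s - real j * ln 2" for j using s by (simp add: ln_div ln_realpow)
   have term_le: "s / 2 ^ J * (1 / ?G j / (s / 2 ^ j)) \<le> K / ?G J * (3/4) ^ (J - j)" if j: "j < J" for j
   proof -
    have dL: "?L J - ?L j = real (J - j) * ln 2" using j unfolding lnj by (simp add: of_nat_diff algebra_simps)
    have "?L j \<le> ?L J" 
    proof -
     have "0 \<le> ?L J - ?L j" unfolding dL by simp
     then show ?thesis by (simp only: diff_ge_0_iff_ge)
    qed
    then have "?G J \<le> K * exp ((?L J - ?L j) / 2) * ?G j" by (rule K(2)[OF L])
    also have "exp ((?L J - ?L j) / 2) = exp (ln 2 / 2) ^ (J - j)" unfolding dL by (simp add: exp_of_nat_mult[symmetric])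
    finally have "1 / ?G j \<le> K * exp (ln 2 / 2) ^ (J - j) / ?G J" using G[of j] G[of J] by (simp add: field_simps)
    then have "(1 / 2) ^ (J - j) * (1 / ?G j) \<le> (1 / 2) ^ (J - j) * (K * exp (ln 2 / 2) ^ (J - j) / ?G J)" by (intro mult_left_mono) auto
    also have "\<dots> = K / ?G J * (exp (ln 2 / 2) / 2) ^ (J - j)" by (simp add: power_divide)
    also have "\<dots> \<le> K / ?G J * (3/4) ^ (J - j)" using K(1) G[of J] h by (intro mult_left_mono power_mono) auto
    also have "(1 / 2) ^ (J - j) = s / 2 ^ J / (s / 2 ^ j)" using s j by (simp add: power_diff power_divide)
    finally have "s / 2 ^ J / (s / 2 ^ j) * (1 / ?G j) \<le> K / ?G J * (3/4) ^ (J - j)" .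
    moreover have "x / y * (1 / g) = x * (1 / g / y)" for x y g :: real by simp
    ultimately show ?thesis by (simp only:)
   qed
   have "s / 2 ^ J * (\<Sum>j<J. 1 / ?G j / (s / 2 ^ j)) \<le> (\<Sum>j<J. K / ?G J * (3/4) ^ (J - j))"
    unfolding sum_distrib_left by (intro sum_mono term_le) auto
   also have "\<dots> = K / ?G J * (\<Sum>j<J. (3/4) ^ (J - j))" by (simp only: sum_distrib_left)
   also have "\<dots> \<le> K / ?G J * 3" using K(1) G[of J] geo[of J] by (intro mult_left_mono) auto
   finally show ?thesis by (simp add: mult.commute)
  qed
  moreover have "0 < 3 * K" using K by simp
  ultimately show ?thesis by blast
qed

lemma dyadic_scale:
  fixes d s :: real
  assumes "0 < d" "d \<le> s"
  shows "\<exists>J. s / 2 ^ Suc J < d \<and> d \<le> s / 2 ^ J"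
proof -
  let ?P = "\<lambda>J. s / 2 ^ Suc J < d"
  have s: "0 < s" using assms by linarith
  obtain k where "(1/2) ^ k < d / s" using real_arch_pow_inv[of "d / s" "1/2"] assms s by auto
  then have "s / 2 ^ k < d" using s by (simp add: power_divide field_simps)
  moreover have "s / 2 ^ Suc k \<le> s / 2 ^ k" using s by (simp add: field_simps)
  ultimately have P: "?P k" by linarith
  define J where "J = (LEAST J. ?P J)"
  have "?P J" unfolding J_def by (rule LeastI[of ?P, OF P])
  moreover have "d \<le> s / 2 ^ J"
  proof (cases J)
   case (Suc j)
   then have "\<not> ?P j" using not_less_Least[of j ?P] by (simp add: J_def)
   then show ?thesis using Suc by simp
  qed (use assms in simp)
  ultimately show ?thesis by blast
qed

lemma sobolev_LZ_norm_component:
  assumes "u \<in> sobolev_LZ_space \<Omega> m q \<alpha> \<beta>"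
  obtains U where "0 \<le> U" "sobolev_LZ_norm \<Omega> m q \<alpha> \<beta> u = ennreal U"
   "\<And>k. k \<le> m \<Longrightarrow> LZ_norm_on \<Omega> q \<alpha> \<beta> (abs_weak_grad \<Omega> k u) \<le> ennreal U"
proof -
  let ?F = "\<lambda>k. LZ_norm_on \<Omega> q \<alpha> \<beta> (abs_weak_grad \<Omega> k u)"
  have "?F k < top" if "k \<in> {0..m}" for k using assms that by (simp add: sobolev_LZ_space_def LZ_space_def)
  then have "sum ?F {0..m} \<noteq> top" by (simp add: less_top[symmetric])
  then obtain U where U: "0 \<le> U" "sum ?F {0..m} = ennreal U" by (cases "sum ?F {0..m}") auto
  show thesis
  proof (rule that[OF U(1)])
   show "sobolev_LZ_norm \<Omega> m q \<alpha> \<beta> u = ennreal U" using U(2) by (simp add: sobolev_LZ_norm_def)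
   show "?F k \<le> ennreal U" if "k \<le> m" for k unfolding U(2)[symmetric] using that by (intro member_le_sum) auto
  qed
qed

text \<open>\<open>nn_integral_le_gauge\<close> provides \<Theta> as a multiple of the reciprocal
  gauge at the dyadic radii. \<open>gauge_dyadic_sum\<close> brings the sum in
  \<open>jones_oscillation\<close> to the same size, and \<open>le_inverse_gauge\<close> does so for
  the linear term.\<close>

lemma sobolev_embeds_hoelder:
  fixes \<Omega> :: "(real^'n::finite) set"
  assumes J: "jones \<Omega> \<epsilon> s0" and bd: "bounded \<Omega>" and ne: "\<Omega> \<noteq> {}" and n2: "2 \<le> CARD('n)"
   and adm: "L1_admissible q \<alpha> \<beta>" and pos: "\<And>r. 0 < r \<Longrightarrow> 0 < \<omega> r"
   and low: "\<And>a b. 0 < a \<Longrightarrow> a \<le> b \<Longrightarrow> \<exists>c>0. \<forall>r\<in>{a..b}. c \<le> \<omega> r"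
   and c: "0 < c" and r0: "0 < r0" and eq: "\<And>r. r \<in> {0<..<r0} \<Longrightarrow> 1 / (c * gauge q \<alpha> \<beta> (1 - ln r)) \<le> \<omega> r"
  shows "embeds \<Omega> (sobolev_LZ_space \<Omega> CARD('n) q \<alpha> \<beta>) (sobolev_LZ_norm \<Omega> CARD('n) q \<alpha> \<beta>)
   (hoelder_space \<Omega> \<omega>) (hoelder_norm \<Omega> \<omega>)"
proof -
  let ?n = "CARD('n)"
  let ?D = "\<lambda>\<Theta> J. s0 / 2 ^ J * (\<Sum>j<J. \<Theta> j / (s0 / 2 ^ j))"
  let ?g = "gauge q \<alpha> \<beta>"
  define s where "s j = s0 / 2 ^ j" for j :: nat
  define G where "G j = ?g (1 - ln (s j))" for j
  define S where "S = (\<Sum>k\<le>?n. real ?n ^ k)"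
  define g1 where "g1 = ?g (1 - ln 1)"
  note op = jones.jones_open[OF J] and s0 = jones.s0[OF J] and \<epsilon> = jones.\<epsilon>[OF J]
  have lm: "\<Omega> \<in> lmeasurable" using op bd by (simp add: lmeasurable_open)
  have ls: "\<Omega> \<in> sets lebesgue" using lm by auto
  have V: "0 < measure lebesgue \<Omega>" using open_not_negligible[OF op ne] lm by (simp add: negligible_iff_measure zero_less_measure_iff)
  have n1: "1 \<le> ?n" using n2 by linarith
  have sj: "0 < s j" "s j \<le> 1" for j
  proof -
   have "s0 \<le> 2 ^ j" using s0 one_le_power[of "2::real" j] by linarith
   then show "0 < s j" "s j \<le> 1" using s0 by (auto simp: s_def)
  qed
  have G: "0 < G j" for j unfolding G_def by (intro gauge_pos one_le_one_minus_ln sj)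
  have g1: "0 < g1" unfolding g1_def by (rule gauge_pos) simp
  have S: "0 < S" unfolding S_def by (intro sum_pos) auto
  have reach: "0 < reach \<epsilon>" using \<epsilon> by (simp add: reach_def add_pos_pos)
  \<comment> \<open>Large enough for two uses: for balls of radius
    \<open>reach \<epsilon> * s\<close> with r = s, and for all of \<Omega> with r = 1, which bounds
    the integrals of the gradients of every order.\<close>
  define A where "A = max (unit_ball_vol (real ?n) * reach \<epsilon> ^ ?n) (measure lebesgue \<Omega>)"
  obtain CA where CA: "0 < CA" and int: "\<And>u D r U. u \<in> borel_measurable (lebesgue_on \<Omega>) \<Longrightarrow> LZ_norm_on \<Omega> q \<alpha> \<beta> u \<le> ennreal U \<Longrightarrow> 0 \<le> U \<Longrightarrow>
   D \<in> sets lebesgue \<Longrightarrow> D \<subseteq> \<Omega> \<Longrightarrow> 0 < r \<Longrightarrow> r \<le> 1 \<Longrightarrow> measure lebesgue D \<le> A * r ^ ?n \<Longrightarrow>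
   (\<integral>\<^sup>+x\<in>D. ennreal \<bar>u x\<bar> \<partial>lebesgue_on \<Omega>) \<le> ennreal (CA * U / ?g (1 - ln r))"
   using nn_integral_le_gauge[OF adm lm V n1, of A] by blast
  obtain KD where KD0: "0 < KD" and KD': "\<And>s J. 0 < s \<Longrightarrow> s \<le> 1 \<Longrightarrow>
    s / 2 ^ J * (\<Sum>j<J. 1 / ?g (1 - ln (s / 2 ^ j)) / (s / 2 ^ j)) \<le> KD / ?g (1 - ln (s / 2 ^ J))"
   using gauge_dyadic_sum[of q \<alpha> \<beta>] by blast
  have KD: "0 < KD" "s J * (\<Sum>j<J. 1 / G j / s j) \<le> KD / G J" for J unfolding s_def G_def using s0 by (intro KD0 KD'; linarith)+
  obtain KL where KL: "0 < KL" "\<And>r. 0 < r \<Longrightarrow> r \<le> 1 \<Longrightarrow> r * ?g (1 - ln r) \<le> KL"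
   using le_inverse_gauge[of q \<alpha> \<beta>] by blast
  obtain M where M: "0 \<le> M" "\<And>y y' c. 1 \<le> y \<Longrightarrow> y \<le> y' \<Longrightarrow> y' \<le> c * y \<Longrightarrow> ?g y' \<le> c powr M * ?g y"
   using gauge_ratio[of q \<alpha> \<beta>] by blast
  obtain CJ where CJ: "0 \<le> CJ" and osc: "\<And>w \<Theta>. sobolev_family \<Omega> ?n w \<Longrightarrow> (\<forall>j. 0 \<le> \<Theta> j) \<Longrightarrow>
    (\<forall>x\<in>\<Omega>. \<forall>j. (\<integral>z. grad_sum ?n w z * indicator (\<Omega> \<inter> cball x (reach \<epsilon> * (s0 / 2 ^ j))) z \<partial>lebesgue) \<le> \<Theta> j) \<Longrightarrow>
    (\<lambda>J. \<Theta> J + ?D \<Theta> J) \<longlonglongrightarrow> 0 \<Longrightarrow>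
    (\<exists>v. continuous_on \<Omega> v \<and> (AE x in lebesgue_on \<Omega>. v x = w [] x)
     \<and> (\<forall>x\<in>\<Omega>. \<bar>v x\<bar> \<le> CJ * (\<Theta> 0 + (\<Sum>k\<le>?n. \<integral>z. grad_sum k w z \<partial>lebesgue)))
     \<and> (\<forall>J. \<forall>x\<in>\<Omega>. \<forall>y\<in>\<Omega>. dist x y \<le> s0 / 2 ^ J \<longrightarrow>
       \<bar>v x - v y\<bar> \<le> CJ * (\<Theta> J + ?D \<Theta> J
        + s0 / 2 ^ J * (\<Sum>k\<le>?n. \<integral>z. grad_sum k w z \<partial>lebesgue))))" using jones_oscillation[OF J n2] by blast
  define B where "B = real ?n ^ ?n * CA"
  define CT where "CT = S * CA / g1"
  have B: "0 < B" "0 < CT" using CA S g1 by (auto simp: B_def CT_def)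
  define C1 where "C1 = CJ * (B + B * KD + KL * CT)"
  define C2 where "C2 = CJ * (B / G 0 + CT)"
  have C12: "0 \<le> C1" "0 \<le> C2" using CJ B KD KL G[of 0] by (auto simp: C1_def C2_def)
  define r1 where "r1 = min r0 s0"
  have r1: "0 < r1" "r1 \<le> r0" "r1 \<le> s0" using r0 s0 by (auto simp: r1_def)
  \<comment> \<open>Distances in \<Omega> that are not small lie in \<open>{r1..b}\<close>, where
    \<omega> is bounded below; there the supremum of v suffices.\<close>
  define b where "b = max r1 (diameter \<Omega>)"
  obtain m where m: "0 < m" "\<And>r. r \<in> {r1..b} \<Longrightarrow> m \<le> \<omega> r" using low[of r1 b] r1 by (auto simp: b_def)
  define C3 where "C3 = C1 * 2 powr M * c + 2 * C2 / m"
  have C3: "0 \<le> C3" using C12 c m by (simp add: C3_def)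
  have core: "\<exists>v\<in>hoelder_space \<Omega> \<omega>. (AE x in lebesgue_on \<Omega>. v x = u x) \<and> hoelder_norm \<Omega> \<omega> v \<le> ennreal (1 + C2 + C3) * sobolev_LZ_norm \<Omega> ?n q \<alpha> \<beta> u"
   if u: "u \<in> sobolev_LZ_space \<Omega> ?n q \<alpha> \<beta>" for u
  proof -
   obtain U where U: "0 \<le> U" "sobolev_LZ_norm \<Omega> ?n q \<alpha> \<beta> u = ennreal U"
    and LZ: "\<And>k. k \<le> ?n \<Longrightarrow> LZ_norm_on \<Omega> q \<alpha> \<beta> (abs_weak_grad \<Omega> k u) \<le> ennreal U"
    using sobolev_LZ_norm_component[OF u] by blast
   have wd: "weakly_differentiable \<Omega> ?n u" using u by (simp add: sobolev_LZ_space_def)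
   note meas = abs_weak_grad_measurable[OF op wd]
   have intD: "(\<integral>\<^sup>+x\<in>D. ennreal \<bar>abs_weak_grad \<Omega> k u x\<bar> \<partial>lebesgue_on \<Omega>) \<le> ennreal (CA * U / ?g (1 - ln r))"
    if "k \<le> ?n" "D \<in> sets lebesgue" "D \<subseteq> \<Omega>" "0 < r" "r \<le> 1" "measure lebesgue D \<le> A * r ^ ?n" for D k r
    by (rule int[OF meas[OF that(1)] LZ[OF that(1)] U(1) that(2-)])
   have int\<Omega>: "(\<integral>\<^sup>+x\<in>\<Omega>. ennreal \<bar>abs_weak_grad \<Omega> k u x\<bar> \<partial>lebesgue_on \<Omega>) \<le> ennreal (CA * U / g1)" if "k \<le> ?n" for k
    unfolding g1_def by (rule intD[OF that ls order_refl]) (auto simp: A_def)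
   have integrable: "integrable (lebesgue_on \<Omega>) (weak_deriv \<Omega> is u)" if l: "length is \<le> ?n" for "is"
   proof (rule integrableI_bounded)
    show "weak_deriv \<Omega> is u \<in> borel_measurable (lebesgue_on \<Omega>)" by (rule weak_deriv_measurable[OF op wd l])
    have "(\<integral>\<^sup>+x. ennreal (norm (weak_deriv \<Omega> is u x)) \<partial>lebesgue_on \<Omega>) \<le> (\<integral>\<^sup>+x\<in>\<Omega>. ennreal \<bar>abs_weak_grad \<Omega> (length is) u x\<bar> \<partial>lebesgue_on \<Omega>)"
     by (intro nn_integral_mono) (auto intro!: ennreal_leI weak_deriv_le_abs_weak_grad)
    also have "\<dots> \<le> ennreal (CA * U / g1)" by (rule int\<Omega>[OF l])
    finally show "(\<integral>\<^sup>+x. ennreal (norm (weak_deriv \<Omega> is u x)) \<partial>lebesgue_on \<Omega>) < \<infinity>" by (rule le_less_trans) simp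
   qed
   let ?w = "weak_rep \<Omega> u"
   have fam: "sobolev_family \<Omega> ?n ?w" and w0: "AE x in lebesgue_on \<Omega>. ?w [] x = u x"
    using sobolev_family_weak_rep[OF op bd wd integrable] by auto
   define \<Theta> where "\<Theta> j = B * U / G j" for j
   define T where "T = (\<Sum>k\<le>?n. \<integral>z. grad_sum k ?w z \<partial>lebesgue)"
   have \<Theta>0: "\<forall>j. 0 \<le> \<Theta> j" using B U G by (auto simp: \<Theta>_def intro!: divide_nonneg_pos)
   have T: "T \<le> CT * U"
   proof -
    have "(\<integral>z. grad_sum k ?w z \<partial>lebesgue) \<le> real ?n ^ k * (CA * U / g1)" if "k \<le> ?n" for k
    proof -
     have "(\<integral>z. grad_sum k ?w z * indicator \<Omega> z \<partial>lebesgue) \<le> real ?n ^ k * (CA * U / g1)"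
      using CA U g1 by (intro grad_sum_weak_rep_integral_le[OF ls ls order_refl meas[OF that] int\<Omega>[OF that]]) auto
     moreover have "grad_sum k ?w z * indicator \<Omega> z = grad_sum k ?w z" for z
      by (cases "z \<in> \<Omega>") (simp_all add: grad_sum_def weak_rep_def)
     ultimately show ?thesis by simp
    qed
    then have "T \<le> (\<Sum>k\<le>?n. real ?n ^ k * (CA * U / g1))" unfolding T_def by (intro sum_mono) auto
    also have "\<dots> = S * (CA * U / g1)" by (simp only: S_def sum_distrib_right)
    finally show ?thesis by (simp add: CT_def)
   qed
   have ball: "\<forall>x\<in>\<Omega>. \<forall>j. (\<integral>z. grad_sum ?n ?w z * indicator (\<Omega> \<inter> cball x (reach \<epsilon> * (s0 / 2 ^ j))) z \<partial>lebesgue) \<le> \<Theta> j"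
   proof (intro ballI allI)
    fix x j assume "x \<in> \<Omega>"
    let ?D = "\<Omega> \<inter> cball x (reach \<epsilon> * (s0 / 2 ^ j))"
    have D: "?D \<in> sets lebesgue" "?D \<subseteq> \<Omega>" using ls by auto
    have "measure lebesgue ?D \<le> measure lebesgue (cball x (reach \<epsilon> * (s0 / 2 ^ j)))"
     using D by (intro measure_mono_fmeasurable) auto
    also have "\<dots> = unit_ball_vol (real ?n) * (reach \<epsilon> * (s0 / 2 ^ j)) ^ ?n" using reach s0 by (intro measure_cball_cart) auto
    also have "\<dots> = (unit_ball_vol (real ?n) * reach \<epsilon> ^ ?n) * s j ^ ?n" by (simp only: s_def power_mult_distrib mult.assoc)
    also have "\<dots> \<le> A * s j ^ ?n" using sj(1)[of j] by (intro mult_right_mono) (auto simp: A_def)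
    finally have mD: "measure lebesgue ?D \<le> A * s j ^ ?n" .
    have "(\<integral>z. grad_sum ?n ?w z * indicator ?D z \<partial>lebesgue) \<le> real ?n ^ ?n * (CA * U / ?g (1 - ln (s j)))"
     using CA U G[of j] by (intro grad_sum_weak_rep_integral_le[OF ls D meas[OF order_refl] intD[OF order_refl D sj mD]]) (auto simp: G_def)
    then show "(\<integral>z. grad_sum ?n ?w z * indicator ?D z \<partial>lebesgue) \<le> \<Theta> j" by (simp add: \<Theta>_def B_def G_def)
   qed
   have dy: "?D \<Theta> J \<le> B * U * KD / G J" for J
   proof -
    have "?D \<Theta> J = B * U * (s J * (\<Sum>j<J. 1 / G j / s j))" by (simp add: s_def[symmetric] \<Theta>_def sum_distrib_left mult_ac)
    also have "\<dots> \<le> B * U * (KD / G J)" using B U by (intro mult_left_mono KD) auto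
    finally show ?thesis by simp
   qed
   have lim: "(\<lambda>J. \<Theta> J + ?D \<Theta> J) \<longlonglongrightarrow> 0"
   proof (rule tendsto_sandwich[of "\<lambda>_. 0"])
    show "\<forall>\<^sub>F J in sequentially. 0 \<le> \<Theta> J + ?D \<Theta> J"
     using \<Theta>0 s0 by (intro always_eventually allI add_nonneg_nonneg mult_nonneg_nonneg sum_nonneg divide_nonneg_nonneg) auto
    show "\<forall>\<^sub>F J in sequentially. \<Theta> J + ?D \<Theta> J \<le> (B * U + B * U * KD) / G J"
     using dy by (intro always_eventually allI) (simp add: \<Theta>_def add_divide_distrib)
    have "filterlim (\<lambda>J. (1 - ln s0) + real J * ln 2) at_top sequentially"
     by (intro filterlim_tendsto_add_at_top[OF tendsto_const] filterlim_at_top_mult_tendsto_pos[OF tendsto_const _ filterlim_real_sequentially]) simp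
    moreover have "(1 - ln s0) + real J * ln 2 = 1 - ln (s J)" for J using s0 by (simp add: s_def ln_div ln_realpow)
    ultimately have "filterlim (\<lambda>J. 1 - ln (s J)) at_top sequentially" by simp
    from filterlim_compose[OF gauge_at_top[OF adm] this] have "filterlim G at_top sequentially" by (simp add: G_def[abs_def])
    then show "(\<lambda>J. (B * U + B * U * KD) / G J) \<longlonglongrightarrow> 0"
     by (intro tendsto_divide_0[OF tendsto_const] filterlim_at_top_imp_at_infinity)
   qed simp
   obtain v where v: "continuous_on \<Omega> v" "AE x in lebesgue_on \<Omega>. v x = ?w [] x"
    and v0: "\<And>x. x \<in> \<Omega> \<Longrightarrow> \<bar>v x\<bar> \<le> CJ * (\<Theta> 0 + T)"
    and v1: "\<And>J x y. x \<in> \<Omega> \<Longrightarrow> y \<in> \<Omega> \<Longrightarrow> dist x y \<le> s0 / 2 ^ J \<Longrightarrow>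
     \<bar>v x - v y\<bar> \<le> CJ * (\<Theta> J + ?D \<Theta> J + s0 / 2 ^ J * T)"
    using osc[OF fam \<Theta>0 ball lim] unfolding T_def by blast
   have sup: "\<bar>v x\<bar> \<le> C2 * U" if "x \<in> \<Omega>" for x
   proof -
    have "\<bar>v x\<bar> \<le> CJ * (\<Theta> 0 + T)" by (rule v0[OF that])
    also have "\<dots> \<le> CJ * (B * U / G 0 + CT * U)" using CJ T by (intro mult_left_mono) (auto simp: \<Theta>_def)
    also have "\<dots> = C2 * U" by (simp add: C2_def algebra_simps)
    finally show ?thesis .
   qed
   have os: "\<bar>v x - v y\<bar> \<le> C1 * U / G J" if xy: "x \<in> \<Omega>" "y \<in> \<Omega>" "dist x y \<le> s0 / 2 ^ J" for x y J
   proof -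
    have "s J * T \<le> (KL / G J) * (CT * U)"
    proof -
     have "s J * G J \<le> KL" unfolding G_def by (rule KL(2)[OF sj])
     then have "s J \<le> KL / G J" using G[of J] by (simp add: pos_le_divide_eq)
     then have "s J * (CT * U) \<le> (KL / G J) * (CT * U)" using B U by (intro mult_right_mono) auto
     moreover have "s J * T \<le> s J * (CT * U)" using T sj(1)[of J] by (intro mult_left_mono) auto
     ultimately show ?thesis by linarith
    qed
    then have "\<Theta> J + ?D \<Theta> J + s0 / 2 ^ J * T \<le> B * U / G J + B * U * KD / G J + (KL / G J) * (CT * U)"
     using dy[of J] by (simp add: s_def \<Theta>_def)
    also have "\<dots> = (B + B * KD + KL * CT) * U / G J" by (simp add: add_divide_distrib algebra_simps)
    finally have "CJ * (\<Theta> J + ?D \<Theta> J + s0 / 2 ^ J * T) \<le> CJ * ((B + B * KD + KL * CT) * U / G J)"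
     using CJ by (rule mult_left_mono)
    with v1[OF xy] show ?thesis by (simp add: C1_def mult.assoc)
   qed
   have main: "\<bar>v x - v y\<bar> / \<omega> (dist x y) \<le> C3 * U" if xy: "x \<in> \<Omega>" "y \<in> \<Omega>" "x \<noteq> y" for x y
   proof (cases "dist x y < r1")
    case True
    define d where "d = dist x y"
    have d: "0 < d" "d < r0" "d \<le> s0" using True r1 xy by (auto simp: d_def)
    obtain J where Jd: "s0 / 2 ^ Suc J < d" "d \<le> s0 / 2 ^ J" using dyadic_scale[OF d(1,3)] by blast
    have d1: "d \<le> 1" using d s0 by linarith
    have yd: "1 \<le> 1 - ln d" by (rule one_le_one_minus_ln[OF d(1) d1])
    have gd: "0 < ?g (1 - ln d)" by (rule gauge_pos[OF yd])
    have gG: "?g (1 - ln d) \<le> 2 powr M * G J" unfolding G_def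
    proof (rule M(2))
     show y: "1 \<le> 1 - ln (s J)" by (rule one_le_one_minus_ln[OF sj])
     have "ln d \<le> ln (s J)" using d Jd by (intro ln_mono) (auto simp: s_def)
     then show "1 - ln (s J) \<le> 1 - ln d" by simp
     have "s J < 2 * d" using Jd(1) by (simp add: s_def)
     then have "ln (s J) \<le> ln (2 * d)" using sj by (intro ln_mono) auto
     also have "\<dots> = ln 2 + ln d" using d by (simp add: ln_mult)
     finally have "1 - ln d \<le> (1 - ln (s J)) + ln 2" by simp
     moreover have "a \<le> 2 * b" if "a \<le> b + c" "1 \<le> b" "c < 1" for a b c :: real using that by linarith
     ultimately show "1 - ln d \<le> 2 * (1 - ln (s J))" using y ln_2_less_1 by blast
    qed
    have "\<bar>v x - v y\<bar> \<le> C1 * U / G J" using os xy Jd(2) by (simp add: d_def)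
    also have "\<dots> \<le> C1 * U * (2 powr M / ?g (1 - ln d))"
    proof -
     have "1 / G J \<le> 2 powr M / ?g (1 - ln d)" using gG gd G[of J] by (simp add: field_simps)
     then have "C1 * U * (1 / G J) \<le> C1 * U * (2 powr M / ?g (1 - ln d))" using C12 U by (intro mult_left_mono) auto
     then show ?thesis by simp
    qed
    also have "\<dots> = C1 * U * 2 powr M * c * (1 / (c * ?g (1 - ln d)))" using c by simp
    also have "\<dots> \<le> C1 * U * 2 powr M * c * \<omega> d" using C12 U c eq[of d] d by (intro mult_left_mono) auto
    finally have "\<bar>v x - v y\<bar> / \<omega> d \<le> C1 * 2 powr M * c * U" using pos[OF d(1)] by (simp add: pos_divide_le_eq mult_ac)
    also have "\<dots> \<le> C3 * U" using C12 U m by (intro mult_right_mono) (auto simp: C3_def)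
    finally show ?thesis by (simp add: d_def)
   next
    case False
    have "dist x y \<le> diameter \<Omega>" by (rule diameter_bounded_bound[OF bd xy(1,2)])
    then have "m \<le> \<omega> (dist x y)" using False by (intro m(2)) (auto simp: b_def)
    moreover have "\<bar>v x - v y\<bar> \<le> 2 * (C2 * U)" using sup[OF xy(1)] sup[OF xy(2)] by linarith
    ultimately have "\<bar>v x - v y\<bar> / \<omega> (dist x y) \<le> 2 * (C2 * U) / m" using m(1) C12 U by (intro frac_le) auto
    also have "\<dots> = (2 * C2 / m) * U" by simp
    also have "\<dots> \<le> C3 * U" using C12 U c by (intro mult_right_mono) (auto simp: C3_def)
    finally show ?thesis .
   qed
   have norm: "hoelder_norm \<Omega> \<omega> v \<le> ennreal (1 + C2 + C3) * ennreal U"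
   proof -
    have mv: "(\<lambda>x. ennreal \<bar>v x\<bar>) \<in> borel_measurable (lebesgue_on \<Omega>)"
     using continuous_imp_measurable_on_sets_lebesgue[OF v(1) ls] by measurable
    have "Lq_norm (lebesgue_on \<Omega>) \<infinity> (\<lambda>x. ennreal \<bar>v x\<bar>) \<le> ennreal (C2 * U)"
     unfolding Lq_norm_def using mv sup by (auto intro!: esssup_I AE_I2 ennreal_leI)
    moreover have "(SUP (x, y)\<in>{(x, y). x \<in> \<Omega> \<and> y \<in> \<Omega> \<and> x \<noteq> y}. ennreal (\<bar>v x - v y\<bar> / \<omega> (dist x y))) \<le> ennreal (C3 * U)"
     by (intro SUP_least) (auto intro!: ennreal_leI main)
    ultimately have "hoelder_norm \<Omega> \<omega> v \<le> ennreal (C2 * U) + ennreal (C3 * U)" unfolding hoelder_norm_def by (rule add_mono)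
    also have "\<dots> = ennreal (C2 * U + C3 * U)" using C12 C3 U by (intro ennreal_plus[symmetric]) auto
    also have "\<dots> \<le> ennreal ((1 + C2 + C3) * U)" using U by (intro ennreal_leI) (simp add: distrib_right)
    also have "\<dots> = ennreal (1 + C2 + C3) * ennreal U" using C12 C3 U by (intro ennreal_mult) auto
    finally show ?thesis .
   qed
   have "v \<in> hoelder_space \<Omega> \<omega>"
   proof -
    have "bounded (v ` \<Omega>)" unfolding bounded_iff using sup by auto
    moreover have "hoelder_norm \<Omega> \<omega> v < \<infinity>" by (rule le_less_trans[OF norm]) (simp add: ennreal_mult_less_top)
    ultimately show ?thesis using v(1) by (simp add: hoelder_space_def)
   qed
   moreover have "AE x in lebesgue_on \<Omega>. v x = u x" using v(2) w0 by eventually_elim simp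
   ultimately show ?thesis using norm unfolding U(2) by blast
  qed
  have "0 < 1 + C2 + C3" using C12 C3 by linarith
  with core show ?thesis unfolding embeds_def by blast
qed

text \<open>\<open>Jones_domain\<close> admits the empty set, for which the construction of inner
  points has nothing to start from. All Hoelder norms over it vanish.\<close>

lemma embeds_empty: "embeds ({} :: (real^'n::finite) set) A nA (hoelder_space {} \<omega>) (hoelder_norm {} \<omega>)"
proof -
  have e: "esssup (lebesgue_on {}) (\<lambda>x. ennreal \<bar>v x\<bar>) \<le> 0" for v :: "real^'n \<Rightarrow> real"
  proof (rule esssup_I)
   show "(\<lambda>x. ennreal \<bar>v x\<bar>) \<in> borel_measurable (lebesgue_on {})"
    by (rule measurableI) (simp_all add: space_restrict_space)
  qed (rule AE_I2, simp)
  have H: "hoelder_norm {} \<omega> v = 0" for v :: "real^'n \<Rightarrow> real"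
   using e[of v] by (simp add: hoelder_norm_def Lq_norm_def bot_ennreal)
  show ?thesis unfolding embeds_def by (rule exI[of _ 1]) (auto simp: hoelder_space_def H intro!: bexI AE_I2)
qed

theorem theorem3p6:
  fixes \<Omega> :: "(real^'n::finite) set"
    and q :: ennreal
    and \<alpha> \<beta> :: real
    and \<omega> :: "real \<Rightarrow> real"
  assumes "CARD('n) \<ge> 2"
    and "bounded \<Omega>"
    and "Jones_domain \<Omega>"
    and "L1_admissible q \<alpha> \<beta>"
    and "\<forall>r>0. \<omega> r > 0"
    (* Excludes degeneration of omega away from 0, where its values are immaterial otherwise. *)
    and "\<forall>a b. 0 < a \<longrightarrow> a \<le> b \<longrightarrow> (\<exists>c>0. \<forall>r\<in>{a..b}. c \<le> \<omega> r)"
    and "\<alpha> > - recip q \<Longrightarrow>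
      equiv_near_0 \<omega>
        (\<lambda>r. ln (exp 1 / r) powr (- recip q - \<alpha>) * ln (ln (exp 1 / r)) powr (- \<beta>))"
    and "\<alpha> = - recip q \<Longrightarrow> \<beta> > - recip q \<Longrightarrow>
      equiv_near_0 \<omega> (\<lambda>r. ln (ln (exp 1 / r)) powr (- recip q - \<beta>))"
    and "q < \<infinity> \<Longrightarrow> \<alpha> = - recip q \<Longrightarrow> \<beta> = - recip q \<Longrightarrow>
      equiv_near_0 \<omega> (\<lambda>r. ln (ln (ln (exp 1 / r))) powr (- recip q))"
  shows "embeds \<Omega> (sobolev_LZ_space \<Omega> CARD('n) q \<alpha> \<beta>) (sobolev_LZ_norm \<Omega> CARD('n) q \<alpha> \<beta>)
           (hoelder_space \<Omega> \<omega>) (hoelder_norm \<Omega> \<omega>)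
       \<and> modulus_of_continuity \<omega>
       \<and> (\<forall>\<sigma>. modulus_of_continuity \<sigma> \<longrightarrow>
            embeds \<Omega> (sobolev_LZ_space \<Omega> CARD('n) q \<alpha> \<beta>) (sobolev_LZ_norm \<Omega> CARD('n) q \<alpha> \<beta>)
              (hoelder_space \<Omega> \<sigma>) (hoelder_norm \<Omega> \<sigma>) \<longrightarrow>
            embeds \<Omega> (hoelder_space \<Omega> \<omega>) (hoelder_norm \<Omega> \<omega>)
              (hoelder_space \<Omega> \<sigma>) (hoelder_norm \<Omega> \<sigma>))"
proof -
  let ?\<gamma> = "gauge q \<alpha> \<beta>"
  note adm = assms(4)
  have op: "open \<Omega>" using assms(3) by (simp add: Jones_domain_def)
  obtain c r0 where c: "0 < c" and r0: "0 < r0" "r0 \<le> 1"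
   and eq: "\<And>r. r \<in> {0<..<r0} \<Longrightarrow> 1 / (c * ?\<gamma> (1 - ln r)) \<le> \<omega> r \<and> \<omega> r \<le> c / ?\<gamma> (1 - ln r)"
   using gauge_equiv[OF adm assms(7-9)] by blast
  have mod: "modulus_of_continuity \<omega>" by (rule modulus_of_continuity_gauge[OF adm assms(5) c r0 eq])
  show ?thesis
  proof (cases "\<Omega> = {}")
   case True
   then show ?thesis using mod embeds_empty by blast
  next
   case False
   have pos: "0 < \<omega> r" if "0 < r" for r using assms(5) that by blast
   obtain \<epsilon> s0 where J: "jones \<Omega> \<epsilon> s0" using Jones_domain_imp_jones[OF assms(3,2) False] by blast
   have "embeds \<Omega> (hoelder_space \<Omega> \<omega>) (hoelder_norm \<Omega> \<omega>) (hoelder_space \<Omega> \<sigma>) (hoelder_norm \<Omega> \<sigma>)"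
    if \<sigma>: "modulus_of_continuity \<sigma>" and emb: "embeds \<Omega> (sobolev_LZ_space \<Omega> CARD('n) q \<alpha> \<beta>) (sobolev_LZ_norm \<Omega> CARD('n) q \<alpha> \<beta>)
     (hoelder_space \<Omega> \<sigma>) (hoelder_norm \<Omega> \<sigma>)" for \<sigma>
   proof -
    have \<sigma>pos: "0 < \<sigma> r" if "0 < r" for r using \<sigma> that by (simp add: modulus_of_continuity_def)
    obtain C r1 where C: "0 < C" "0 < r1" "\<And>r. 0 < r \<Longrightarrow> r < r1 \<Longrightarrow> 1 / ?\<gamma> (1 - ln r) \<le> C * \<sigma> r"
     using embedding_modulus_lower_bound(1)[OF adm op assms(2) False \<sigma>pos emb] by blast
    obtain D where D: "0 < D" "\<And>x y. x \<in> \<Omega> \<Longrightarrow> y \<in> \<Omega> \<Longrightarrow> x \<noteq> y \<Longrightarrow> dist x y \<le> D * \<sigma> (dist x y)"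
     using embedding_modulus_lower_bound(2)[OF adm op assms(2) False \<sigma>pos emb] by blast
    \<comment> \<open>Below r both the upper bound of \<omega> and the lower bound of \<sigma> by
      the reciprocal gauge hold, which compares the two moduli. From r on, \<sigma> is at least r /
      D by the linear bound.\<close>
    define r where "r = min r0 r1"
    have r: "0 < r" "r \<le> r0" "r \<le> r1" using r0 C by (auto simp: r_def)
    show ?thesis
    proof (rule hoelder_embeds[OF op pos \<sigma>pos])
     show "0 < c * C" "0 < r / D" using c C D r by auto
     fix x y assume xy: "x \<in> \<Omega>" "y \<in> \<Omega>"
     {
      assume d: "x \<noteq> y" "dist x y < r"
      have "\<omega> (dist x y) \<le> c * (1 / ?\<gamma> (1 - ln (dist x y)))" using eq[of "dist x y"] d r by simp
      also have "\<dots> \<le> c * (C * \<sigma> (dist x y))" using c d r by (intro mult_left_mono C(3)) auto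
      finally show "\<omega> (dist x y) \<le> c * C * \<sigma> (dist x y)" by simp
     }
     assume d: "r \<le> dist x y"
     then have "x \<noteq> y" using r by auto
     then have "r \<le> D * \<sigma> (dist x y)" using D(2)[OF xy] d by linarith
     then show "r / D \<le> \<sigma> (dist x y)" using D(1) by (simp add: pos_divide_le_eq mult.commute)
    qed
   qed
   moreover have "embeds \<Omega> (sobolev_LZ_space \<Omega> CARD('n) q \<alpha> \<beta>) (sobolev_LZ_norm \<Omega> CARD('n) q \<alpha> \<beta>)
     (hoelder_space \<Omega> \<omega>) (hoelder_norm \<Omega> \<omega>)"
    using assms(6) eq by (intro sobolev_embeds_hoelder[OF J assms(2) False assms(1) adm pos _ c r0(1)]) auto
   ultimately show ?thesis using mod by blast
  qed
qed

end
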